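(* Let $(M,g,J,\omega,\nabla,\xi)$ be a conical affine special Kähler (CASK) manifold and, for $c>0$, let $(\bar N^c,g^c_{\bar N},\mathcal Q^c)$ be the quaternionic Kähler manifold obtained from it by the deformed supergravity c-map with deformation parameter $c$. Then, for any $c>0$, the Riemannian manifold $(\bar N^c,g^c_{\bar N})$ is not locally homogeneous.
   Context: Locally homogeneous: a Riemannian manifold $(X,h)$ of dimension $m$ is locally homogeneous if for every $p\in X$ there are $m$ Killing vector fields defined in a neighbourhood of $p$ which are linearly independent at $p$. ASK manifold: a (pseudo-)Kähler manifold $(M,g,J,\omega)$, with the convention $\omega=g(J\cdot,\cdot)$, endowed with a flat torsion-free connection $\nabla$ such that $\nabla\omega=0$ and $d^\nabla J=0$ (i.e. $(\nabla_XJ)Y=(\nabla_YJ)X$). CASK manifold: an ASK manifold endowed with a complete vector field $\xi$ such that $g$ is negative-definite on $\mathrm{span}\{\xi,J\xi\}$ and positive-definite on its orthogonal complement, and $D\xi=\nabla\xi=\mathrm{id}$, where $D$ is the Levi-Civita connection of $g$. Standing assumptions: $M$ is connected and $\xi,J\xi$ generate a principal $\mathbb C^\times$-action on $M$. Rigid c-map: let $\dim_{\mathbb R}M=2n+2$, $N=T^*M$, $\pi:N\to M$. Using $\nabla$, decompose $TN=T^{\mathrm H}N\oplus T^{\mathrm V}N\cong\pi^*TM\oplus\pi^*T^*M$ (horizontal plus vertical). Then $N$ carries the pseudo-hyper-Kähler structure $$g_N=\begin{pmatrix}g&0\\0&g^{-1}\end{pmatrix},\quad I_1=\begin{pmatrix}J&0\\0&J^*\end{pmatrix},\quad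 I_2=\begin{pmatrix}0&-\omega^{-1}\\\omega&0\end{pmatrix},\quad I_3=I_1I_2,$$ where $\omega$ is regarded as the map $X\mapsto\omega(X,\cdot)$. HK/QK data: set $Z=-\widetilde{J\xi}$ (the horizontal lift of $-J\xi$ to $N$ with respect to $\nabla$), $\omega_1=g_N(I_1\cdot,\cdot)$, $\omega_{\mathrm H}=\omega_1+d\iota_Zg_N$, $f_Z=-\tfrac12g_N(Z,Z)$, $f_{\mathrm H}=\tfrac12g_N(Z,Z)$, $f^c_Z=f_Z-\tfrac12c$, $f^c_{\mathrm H}=f_{\mathrm H}-\tfrac12c$. One has $\iota_Z\omega_1=-df^c_Z$ and $\iota_Z\omega_{\mathrm H}=-df^c_{\mathrm H}$. It is assumed that $Z$ generates a free circle action. We restrict $N$ to the open subset where $f^c_Z>0$ (equivalently $f_Z>c/2$), still denoted $N$; there $f^c_{\mathrm H}<0$. Let $\mathbb HZ=\mathrm{span}\{Z,I_1Z,I_2Z,I_3Z\}$, with $g_N$-orthogonal complement $(\mathbb HZ)^\perp$, and set $$g^c_{\mathrm H}=\frac1{f^c_Z}\,g_N|_{(\mathbb HZ)^\perp}+\frac{f^c_{\mathrm H}}{(f^c_Z)^2}\,g_N|_{\mathbb HZ},$$ which is positive-definite. Supergravity c-map, as a twist: let $P\to N$ be a principal $S^1$-bundle with connection $\eta$ of curvature $\omega_{\mathrm H}$ ($d\eta$ equals the pullback of $\omega_{\mathrm H}$), let $X_P$ be the generator of the principal action with $\eta(X_P)=1$, and let $Z_P=\hat Z+f^c_{\mathrm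 H}X_P$, where $\hat Z$ is the $\eta$-horizontal lift of $Z$. Then $\bar N^c=P/\langle Z_P\rangle$ (the action generated by $Z_P$ being assumed such that the quotient is a smooth manifold). A $Z$-invariant covariant tensor field on $N$ and a covariant tensor field on $\bar N^c$ are called $\mathcal H$-related if their pullbacks to $P$ coincide on $\ker\eta$. The metric $g^c_{\bar N}$ is the one $\mathcal H$-related to $g^c_{\mathrm H}$, and $\mathcal Q^c\subset\mathrm{End}(T\bar N^c)$ is the rank-three bundle corresponding to $\mathrm{span}\{I_1,I_2,I_3\}$ under the identifications of tangent spaces of $N$ and $\bar N^c$ with $\ker\eta$. Then $(\bar N^c,g^c_{\bar N},\mathcal Q^c)$ is a positive-definite quaternionic Kähler manifold of negative scalar curvature. The case $c=0$ is the undeformed supergravity c-map; the cases $c\neq 0$ are called deformed (one-loop deformation). *)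

theory Defs
  imports "HOL-Analysis.Analysis"
begin

section \<open>Smooth manifolds\<close>

text \<open>For open \<open>S\<close>, \<open>Ck k S f\<close> says that \<open>f\<close> is \<open>k\<close> times continuously differentiable on \<open>S\<close>.\<close>

primrec Ck :: "nat \<Rightarrow> 'e::euclidean_space set \<Rightarrow> ('e \<Rightarrow> 'f::euclidean_space) \<Rightarrow> bool" where
  "Ck 0 S f \<longleftrightarrow> continuous_on S f"
| "Ck (Suc k) S f \<longleftrightarrow> (\<forall>x\<in>S. f differentiable (at x)) \<and>
     (\<forall>v. Ck k S (\<lambda>x. frechet_derivative f (at x) v))"

definition smooth_on :: "'e::euclidean_space set \<Rightarrow> ('e \<Rightarrow> 'f::euclidean_space) \<Rightarrow> bool" where
  "smooth_on S f \<longleftrightarrow> (\<forall>k. Ck k S f)"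

text \<open>A chart is a pair of its domain and the coordinate map; values of the coordinate map outside
  the domain are irrelevant.\<close>

record ('a, 'e) mfd =
  mtop :: "'a topology"
  charts :: "('a set \<times> ('a \<Rightarrow> 'e)) set"

abbreviation points :: "('a, 'e) mfd \<Rightarrow> 'a set" where
  "points M \<equiv> topspace (mtop M)"

definition smooth_manifold :: "('a, 'e::euclidean_space) mfd \<Rightarrow> bool" where
  "smooth_manifold M \<longleftrightarrow>
     Hausdorff_space (mtop M) \<and> second_countable (mtop M) \<and>
     \<Union> (fst ` charts M) = points M \<and>
     (\<forall>(U, \<phi>) \<in> charts M. openin (mtop M) U \<and> open (\<phi> ` U) \<and>
        homeomorphic_map (subtopology (mtop M) U) (top_of_set (\<phi> ` U)) \<phi>) \<and>
     (\<forall>(U, \<phi>) \<in> charts M. \<forall>(V, \<psi>) \<in> charts M.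
        smooth_on (\<phi> ` (U \<inter> V)) (\<psi> \<circ> inv_into U \<phi>))"

definition smooth_map ::
  "('a, 'e::euclidean_space) mfd \<Rightarrow> ('b, 'f::euclidean_space) mfd \<Rightarrow> ('a \<Rightarrow> 'b) \<Rightarrow> bool" where
  "smooth_map M N F \<longleftrightarrow> continuous_map (mtop M) (mtop N) F \<and>
     (\<forall>(U, \<phi>) \<in> charts M. \<forall>(V, \<psi>) \<in> charts N.
        smooth_on (\<phi> ` (U \<inter> F -` V)) (\<psi> \<circ> F \<circ> inv_into U \<phi>))"

definition diffeo ::
  "('a, 'e::euclidean_space) mfd \<Rightarrow> ('b, 'f::euclidean_space) mfd \<Rightarrow> ('a \<Rightarrow> 'b) \<Rightarrow> bool" where
  "diffeo M N F \<longleftrightarrow> smooth_map M N F \<and> bij_betw F (points M) (points N) \<and>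
     smooth_map N M (inv_into (points M) F)"

definition restrict_mfd :: "('a, 'e) mfd \<Rightarrow> 'a set \<Rightarrow> ('a, 'e) mfd" where
  "restrict_mfd M W = \<lparr>mtop = subtopology (mtop M) W,
     charts = {(U \<inter> W, \<phi>) | U \<phi>. (U, \<phi>) \<in> charts M}\<rparr>"

definition prod_mfd :: "('a, 'e) mfd \<Rightarrow> ('b, 'f) mfd \<Rightarrow> ('a \<times> 'b, 'e \<times> 'f) mfd" where
  "prod_mfd M N = \<lparr>mtop = prod_topology (mtop M) (mtop N),
     charts = {(U \<times> V, map_prod \<phi> \<psi>) | U \<phi> V \<psi>. (U, \<phi>) \<in> charts M \<and> (V, \<psi>) \<in> charts N}\<rparr>"

definition euclidean_open_mfd :: "'e::euclidean_space set \<Rightarrow> ('e, 'e) mfd" where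
  "euclidean_open_mfd S = \<lparr>mtop = top_of_set S, charts = {(S, id)}\<rparr>"

text \<open>The unit circle, with the angular charts centred at \<open>cis \<theta>\<close>.\<close>

definition circle_mfd :: "(complex, real) mfd" where
  "circle_mfd = \<lparr>mtop = top_of_set (sphere 0 1),
     charts = {(sphere 0 1 - {- cis \<theta>}, \<lambda>z. Arg (z * cis (- \<theta>))) | \<theta>. True}\<rparr>"

definition cstar_mfd :: "(complex, complex) mfd" where
  "cstar_mfd = euclidean_open_mfd (- {0})"

section \<open>Functions, tangent vectors, vector fields\<close>

definition smooth_fun :: "('a, 'e::euclidean_space) mfd \<Rightarrow> 'a set \<Rightarrow> ('a \<Rightarrow> real) \<Rightarrow> bool" where
  "smooth_fun M W f \<longleftrightarrow> openin (mtop M) W \<and>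
     (\<forall>(U, \<phi>) \<in> charts M. smooth_on (\<phi> ` (U \<inter> W)) (f \<circ> inv_into U \<phi>))"

definition smooth_near :: "('a, 'e::euclidean_space) mfd \<Rightarrow> 'a \<Rightarrow> ('a \<Rightarrow> real) \<Rightarrow> bool" where
  "smooth_near M p f \<longleftrightarrow> (\<exists>W. p \<in> W \<and> smooth_fun M W f)"

type_synonym 'a tv = "('a \<Rightarrow> real) \<Rightarrow> real"

definition lcomb :: "real \<Rightarrow> ('x \<Rightarrow> real) \<Rightarrow> real \<Rightarrow> ('x \<Rightarrow> real) \<Rightarrow> 'x \<Rightarrow> real" where
  "lcomb a u b v = (\<lambda>f. a * u f + b * v f)"

text \<open>Tangent vectors at \<open>p\<close> are the derivations at \<open>p\<close> of the algebra of functions that are smooth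
  near \<open>p\<close>. Such a derivation depends only on germs: the indicator function of a neighbourhood of \<open>p\<close>
  belongs to the algebra, and the Leibniz rule makes derivations vanish on it. In particular the
  tangent spaces of an open submanifold are literally those of the ambient manifold. The value at
  the remaining functions is normalised to 0.\<close>

definition tangent :: "('a, 'e::euclidean_space) mfd \<Rightarrow> 'a \<Rightarrow> 'a tv set" where
  "tangent M p = {v. p \<in> points M \<and> (\<forall>f. \<not> smooth_near M p f \<longrightarrow> v f = 0) \<and>
     (\<forall>f h a b. smooth_near M p f \<and> smooth_near M p h \<longrightarrow> v (lcomb a f b h) = a * v f + b * v h) \<and>
     (\<forall>f h. smooth_near M p f \<and> smooth_near M p h \<longrightarrow>
        v (\<lambda>x. f x * h x) = v f * h p + f p * v h)}"

definition push :: "('a, 'e::euclidean_space) mfd \<Rightarrow> ('b, 'f::euclidean_space) mfd \<Rightarrow>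
    ('a \<Rightarrow> 'b) \<Rightarrow> 'a \<Rightarrow> 'a tv \<Rightarrow> 'b tv" where
  "push M N F p v = (\<lambda>f. if smooth_near N (F p) f then v (f \<circ> F) else 0)"

definition vfield_on :: "('a, 'e::euclidean_space) mfd \<Rightarrow> 'a set \<Rightarrow> ('a \<Rightarrow> 'a tv) \<Rightarrow> bool" where
  "vfield_on M U X \<longleftrightarrow> openin (mtop M) U \<and> (\<forall>x\<in>U. X x \<in> tangent M x) \<and>
     (\<forall>V f. V \<subseteq> U \<and> smooth_fun M V f \<longrightarrow> smooth_fun M V (\<lambda>x. X x f))"

definition lie_bracket ::
  "('a, 'e::euclidean_space) mfd \<Rightarrow> ('a \<Rightarrow> 'a tv) \<Rightarrow> ('a \<Rightarrow> 'a tv) \<Rightarrow> 'a \<Rightarrow> 'a tv" where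
  "lie_bracket M X Y x =
     (\<lambda>f. if smooth_near M x f then X x (\<lambda>y. Y y f) - Y x (\<lambda>y. X y f) else 0)"

definition curve_velocity ::
  "('a, 'e::euclidean_space) mfd \<Rightarrow> (real \<Rightarrow> 'a) \<Rightarrow> real \<Rightarrow> 'a tv" where
  "curve_velocity M \<gamma> t = (\<lambda>f. if smooth_near M (\<gamma> t) f then deriv (\<lambda>s. f (\<gamma> s)) t else 0)"

definition integral_curve ::
  "('a, 'e::euclidean_space) mfd \<Rightarrow> ('a \<Rightarrow> 'a tv) \<Rightarrow> (real \<Rightarrow> 'a) \<Rightarrow> bool" where
  "integral_curve M X \<gamma> \<longleftrightarrow> continuous_map euclidean (mtop M) \<gamma> \<and>
     (\<forall>t f. smooth_near M (\<gamma> t) f \<longrightarrow>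
        ((\<lambda>s. f (\<gamma> s)) has_real_derivative X (\<gamma> t) f) (at t))"

definition complete_vfield :: "('a, 'e::euclidean_space) mfd \<Rightarrow> ('a \<Rightarrow> 'a tv) \<Rightarrow> bool" where
  "complete_vfield M X \<longleftrightarrow> vfield_on M (points M) X \<and>
     (\<forall>x\<in>points M. \<exists>\<gamma>. \<gamma> 0 = x \<and> integral_curve M X \<gamma>)"

section \<open>Tensor fields\<close>

definition linear_form_on :: "('x \<Rightarrow> real) set \<Rightarrow> (('x \<Rightarrow> real) \<Rightarrow> real) \<Rightarrow> bool" where
  "linear_form_on T \<alpha> \<longleftrightarrow> (\<forall>u\<in>T. \<forall>v\<in>T. \<forall>a b. \<alpha> (lcomb a u b v) = a * \<alpha> u + b * \<alpha> v)"

definition linear_endo_on :: "('x \<Rightarrow> real) set \<Rightarrow> (('x \<Rightarrow> real) \<Rightarrow> 'x \<Rightarrow> real) \<Rightarrow> bool" where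
  "linear_endo_on T A \<longleftrightarrow> (\<forall>u\<in>T. A u \<in> T) \<and>
     (\<forall>u\<in>T. \<forall>v\<in>T. \<forall>a b. A (lcomb a u b v) = lcomb a (A u) b (A v))"

definition cotangent :: "('a, 'e::euclidean_space) mfd \<Rightarrow> 'a \<Rightarrow> ('a tv \<Rightarrow> real) set" where
  "cotangent M p = {\<alpha>. p \<in> points M \<and> linear_form_on (tangent M p) \<alpha> \<and>
     (\<forall>v. v \<notin> tangent M p \<longrightarrow> \<alpha> v = 0)}"

definition one_form_on ::
  "('a, 'e::euclidean_space) mfd \<Rightarrow> 'a set \<Rightarrow> ('a \<Rightarrow> 'a tv \<Rightarrow> real) \<Rightarrow> bool" where
  "one_form_on M U s \<longleftrightarrow> openin (mtop M) U \<and> (\<forall>x\<in>U. s x \<in> cotangent M x) \<and>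
     (\<forall>V X. V \<subseteq> U \<and> vfield_on M V X \<longrightarrow> smooth_fun M V (\<lambda>x. s x (X x)))"

definition tensor2_field ::
  "('a, 'e::euclidean_space) mfd \<Rightarrow> ('a \<Rightarrow> 'a tv \<Rightarrow> 'a tv \<Rightarrow> real) \<Rightarrow> bool" where
  "tensor2_field M h \<longleftrightarrow>
     (\<forall>x\<in>points M. \<forall>u\<in>tangent M x.
        linear_form_on (tangent M x) (h x u) \<and> linear_form_on (tangent M x) (\<lambda>v. h x v u)) \<and>
     (\<forall>V X Y. vfield_on M V X \<and> vfield_on M V Y \<longrightarrow> smooth_fun M V (\<lambda>x. h x (X x) (Y x)))"

definition endo_field ::
  "('a, 'e::euclidean_space) mfd \<Rightarrow> ('a \<Rightarrow> 'a tv \<Rightarrow> 'a tv) \<Rightarrow> bool" where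
  "endo_field M A \<longleftrightarrow> (\<forall>x\<in>points M. linear_endo_on (tangent M x) (A x)) \<and>
     (\<forall>V X. vfield_on M V X \<longrightarrow> vfield_on M V (\<lambda>x. A x (X x)))"

text \<open>Exterior derivative of a 1-form, evaluated on two vectors through arbitrary local extensions
  (the value does not depend on them).\<close>

definition ext_deriv1 :: "('a, 'e::euclidean_space) mfd \<Rightarrow> ('a \<Rightarrow> 'a tv \<Rightarrow> real) \<Rightarrow>
    'a \<Rightarrow> 'a tv \<Rightarrow> 'a tv \<Rightarrow> real" where
  "ext_deriv1 M \<alpha> x u v = (THE r. \<forall>U X Y. x \<in> U \<and> vfield_on M U X \<and> vfield_on M U Y \<and>
      X x = u \<and> Y x = v \<longrightarrow>
      r = X x (\<lambda>y. \<alpha> y (Y y)) - Y x (\<lambda>y. \<alpha> y (X y)) - \<alpha> x (lie_bracket M X Y x))"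

definition closed2 ::
  "('a, 'e::euclidean_space) mfd \<Rightarrow> ('a \<Rightarrow> 'a tv \<Rightarrow> 'a tv \<Rightarrow> real) \<Rightarrow> bool" where
  "closed2 M w \<longleftrightarrow> (\<forall>U X Y Z. vfield_on M U X \<and> vfield_on M U Y \<and> vfield_on M U Z \<longrightarrow>
     (\<forall>x\<in>U. X x (\<lambda>y. w y (Y y) (Z y)) + Y x (\<lambda>y. w y (Z y) (X y)) + Z x (\<lambda>y. w y (X y) (Y y))
        - w x (lie_bracket M X Y x) (Z x) - w x (lie_bracket M Y Z x) (X x)
        - w x (lie_bracket M Z X x) (Y x) = 0))"

section \<open>Metrics, Killing fields, local homogeneity\<close>

definition pseudo_riemannian ::
  "('a, 'e::euclidean_space) mfd \<Rightarrow> ('a \<Rightarrow> 'a tv \<Rightarrow> 'a tv \<Rightarrow> real) \<Rightarrow> bool" where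
  "pseudo_riemannian M g \<longleftrightarrow> smooth_manifold M \<and> tensor2_field M g \<and>
     (\<forall>x\<in>points M. \<forall>u\<in>tangent M x. \<forall>v\<in>tangent M x. g x u v = g x v u) \<and>
     (\<forall>x\<in>points M. \<forall>u\<in>tangent M x. (\<forall>v\<in>tangent M x. g x u v = 0) \<longrightarrow> u = (\<lambda>_. 0))"

text \<open>The condition is \<open>(L\<^sub>K h)(X, Y) = 0\<close>.\<close>

definition killing_on :: "('a, 'e::euclidean_space) mfd \<Rightarrow> ('a \<Rightarrow> 'a tv \<Rightarrow> 'a tv \<Rightarrow> real) \<Rightarrow>
    'a set \<Rightarrow> ('a \<Rightarrow> 'a tv) \<Rightarrow> bool" where
  "killing_on M h U K \<longleftrightarrow> vfield_on M U K \<and>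
     (\<forall>V X Y. V \<subseteq> U \<and> vfield_on M V X \<and> vfield_on M V Y \<longrightarrow>
       (\<forall>x\<in>V. K x (\<lambda>y. h y (X y) (Y y))
          = h x (lie_bracket M K X x) (Y x) + h x (X x) (lie_bracket M K Y x)))"

definition locally_homogeneous ::
  "('a, 'e::euclidean_space) mfd \<Rightarrow> ('a \<Rightarrow> 'a tv \<Rightarrow> 'a tv \<Rightarrow> real) \<Rightarrow> bool" where
  "locally_homogeneous M h \<longleftrightarrow>
     (\<forall>p\<in>points M. \<exists>U K. openin (mtop M) U \<and> p \<in> U \<and>
        (\<forall>i<DIM('e). killing_on M h U (K i)) \<and>
        (\<forall>a. (\<forall>f. (\<Sum>i<DIM('e). a i * K i p f) = 0) \<longrightarrow> (\<forall>i<DIM('e). a i = 0)))"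

section \<open>Connections\<close>

text \<open>\<open>nab x v Y\<close> is the covariant derivative at \<open>x\<close> in direction \<open>v\<close> of a vector field \<open>Y\<close> defined
  near \<open>x\<close>. As for tangent vectors, the Leibniz rule applied to indicator functions forces the value
  to depend only on the germ of \<open>Y\<close>.\<close>

type_synonym 'a conn = "'a \<Rightarrow> 'a tv \<Rightarrow> ('a \<Rightarrow> 'a tv) \<Rightarrow> 'a tv"

definition affine_connection :: "('a, 'e::euclidean_space) mfd \<Rightarrow> 'a conn \<Rightarrow> bool" where
  "affine_connection M nab \<longleftrightarrow>
     (\<forall>U X Y. vfield_on M U X \<and> vfield_on M U Y \<longrightarrow> vfield_on M U (\<lambda>x. nab x (X x) Y)) \<and>
     (\<forall>U Y. vfield_on M U Y \<longrightarrow> (\<forall>x\<in>U.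
        (\<forall>u\<in>tangent M x. nab x u Y \<in> tangent M x) \<and>
        (\<forall>u\<in>tangent M x. \<forall>v\<in>tangent M x. \<forall>a b.
           nab x (lcomb a u b v) Y = lcomb a (nab x u Y) b (nab x v Y)))) \<and>
     (\<forall>U Y Z. vfield_on M U Y \<and> vfield_on M U Z \<longrightarrow> (\<forall>x\<in>U. \<forall>v\<in>tangent M x.
        nab x v (\<lambda>y. lcomb 1 (Y y) 1 (Z y)) = lcomb 1 (nab x v Y) 1 (nab x v Z))) \<and>
     (\<forall>U Y f. vfield_on M U Y \<and> smooth_fun M U f \<longrightarrow> (\<forall>x\<in>U. \<forall>v\<in>tangent M x.
        nab x v (\<lambda>y h. f y * Y y h) = lcomb (v f) (Y x) (f x) (nab x v Y)))"

definition torsion_free :: "('a, 'e::euclidean_space) mfd \<Rightarrow> 'a conn \<Rightarrow> bool" where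
  "torsion_free M nab \<longleftrightarrow> (\<forall>U X Y. vfield_on M U X \<and> vfield_on M U Y \<longrightarrow>
     (\<forall>x\<in>U. lcomb 1 (nab x (X x) Y) (- 1) (nab x (Y x) X) = lie_bracket M X Y x))"

definition flat_connection :: "('a, 'e::euclidean_space) mfd \<Rightarrow> 'a conn \<Rightarrow> bool" where
  "flat_connection M nab \<longleftrightarrow>
     (\<forall>U X Y Z. vfield_on M U X \<and> vfield_on M U Y \<and> vfield_on M U Z \<longrightarrow> (\<forall>x\<in>U.
        lcomb 1 (nab x (X x) (\<lambda>y. nab y (Y y) Z)) (- 1) (nab x (Y x) (\<lambda>y. nab y (X y) Z))
          = nab x (lie_bracket M X Y x) Z))"

definition parallel2 :: "('a, 'e::euclidean_space) mfd \<Rightarrow> 'a conn \<Rightarrow>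
    ('a \<Rightarrow> 'a tv \<Rightarrow> 'a tv \<Rightarrow> real) \<Rightarrow> bool" where
  "parallel2 M nab h \<longleftrightarrow> (\<forall>U Y Z. vfield_on M U Y \<and> vfield_on M U Z \<longrightarrow>
     (\<forall>x\<in>U. \<forall>v\<in>tangent M x.
        v (\<lambda>y. h y (Y y) (Z y)) = h x (nab x v Y) (Z x) + h x (Y x) (nab x v Z)))"

definition levi_civita :: "('a, 'e::euclidean_space) mfd \<Rightarrow>
    ('a \<Rightarrow> 'a tv \<Rightarrow> 'a tv \<Rightarrow> real) \<Rightarrow> 'a conn \<Rightarrow> bool" where
  "levi_civita M g D \<longleftrightarrow> affine_connection M D \<and> torsion_free M D \<and> parallel2 M D g"

text \<open>\<open>(\<nabla>s)\<^sub>p = 0\<close> for a 1-form \<open>s\<close>, with respect to the dual connection on the cotangent bundle.\<close>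

definition form_parallel_at :: "('a, 'e::euclidean_space) mfd \<Rightarrow> 'a conn \<Rightarrow>
    ('a \<Rightarrow> 'a tv \<Rightarrow> real) \<Rightarrow> 'a \<Rightarrow> bool" where
  "form_parallel_at M nab s p \<longleftrightarrow> (\<forall>U Y. p \<in> U \<and> vfield_on M U Y \<longrightarrow>
     (\<forall>v\<in>tangent M p. v (\<lambda>x. s x (Y x)) - s p (nab p v Y) = 0))"

section \<open>Group actions and principal bundles\<close>

text \<open>\<open>G\<close> is a Lie group of complex numbers under multiplication, either the unit circle or the
  punctured plane.\<close>

definition smooth_action :: "(complex, 'g::euclidean_space) mfd \<Rightarrow> ('a, 'e::euclidean_space) mfd \<Rightarrow>
    (complex \<Rightarrow> 'a \<Rightarrow> 'a) \<Rightarrow> bool" where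
  "smooth_action G M act \<longleftrightarrow> smooth_map (prod_mfd G M) M (\<lambda>(z, x). act z x) \<and>
     (\<forall>x\<in>points M. act 1 x = x) \<and>
     (\<forall>z\<in>points G. \<forall>w\<in>points G. \<forall>x\<in>points M. act (z * w) x = act z (act w x))"

definition free_action :: "(complex, 'g::euclidean_space) mfd \<Rightarrow> ('a, 'e::euclidean_space) mfd \<Rightarrow>
    (complex \<Rightarrow> 'a \<Rightarrow> 'a) \<Rightarrow> bool" where
  "free_action G M act \<longleftrightarrow> (\<forall>z\<in>points G. \<forall>x\<in>points M. act z x = x \<longrightarrow> z = 1)"

definition principal_action :: "(complex, 'g::euclidean_space) mfd \<Rightarrow> ('a, 'e::euclidean_space) mfd \<Rightarrow>
    (complex \<Rightarrow> 'a \<Rightarrow> 'a) \<Rightarrow> bool" where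
  "principal_action G M act \<longleftrightarrow> smooth_action G M act \<and> free_action G M act \<and>
     proper_map (prod_topology (mtop G) (mtop M)) (prod_topology (mtop M) (mtop M))
       (\<lambda>(z, x). (act z x, x))"

definition generates_free_circle_action ::
  "('a, 'e::euclidean_space) mfd \<Rightarrow> ('a \<Rightarrow> 'a tv) \<Rightarrow> bool" where
  "generates_free_circle_action M X \<longleftrightarrow> vfield_on M (points M) X \<and>
     (\<exists>act. smooth_action circle_mfd M act \<and> free_action circle_mfd M act \<and>
        (\<forall>x\<in>points M. integral_curve M X (\<lambda>t. act (cis t) x)))"

definition principal_circle_bundle :: "('p, 'f::euclidean_space) mfd \<Rightarrow>
    ('b, 'e::euclidean_space) mfd \<Rightarrow> ('p \<Rightarrow> 'b) \<Rightarrow> (complex \<Rightarrow> 'p \<Rightarrow> 'p) \<Rightarrow> bool" where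
  "principal_circle_bundle P B pr act \<longleftrightarrow>
     smooth_manifold P \<and> smooth_manifold B \<and> smooth_map P B pr \<and>
     smooth_action circle_mfd P act \<and>
     (\<forall>z\<in>points circle_mfd. \<forall>x\<in>points P. pr (act z x) = pr x) \<and>
     (\<forall>b\<in>points B. \<exists>V \<Psi>. openin (mtop B) V \<and> b \<in> V \<and>
        diffeo (restrict_mfd P {x \<in> points P. pr x \<in> V})
          (prod_mfd (restrict_mfd B V) circle_mfd) \<Psi> \<and>
        (\<forall>x\<in>points P. pr x \<in> V \<longrightarrow> fst (\<Psi> x) = pr x \<and>
           (\<forall>z\<in>points circle_mfd. \<Psi> (act z x) = (pr x, z * snd (\<Psi> x)))))"

text \<open>The generator of a circle action, where the circle is regarded as the quotient of the real line
  by multiples of the period \<open>T > 0\<close>; \<open>T = 2 * pi\<close> gives the derivative of \<open>act (cis t) x\<close> at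
  \<open>t = 0\<close>. The period is kept as a parameter since it enters the normalisation of a connection and
  hence the integrality conditions on its curvature.\<close>

definition circle_generator :: "real \<Rightarrow> ('p, 'f::euclidean_space) mfd \<Rightarrow>
    (complex \<Rightarrow> 'p \<Rightarrow> 'p) \<Rightarrow> 'p \<Rightarrow> 'p tv" where
  "circle_generator T P act x = curve_velocity P (\<lambda>t. act (cis (2 * pi * t / T)) x) 0"

definition principal_connection :: "real \<Rightarrow> ('p, 'f::euclidean_space) mfd \<Rightarrow> (complex \<Rightarrow> 'p \<Rightarrow> 'p) \<Rightarrow>
    ('p \<Rightarrow> 'p tv \<Rightarrow> real) \<Rightarrow> bool" where
  "principal_connection T P act eta \<longleftrightarrow> one_form_on P (points P) eta \<and>
     (\<forall>x\<in>points P. eta x (circle_generator T P act x) = 1) \<and>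
     (\<forall>z\<in>points circle_mfd. \<forall>x\<in>points P. \<forall>u\<in>tangent P x.
        eta (act z x) (push P P (act z) x u) = eta x u)"

text \<open>\<open>q\<close> exhibits \<open>B\<close> as the smooth quotient of \<open>P\<close> by the flow of the complete vector field \<open>X\<close>.\<close>

definition flow_quotient :: "('p, 'f::euclidean_space) mfd \<Rightarrow> ('p \<Rightarrow> 'p tv) \<Rightarrow>
    ('b, 'e::euclidean_space) mfd \<Rightarrow> ('p \<Rightarrow> 'b) \<Rightarrow> bool" where
  "flow_quotient P X B q \<longleftrightarrow> complete_vfield P X \<and> smooth_manifold B \<and>
     smooth_map P B q \<and> q ` points P = points B \<and>
     (\<forall>x\<in>points P. push P B q x ` tangent P x = tangent B (q x)) \<and>
     (\<forall>x\<in>points P. \<forall>y\<in>points P.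
        q x = q y \<longleftrightarrow> (\<exists>\<gamma> t. integral_curve P X \<gamma> \<and> \<gamma> 0 = x \<and> \<gamma> t = y))"

section \<open>Special Kaehler geometry\<close>

text \<open>The last conjunct is the vanishing of the Nijenhuis tensor.\<close>

definition complex_structure ::
  "('a, 'e::euclidean_space) mfd \<Rightarrow> ('a \<Rightarrow> 'a tv \<Rightarrow> 'a tv) \<Rightarrow> bool" where
  "complex_structure M J \<longleftrightarrow> endo_field M J \<and>
     (\<forall>x\<in>points M. \<forall>u\<in>tangent M x. J x (J x u) = (\<lambda>f. - u f)) \<and>
     (\<forall>U X Y. vfield_on M U X \<and> vfield_on M U Y \<longrightarrow> (\<forall>x\<in>U. \<forall>f.
        lie_bracket M (\<lambda>y. J y (X y)) (\<lambda>y. J y (Y y)) x f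
        - J x (lie_bracket M (\<lambda>y. J y (X y)) Y x) f
        - J x (lie_bracket M X (\<lambda>y. J y (Y y)) x) f
        - lie_bracket M X Y x f = 0))"

definition pseudo_kaehler :: "('a, 'e::euclidean_space) mfd \<Rightarrow> ('a \<Rightarrow> 'a tv \<Rightarrow> 'a tv \<Rightarrow> real) \<Rightarrow>
    ('a \<Rightarrow> 'a tv \<Rightarrow> 'a tv) \<Rightarrow> ('a \<Rightarrow> 'a tv \<Rightarrow> 'a tv \<Rightarrow> real) \<Rightarrow> bool" where
  "pseudo_kaehler M g J om \<longleftrightarrow> pseudo_riemannian M g \<and> complex_structure M J \<and>
     (\<forall>x\<in>points M. \<forall>u\<in>tangent M x. \<forall>v\<in>tangent M x.
        g x (J x u) (J x v) = g x u v \<and> om x u v = g x (J x u) v) \<and>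
     closed2 M om"

definition ask_manifold :: "('a, 'e::euclidean_space) mfd \<Rightarrow> ('a \<Rightarrow> 'a tv \<Rightarrow> 'a tv \<Rightarrow> real) \<Rightarrow>
    ('a \<Rightarrow> 'a tv \<Rightarrow> 'a tv) \<Rightarrow> ('a \<Rightarrow> 'a tv \<Rightarrow> 'a tv \<Rightarrow> real) \<Rightarrow> 'a conn \<Rightarrow> bool" where
  "ask_manifold M g J om nab \<longleftrightarrow> pseudo_kaehler M g J om \<and>
     affine_connection M nab \<and> flat_connection M nab \<and> torsion_free M nab \<and> parallel2 M nab om \<and>
     (\<forall>U X Y. vfield_on M U X \<and> vfield_on M U Y \<longrightarrow> (\<forall>x\<in>U.
        lcomb 1 (nab x (X x) (\<lambda>y. J y (Y y))) (- 1) (J x (nab x (X x) Y))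
        = lcomb 1 (nab x (Y x) (\<lambda>y. J y (X y))) (- 1) (J x (nab x (Y x) X))))"

definition cask_manifold :: "('a, 'e::euclidean_space) mfd \<Rightarrow> ('a \<Rightarrow> 'a tv \<Rightarrow> 'a tv \<Rightarrow> real) \<Rightarrow>
    ('a \<Rightarrow> 'a tv \<Rightarrow> 'a tv) \<Rightarrow> ('a \<Rightarrow> 'a tv \<Rightarrow> 'a tv \<Rightarrow> real) \<Rightarrow> 'a conn \<Rightarrow> ('a \<Rightarrow> 'a tv) \<Rightarrow> bool" where
  "cask_manifold M g J om nab xi \<longleftrightarrow> ask_manifold M g J om nab \<and> complete_vfield M xi \<and>
     (\<forall>x\<in>points M. \<forall>a b. let v = lcomb a (xi x) b (J x (xi x)) in
        v \<noteq> (\<lambda>_. 0) \<longrightarrow> g x v v < 0) \<and>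
     (\<forall>x\<in>points M. \<forall>v\<in>tangent M x.
        g x v (xi x) = 0 \<and> g x v (J x (xi x)) = 0 \<and> v \<noteq> (\<lambda>_. 0) \<longrightarrow> g x v v > 0) \<and>
     (\<exists>D. levi_civita M g D \<and>
        (\<forall>x\<in>points M. \<forall>v\<in>tangent M x. D x v xi = v \<and> nab x v xi = v)) \<and>
     connected_space (mtop M) \<and> points M \<noteq> {} \<and>
     (\<exists>act. principal_action cstar_mfd M act \<and>
        (\<forall>x\<in>points M. integral_curve M xi (\<lambda>t. act (of_real (exp t)) x) \<and>
           integral_curve M (\<lambda>y. J y (xi y)) (\<lambda>t. act (cis t) x)))"

section \<open>The cotangent bundle as a manifold\<close>

definition coord_vector :: "('a, 'e::euclidean_space) mfd \<Rightarrow> 'a set \<Rightarrow> ('a \<Rightarrow> 'e) \<Rightarrow> 'a \<Rightarrow> 'e \<Rightarrow> 'a tv" where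
  "coord_vector M U \<phi> p b = (\<lambda>f. if smooth_near M p f
     then frechet_derivative (f \<circ> inv_into U \<phi>) (at (\<phi> p)) b else 0)"

definition cotangent_chart :: "('a, 'e::euclidean_space) mfd \<Rightarrow> 'a set \<Rightarrow> ('a \<Rightarrow> 'e) \<Rightarrow>
    'a \<times> ('a tv \<Rightarrow> real) \<Rightarrow> 'e \<times> 'e" where
  "cotangent_chart M U \<phi> z =
     (\<phi> (fst z), \<Sum>b\<in>Basis. snd z (coord_vector M U \<phi> (fst z) b) *\<^sub>R b)"

definition cotangent_mfd ::
  "('a, 'e::euclidean_space) mfd \<Rightarrow> ('a \<times> ('a tv \<Rightarrow> real), 'e \<times> 'e) mfd" where
  "cotangent_mfd M = \<lparr>
     mtop = topology_generated_by
       {{z \<in> Sigma U (cotangent M). cotangent_chart M U \<phi> z \<in> W} | U \<phi> W.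
          (U, \<phi>) \<in> charts M \<and> open W},
     charts = {(Sigma U (cotangent M), cotangent_chart M U \<phi>) | U \<phi>. (U, \<phi>) \<in> charts M}\<rparr>"

section \<open>Rigid c-map, HK/QK data and supergravity c-map\<close>

locale cask_data =
  fixes M :: "('m, 'e::euclidean_space) mfd"
    and g :: "'m \<Rightarrow> 'm tv \<Rightarrow> 'm tv \<Rightarrow> real"
    and J :: "'m \<Rightarrow> 'm tv \<Rightarrow> 'm tv"
    and om :: "'m \<Rightarrow> 'm tv \<Rightarrow> 'm tv \<Rightarrow> real"
    and nab :: "'m conn"
    and xi :: "'m \<Rightarrow> 'm tv"
begin

definition N :: "('m \<times> ('m tv \<Rightarrow> real), 'e \<times> 'e) mfd" where
  "N = cotangent_mfd M"

definition dpi :: "'m \<times> ('m tv \<Rightarrow> real) \<Rightarrow> ('m \<times> ('m tv \<Rightarrow> real)) tv \<Rightarrow> 'm tv" where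
  "dpi z u = push N M fst z u"

text \<open>The horizontal lift of \<open>v\<close> to \<open>z = (p, \<alpha>)\<close> is \<open>ds(v)\<close> for any local section \<open>s\<close> of the
  cotangent bundle with \<open>s(p) = \<alpha>\<close> and \<open>(\<nabla>s)\<^sub>p = 0\<close>.\<close>

definition hlift :: "'m \<times> ('m tv \<Rightarrow> real) \<Rightarrow> 'm tv \<Rightarrow> ('m \<times> ('m tv \<Rightarrow> real)) tv" where
  "hlift z v = (THE h. \<exists>U s. fst z \<in> U \<and> one_form_on M U s \<and> s (fst z) = snd z \<and>
      form_parallel_at M nab s (fst z) \<and> h = push M N (\<lambda>x. (x, s x)) (fst z) v)"

definition vlift :: "'m \<times> ('m tv \<Rightarrow> real) \<Rightarrow> ('m tv \<Rightarrow> real) \<Rightarrow> ('m \<times> ('m tv \<Rightarrow> real)) tv" where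
  "vlift z \<beta> = curve_velocity N (\<lambda>t. (fst z, lcomb 1 (snd z) t \<beta>)) 0"

text \<open>The inverse of the identification of \<open>TN\<close> with the sum of the pullbacks of \<open>TM\<close> and its dual
  sends \<open>(v, \<beta>)\<close> to \<open>from_split z v \<beta>\<close>; the two components of \<open>u\<close> are \<open>dpi z u\<close> and \<open>vpart z u\<close>.\<close>

definition from_split ::
  "'m \<times> ('m tv \<Rightarrow> real) \<Rightarrow> 'm tv \<Rightarrow> ('m tv \<Rightarrow> real) \<Rightarrow> ('m \<times> ('m tv \<Rightarrow> real)) tv" where
  "from_split z v \<beta> = lcomb 1 (hlift z v) 1 (vlift z \<beta>)"

definition vpart :: "'m \<times> ('m tv \<Rightarrow> real) \<Rightarrow> ('m \<times> ('m tv \<Rightarrow> real)) tv \<Rightarrow> 'm tv \<Rightarrow> real" where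
  "vpart z u = (THE \<beta>. \<beta> \<in> cotangent M (fst z) \<and> u = from_split z (dpi z u) \<beta>)"

definition form_restrict :: "'m \<Rightarrow> ('m tv \<Rightarrow> real) \<Rightarrow> 'm tv \<Rightarrow> real" where
  "form_restrict p \<alpha> = (\<lambda>v. if v \<in> tangent M p then \<alpha> v else 0)"

definition g_sharp :: "'m \<Rightarrow> ('m tv \<Rightarrow> real) \<Rightarrow> 'm tv" where
  "g_sharp p \<beta> = (THE v. v \<in> tangent M p \<and> form_restrict p (g p v) = \<beta>)"

definition g_inv :: "'m \<Rightarrow> ('m tv \<Rightarrow> real) \<Rightarrow> ('m tv \<Rightarrow> real) \<Rightarrow> real" where
  "g_inv p \<alpha> \<beta> = g p (g_sharp p \<alpha>) (g_sharp p \<beta>)"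

definition om_inv :: "'m \<Rightarrow> ('m tv \<Rightarrow> real) \<Rightarrow> 'm tv" where
  "om_inv p \<beta> = (THE v. v \<in> tangent M p \<and> form_restrict p (om p v) = \<beta>)"

definition gN :: "'m \<times> ('m tv \<Rightarrow> real) \<Rightarrow> ('m \<times> ('m tv \<Rightarrow> real)) tv \<Rightarrow>
    ('m \<times> ('m tv \<Rightarrow> real)) tv \<Rightarrow> real" where
  "gN z u w = g (fst z) (dpi z u) (dpi z w) + g_inv (fst z) (vpart z u) (vpart z w)"

definition I1 :: "'m \<times> ('m tv \<Rightarrow> real) \<Rightarrow> ('m \<times> ('m tv \<Rightarrow> real)) tv \<Rightarrow>
    ('m \<times> ('m tv \<Rightarrow> real)) tv" where
  "I1 z u = from_split z (J (fst z) (dpi z u))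
      (form_restrict (fst z) (\<lambda>v. vpart z u (J (fst z) v)))"

definition I2 :: "'m \<times> ('m tv \<Rightarrow> real) \<Rightarrow> ('m \<times> ('m tv \<Rightarrow> real)) tv \<Rightarrow>
    ('m \<times> ('m tv \<Rightarrow> real)) tv" where
  "I2 z u = from_split z (\<lambda>f. - om_inv (fst z) (vpart z u) f)
      (form_restrict (fst z) (om (fst z) (dpi z u)))"

definition I3 :: "'m \<times> ('m tv \<Rightarrow> real) \<Rightarrow> ('m \<times> ('m tv \<Rightarrow> real)) tv \<Rightarrow>
    ('m \<times> ('m tv \<Rightarrow> real)) tv" where
  "I3 z u = I1 z (I2 z u)"

definition Z :: "'m \<times> ('m tv \<Rightarrow> real) \<Rightarrow> ('m \<times> ('m tv \<Rightarrow> real)) tv" where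
  "Z z = hlift z (\<lambda>f. - J (fst z) (xi (fst z)) f)"

definition omega1 :: "'m \<times> ('m tv \<Rightarrow> real) \<Rightarrow> ('m \<times> ('m tv \<Rightarrow> real)) tv \<Rightarrow>
    ('m \<times> ('m tv \<Rightarrow> real)) tv \<Rightarrow> real" where
  "omega1 z u w = gN z (I1 z u) w"

definition iota_Z_gN :: "'m \<times> ('m tv \<Rightarrow> real) \<Rightarrow> ('m \<times> ('m tv \<Rightarrow> real)) tv \<Rightarrow> real" where
  "iota_Z_gN z = (\<lambda>u. if u \<in> tangent N z then gN z (Z z) u else 0)"

definition omegaH :: "'m \<times> ('m tv \<Rightarrow> real) \<Rightarrow> ('m \<times> ('m tv \<Rightarrow> real)) tv \<Rightarrow>
    ('m \<times> ('m tv \<Rightarrow> real)) tv \<Rightarrow> real" where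
  "omegaH z u w = omega1 z u w + ext_deriv1 N iota_Z_gN z u w"

definition fZ :: "'m \<times> ('m tv \<Rightarrow> real) \<Rightarrow> real" where
  "fZ z = - (1/2) * gN z (Z z) (Z z)"

definition fH :: "'m \<times> ('m tv \<Rightarrow> real) \<Rightarrow> real" where
  "fH z = (1/2) * gN z (Z z) (Z z)"

definition fZc :: "real \<Rightarrow> 'm \<times> ('m tv \<Rightarrow> real) \<Rightarrow> real" where
  "fZc c z = fZ z - (1/2) * c"

definition fHc :: "real \<Rightarrow> 'm \<times> ('m tv \<Rightarrow> real) \<Rightarrow> real" where
  "fHc c z = fH z - (1/2) * c"

definition Nc :: "real \<Rightarrow> ('m \<times> ('m tv \<Rightarrow> real), 'e \<times> 'e) mfd" where
  "Nc c = restrict_mfd N {z \<in> points N. fZc c z > 0}"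

definition HZ :: "'m \<times> ('m tv \<Rightarrow> real) \<Rightarrow> ('m \<times> ('m tv \<Rightarrow> real)) tv set" where
  "HZ z = {(\<lambda>f. a0 * Z z f + a1 * I1 z (Z z) f + a2 * I2 z (Z z) f + a3 * I3 z (Z z) f)
             | a0 a1 a2 a3. True}"

definition projHZ :: "'m \<times> ('m tv \<Rightarrow> real) \<Rightarrow> ('m \<times> ('m tv \<Rightarrow> real)) tv \<Rightarrow>
    ('m \<times> ('m tv \<Rightarrow> real)) tv" where
  "projHZ z u = (THE v. v \<in> HZ z \<and> (\<forall>w\<in>HZ z. gN z (lcomb 1 u (- 1) v) w = 0))"

definition gHc :: "real \<Rightarrow> 'm \<times> ('m tv \<Rightarrow> real) \<Rightarrow> ('m \<times> ('m tv \<Rightarrow> real)) tv \<Rightarrow>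
    ('m \<times> ('m tv \<Rightarrow> real)) tv \<Rightarrow> real" where
  "gHc c z u w =
     (1 / fZc c z) * gN z (lcomb 1 u (- 1) (projHZ z u)) (lcomb 1 w (- 1) (projHZ z w))
     + (fHc c z / (fZc c z)\<^sup>2) * gN z (projHZ z u) (projHZ z w)"

text \<open>The twist data: \<open>P\<close> is the total space, \<open>pr\<close> the projection to the restricted cotangent bundle,
  \<open>act\<close> the principal action with circle of period \<open>T\<close>, and \<open>eta\<close> the connection form.\<close>

definition twist_bundle :: "real \<Rightarrow> real \<Rightarrow> ('p, 'f::euclidean_space) mfd \<Rightarrow>
    ('p \<Rightarrow> 'm \<times> ('m tv \<Rightarrow> real)) \<Rightarrow> (complex \<Rightarrow> 'p \<Rightarrow> 'p) \<Rightarrow> ('p \<Rightarrow> 'p tv \<Rightarrow> real) \<Rightarrow> bool" where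
  "twist_bundle c T P pr act eta \<longleftrightarrow>
     principal_circle_bundle P (Nc c) pr act \<and> principal_connection T P act eta \<and>
     (\<forall>x\<in>points P. \<forall>u\<in>tangent P x. \<forall>v\<in>tangent P x.
        ext_deriv1 P eta x u v
        = omegaH (pr x) (push P (Nc c) pr x u) (push P (Nc c) pr x v))"

definition Zhat :: "real \<Rightarrow> ('p, 'f::euclidean_space) mfd \<Rightarrow>
    ('p \<Rightarrow> 'm \<times> ('m tv \<Rightarrow> real)) \<Rightarrow> ('p \<Rightarrow> 'p tv \<Rightarrow> real) \<Rightarrow> 'p \<Rightarrow> 'p tv" where
  "Zhat c P pr eta x =
     (THE u. u \<in> tangent P x \<and> eta x u = 0 \<and> push P (Nc c) pr x u = Z (pr x))"

definition ZP :: "real \<Rightarrow> real \<Rightarrow> ('p, 'f::euclidean_space) mfd \<Rightarrow> ('p \<Rightarrow> 'm \<times> ('m tv \<Rightarrow> real)) \<Rightarrow>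
    (complex \<Rightarrow> 'p \<Rightarrow> 'p) \<Rightarrow> ('p \<Rightarrow> 'p tv \<Rightarrow> real) \<Rightarrow> 'p \<Rightarrow> 'p tv" where
  "ZP c T P pr act eta x = lcomb 1 (Zhat c P pr eta x) (fHc c (pr x)) (circle_generator T P act x)"

definition H_related2 :: "real \<Rightarrow> ('p, 'f::euclidean_space) mfd \<Rightarrow>
    ('p \<Rightarrow> 'm \<times> ('m tv \<Rightarrow> real)) \<Rightarrow> ('p \<Rightarrow> 'p tv \<Rightarrow> real) \<Rightarrow> ('b, 'h::euclidean_space) mfd \<Rightarrow>
    ('p \<Rightarrow> 'b) \<Rightarrow> ('m \<times> ('m tv \<Rightarrow> real) \<Rightarrow> ('m \<times> ('m tv \<Rightarrow> real)) tv \<Rightarrow>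
      ('m \<times> ('m tv \<Rightarrow> real)) tv \<Rightarrow> real) \<Rightarrow> ('b \<Rightarrow> 'b tv \<Rightarrow> 'b tv \<Rightarrow> real) \<Rightarrow> bool" where
  "H_related2 c P pr eta B q h k \<longleftrightarrow>
     (\<forall>x\<in>points P. \<forall>u\<in>tangent P x. \<forall>v\<in>tangent P x. eta x u = 0 \<and> eta x v = 0 \<longrightarrow>
        k (q x) (push P B q x u) (push P B q x v)
        = h (pr x) (push P (Nc c) pr x u) (push P (Nc c) pr x v))"

text \<open>\<open>Q y\<close> is the set of endomorphisms of the tangent space at \<open>y\<close> which correspond, through
  \<open>ker eta\<close>, to real linear combinations of \<open>I1\<close>, \<open>I2\<close>, \<open>I3\<close>. Endomorphisms are extended by 0
  outside the tangent space.\<close>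

definition twisted_Q :: "real \<Rightarrow> ('p, 'f::euclidean_space) mfd \<Rightarrow>
    ('p \<Rightarrow> 'm \<times> ('m tv \<Rightarrow> real)) \<Rightarrow> ('p \<Rightarrow> 'p tv \<Rightarrow> real) \<Rightarrow> ('b, 'h::euclidean_space) mfd \<Rightarrow>
    ('p \<Rightarrow> 'b) \<Rightarrow> ('b \<Rightarrow> ('b tv \<Rightarrow> 'b tv) set) \<Rightarrow> bool" where
  "twisted_Q c P pr eta B q Q \<longleftrightarrow> (\<forall>x\<in>points P. Q (q x) =
     {A. linear_endo_on (tangent B (q x)) A \<and> (\<forall>u. u \<notin> tangent B (q x) \<longrightarrow> A u = (\<lambda>_. 0)) \<and>
       (\<exists>a1 a2 a3. \<forall>u\<in>tangent P x. \<forall>w\<in>tangent P x. eta x u = 0 \<and> eta x w = 0 \<and>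
          push P (Nc c) pr x w = (let v = push P (Nc c) pr x u in
             (\<lambda>f. a1 * I1 (pr x) v f + a2 * I2 (pr x) v f + a3 * I3 (pr x) v f)) \<longrightarrow>
          A (push P B q x u) = push P B q x w)})"

definition deformed_sugra_cmap :: "real \<Rightarrow> real \<Rightarrow> ('p, 'f::euclidean_space) mfd \<Rightarrow>
    ('p \<Rightarrow> 'm \<times> ('m tv \<Rightarrow> real)) \<Rightarrow> (complex \<Rightarrow> 'p \<Rightarrow> 'p) \<Rightarrow> ('p \<Rightarrow> 'p tv \<Rightarrow> real) \<Rightarrow>
    ('b, 'h::euclidean_space) mfd \<Rightarrow> ('p \<Rightarrow> 'b) \<Rightarrow> ('b \<Rightarrow> 'b tv \<Rightarrow> 'b tv \<Rightarrow> real) \<Rightarrow>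
    ('b \<Rightarrow> ('b tv \<Rightarrow> 'b tv) set) \<Rightarrow> bool" where
  "deformed_sugra_cmap c T P pr act eta Nbar q gbar Q \<longleftrightarrow>
     T > 0 \<and> generates_free_circle_action N Z \<and>
     twist_bundle c T P pr act eta \<and>
     flow_quotient P (ZP c T P pr act eta) Nbar q \<and>
     tensor2_field Nbar gbar \<and> H_related2 c P pr eta Nbar q (gHc c) gbar \<and>
     twisted_Q c P pr eta Nbar q Q"

end

end

theory Submission
  imports Defs
begin

text \<open>Put \<open>y = - g(\<xi>, \<xi>)\<close>, that is \<open>y = 2 f\<^sub>Z\<close>. The horizontal lift of \<open>\<xi>\<close> to \<open>N\<close>, lifted further to the
  twist bundle, and the generator of the principal action both commute with the vector field by
  which one divides, and descend to commuting vector fields \<open>R\<close>, \<open>X\<close> on the quotient. The function \<open>y\<close>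
  descends as well. On the span of \<open>R\<close> and \<open>X\<close> the twisted metric is explicit: it satisfies
  \<open>g(R, .) = \<beta>(y) dy\<close> and \<open>g(X, .) = \<gamma>(y) \<theta>\<close> with \<open>R y = 2 y\<close>, \<open>X y = 0\<close> and a 1-form \<open>\<theta>\<close> whose
  exterior derivative annihilates \<open>R\<close> and \<open>X\<close>. For a Killing field \<open>K\<close> these data turn the Killing equation
  into an overdetermined linear system for \<open>K y\<close> and \<open>\<theta>(K)\<close>, whose integrability condition forces
  \<open>K y = 0\<close> as soon as \<open>c > 0\<close>. All Killing fields are therefore tangent to the level sets of
  \<open>y\<close> and cannot span any tangent space, since \<open>R y\<close> is nonzero.\<close>

section \<open>Calculus of k times continuously differentiable maps\<close>

text \<open>The form \<theta> is forced. On the twist bundle the forms at hand are the connection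
  \<open>eta\<close> and \<open>lam = g(J xi, .)\<close>. The dividing field takes the values - (y +
  c)/2 and y on them, so a combination \<open>eta + F(y) lam\<close> can descend only if F = (y +
  c)/(2y). The derivative of this F is - c/(2 y^2), and exactly this term makes d\<theta> vanish
  along R.

  The metric enters only through its pairings with R and X. Both correspond to vectors in the
  quaternionic span of Z, where the deformed metric is a multiple of \<open>gN\<close>; hence no
  curvature has to be computed.

  The length has another source. Exterior derivatives, horizontal lifts, the splitting of TN, the
  projection to the quaternionic span and the lift of Z are definite descriptions over derivations.
  Each of them says something only once existence and uniqueness are shown, and this takes
  coordinates on the cotangent bundle and on the circle bundle, Hadamard's lemma and local sections
  of submersions.

  Local homogeneity is vacuous on an empty space, so a point of the quotient has to be exhibited as
  well.\<close>

lemma Ck_SucI: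
  assumes "\<And>x. x \<in> S \<Longrightarrow> (f has_derivative f' x) (at x)"
    and "\<And>v. Ck k S (\<lambda>x. f' x v)" and "open S"
  shows "Ck (Suc k) S f"
proof -
  have *: "frechet_derivative f (at x) v = f' x v" if "x \<in> S" for x v
    using frechet_derivative_at[OF assms(1)[OF that]] by simp
  \<comment> \<open>\<open>Ck_cong\<close> will rest on this lemma, so the congruence gets its own
    induction here. It holds because derivatives at points of an open set depend only on values in
    that set.\<close>
  have cong: "Ck k S g" if "Ck k S h" "\<And>x. x \<in> S \<Longrightarrow> g x = h x" for g h :: "'a \<Rightarrow> 'b"
    using that
  proof (induction k arbitrary: g h)
    case 0
    then show ?case using continuous_on_cong by fastforce
  next
    case (Suc k)
    have d: "(g has_derivative frechet_derivative h (at x)) (at x)" if "x \<in> S" for x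
      using has_derivative_transform_within_open[of h _ x UNIV S g] Suc.prems that \<open>open S\<close>
      by (simp add: frechet_derivative_works)
    show ?case
      using d Suc.prems(1) Suc.IH[of "\<lambda>x. frechet_derivative h (at x) v"
          "\<lambda>x. frechet_derivative g (at x) v" for v]
      by (auto simp: differentiable_def frechet_derivative_at[OF d, symmetric])
  qed
  show ?thesis
    using assms(1) by (auto simp: differentiable_def * intro!: cong[OF assms(2)])
qed

lemma Ck_Suc_has_derivative:
  assumes "Ck (Suc k) S f" "x \<in> S"
  shows "(f has_derivative frechet_derivative f (at x)) (at x)"
  using assms by (simp add: frechet_derivative_works)

lemma Ck_cong:
  assumes "Ck k S f" "open S" "\<And>x. x \<in> S \<Longrightarrow> g x = f x"
  shows "Ck k S g"
proof (cases k)
  case 0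
  then show ?thesis using assms continuous_on_cong by fastforce
next
  case (Suc j)
  have "(g has_derivative frechet_derivative f (at x)) (at x)" if "x \<in> S" for x
    using has_derivative_transform_within_open[of f _ x UNIV S g] assms that Suc
    by (simp add: frechet_derivative_works)
  then show ?thesis
    using Ck_SucI[of S g "\<lambda>x. frechet_derivative f (at x)" j] assms Suc by simp
qed

lemma Ck_imp_continuous_on: "Ck k S f \<Longrightarrow> continuous_on S f"
  by (cases k) (auto intro!: continuous_at_imp_continuous_on differentiable_imp_continuous_within)

lemma Ck_SucD: "Ck (Suc k) S f \<Longrightarrow> Ck k S f"
proof (induction k arbitrary: f)
  case 0
  then show ?case using Ck_imp_continuous_on by (metis Ck.simps(1))
next
  case (Suc k)
  then show ?case by simp
qed

lemma Ck_subset: "Ck k S f \<Longrightarrow> T \<subseteq> S \<Longrightarrow> Ck k T f"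
  by (induction k arbitrary: f) (auto intro: continuous_on_subset)

lemma Ck_local:
  assumes "\<And>x. x \<in> S \<Longrightarrow> \<exists>T. open T \<and> x \<in> T \<and> Ck k T f"
  shows "Ck k S f"
  using assms
proof (induction k arbitrary: f)
  case 0
  have "continuous (at x) f" if "x \<in> S" for x
    using 0[OF that] by (auto simp: continuous_on_eq_continuous_at)
  then show ?case by (auto intro: continuous_at_imp_continuous_on)
next
  case (Suc k)
  have "f differentiable (at x)" if "x \<in> S" for x
    using Suc.prems[OF that] by auto
  moreover have "Ck k S (\<lambda>x. frechet_derivative f (at x) v)" for v
    by (rule Suc.IH) (use Suc.prems in fastforce)
  ultimately show ?case by simp
qed

lemma Ck_const: "open S \<Longrightarrow> Ck k S (\<lambda>x. c)"
proof (induction k arbitrary: c)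
  case (Suc k)
  show ?case by (rule Ck_SucI[where f'="\<lambda>x v. 0"]) (use Suc in auto)
qed simp

lemma Ck_bounded_linear:
  assumes "bounded_linear L" "open S"
  shows "Ck k S L"
proof (cases k)
  case 0
  then show ?thesis using assms by (simp add: linear_continuous_on)
next
  case (Suc j)
  then show ?thesis
    using Ck_SucI[of S L "\<lambda>x. L" j] Ck_const[OF \<open>open S\<close>, of j] bounded_linear_imp_has_derivative[OF assms(1)] assms
    by blast
qed

lemma Ck_add:
  assumes "Ck k S f" "Ck k S g" "open S"
  shows "Ck k S (\<lambda>x. f x + g x)"
  using assms
proof (induction k arbitrary: f g)
  case 0
  then show ?case by (auto intro: continuous_intros)
next
  case (Suc k)
  show ?case
    by (rule Ck_SucI[where f'="\<lambda>x v. frechet_derivative f (at x) v + frechet_derivative g (at x) v"])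
       (use Suc in \<open>auto intro!: has_derivative_add Ck_Suc_has_derivative\<close>)
qed

lemma Ck_sum:
  assumes "\<And>i. i \<in> I \<Longrightarrow> Ck k S (f i)" "open S"
  shows "Ck k S (\<lambda>x. \<Sum>i\<in>I. f i x)"
  using assms(1)
  by (induction I rule: infinite_finite_induct) (auto intro!: Ck_add Ck_const assms(2))

lemma Ck_bilinear:
  fixes prod :: "'b::euclidean_space \<Rightarrow> 'c::euclidean_space \<Rightarrow> 'd::euclidean_space"
    and f :: "'a::euclidean_space \<Rightarrow> 'b"
  assumes "bounded_bilinear prod" "Ck k S f" "Ck k S g" "open S"
  shows "Ck k S (\<lambda>x. prod (f x) (g x))"
  using assms(2-4)
proof (induction k arbitrary: f g)
  case 0
  then show ?case by (auto intro: bounded_bilinear.continuous_on[OF assms(1)])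
next
  case (Suc k)
  show ?case
  proof (rule Ck_SucI[where f'="\<lambda>x v. prod (f x) (frechet_derivative g (at x) v)
      + prod (frechet_derivative f (at x) v) (g x)"])
    fix x assume "x \<in> S"
    then show "((\<lambda>x. prod (f x) (g x)) has_derivative (\<lambda>v. prod (f x) (frechet_derivative g (at x) v)
      + prod (frechet_derivative f (at x) v) (g x))) (at x)"
      using Suc.prems by (intro bounded_bilinear.FDERIV[OF assms(1)] Ck_Suc_has_derivative) auto
  next
    fix v
    show "Ck k S (\<lambda>x. prod (f x) (frechet_derivative g (at x) v)
      + prod (frechet_derivative f (at x) v) (g x))"
      using Suc.prems Ck_SucD[OF Suc.prems(1)] Ck_SucD[OF Suc.prems(2)]
      by (intro Ck_add Suc.IH) auto
  qed (fact Suc.prems)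
qed

lemmas Ck_mult = Ck_bilinear[OF bounded_bilinear_mult]
  and Ck_scaleR = Ck_bilinear[OF bounded_bilinear_scaleR]

lemma Ck_linear_compose:
  assumes "bounded_linear L" "Ck k S f" "open S"
  shows "Ck k S (\<lambda>x. L (f x))"
  using assms(2)
proof (induction k arbitrary: f)
  case 0
  then show ?case using bounded_linear.continuous_on[OF assms(1)] by simp
next
  case (Suc k)
  show ?case
    by (rule Ck_SucI[where f'="\<lambda>x v. L (frechet_derivative f (at x) v)"])
       (use Suc assms in \<open>auto intro!: bounded_linear.has_derivative[OF assms(1)] Ck_Suc_has_derivative\<close>)
qed

lemma Ck_componentwise:
  assumes "\<And>b. b \<in> Basis \<Longrightarrow> Ck k S (\<lambda>x. f x \<bullet> b)" "open S"
  shows "Ck k S f"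
proof -
  have "Ck k S (\<lambda>x. \<Sum>b\<in>Basis. (f x \<bullet> b) *\<^sub>R b)"
    using assms by (intro Ck_sum Ck_scaleR Ck_const) auto
  then show ?thesis by (simp add: euclidean_representation)
qed

lemma linear_basis_sum:
  fixes L :: "'a::euclidean_space \<Rightarrow> 'b::real_vector"
  assumes "linear L"
  shows "L v = (\<Sum>b\<in>Basis. (v \<bullet> b) *\<^sub>R L b)"
proof -
  have "L v = L (\<Sum>b\<in>Basis. (v \<bullet> b) *\<^sub>R b)" by (simp add: euclidean_representation)
  then show ?thesis by (simp only: linear_sum[OF assms] linear_cmul[OF assms])
qed

lemma Ck_compose:
  assumes "Ck k S f" "Ck k T g" "open S" "open T" "f ` S \<subseteq> T"
  shows "Ck k S (\<lambda>x. g (f x))"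
  using assms(1,2)
proof (induction k arbitrary: g)
  case 0
  then show ?case using continuous_on_compose2[of T g S f] assms by auto
next
  case (Suc k)
  \<comment> \<open>Expanding over a basis separates the two factors of the chain rule: the partial
    derivatives of \<open>g\<close> composed with \<open>f\<close> fall under the induction
    hypothesis, which is therefore kept general in \<open>g\<close>.\<close>
  let ?D = "\<lambda>x v. \<Sum>b\<in>Basis. (frechet_derivative f (at x) v \<bullet> b) *\<^sub>R frechet_derivative g (at (f x)) b"
  show ?case
  proof (rule Ck_SucI[where f'="?D"])
    fix x assume x: "x \<in> S"
    have g: "(g has_derivative frechet_derivative g (at (f x))) (at (f x))"
      using x assms(5) Suc.prems(2) by (intro Ck_Suc_has_derivative) auto
    have "((\<lambda>x. g (f x)) has_derivative (\<lambda>v. frechet_derivative g (at (f x)) (frechet_derivative f (at x) v))) (at x)"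
      using diff_chain_at[OF Ck_Suc_has_derivative[OF Suc.prems(1) x] g] by (simp add: o_def)
    then show "((\<lambda>x. g (f x)) has_derivative ?D x) (at x)"
      by (subst (asm) linear_basis_sum[OF has_derivative_linear[OF g]])
  next
    fix v
    show "Ck k S (\<lambda>x. ?D x v)"
      using Suc.prems assms(3,5)
      by (intro Ck_sum Ck_scaleR Ck_linear_compose[OF bounded_linear_inner_left] Suc.IH Ck_SucD[OF Suc.prems(1)])
         auto
  qed (fact assms(3))
qed

text \<open>The derivative of \<open>1/f\<close> contains only \<open>1/f\<close> itself and one
  derivative of \<open>f\<close>, so the induction closes for a fixed \<open>f\<close>.\<close>

lemma Ck_inverse:
  fixes f :: "'a::euclidean_space \<Rightarrow> real"
  assumes "Ck k S f" "open S" "\<And>x. x \<in> S \<Longrightarrow> f x \<noteq> 0"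
  shows "Ck k S (\<lambda>x. inverse (f x))"
  using assms(1)
proof (induction k)
  case 0
  then show ?case using assms by (auto intro!: continuous_intros)
next
  case (Suc k)
  show ?case
  proof (rule Ck_SucI[where f'="\<lambda>x v. (-1) * (inverse (f x) * frechet_derivative f (at x) v * inverse (f x))"])
    fix x assume x: "x \<in> S"
    show "((\<lambda>x. inverse (f x)) has_derivative
         (\<lambda>v. (-1) * (inverse (f x) * frechet_derivative f (at x) v * inverse (f x)))) (at x)"
      using Ck_Suc_has_derivative[OF Suc.prems x] assms(3)[OF x] has_derivative_inverse by fastforce
  next
    fix v
    have "Ck k S (\<lambda>x. inverse (f x))" using Suc.IH Ck_SucD[OF Suc.prems] .
    then show "Ck k S (\<lambda>x. (-1) * (inverse (f x) * frechet_derivative f (at x) v * inverse (f x)))"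
      using Suc.prems assms(2) by (intro Ck_mult Ck_const) auto
  qed (fact assms(2))
qed

section \<open>Inverses of families of linear maps\<close>

lemma has_derivative_scaleR_zero:
  fixes r :: "'a::real_normed_vector \<Rightarrow> real" and c :: "'a \<Rightarrow> 'b::real_normed_vector"
  assumes r: "(r has_derivative r') (at x0)" "r x0 = 0" and c: "isCont c x0"
  shows "((\<lambda>x. r x *\<^sub>R c x) has_derivative (\<lambda>v. r' v *\<^sub>R c x0)) (at x0)"
proof -
  have bl: "bounded_linear r'" using r(1) by (rule has_derivative_bounded_linear)
  then obtain B where B: "\<And>v. norm (r' v) \<le> norm v * B" using bounded_linear.bounded by blast
  have 1: "((\<lambda>x. norm (r x - r' (x - x0)) / norm (x - x0) * norm (c x)) \<longlongrightarrow> 0 * norm (c x0)) (at x0)"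
    using r c by (intro tendsto_mult tendsto_norm) (auto simp: has_derivative_iff_norm isCont_def)
  have 2: "((\<lambda>x. norm B * norm (c x - c x0)) \<longlongrightarrow> norm B * norm (c x0 - c x0)) (at x0)"
    using c by (intro tendsto_intros) (auto simp: isCont_def)
  have lim: "((\<lambda>x. norm (r x - r' (x - x0)) / norm (x - x0) * norm (c x) + norm B * norm (c x - c x0)) \<longlongrightarrow> 0) (at x0)"
    using tendsto_add[OF 1 2] by simp
  have "((\<lambda>x. norm (r x *\<^sub>R c x - r x0 *\<^sub>R c x0 - r' (x - x0) *\<^sub>R c x0) / norm (x - x0)) \<longlongrightarrow> 0) (at x0)"
  proof (rule Lim_null_comparison[OF _ lim], rule eventuallyI)
    fix x
    \<comment> \<open>At a zero of \<open>r\<close> the product rule has a single term, and this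
      decomposition shows that continuity of \<open>c\<close> is enough for it. So an inverse can be
      differentiated before its differentiability is known.\<close>
    have "r x *\<^sub>R c x - r' (x - x0) *\<^sub>R c x0 = (r x - r' (x - x0)) *\<^sub>R c x + r' (x - x0) *\<^sub>R (c x - c x0)"
      by (simp add: algebra_simps)
    then have "norm (r x *\<^sub>R c x - r' (x - x0) *\<^sub>R c x0)
        \<le> norm (r x - r' (x - x0)) * norm (c x) + norm (r' (x - x0)) * norm (c x - c x0)"
      by (metis norm_scaleR norm_triangle_ineq real_norm_def)
    also have "\<dots> \<le> norm (r x - r' (x - x0)) * norm (c x) + norm (x - x0) * norm B * norm (c x - c x0)"
    proof -
      have "norm (r' (x - x0)) \<le> norm (x - x0) * norm B"
        using order_trans[OF B[of "x - x0"]] by (simp add: mult_left_mono)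
      then show ?thesis by (intro add_left_mono mult_right_mono) auto
    qed
    finally show "norm (norm (r x *\<^sub>R c x - r x0 *\<^sub>R c x0 - r' (x - x0) *\<^sub>R c x0) / norm (x - x0))
      \<le> norm (r x - r' (x - x0)) / norm (x - x0) * norm (c x) + norm B * norm (c x - c x0)"
      using r(2) by (cases "x = x0") (auto simp: field_simps)
  qed
  then show ?thesis
    using bounded_linear_scaleR_const[OF bl] by (simp add: has_derivative_iff_norm)
qed

text \<open>From \<open>B x - B x0 = - B x0 (A x - A x0) B x\<close> the error is at most
  \<open>e x * norm (B x v)\<close>, where \<open>e x\<close> tends to 0 because it involves
  \<open>A\<close> on finitely many basis vectors only.\<close>

lemma inverse_family_continuous:
  fixes A B :: "'a::euclidean_space \<Rightarrow> 'b::euclidean_space \<Rightarrow> 'b"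
  assumes "open S" "x0 \<in> S" and lA: "\<And>x. x \<in> S \<Longrightarrow> linear (A x)" and lB: "\<And>x. x \<in> S \<Longrightarrow> linear (B x)"
    and AB: "\<And>x v. x \<in> S \<Longrightarrow> A x (B x v) = v" and BA: "\<And>x v. x \<in> S \<Longrightarrow> B x (A x v) = v"
    and cA: "\<And>v. isCont (\<lambda>x. A x v) x0"
  shows "isCont (\<lambda>x. B x v) x0"
proof -
  define e where "e x = (\<Sum>b\<in>Basis. norm (B x0 (A x b - A x0 b)))" for x
  have blB0: "bounded_linear (B x0)" using lB[OF \<open>x0 \<in> S\<close>] by (simp add: linear_conv_bounded_linear)
  have "((\<lambda>x. e x) \<longlongrightarrow> (\<Sum>b\<in>(Basis::'b set). norm (B x0 (A x0 b - A x0 b)))) (at x0)"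
    unfolding e_def using cA by (intro tendsto_intros bounded_linear.tendsto[OF blB0]) (auto simp: isCont_def)
  then have e0: "(e \<longlongrightarrow> 0) (at x0)" using linear_0[OF lB[OF \<open>x0 \<in> S\<close>]] by simp
  have bound: "norm (B x v - B x0 v) \<le> e x * norm (B x v)" if "x \<in> S" for x
  proof -
    have l: "linear (\<lambda>w. B x0 (A x w - A x0 w))"
      using linear_compose[OF linear_compose_sub[OF lA[OF that] lA[OF \<open>x0 \<in> S\<close>]] lB[OF \<open>x0 \<in> S\<close>]]
      by (simp add: o_def)
    have "B x v - B x0 v = - B x0 (A x (B x v) - A x0 (B x v))"
      using AB[OF that] BA[OF \<open>x0 \<in> S\<close>] linear_diff[OF lB[OF \<open>x0 \<in> S\<close>]] by simp
    also have "norm \<dots> = norm (\<Sum>b\<in>Basis. (B x v \<bullet> b) *\<^sub>R B x0 (A x b - A x0 b))"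
      by (subst linear_basis_sum[OF l]) simp
    also have "\<dots> \<le> (\<Sum>b\<in>Basis. norm (B x v) * norm (B x0 (A x b - A x0 b)))"
      by (rule order_trans[OF norm_sum]) (auto intro!: sum_mono mult_right_mono simp: Basis_le_norm)
    finally show ?thesis by (simp add: e_def sum_distrib_left mult.commute)
  qed
  have "\<forall>\<^sub>F x in at x0. e x < 1/2 \<and> x \<in> S"
    using order_tendstoD(2)[OF e0, of "1/2"] eventually_at_in_open'[OF assms(1,2)] by (auto elim: eventually_elim2)
  then have "\<forall>\<^sub>F x in at x0. norm (B x v - B x0 v) \<le> e x * (2 * norm (B x0 v))"
  proof eventually_elim
    case (elim x)
    have e: "0 \<le> e x" by (auto simp: e_def intro: sum_nonneg)
    \<comment> \<open>As \<open>e x < 1/2\<close>, the unknown norm on the right can be absorbed,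
      which bounds it by twice its value at \<open>x0\<close>.\<close>
    have "norm (B x v) \<le> norm (B x0 v) + norm (B x v - B x0 v)" by (metis norm_triangle_sub)
    also have "\<dots> \<le> norm (B x0 v) + 1/2 * norm (B x v)"
      using bound[of x] elim mult_right_mono[of "e x" "1/2" "norm (B x v)"] by auto
    finally have "norm (B x v) \<le> 2 * norm (B x0 v)" by simp
    then show ?case using bound[of x] elim e mult_left_mono[of "norm (B x v)" _ "e x"] by fastforce
  qed
  then have "((\<lambda>x. B x v - B x0 v) \<longlongrightarrow> 0) (at x0)"
    by (rule Lim_null_comparison) (rule tendsto_mult_left_zero[OF e0])
  then show ?thesis by (simp add: isCont_def LIM_zero_iff)
qed

text \<open>For fixed \<open>x\<close> one has
  \<open>B y v = B x v - B y ((A y - A x) (B x v))\<close>, and the factor \<open>A y - A x\<close>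
  vanishes at \<open>y = x\<close>. Hence continuity of \<open>B\<close> yields a derivative, which
  is again built from \<open>B\<close> and the derivative of \<open>A\<close>; this feeds the
  induction.\<close>

lemma Ck_inverse_family:
  fixes A B :: "'a::euclidean_space \<Rightarrow> 'b::euclidean_space \<Rightarrow> 'b"
  assumes "open S" and lA: "\<And>x. x \<in> S \<Longrightarrow> linear (A x)" and lB: "\<And>x. x \<in> S \<Longrightarrow> linear (B x)"
    and AB: "\<And>x v. x \<in> S \<Longrightarrow> A x (B x v) = v" and BA: "\<And>x v. x \<in> S \<Longrightarrow> B x (A x v) = v"
    and cA: "\<And>v. Ck k S (\<lambda>x. A x v)"
  shows "Ck k S (\<lambda>x. B x v)"
  using cA
proof (induction k arbitrary: v)
  case 0
  have cont: "isCont (\<lambda>x. A x w) x" if "x \<in> S" for x w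
    using Ck_imp_continuous_on[OF 0] that \<open>open S\<close> by (simp add: continuous_on_eq_continuous_at)
  have "isCont (\<lambda>x. B x v) x" if "x \<in> S" for x
    by (rule inverse_family_continuous[where A=A and B=B and S=S])
      (simp_all add: cont lA lB AB BA that \<open>open S\<close>)
  then show ?case by (simp add: continuous_at_imp_continuous_on)
next
  case (Suc k)
  let ?D = "\<lambda>x h. \<Sum>b\<in>Basis. - (frechet_derivative (\<lambda>y. A y (B x v)) (at x) h \<bullet> b) *\<^sub>R B x b"
  have IH: "Ck k S (\<lambda>x. B x w)" for w by (rule Suc.IH) (rule Ck_SucD[OF Suc.prems])
  have contB: "isCont (\<lambda>x. B x w) x" if "x \<in> S" for x w
    using Ck_imp_continuous_on[OF IH] that \<open>open S\<close> by (simp add: continuous_on_eq_continuous_at)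
  have Ab: "A y w = (\<Sum>c\<in>Basis. (w \<bullet> c) *\<^sub>R A y c)" if "y \<in> S" for y w
    using linear_basis_sum[OF lA[OF that]] .
  show "Ck (Suc k) S (\<lambda>x. B x v)"
  proof (rule Ck_SucI[where f'="?D"])
    fix x assume x: "x \<in> S"
    let ?r = "\<lambda>y. A y (B x v) - A x (B x v)"
    have r: "(?r has_derivative frechet_derivative (\<lambda>y. A y (B x v)) (at x)) (at x)"
      using has_derivative_diff[OF Ck_Suc_has_derivative[OF Suc.prems x] has_derivative_const] by simp
    have "((\<lambda>y. (- (?r y \<bullet> b)) *\<^sub>R B y b) has_derivative
        (\<lambda>h. - (frechet_derivative (\<lambda>y. A y (B x v)) (at x) h \<bullet> b) *\<^sub>R B x b)) (at x)" for b
      by (rule has_derivative_scaleR_zero)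
         (auto intro!: has_derivative_minus has_derivative_inner_left r contB[OF x])
    then have "((\<lambda>y. B x v + (\<Sum>b\<in>Basis. (- (?r y \<bullet> b)) *\<^sub>R B y b)) has_derivative (\<lambda>h. 0 + ?D x h)) (at x)"
      by (intro has_derivative_add has_derivative_const has_derivative_sum) auto
    moreover have "B x v + (\<Sum>b\<in>Basis. (- (?r y \<bullet> b)) *\<^sub>R B y b) = B y v" if y: "y \<in> S" for y
    proof -
      have "(\<Sum>b\<in>Basis. (- (?r y \<bullet> b)) *\<^sub>R B y b) = - B y (?r y)"
        by (subst linear_basis_sum[OF lB[OF y], of "?r y"]) (simp add: sum_negf)
      also have "\<dots> = B y v - B x v"
        using AB[OF x] BA[OF y] linear_diff[OF lB[OF y]] by simp
      finally show ?thesis by simp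
    qed
    ultimately have "((\<lambda>x. B x v) has_derivative (\<lambda>h. 0 + ?D x h)) (at x)"
      by (rule has_derivative_transform_within_open[OF _ \<open>open S\<close> x])
    then show "((\<lambda>x. B x v) has_derivative ?D x) (at x)" by simp
  next
    fix h
    \<comment> \<open>\<open>?D\<close> differentiates \<open>A y\<close> with the vector
      \<open>B x v\<close> frozen, which hides how it depends on \<open>x\<close>. Expanding that
      vector over a basis displays it as sums of products of functions of class
      \<open>Ck k\<close>.\<close>
    let ?E = "\<lambda>x. \<Sum>b\<in>Basis. - (\<Sum>c\<in>Basis. (B x v \<bullet> c) *\<^sub>R (frechet_derivative (\<lambda>y. A y c) (at x) h \<bullet> b)) *\<^sub>R B x b"
    have eq: "?D x h = ?E x" if x: "x \<in> S" for x
    proof -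
      have "((\<lambda>y. \<Sum>c\<in>Basis. (B x v \<bullet> c) *\<^sub>R A y c) has_derivative
        (\<lambda>h. \<Sum>c\<in>Basis. (B x v \<bullet> c) *\<^sub>R frechet_derivative (\<lambda>y. A y c) (at x) h)) (at x)"
        by (intro has_derivative_sum has_derivative_scaleR_right Ck_Suc_has_derivative[OF Suc.prems x])
      then have "((\<lambda>y. A y (B x v)) has_derivative
        (\<lambda>h. \<Sum>c\<in>Basis. (B x v \<bullet> c) *\<^sub>R frechet_derivative (\<lambda>y. A y c) (at x) h)) (at x)"
        by (rule has_derivative_transform_within_open[OF _ \<open>open S\<close> x]) (simp add: Ab[symmetric])
      from frechet_derivative_at[OF this, symmetric] show ?thesis by (simp add: inner_sum_left)
    qed
    have "Ck k S (\<lambda>x. \<Sum>b\<in>Basis. ((-1) * (\<Sum>c\<in>Basis. (B x v \<bullet> c) *\<^sub>R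
        (frechet_derivative (\<lambda>y. A y c) (at x) h \<bullet> b))) *\<^sub>R B x b)"
      using Suc.prems
      by (intro Ck_sum Ck_scaleR Ck_mult Ck_const IH \<open>open S\<close> Ck_linear_compose[OF bounded_linear_inner_left]) auto
    then show "Ck k S (\<lambda>x. ?D x h)"
      by (rule Ck_cong[OF _ \<open>open S\<close>]) (simp only: eq mult_minus_left mult_1)
  next
    show "open S" by fact
  qed
qed

section \<open>Smooth maps between Euclidean spaces\<close>

lemma smooth_onI: "(\<And>k. Ck k S f) \<Longrightarrow> smooth_on S f"
  by (simp add: smooth_on_def)

lemma smooth_onD: "smooth_on S f \<Longrightarrow> Ck k S f"
  by (simp add: smooth_on_def)

lemma smooth_on_cong: "smooth_on S f \<Longrightarrow> open S \<Longrightarrow> (\<And>x. x \<in> S \<Longrightarrow> g x = f x) \<Longrightarrow> smooth_on S g"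
  by (auto intro!: smooth_onI intro: smooth_onD Ck_cong)

lemma smooth_on_subset: "smooth_on S f \<Longrightarrow> T \<subseteq> S \<Longrightarrow> smooth_on T f"
  by (auto intro!: smooth_onI intro: smooth_onD Ck_subset)

lemma smooth_on_local: "(\<And>x. x \<in> S \<Longrightarrow> \<exists>T. open T \<and> x \<in> T \<and> smooth_on T f) \<Longrightarrow> smooth_on S f"
  by (rule smooth_onI, rule Ck_local) (meson smooth_onD)

lemma smooth_on_const: "open S \<Longrightarrow> smooth_on S (\<lambda>x. c)"
  by (auto intro!: smooth_onI intro: smooth_onD Ck_const)

lemma smooth_on_add: "smooth_on S f \<Longrightarrow> smooth_on S g \<Longrightarrow> open S \<Longrightarrow> smooth_on S (\<lambda>x. f x + g x)"
  by (auto intro!: smooth_onI intro: smooth_onD Ck_add)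

lemma smooth_on_sum:
  "(\<And>i. i \<in> I \<Longrightarrow> smooth_on S (f i)) \<Longrightarrow> open S \<Longrightarrow> smooth_on S (\<lambda>x. \<Sum>i\<in>I. f i x)"
  by (rule smooth_onI) (rule Ck_sum, auto dest: smooth_onD)

lemma smooth_on_mult:
  fixes f g :: "'a::euclidean_space \<Rightarrow> real"
  shows "smooth_on S f \<Longrightarrow> smooth_on S g \<Longrightarrow> open S \<Longrightarrow> smooth_on S (\<lambda>x. f x * g x)"
  by (auto intro!: smooth_onI intro: smooth_onD Ck_mult)

lemma smooth_on_scaleR:
  "smooth_on S f \<Longrightarrow> smooth_on S g \<Longrightarrow> open S \<Longrightarrow> smooth_on S (\<lambda>x. f x *\<^sub>R g x)"
  by (auto intro!: smooth_onI intro: smooth_onD Ck_scaleR)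

lemma smooth_on_inverse:
  fixes f :: "'a::euclidean_space \<Rightarrow> real"
  shows "smooth_on S f \<Longrightarrow> open S \<Longrightarrow> (\<And>x. x \<in> S \<Longrightarrow> f x \<noteq> 0) \<Longrightarrow> smooth_on S (\<lambda>x. inverse (f x))"
  by (auto intro!: smooth_onI intro: smooth_onD Ck_inverse)

lemma smooth_on_linear: "bounded_linear L \<Longrightarrow> open S \<Longrightarrow> smooth_on S L"
  by (auto intro!: smooth_onI intro: smooth_onD Ck_bounded_linear)

lemma smooth_on_linear_compose:
  "bounded_linear L \<Longrightarrow> smooth_on S f \<Longrightarrow> open S \<Longrightarrow> smooth_on S (\<lambda>x. L (f x))"
  by (auto intro!: smooth_onI intro: smooth_onD Ck_linear_compose)

lemma smooth_on_componentwise: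
  "(\<And>b. b \<in> Basis \<Longrightarrow> smooth_on S (\<lambda>x. f x \<bullet> b)) \<Longrightarrow> open S \<Longrightarrow> smooth_on S f"
  by (auto intro!: smooth_onI intro: smooth_onD Ck_componentwise)

lemma smooth_on_compose:
  "smooth_on S f \<Longrightarrow> smooth_on T g \<Longrightarrow> open S \<Longrightarrow> open T \<Longrightarrow> f ` S \<subseteq> T \<Longrightarrow> smooth_on S (\<lambda>x. g (f x))"
  by (auto intro!: smooth_onI intro: smooth_onD Ck_compose)

lemma smooth_on_imp_continuous_on: "smooth_on S f \<Longrightarrow> continuous_on S f"
  by (rule Ck_imp_continuous_on[OF smooth_onD])

lemma smooth_on_frechet: "smooth_on S f \<Longrightarrow> smooth_on S (\<lambda>x. frechet_derivative f (at x) v)"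
  by (rule smooth_onI) (use smooth_onD[of S f "Suc _"] in simp)

lemma smooth_on_has_derivative:
  "smooth_on S f \<Longrightarrow> x \<in> S \<Longrightarrow> (f has_derivative frechet_derivative f (at x)) (at x)"
  by (rule Ck_Suc_has_derivative[OF smooth_onD])

lemma smooth_on_Pair:
  assumes "smooth_on S f" "smooth_on S g" "open S"
  shows "smooth_on S (\<lambda>x. (f x, g x))"
proof -
  have "bounded_linear (\<lambda>u. (u, 0::'c))" "bounded_linear (\<lambda>u. (0::'b, u))"
    by (simp_all add: bounded_linear_Pair bounded_linear_ident bounded_linear_zero)
  from this[THEN smooth_on_linear_compose] assms
  have "smooth_on S (\<lambda>x. (f x, 0) + (0, g x))" by (intro smooth_on_add) auto
  then show ?thesis by simp
qed

text \<open>The library's inverse function theorem gives a differentiable inverse \<open>g\<close>; smoothness is bootstrapped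
  from the equation expressing \<open>g'\<close> as the inverse of \<open>f' \<circ> g\<close>.\<close>

lemma smooth_inverse_function:
  fixes f :: "'a::euclidean_space \<Rightarrow> 'a"
  assumes "open S" "x0 \<in> S" "smooth_on S f" and D0: "\<And>v. frechet_derivative f (at x0) v = v"
  obtains T U g where "open T" "open U" "f x0 \<in> T" "U \<subseteq> S" "x0 \<in> U" "g ` T \<subseteq> U" "smooth_on T g"
    "g (f x0) = x0" "\<And>y. y \<in> T \<Longrightarrow> f (g y) = y"
proof -
  define f' where "f' x = Blinfun (frechet_derivative f (at x))" for x
  have der: "(f has_derivative frechet_derivative f (at x)) (at x)" if "x \<in> S" for x
    using smooth_on_has_derivative[OF assms(3) that] .
  have app: "blinfun_apply (f' x) = frechet_derivative f (at x)" if "x \<in> S" for x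
    unfolding f'_def by (rule bounded_linear_Blinfun_apply[OF has_derivative_bounded_linear[OF der[OF that]]])
  have cont: "continuous_on S f'"
  proof (rule continuous_on_blinfun_componentwise)
    fix i :: 'a assume "i \<in> Basis"
    have "continuous_on S (\<lambda>x. frechet_derivative f (at x) i)"
      by (rule smooth_on_imp_continuous_on[OF smooth_on_frechet[OF assms(3)]])
    then show "continuous_on S (\<lambda>x. blinfun_apply (f' x) i)"
      by (rule continuous_on_eq) (simp add: app)
  qed
  have inv0: "id_blinfun o\<^sub>L f' x0 = id_blinfun"
    by (rule blinfun_eqI) (simp add: app[OF assms(2)] D0)
  obtain U V g g' where U: "open U" "U \<subseteq> S" "x0 \<in> U" and V: "open V" "f x0 \<in> V"
    and hom: "homeomorphism U V f g"
    and g: "\<And>y. y \<in> V \<Longrightarrow> (g has_derivative (g' y)) (at y)"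
    and g': "\<And>y. y \<in> V \<Longrightarrow> g' y = inv (blinfun_apply (f' (g y)))"
    and bij: "\<And>y. y \<in> V \<Longrightarrow> bij (blinfun_apply (f' (g y)))"
    by (rule inverse_function_theorem[OF assms(1) _ cont assms(2) inv0, of f]) (auto simp: app intro: der)
  have gV: "g ` V \<subseteq> U" using hom by (auto simp: homeomorphism_def)
  have gS: "g y \<in> S" if "y \<in> V" for y using gV U that by auto
  have g'lin: "linear (g' y)" if "y \<in> V" for y using has_derivative_linear[OF g[OF that]] .
  have flin: "linear (frechet_derivative f (at (g y)))" if "y \<in> V" for y
    using has_derivative_linear[OF der[OF gS[OF that]]] .
  have fg: "frechet_derivative f (at (g y)) (g' y v) = v" "g' y (frechet_derivative f (at (g y)) v) = v"
    if "y \<in> V" for y v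
    using bij[OF that] g'[OF that] app[OF gS[OF that]]
    by (simp_all add: bij_is_surj surj_f_inv_f bij_is_inj)
  have "Ck k V g" for k
  proof (induction k)
    case 0
    then show ?case using hom by (simp add: homeomorphism_def)
  next
    case (Suc k)
    have "Ck k V (\<lambda>y. g' y v)" for v
    proof (rule Ck_inverse_family[where A="\<lambda>y. frechet_derivative f (at (g y))"])
      fix v
      show "Ck k V (\<lambda>y. frechet_derivative f (at (g y)) v)"
        using gS by (intro Ck_compose[OF Suc smooth_onD[OF smooth_on_frechet[OF assms(3)]]] V assms(1)) auto
    qed (use V fg g'lin flin in simp_all)
    then show ?case by (intro Ck_SucI[OF g] V) auto
  qed
  then have sm: "smooth_on V g" by (rule smooth_onI)
  show thesis
  proof (rule that[OF V(1) U(1) V(2) U(2,3) gV sm])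
    show "g (f x0) = x0" using hom U by (auto simp: homeomorphism_def)
    show "f (g y) = y" if "y \<in> V" for y using hom that by (auto simp: homeomorphism_def)
  qed
qed

text \<open>Along an affine right inverse \<open>h\<close> of its derivative, \<open>f\<close>
  becomes a map with identity derivative, the normal form that
  \<open>smooth_inverse_function\<close> asks for. The section is \<open>h\<close> after the local
  inverse.\<close>

lemma smooth_local_section:
  fixes f :: "'a::euclidean_space \<Rightarrow> 'b::euclidean_space"
  assumes "open S" "x0 \<in> S" "smooth_on S f" and surj: "surj (frechet_derivative f (at x0))"
  obtains T \<sigma> where "open T" "f x0 \<in> T" "smooth_on T \<sigma>" "\<sigma> ` T \<subseteq> S" "\<sigma> (f x0) = x0"
    "\<And>y. y \<in> T \<Longrightarrow> f (\<sigma> y) = y"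
proof -
  have der: "(f has_derivative frechet_derivative f (at x0)) (at x0)"
    using smooth_on_has_derivative[OF assms(3,2)] .
  obtain L where L: "linear L" "frechet_derivative f (at x0) \<circ> L = id"
    using linear_surjective_right_inverse[OF has_derivative_linear[OF der] surj] by blast
  have bL: "bounded_linear L" using L(1) by (simp add: linear_conv_bounded_linear)
  define h where "h w = x0 + L (w - f x0)" for w
  have cL: "continuous_on UNIV h"
    unfolding h_def using bL by (intro continuous_intros bounded_linear.continuous_on[OF bL])
  define W where "W = h -` S"
  have oW: "open W" unfolding W_def using cL assms(1) by (simp add: open_vimage)
  have h0: "h (f x0) = x0" by (simp add: h_def linear_0[OF L(1)])
  have smh: "smooth_on A h" if "open A" for A
  proof -
    have "smooth_on A (\<lambda>w. (x0 - L (f x0)) + L w)"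
      by (intro smooth_on_add smooth_on_const smooth_on_linear[OF bL] that)
    then show ?thesis by (rule smooth_on_cong) (simp_all add: that h_def linear_diff[OF L(1)])
  qed
  have sm: "smooth_on W (\<lambda>w. f (h w))"
    by (rule smooth_on_compose[OF smh[OF oW] assms(3) oW assms(1)]) (auto simp: W_def)
  have "(h has_derivative (\<lambda>v. 0 + L (v - 0))) (at (f x0))"
    unfolding h_def by (intro has_derivative_add has_derivative_const
        bounded_linear.has_derivative[OF bL] has_derivative_diff has_derivative_ident)
  then have "((f \<circ> h) has_derivative (frechet_derivative f (at x0) \<circ> L)) (at (f x0))"
    using diff_chain_at[of h L "f x0" f "frechet_derivative f (at x0)"] der h0 by simp
  then have D: "frechet_derivative (\<lambda>w. f (h w)) (at (f x0)) v = v" for v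
    using frechet_derivative_at[of "f \<circ> h"] L(2) by (simp add: o_def fun_eq_iff)
  have x0W: "f x0 \<in> W" using h0 assms(2) by (simp add: W_def)
  obtain T U g where g: "open T" "open U" "f (h (f x0)) \<in> T" "U \<subseteq> W" "f x0 \<in> U" "g ` T \<subseteq> U"
    "smooth_on T g" "g (f (h (f x0))) = f x0" "\<And>y. y \<in> T \<Longrightarrow> f (h (g y)) = y"
    using smooth_inverse_function[OF oW x0W sm D] by blast
  show thesis
  proof (rule that[of T "\<lambda>y. h (g y)"])
    show "smooth_on T (\<lambda>y. h (g y))"
      by (rule smooth_on_compose[OF g(7) smh[OF g(2)] g(1,2,6)])
  qed (use g h0 in \<open>auto simp: W_def\<close>)
qed

text \<open>Differentiation under the integral sign. The chain rule brings out one more factor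
  \<open>t\<close> at each step, hence the power \<open>t ^ j\<close> with \<open>j\<close>
  arbitrary in the induction.\<close>

lemma Ck_integral_line:
  fixes F :: "'a::euclidean_space \<Rightarrow> real"
  assumes "Ck k (ball p r) F" "r > 0"
  shows "Ck k (ball p r) (\<lambda>x. integral {0..1} (\<lambda>t. t ^ j * F (p + t *\<^sub>R (x - p))))"
  using assms(1)
proof (induction k arbitrary: F j)
  case 0
  have in_ball: "p + t *\<^sub>R (x - p) \<in> ball p r" if "x \<in> ball p r" "t \<in> {0..1}" for x t
  proof -
    have "norm (t *\<^sub>R (x - p)) \<le> 1 * norm (x - p)" using that by (auto intro: mult_left_le_one_le)
    also have "\<dots> < r" using that by (simp add: dist_norm norm_minus_commute)
    finally show ?thesis by (simp add: dist_norm)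
  qed
  have "continuous_on (ball p r \<times> {0..1}) (\<lambda>z. snd z ^ j * F (p + snd z *\<^sub>R (fst z - p)))"
    using in_ball
    by (intro continuous_intros continuous_on_compose2[OF Ck_imp_continuous_on[OF 0]]) (auto simp del: mem_ball)
  then have "continuous_on (ball p r) (\<lambda>x. integral (cbox 0 1) (\<lambda>t. t ^ j * F (p + t *\<^sub>R (x - p))))"
    by (intro integral_continuous_on_param) (simp add: split_beta cbox_interval)
  then show ?case by (simp add: cbox_interval)
next
  case (Suc k)
  have in_ball: "p + t *\<^sub>R (x - p) \<in> ball p r" if "x \<in> ball p r" "t \<in> {0..1}" for x t
  proof -
    have "norm (t *\<^sub>R (x - p)) \<le> 1 * norm (x - p)" using that by (auto intro: mult_left_le_one_le)
    also have "\<dots> < r" using that by (simp add: dist_norm norm_minus_commute)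
    finally show ?thesis by (simp add: dist_norm)
  qed
  let ?DF = "\<lambda>x. frechet_derivative F (at x)"
  have DF: "(F has_derivative ?DF x) (at x)" if "x \<in> ball p r" for x
    by (rule Ck_Suc_has_derivative[OF Suc.prems that])
  have cDF: "continuous_on (ball p r) (\<lambda>x. ?DF x v)" for v
    by (rule Ck_imp_continuous_on[of k]) (use Suc.prems in simp)
  \<comment> \<open>The Leibniz rule takes the derivative as a continuous map into bounded linear
    operators; continuity is then checked on basis vectors.\<close>
  let ?fx = "\<lambda>x t. Blinfun (\<lambda>v. t ^ Suc j * ?DF (p + t *\<^sub>R (x - p)) v)"
  have bl: "bounded_linear (\<lambda>v. t ^ Suc j * ?DF (p + t *\<^sub>R (x - p)) v)"
    if "x \<in> ball p r" "t \<in> {0..1}" for x t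
    by (intro bounded_linear_const_mult has_derivative_bounded_linear[OF DF[OF in_ball[OF that]]])
  note app = bounded_linear_Blinfun_apply[OF bl]
  have cont: "continuous_on (ball p r \<times> cbox 0 1) (\<lambda>(x, t). ?fx x t)"
  proof (rule continuous_on_blinfun_componentwise)
    fix i :: 'a
    have "continuous_on (ball p r \<times> {0..1}) (\<lambda>z. snd z ^ Suc j * ?DF (p + snd z *\<^sub>R (fst z - p)) i)"
      using in_ball by (intro continuous_intros continuous_on_compose2[OF cDF]) (auto simp del: mem_ball)
    then show "continuous_on (ball p r \<times> cbox 0 1) (\<lambda>z. blinfun_apply (case z of (x, t) \<Rightarrow> ?fx x t) i)"
      unfolding cbox_interval
      by (rule continuous_on_eq) (auto simp: app split: prod.splits simp del: mem_ball power_Suc)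
  qed
  have contF: "continuous_on (ball p r) F" by (rule Ck_imp_continuous_on[OF Suc.prems])
  have der: "((\<lambda>x. integral (cbox 0 1) (\<lambda>t. t ^ j * F (p + t *\<^sub>R (x - p)))) has_derivative
      integral (cbox 0 1) (?fx x)) (at x within ball p r)" if "x \<in> ball p r" for x
  proof (rule leibniz_rule[OF _ _ cont that convex_ball])
    fix x t assume xt: "x \<in> ball p r" "t \<in> cbox 0 (1::real)"
    then have t: "t \<in> {0..1}" by (simp add: cbox_interval)
    have "((\<lambda>x. p + t *\<^sub>R (x - p)) has_derivative (\<lambda>v. t *\<^sub>R v)) (at x)"
      by (auto intro!: derivative_eq_intros simp: scaleR_diff_right)
    from diff_chain_at[OF this DF[OF in_ball[OF xt(1) t]]]
    have "((\<lambda>x. F (p + t *\<^sub>R (x - p))) has_derivative (\<lambda>v. t * ?DF (p + t *\<^sub>R (x - p)) v)) (at x)"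
      using linear_cmul[OF has_derivative_linear[OF DF[OF in_ball[OF xt(1) t]]]] by (simp add: o_def)
    from has_derivative_mult_right[OF this, of "t ^ j"]
    have "((\<lambda>x. t ^ j * F (p + t *\<^sub>R (x - p))) has_derivative blinfun_apply (?fx x t)) (at x)"
      by (subst app[OF xt(1) t]) (simp add: mult_ac)
    then show "((\<lambda>x. t ^ j * F (p + t *\<^sub>R (x - p))) has_derivative blinfun_apply (?fx x t)) (at x within ball p r)"
      by (rule has_derivative_at_withinI)
  next
    fix x assume "x \<in> ball p r"
    then have "continuous_on {0..1} (\<lambda>t. t ^ j * F (p + t *\<^sub>R (x - p)))"
      using in_ball by (intro continuous_intros continuous_on_compose2[OF contF]) (auto simp del: mem_ball)
    then show "(\<lambda>t. t ^ j * F (p + t *\<^sub>R (x - p))) integrable_on cbox 0 1"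
      by (simp add: cbox_interval integrable_continuous_real)
  qed
  have ev: "blinfun_apply (integral (cbox 0 1) (?fx x)) v
      = integral {0..1} (\<lambda>t. t ^ Suc j * ?DF (p + t *\<^sub>R (x - p)) v)" if x: "x \<in> ball p r" for x v
  proof -
    have "continuous_on (cbox 0 1) (?fx x)"
      by (rule continuous_on_compose2[OF cont, of "cbox 0 1" "\<lambda>t. (x, t)", unfolded prod.case])
         (use x in \<open>auto intro!: continuous_intros\<close>)
    then have "(?fx x) integrable_on cbox 0 1" by (rule integrable_continuous)
    then have "blinfun_apply (integral (cbox 0 1) (?fx x)) v = integral (cbox 0 1) (\<lambda>t. blinfun_apply (?fx x t) v)"
      by (rule blinfun_apply_integral)
    also have "\<dots> = integral {0..1} (\<lambda>t. t ^ Suc j * ?DF (p + t *\<^sub>R (x - p)) v)"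
      unfolding cbox_interval by (rule integral_cong) (simp add: app[OF x] del: power_Suc atLeastAtMost_iff)
    finally show ?thesis .
  qed
  have "Ck (Suc k) (ball p r) (\<lambda>x. integral (cbox 0 1) (\<lambda>t. t ^ j * F (p + t *\<^sub>R (x - p))))"
  proof (rule Ck_SucI[where f'="\<lambda>x. blinfun_apply (integral (cbox 0 1) (?fx x))"])
    fix v
    have "Ck k (ball p r) (\<lambda>x. integral {0..1} (\<lambda>t. t ^ Suc j * ?DF (p + t *\<^sub>R (x - p)) v))"
      using Suc.prems by (intro Suc.IH) simp
    then show "Ck k (ball p r) (\<lambda>x. blinfun_apply (integral (cbox 0 1) (?fx x)) v)"
      by (rule Ck_cong) (simp_all only: ev open_ball)
  next
    fix x assume x: "x \<in> ball p r"
    show "((\<lambda>x. integral (cbox 0 1) (\<lambda>t. t ^ j * F (p + t *\<^sub>R (x - p)))) has_derivative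
      blinfun_apply (integral (cbox 0 1) (?fx x))) (at x)"
      using der[OF x] unfolding at_within_open[OF x open_ball] .
  qed (rule open_ball)
  then show ?case by (simp only: cbox_interval)
qed

text \<open>\<open>h b\<close> is the mean of a partial derivative along the segment from
  \<open>p\<close> to \<open>x\<close>; on a ball this segment stays inside
  \<open>S\<close>.\<close>

lemma Hadamard:
  fixes f :: "'a::euclidean_space \<Rightarrow> real"
  assumes "open S" "p \<in> S" "smooth_on S f"
  obtains r h where "r > 0" "ball p r \<subseteq> S" "\<And>b. b \<in> Basis \<Longrightarrow> smooth_on (ball p r) (h b)"
    "\<And>x. x \<in> ball p r \<Longrightarrow> f x = f p + (\<Sum>b\<in>Basis. ((x - p) \<bullet> b) * h b x)"
    "\<And>b. b \<in> Basis \<Longrightarrow> h b p = frechet_derivative f (at p) b"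
proof -
  obtain r where r: "r > 0" "ball p r \<subseteq> S" using assms(1,2) open_contains_ball by blast
  \<comment> \<open>The factor \<open>t ^ 0\<close> gives the integrand the shape treated in
    \<open>Ck_integral_line\<close>.\<close>
  define h where "h b x = integral {0..1} (\<lambda>t. t ^ 0 * frechet_derivative f (at (p + t *\<^sub>R (x - p))) b)" for b x
  have der: "(f has_derivative frechet_derivative f (at x)) (at x)" if "x \<in> ball p r" for x
    using smooth_on_has_derivative[OF assms(3)] r that by auto
  show thesis
  proof (rule that[OF r, of h])
    fix b :: 'a
    show "smooth_on (ball p r) (h b)"
      unfolding h_def
      by (intro smooth_onI Ck_integral_line Ck_subset[OF smooth_onD[OF smooth_on_frechet[OF assms(3)]] r(2)] r(1))
    show "h b p = frechet_derivative f (at p) b" by (simp add: h_def)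
  next
    fix x assume x: "x \<in> ball p r"
    have in_ball: "p + t *\<^sub>R (x - p) \<in> ball p r" if "t \<in> {0..1}" for t
    proof -
      have "norm (t *\<^sub>R (x - p)) \<le> 1 * norm (x - p)" using that by (auto intro: mult_left_le_one_le)
      also have "\<dots> < r" using x by (simp add: dist_norm norm_minus_commute)
      finally show ?thesis by (simp add: dist_norm)
    qed
    have img: "(\<lambda>t. p + t *\<^sub>R (x - p)) ` {0..1} \<subseteq> S"
      by (rule image_subsetI) (rule subsetD[OF r(2) in_ball])
    let ?D = "\<lambda>t. frechet_derivative f (at (p + t *\<^sub>R (x - p)))"
    have "((\<lambda>t. f (p + t *\<^sub>R (x - p))) has_vector_derivative ?D t (x - p)) (at t within {0..1})"
      if "t \<in> {0..1}" for t
    proof -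
      have "((\<lambda>t. p + t *\<^sub>R (x - p)) has_derivative (\<lambda>s. s *\<^sub>R (x - p))) (at t)"
        by (auto intro!: derivative_eq_intros)
      from diff_chain_at[OF this der[OF in_ball[OF that]]]
      have "((\<lambda>t. f (p + t *\<^sub>R (x - p))) has_derivative (\<lambda>s. s *\<^sub>R ?D t (x - p))) (at t)"
        using linear_cmul[OF has_derivative_linear[OF der[OF in_ball[OF that]]]] by (simp add: o_def)
      then show ?thesis
        unfolding has_vector_derivative_def by (rule has_derivative_at_withinI)
    qed
    from fundamental_theorem_of_calculus[OF _ this]
    have "((\<lambda>t. ?D t (x - p)) has_integral f x - f p) {0..1}" by simp
    then have "f x - f p = integral {0..1} (\<lambda>t. ?D t (x - p))" by (simp add: integral_unique)
    also have "\<dots> = integral {0..1} (\<lambda>t. \<Sum>b\<in>Basis. ((x - p) \<bullet> b) * ?D t b)"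
    proof (rule integral_cong)
      fix t :: real assume "t \<in> {0..1}"
      from linear_basis_sum[OF has_derivative_linear[OF der[OF in_ball[OF this]]], of "x - p"]
      show "?D t (x - p) = (\<Sum>b\<in>Basis. ((x - p) \<bullet> b) * ?D t b)" by simp
    qed
    also have "\<dots> = (\<Sum>b\<in>Basis. integral {0..1} (\<lambda>t. ((x - p) \<bullet> b) * ?D t b))"
    proof (rule integral_sum)
      fix b :: 'a
      have "continuous_on S (\<lambda>x. frechet_derivative f (at x) b)"
        by (rule smooth_on_imp_continuous_on[OF smooth_on_frechet[OF assms(3)]])
      then have "continuous_on {0..1} (\<lambda>t. ?D t b)"
        by (rule continuous_on_compose2[OF _ _ img]) (intro continuous_intros)
      then have "continuous_on {0..1} (\<lambda>t. ((x - p) \<bullet> b) * ?D t b)"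
        by (intro continuous_on_mult continuous_on_const)
      then show "(\<lambda>t. ((x - p) \<bullet> b) * ?D t b) integrable_on {0..1}" by (rule integrable_continuous_real)
    qed simp
    finally show "f x = f p + (\<Sum>b\<in>Basis. ((x - p) \<bullet> b) * h b x)" by (simp add: h_def)
  qed
qed

section \<open>Coordinate systems\<close>

text \<open>A chart of \<open>M\<close> with values in an arbitrary Euclidean space; an atlas is what remains of
  \<open>smooth_manifold\<close> without the separation and countability conditions.\<close>

definition coords :: "('a, 'e::euclidean_space) mfd \<Rightarrow> 'a set \<Rightarrow> ('a \<Rightarrow> 'k::euclidean_space) \<Rightarrow> bool" where
  "coords M U \<kappa> \<longleftrightarrow> openin (mtop M) U \<and> inj_on \<kappa> U \<and>
     (\<forall>W. W \<subseteq> U \<longrightarrow> (openin (mtop M) W \<longleftrightarrow> open (\<kappa> ` W))) \<and>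
     (\<forall>(V, \<psi>) \<in> charts M. smooth_on (\<psi> ` (U \<inter> V)) (\<kappa> \<circ> inv_into V \<psi>) \<and>
        smooth_on (\<kappa> ` (U \<inter> V)) (\<psi> \<circ> inv_into U \<kappa>))"

definition atlas :: "('a, 'e::euclidean_space) mfd \<Rightarrow> bool" where
  "atlas M \<longleftrightarrow> \<Union> (fst ` charts M) = points M \<and> (\<forall>(U, \<phi>) \<in> charts M. coords M U \<phi>)"

lemma smooth_manifold_imp_atlas:
  assumes "smooth_manifold M"
  shows "atlas M"
  unfolding atlas_def
proof (intro conjI ballI)
  show "\<Union> (fst ` charts M) = points M" using assms by (simp add: smooth_manifold_def)
  fix c assume c: "c \<in> charts M"
  obtain U \<phi> where [simp]: "c = (U, \<phi>)" by fastforce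
  have U: "openin (mtop M) U" "open (\<phi> ` U)"
    and h: "homeomorphic_map (subtopology (mtop M) U) (top_of_set (\<phi> ` U)) \<phi>"
    and tr: "\<And>V \<psi>. (V, \<psi>) \<in> charts M \<Longrightarrow> smooth_on (\<phi> ` (U \<inter> V)) (\<psi> \<circ> inv_into U \<phi>) \<and>
      smooth_on (\<psi> ` (V \<inter> U)) (\<phi> \<circ> inv_into V \<psi>)"
    using assms c unfolding smooth_manifold_def by fastforce+
  have top: "topspace (subtopology (mtop M) U) = U" using openin_subset[OF U(1)] by auto
  have "inj_on \<phi> U" using h top by (metis homeomorphic_eq_everything_map)
  moreover have "openin (mtop M) W \<longleftrightarrow> open (\<phi> ` W)" if "W \<subseteq> U" for W
    using homeomorphic_map_openness[OF h, of W] that top U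
    by (metis image_mono openin_open_eq openin_open_subtopology)
  ultimately have "coords M U \<phi>"
    unfolding coords_def using U tr by (auto simp: Int_commute)
  then show "case c of (U, \<phi>) \<Rightarrow> coords M U \<phi>" by simp
qed

lemma atlas_chart: "atlas M \<Longrightarrow> (U, \<phi>) \<in> charts M \<Longrightarrow> coords M U \<phi>"
  by (auto simp: atlas_def)

lemma atlas_chart_at:
  assumes "atlas M" "p \<in> points M"
  obtains U \<phi> where "(U, \<phi>) \<in> charts M" "coords M U \<phi>" "p \<in> U"
proof -
  have "p \<in> \<Union> (fst ` charts M)" using assms by (simp add: atlas_def)
  then obtain c where "c \<in> charts M" "p \<in> fst c" by blast
  then show thesis using that[of "fst c" "snd c"] atlas_chart[OF assms(1), of "fst c" "snd c"] by simp
qed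

lemma coordsD:
  assumes "coords M U \<kappa>"
  shows "openin (mtop M) U" "inj_on \<kappa> U" "\<And>W. W \<subseteq> U \<Longrightarrow> openin (mtop M) W \<longleftrightarrow> open (\<kappa> ` W)"
    "U \<subseteq> points M"
    "\<And>V \<psi>. (V, \<psi>) \<in> charts M \<Longrightarrow> smooth_on (\<psi> ` (U \<inter> V)) (\<kappa> \<circ> inv_into V \<psi>)"
    "\<And>V \<psi>. (V, \<psi>) \<in> charts M \<Longrightarrow> smooth_on (\<kappa> ` (U \<inter> V)) (\<psi> \<circ> inv_into U \<kappa>)"
proof -
  show o: "openin (mtop M) U" and "inj_on \<kappa> U" using assms by (simp_all add: coords_def)
  show "U \<subseteq> points M" using openin_subset[OF o] .
  show "openin (mtop M) W \<longleftrightarrow> open (\<kappa> ` W)" if "W \<subseteq> U" for W using assms that by (simp add: coords_def)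
  show "smooth_on (\<psi> ` (U \<inter> V)) (\<kappa> \<circ> inv_into V \<psi>)" "smooth_on (\<kappa> ` (U \<inter> V)) (\<psi> \<circ> inv_into U \<kappa>)"
    if "(V, \<psi>) \<in> charts M" for V \<psi> using assms that by (simp_all add: coords_def split_beta) force+
qed

lemma coords_open:
  assumes "coords M U \<kappa>" "openin (mtop M) W"
  shows "open (\<kappa> ` (U \<inter> W))"
  using coordsD(3)[OF assms(1), of "U \<inter> W"] openin_Int[OF coordsD(1)[OF assms(1)] assms(2)] by simp

lemma coords_inv: "coords M U \<kappa> \<Longrightarrow> x \<in> U \<Longrightarrow> inv_into U \<kappa> (\<kappa> x) = x"
  by (rule inv_into_f_f[OF coordsD(2)])

lemma coords_preimage_open:
  assumes "coords M U \<kappa>" "open S" "openin (mtop M) W" "W \<subseteq> U"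
  shows "openin (mtop M) {x \<in> W. \<kappa> x \<in> S}"
proof -
  have "\<kappa> ` {x \<in> W. \<kappa> x \<in> S} = \<kappa> ` W \<inter> S" by auto
  moreover have "open (\<kappa> ` W)" using coordsD(3)[OF assms(1,4)] assms(3) by simp
  ultimately show ?thesis
    using coordsD(3)[OF assms(1), of "{x \<in> W. \<kappa> x \<in> S}"] assms(2,4) by auto
qed

section \<open>Smooth functions on a manifold\<close>

lemma smooth_fun_open: "smooth_fun M W f \<Longrightarrow> openin (mtop M) W"
  by (simp add: smooth_fun_def)

lemma smooth_funI:
  "openin (mtop M) W \<Longrightarrow>
    (\<And>U \<phi>. (U, \<phi>) \<in> charts M \<Longrightarrow> smooth_on (\<phi> ` (U \<inter> W)) (f \<circ> inv_into U \<phi>)) \<Longrightarrow> smooth_fun M W f"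
  by (auto simp: smooth_fun_def)

lemma smooth_funD:
  "smooth_fun M W f \<Longrightarrow> (U, \<phi>) \<in> charts M \<Longrightarrow> smooth_on (\<phi> ` (U \<inter> W)) (f \<circ> inv_into U \<phi>)"
  by (auto simp: smooth_fun_def)

lemma smooth_fun_subset:
  assumes "smooth_fun M W f" "openin (mtop M) V" "V \<subseteq> W"
  shows "smooth_fun M V f"
  by (rule smooth_funI[OF assms(2)], rule smooth_on_subset[OF smooth_funD[OF assms(1)]]) (use assms(3) in auto)

lemma smooth_fun_cong:
  assumes "atlas M" "smooth_fun M W f" "\<And>x. x \<in> W \<Longrightarrow> g x = f x"
  shows "smooth_fun M W g"
proof (rule smooth_funI[OF smooth_fun_open[OF assms(2)]])
  fix U \<phi> assume c: "(U, \<phi>) \<in> charts M"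
  note co = atlas_chart[OF assms(1) c]
  show "smooth_on (\<phi> ` (U \<inter> W)) (g \<circ> inv_into U \<phi>)"
    by (rule smooth_on_cong[OF smooth_funD[OF assms(2) c] coords_open[OF co smooth_fun_open[OF assms(2)]]])
       (auto simp: coords_inv[OF co] assms(3))
qed

text \<open>Near each point, \<open>f\<close> in the coordinates \<open>\<kappa>\<close> is
  \<open>f\<close> in a chart after a transition map. The values of \<open>\<kappa>\<close> may lie
  in another Euclidean space than those of the charts, as they do for the bundle coordinates on
  \<open>P\<close>.\<close>

lemma smooth_fun_coords:
  assumes "atlas M" "coords M U \<kappa>" "smooth_fun M W f"
  shows "smooth_on (\<kappa> ` (U \<inter> W)) (f \<circ> inv_into U \<kappa>)"
proof (rule smooth_on_local)
  fix y assume "y \<in> \<kappa> ` (U \<inter> W)"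
  then obtain x where x: "x \<in> U" "x \<in> W" "y = \<kappa> x" by auto
  have W: "openin (mtop M) W" using assms(3) by (rule smooth_fun_open)
  obtain V \<psi> where V: "(V, \<psi>) \<in> charts M" "coords M V \<psi>" "x \<in> V"
    using atlas_chart_at[OF assms(1)] coordsD(4)[OF assms(2)] x by blast
  let ?T = "\<kappa> ` (U \<inter> (V \<inter> W))"
  have oT: "open ?T" using coords_open[OF assms(2)] coordsD(1)[OF V(2)] W by blast
  have 1: "smooth_on ?T (\<psi> \<circ> inv_into U \<kappa>)"
    by (rule smooth_on_subset[OF coordsD(6)[OF assms(2) V(1)]]) auto
  have 2: "smooth_on (\<psi> ` (V \<inter> W)) (f \<circ> inv_into V \<psi>)"
    using assms(3) V(1) by (auto simp: smooth_fun_def)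
  have "smooth_on ?T (\<lambda>y. (f \<circ> inv_into V \<psi>) ((\<psi> \<circ> inv_into U \<kappa>) y))"
    by (rule smooth_on_compose[OF 1 2 oT coords_open[OF V(2) W]])
       (auto simp: coords_inv[OF assms(2)])
  then have "smooth_on ?T (f \<circ> inv_into U \<kappa>)"
    by (rule smooth_on_cong[OF _ oT]) (auto simp: coords_inv[OF assms(2)] coords_inv[OF V(2)])
  then show "\<exists>T. open T \<and> y \<in> T \<and> smooth_on T (f \<circ> inv_into U \<kappa>)"
    using oT x V(3) by blast
qed

lemma smooth_fun_coordsI:
  assumes "atlas M" "coords M U \<kappa>" "openin (mtop M) W" "W \<subseteq> U"
    and "smooth_on (\<kappa> ` W) (f \<circ> inv_into U \<kappa>)"
  shows "smooth_fun M W f"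
  unfolding smooth_fun_def
proof (intro conjI ballI)
  fix c assume c: "c \<in> charts M"
  obtain V \<psi> where [simp]: "c = (V, \<psi>)" by fastforce
  have V: "coords M V \<psi>" using atlas_chart[OF assms(1)] c by simp
  have oT: "open (\<psi> ` (V \<inter> W))" by (rule coords_open[OF V assms(3)])
  have 1: "smooth_on (\<psi> ` (V \<inter> W)) (\<kappa> \<circ> inv_into V \<psi>)"
    by (rule smooth_on_subset[OF coordsD(5)[OF assms(2)]]) (use c assms(4) in auto)
  have "smooth_on (\<psi> ` (V \<inter> W)) (\<lambda>y. (f \<circ> inv_into U \<kappa>) ((\<kappa> \<circ> inv_into V \<psi>) y))"
    by (rule smooth_on_compose[OF 1 assms(5) oT])
       (use coordsD(3)[OF assms(2,4)] assms(3) in \<open>auto simp: coords_inv[OF V]\<close>)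
  then have "smooth_on (\<psi> ` (V \<inter> W)) (f \<circ> inv_into V \<psi>)"
    by (rule smooth_on_cong[OF _ oT])
       (use assms(4) in \<open>auto simp: coords_inv[OF assms(2)] coords_inv[OF V] subset_iff\<close>)
  then show "case c of (V, \<psi>) \<Rightarrow> smooth_on (\<psi> ` (V \<inter> W)) (f \<circ> inv_into V \<psi>)" by simp
qed (fact assms(3))

lemma smooth_fun_local:
  assumes "atlas M" "\<And>x. x \<in> W \<Longrightarrow> \<exists>V. x \<in> V \<and> V \<subseteq> W \<and> smooth_fun M V f"
  shows "smooth_fun M W f"
  unfolding smooth_fun_def
proof (intro conjI ballI)
  show "openin (mtop M) W"
    by (subst openin_subopen) (meson assms(2) smooth_fun_open)
  fix c assume c: "c \<in> charts M"
  obtain U \<phi> where [simp]: "c = (U, \<phi>)" by fastforce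
  have U: "coords M U \<phi>" using atlas_chart[OF assms(1)] c by simp
  have "smooth_on (\<phi> ` (U \<inter> W)) (f \<circ> inv_into U \<phi>)"
  proof (rule smooth_on_local)
    fix y assume "y \<in> \<phi> ` (U \<inter> W)"
    then obtain x where x: "x \<in> U" "x \<in> W" "y = \<phi> x" by auto
    then obtain V where V: "x \<in> V" "smooth_fun M V f" using assms(2) by blast
    show "\<exists>T. open T \<and> y \<in> T \<and> smooth_on T (f \<circ> inv_into U \<phi>)"
      using smooth_fun_coords[OF assms(1) U V(2)] coords_open[OF U smooth_fun_open[OF V(2)]] x V(1) by blast
  qed
  then show "case c of (U, \<phi>) \<Rightarrow> smooth_on (\<phi> ` (U \<inter> W)) (f \<circ> inv_into U \<phi>)" by simp
qed

lemma smooth_fun_const: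
  assumes "atlas M" "openin (mtop M) W"
  shows "smooth_fun M W (\<lambda>x. c)"
  by (rule smooth_funI[OF assms(2)], unfold o_def)
     (rule smooth_on_const[OF coords_open[OF atlas_chart[OF assms(1)] assms(2)]])

lemma smooth_fun_add:
  assumes "atlas M" "smooth_fun M W f" "smooth_fun M W g"
  shows "smooth_fun M W (\<lambda>x. f x + g x)"
proof (rule smooth_funI[OF smooth_fun_open[OF assms(2)]])
  fix U \<phi> assume c: "(U, \<phi>) \<in> charts M"
  show "smooth_on (\<phi> ` (U \<inter> W)) ((\<lambda>x. f x + g x) \<circ> inv_into U \<phi>)"
    using smooth_on_add[OF smooth_funD[OF assms(2) c] smooth_funD[OF assms(3) c]
        coords_open[OF atlas_chart[OF assms(1) c] smooth_fun_open[OF assms(2)]]]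
    by (simp add: o_def)
qed

lemma smooth_fun_mult:
  assumes "atlas M" "smooth_fun M W f" "smooth_fun M W g"
  shows "smooth_fun M W (\<lambda>x. f x * g x)"
proof (rule smooth_funI[OF smooth_fun_open[OF assms(2)]])
  fix U \<phi> assume c: "(U, \<phi>) \<in> charts M"
  show "smooth_on (\<phi> ` (U \<inter> W)) ((\<lambda>x. f x * g x) \<circ> inv_into U \<phi>)"
    using smooth_on_mult[OF smooth_funD[OF assms(2) c] smooth_funD[OF assms(3) c]
        coords_open[OF atlas_chart[OF assms(1) c] smooth_fun_open[OF assms(2)]]]
    by (simp add: o_def)
qed

lemma smooth_fun_sum:
  assumes "atlas M" "openin (mtop M) W" "\<And>i. i \<in> I \<Longrightarrow> smooth_fun M W (f i)"
  shows "smooth_fun M W (\<lambda>x. \<Sum>i\<in>I. f i x)"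
  using assms(3)
  by (induction I rule: infinite_finite_induct)
     (auto intro!: smooth_fun_add[OF assms(1)] smooth_fun_const[OF assms(1,2)])

lemma smooth_fun_lcomb:
  assumes "atlas M" "smooth_fun M W f" "smooth_fun M W g"
  shows "smooth_fun M W (lcomb a f b g)"
  unfolding lcomb_def using assms smooth_fun_open[OF assms(2)]
  by (intro smooth_fun_add smooth_fun_mult smooth_fun_const) auto

lemma smooth_fun_compose:
  fixes h :: "real \<Rightarrow> real"
  assumes "atlas M" "smooth_fun M W f" "smooth_on S h" "open S" "f ` W \<subseteq> S"
  shows "smooth_fun M W (\<lambda>x. h (f x))"
  unfolding smooth_fun_def
proof (intro conjI ballI)
  show W: "openin (mtop M) W" using assms(2) by (rule smooth_fun_open)
  fix c assume c: "c \<in> charts M"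
  obtain U \<phi> where [simp]: "c = (U, \<phi>)" by fastforce
  have U: "coords M U \<phi>" using atlas_chart[OF assms(1)] c by simp
  have "smooth_on (\<phi> ` (U \<inter> W)) (\<lambda>y. h ((f \<circ> inv_into U \<phi>) y))"
    by (rule smooth_on_compose[OF smooth_fun_coords[OF assms(1) U assms(2)] assms(3) coords_open[OF U W] assms(4)])
       (use assms(5) in \<open>auto simp: coords_inv[OF U]\<close>)
  then show "case c of (U, \<phi>) \<Rightarrow> smooth_on (\<phi> ` (U \<inter> W)) ((\<lambda>x. h (f x)) \<circ> inv_into U \<phi>)"
    by (simp add: o_def)
qed

lemma smooth_fun_of_coords:
  assumes "atlas M" "coords M U \<kappa>" "openin (mtop M) W" "W \<subseteq> U" "smooth_on S G" "\<kappa> ` W \<subseteq> S"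
  shows "smooth_fun M W (\<lambda>x. G (\<kappa> x))"
proof (rule smooth_fun_coordsI[OF assms(1-4)])
  have "open (\<kappa> ` W)" using coordsD(3)[OF assms(2,4)] assms(3) by simp
  then show "smooth_on (\<kappa> ` W) ((\<lambda>x. G (\<kappa> x)) \<circ> inv_into U \<kappa>)"
    by (rule smooth_on_cong[OF smooth_on_subset[OF assms(5,6)]])
       (use assms(4) in \<open>auto simp: coords_inv[OF assms(2)] subset_iff\<close>)
qed

lemma coord_fun_smooth:
  assumes "atlas M" "coords M U \<kappa>"
  shows "smooth_fun M U (\<lambda>x. \<kappa> x \<bullet> b)"
  by (rule smooth_fun_of_coords[OF assms coordsD(1)[OF assms(2)] order_refl, of UNIV "\<lambda>y. y \<bullet> b"])
     (auto intro: smooth_on_linear bounded_linear_inner_left)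

lemma smooth_fun_imp_near: "smooth_fun M W f \<Longrightarrow> p \<in> W \<Longrightarrow> smooth_near M p f"
  by (auto simp: smooth_near_def)

lemma smooth_near_const: "atlas M \<Longrightarrow> p \<in> points M \<Longrightarrow> smooth_near M p (\<lambda>x. c)"
  using smooth_fun_imp_near[OF smooth_fun_const, of M "points M" p c] by auto

lemma smooth_near2E:
  assumes "smooth_near M p f" "smooth_near M p g"
  obtains W where "p \<in> W" "smooth_fun M W f" "smooth_fun M W g"
proof -
  obtain U V where U: "p \<in> U" "smooth_fun M U f" and V: "p \<in> V" "smooth_fun M V g"
    using assms by (auto simp: smooth_near_def)
  have o: "openin (mtop M) (U \<inter> V)" using U V smooth_fun_open by blast
  show thesis
    using that[of "U \<inter> V"] smooth_fun_subset[OF U(2) o] smooth_fun_subset[OF V(2) o] U V by blast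
qed

lemma smooth_near_mult:
  assumes "atlas M" "smooth_near M p f" "smooth_near M p g"
  shows "smooth_near M p (\<lambda>x. f x * g x)"
  by (rule smooth_near2E[OF assms(2,3)]) (rule smooth_fun_imp_near[OF smooth_fun_mult[OF assms(1)]])

lemma smooth_near_add:
  assumes "atlas M" "smooth_near M p f" "smooth_near M p g"
  shows "smooth_near M p (\<lambda>x. f x + g x)"
  by (rule smooth_near2E[OF assms(2,3)]) (rule smooth_fun_imp_near[OF smooth_fun_add[OF assms(1)]])

lemma smooth_near_lcomb:
  assumes "atlas M" "smooth_near M p f" "smooth_near M p g"
  shows "smooth_near M p (lcomb a f b g)"
  by (rule smooth_near2E[OF assms(2,3)]) (rule smooth_fun_imp_near[OF smooth_fun_lcomb[OF assms(1)]])

lemma smooth_near_sum: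
  assumes "atlas M" "p \<in> points M" "\<And>i. i \<in> I \<Longrightarrow> smooth_near M p (f i)"
  shows "smooth_near M p (\<lambda>x. \<Sum>i\<in>I. f i x)"
  using assms(3)
  by (induction I rule: infinite_finite_induct)
     (auto intro!: smooth_near_add[OF assms(1)] smooth_near_const[OF assms(1,2)])

lemma smooth_near_cong:
  assumes "atlas M" "smooth_near M p f" "openin (mtop M) W" "p \<in> W" "\<And>x. x \<in> W \<Longrightarrow> f x = g x"
  shows "smooth_near M p g"
proof -
  obtain V where V: "p \<in> V" "smooth_fun M V f" using assms(2) by (auto simp: smooth_near_def)
  have "openin (mtop M) (V \<inter> W)" using smooth_fun_open[OF V(2)] assms(3) by blast
  from smooth_fun_cong[OF assms(1) smooth_fun_subset[OF V(2) this], of g]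
  show ?thesis using assms(4,5) V(1) by (intro smooth_fun_imp_near[of M "V \<inter> W"]) auto
qed

section \<open>Tangent vectors\<close>

lemma tangent_points: "v \<in> tangent M p \<Longrightarrow> p \<in> points M"
  by (simp add: tangent_def)

lemma tangent_outside: "v \<in> tangent M p \<Longrightarrow> \<not> smooth_near M p f \<Longrightarrow> v f = 0"
  by (simp add: tangent_def)

lemma tangent_lcomb:
  "v \<in> tangent M p \<Longrightarrow> smooth_near M p f \<Longrightarrow> smooth_near M p g \<Longrightarrow> v (lcomb a f b g) = a * v f + b * v g"
  by (simp add: tangent_def)

lemma tangent_mult:
  "v \<in> tangent M p \<Longrightarrow> smooth_near M p f \<Longrightarrow> smooth_near M p g \<Longrightarrow>
    v (\<lambda>x. f x * g x) = v f * g p + f p * v g"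
  by (simp add: tangent_def)

lemma tangent_add:
  "v \<in> tangent M p \<Longrightarrow> smooth_near M p f \<Longrightarrow> smooth_near M p g \<Longrightarrow> v (\<lambda>x. f x + g x) = v f + v g"
  using tangent_lcomb[of v M p f g 1 1] by (simp add: lcomb_def)

lemma tangent_const:
  assumes "atlas M" "v \<in> tangent M p"
  shows "v (\<lambda>x. c) = 0"
proof -
  have s: "smooth_near M p (\<lambda>x. 1)" using smooth_near_const[OF assms(1) tangent_points[OF assms(2)]] .
  have "v (\<lambda>x. 1) = 0" using tangent_mult[OF assms(2) s s] by simp
  then show ?thesis using tangent_lcomb[OF assms(2) s s, of c 0] by (simp add: lcomb_def)
qed

lemma tangent_cmult:
  assumes "atlas M" "v \<in> tangent M p" "smooth_near M p f"
  shows "v (\<lambda>x. c * f x) = c * v f"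
  using tangent_lcomb[OF assms(2,3,3), of c 0] by (simp add: lcomb_def)

lemma tangent_sum:
  assumes "atlas M" "v \<in> tangent M p" "\<And>i. i \<in> I \<Longrightarrow> smooth_near M p (f i)"
  shows "v (\<lambda>x. \<Sum>i\<in>I. f i x) = (\<Sum>i\<in>I. v (f i))"
  using assms(3)
proof (induction I rule: infinite_finite_induct)
  case (insert i I)
  then show ?case
    using tangent_add[OF assms(2), of "f i" "\<lambda>x. \<Sum>i\<in>I. f i x"]
      smooth_near_sum[OF assms(1) tangent_points[OF assms(2)], of I f] by simp
qed (auto intro: tangent_const[OF assms(1,2)])

lemma tangent_germ:
  assumes "atlas M" "v \<in> tangent M p" "openin (mtop M) W" "p \<in> W" "\<And>x. x \<in> W \<Longrightarrow> f x = g x"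
  shows "v f = v g"
proof (cases "smooth_near M p f")
  case True
  have g: "smooth_near M p g" by (rule smooth_near_cong[OF assms(1) True assms(3,4,5)])
  let ?i = "\<lambda>x. if x \<in> W then 1 else (0::real)"
  have i: "smooth_near M p ?i"
    by (rule smooth_near_cong[OF assms(1) smooth_near_const[OF assms(1) tangent_points[OF assms(2)], of 1] assms(3,4)]) simp
  have "(\<lambda>x. ?i x * ?i x) = ?i" by auto
  then have "v ?i = v ?i + v ?i" using tangent_mult[OF assms(2) i i] assms(4) by simp
  then have vi: "v ?i = 0" by simp
  have "(\<lambda>x. ?i x * f x) = (\<lambda>x. ?i x * g x)" using assms(5) by auto
  then show ?thesis
    using tangent_mult[OF assms(2) i True] tangent_mult[OF assms(2) i g] vi assms(4) by simp
next
  \<comment> \<open>Then \<open>g\<close> is not smooth near \<open>p\<close> either, and both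
    values are the default 0.\<close>
  case False
  have "\<not> smooth_near M p g"
    using smooth_near_cong[OF assms(1) _ assms(3,4), where f=g and g=f] assms(5) False by metis
  then show ?thesis using False tangent_outside[OF assms(2)] by simp
qed

text \<open>By Hadamard's lemma a derivation is determined by its values on coordinate functions.\<close>

lemma tangent_coords:
  assumes "atlas M" "coords M U \<kappa>" "p \<in> U" "v \<in> tangent M p" "smooth_near M p f"
  shows "v f = (\<Sum>b\<in>Basis. v (\<lambda>x. \<kappa> x \<bullet> b) * frechet_derivative (f \<circ> inv_into U \<kappa>) (at (\<kappa> p)) b)"
proof -
  obtain W where W: "p \<in> W" "smooth_fun M W f" using assms(5) by (auto simp: smooth_near_def)
  have oW: "openin (mtop M) W" by (rule smooth_fun_open[OF W(2)])
  let ?F = "f \<circ> inv_into U \<kappa>" and ?S = "\<kappa> ` (U \<inter> W)"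
  have pS: "\<kappa> p \<in> ?S" using assms(3) W(1) by blast
  obtain r h where r: "r > 0" "ball (\<kappa> p) r \<subseteq> ?S" and h: "\<And>b. b \<in> Basis \<Longrightarrow> smooth_on (ball (\<kappa> p) r) (h b)"
    and F: "\<And>x. x \<in> ball (\<kappa> p) r \<Longrightarrow> ?F x = ?F (\<kappa> p) + (\<Sum>b\<in>Basis. ((x - \<kappa> p) \<bullet> b) * h b x)"
    and hp: "\<And>b. b \<in> Basis \<Longrightarrow> h b (\<kappa> p) = frechet_derivative ?F (at (\<kappa> p)) b"
    by (rule Hadamard[OF coords_open[OF assms(2) oW] pS smooth_fun_coords[OF assms(1,2) W(2)]]) (rule that; assumption)
  let ?W = "{x \<in> U. \<kappa> x \<in> ball (\<kappa> p) r}"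
  have oW': "openin (mtop M) ?W"
    by (rule coords_preimage_open[OF assms(2) open_ball coordsD(1)[OF assms(2)] order_refl])
  have pW: "p \<in> ?W" using assms(3) r by simp
  have pM: "p \<in> points M" using assms(4) by (rule tangent_points)
  have sk: "smooth_near M p (\<lambda>x. \<kappa> x \<bullet> b)" for b
    by (rule smooth_fun_imp_near[OF coord_fun_smooth[OF assms(1,2)] assms(3)])
  have skk: "smooth_near M p (\<lambda>x. \<kappa> x \<bullet> b + - (\<kappa> p \<bullet> b))" for b
    by (intro smooth_near_add smooth_near_const sk assms(1) pM)
  have sh: "smooth_near M p (\<lambda>x. h b (\<kappa> x))" if "b \<in> Basis" for b
    by (rule smooth_fun_imp_near[OF smooth_fun_of_coords[OF assms(1,2) oW' _ h[OF that]] pW]) auto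
  let ?g = "\<lambda>x. f p + (\<Sum>b\<in>Basis. (\<kappa> x \<bullet> b + - (\<kappa> p \<bullet> b)) * h b (\<kappa> x))"
  have "v f = v ?g"
  proof (rule tangent_germ[OF assms(1,4) oW' pW])
    fix x assume "x \<in> ?W"
    then show "f x = ?g x"
      using F[of "\<kappa> x"] coords_inv[OF assms(2)] assms(3) by (simp add: inner_diff_left)
  qed
  also have "\<dots> = v (\<lambda>x. f p) + v (\<lambda>x. \<Sum>b\<in>Basis. (\<kappa> x \<bullet> b + - (\<kappa> p \<bullet> b)) * h b (\<kappa> x))"
    by (rule tangent_add[OF assms(4) smooth_near_const[OF assms(1) pM] smooth_near_sum[OF assms(1) pM
          smooth_near_mult[OF assms(1) skk sh]]])
  also have "\<dots> = (\<Sum>b\<in>Basis. v (\<lambda>x. (\<kappa> x \<bullet> b + - (\<kappa> p \<bullet> b)) * h b (\<kappa> x)))"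
    by (subst tangent_sum[OF assms(1,4) smooth_near_mult[OF assms(1) skk sh]])
       (simp_all add: tangent_const[OF assms(1,4)])
  also have "\<dots> = (\<Sum>b\<in>Basis. v (\<lambda>x. \<kappa> x \<bullet> b) * frechet_derivative ?F (at (\<kappa> p)) b)"
  proof (rule sum.cong[OF refl])
    fix b :: 'c assume b: "b \<in> Basis"
    have "v (\<lambda>x. \<kappa> x \<bullet> b + - (\<kappa> p \<bullet> b)) = v (\<lambda>x. \<kappa> x \<bullet> b)"
      by (subst tangent_add[OF assms(4) sk smooth_near_const[OF assms(1) pM]])
         (simp add: tangent_const[OF assms(1,4)])
    then show "v (\<lambda>x. (\<kappa> x \<bullet> b + - (\<kappa> p \<bullet> b)) * h b (\<kappa> x))
        = v (\<lambda>x. \<kappa> x \<bullet> b) * frechet_derivative ?F (at (\<kappa> p)) b"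
      using tangent_mult[OF assms(4) skk sh[OF b]] hp[OF b] by simp
  qed
  finally show ?thesis .
qed

lemma tangent_eqI:
  assumes "atlas M" "coords M U \<kappa>" "p \<in> U" "u \<in> tangent M p" "v \<in> tangent M p"
    and "\<And>b. b \<in> Basis \<Longrightarrow> u (\<lambda>x. \<kappa> x \<bullet> b) = v (\<lambda>x. \<kappa> x \<bullet> b)"
  shows "u = v"
proof
  fix f
  show "u f = v f"
    using tangent_coords[OF assms(1-4), of f] tangent_coords[OF assms(1-3,5), of f] assms(6)
      tangent_outside[OF assms(4), of f] tangent_outside[OF assms(5), of f]
    by (cases "smooth_near M p f") (simp_all cong: sum.cong)
qed

text \<open>This is \<open>coord_vector\<close> for coordinates whose values may lie in a space
  \<open>'k\<close> other than the model space \<open>'e\<close>.\<close>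

definition cv :: "('a, 'e::euclidean_space) mfd \<Rightarrow> 'a set \<Rightarrow> ('a \<Rightarrow> 'k::euclidean_space) \<Rightarrow> 'a \<Rightarrow> 'k \<Rightarrow> 'a tv" where
  "cv M U \<kappa> p w = (\<lambda>f. if smooth_near M p f
     then frechet_derivative (f \<circ> inv_into U \<kappa>) (at (\<kappa> p)) w else 0)"

lemma smooth_near_coords_derivative:
  assumes "atlas M" "coords M U \<kappa>" "p \<in> U" "smooth_near M p f"
  shows "(f \<circ> inv_into U \<kappa> has_derivative frechet_derivative (f \<circ> inv_into U \<kappa>) (at (\<kappa> p))) (at (\<kappa> p))"
proof -
  obtain W where W: "p \<in> W" "smooth_fun M W f" using assms(4) by (auto simp: smooth_near_def)
  show ?thesis
    by (rule smooth_on_has_derivative[OF smooth_fun_coords[OF assms(1,2) W(2)]]) (use assms(3) W(1) in auto)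
qed

lemma cv_tangent:
  assumes "atlas M" "coords M U \<kappa>" "p \<in> U"
  shows "cv M U \<kappa> p w \<in> tangent M p"
proof -
  note der = smooth_near_coords_derivative[OF assms]
  have [simp]: "inv_into U \<kappa> (\<kappa> p) = p" using coords_inv[OF assms(2,3)] .
  have lc: "cv M U \<kappa> p w (lcomb a f b g) = a * cv M U \<kappa> p w f + b * cv M U \<kappa> p w g"
    if f: "smooth_near M p f" and g: "smooth_near M p g" for f g a b
  proof -
    have "((\<lambda>x. a * (f \<circ> inv_into U \<kappa>) x + b * (g \<circ> inv_into U \<kappa>) x) has_derivative
      (\<lambda>w. a * frechet_derivative (f \<circ> inv_into U \<kappa>) (at (\<kappa> p)) w
        + b * frechet_derivative (g \<circ> inv_into U \<kappa>) (at (\<kappa> p)) w)) (at (\<kappa> p))"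
      by (intro has_derivative_add has_derivative_mult_right der f g)
    from frechet_derivative_at[OF this, symmetric] show ?thesis
      using f g smooth_near_lcomb[OF assms(1) f g] by (simp add: cv_def lcomb_def o_def)
  qed
  have mu: "cv M U \<kappa> p w (\<lambda>x. f x * g x) = cv M U \<kappa> p w f * g p + f p * cv M U \<kappa> p w g"
    if f: "smooth_near M p f" and g: "smooth_near M p g" for f g
  proof -
    have "((\<lambda>x. (f \<circ> inv_into U \<kappa>) x * (g \<circ> inv_into U \<kappa>) x) has_derivative
      (\<lambda>w. (f \<circ> inv_into U \<kappa>) (\<kappa> p) * frechet_derivative (g \<circ> inv_into U \<kappa>) (at (\<kappa> p)) w
        + frechet_derivative (f \<circ> inv_into U \<kappa>) (at (\<kappa> p)) w * (g \<circ> inv_into U \<kappa>) (\<kappa> p))) (at (\<kappa> p))"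
      by (intro has_derivative_mult der f g)
    from frechet_derivative_at[OF this, symmetric] show ?thesis
      using f g smooth_near_mult[OF assms(1) f g] by (simp add: cv_def o_def)
  qed
  show ?thesis
    using lc mu coordsD(4)[OF assms(2)] assms(3) unfolding tangent_def by (auto simp: cv_def)
qed

lemma cv_coord:
  assumes "atlas M" "coords M U \<kappa>" "p \<in> U"
  shows "cv M U \<kappa> p w (\<lambda>x. \<kappa> x \<bullet> b) = w \<bullet> b"
proof -
  have o: "open (\<kappa> ` U)" using coordsD(1,3)[OF assms(2)] by blast
  have "((\<lambda>y. y \<bullet> b) has_derivative (\<lambda>w. w \<bullet> b)) (at (\<kappa> p))"
    by (intro bounded_linear_imp_has_derivative bounded_linear_inner_left)
  then have "((\<lambda>x. \<kappa> x \<bullet> b) \<circ> inv_into U \<kappa> has_derivative (\<lambda>w. w \<bullet> b)) (at (\<kappa> p))"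
    by (rule has_derivative_transform_within_open[OF _ o]) (use assms(3) coords_inv[OF assms(2)] in auto)
  from frechet_derivative_at[OF this, symmetric] show ?thesis
    using smooth_fun_imp_near[OF coord_fun_smooth[OF assms(1,2)] assms(3)] by (simp add: cv_def)
qed

lemma lcomb_tangent:
  assumes "atlas M" "u \<in> tangent M p" "v \<in> tangent M p"
  shows "lcomb a u b v \<in> tangent M p"
proof -
  have "lcomb a u b v (lcomb c f d g) = c * lcomb a u b v f + d * lcomb a u b v g"
    if "smooth_near M p f" "smooth_near M p g" for c f d g
    using tangent_lcomb[OF assms(2) that] tangent_lcomb[OF assms(3) that]
    by (simp add: lcomb_def[of a u b v] algebra_simps)
  moreover have "lcomb a u b v (\<lambda>x. f x * g x) = lcomb a u b v f * g p + f p * lcomb a u b v g"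
    if "smooth_near M p f" "smooth_near M p g" for f g
    using tangent_mult[OF assms(2) that] tangent_mult[OF assms(3) that]
    by (simp add: lcomb_def algebra_simps)
  moreover have "lcomb a u b v f = 0" if "\<not> smooth_near M p f" for f
    using tangent_outside[OF assms(2) that] tangent_outside[OF assms(3) that] by (simp add: lcomb_def)
  ultimately show ?thesis using tangent_points[OF assms(2)] unfolding tangent_def by blast
qed

lemma zero_tangent: "p \<in> points M \<Longrightarrow> (\<lambda>f. 0) \<in> tangent M p"
  by (simp add: tangent_def)

lemma tangent_compose:
  fixes h :: "real \<Rightarrow> real" and M :: "('a, 'e::euclidean_space) mfd"
  assumes "atlas M" "v \<in> tangent M p" "smooth_fun M W f" "p \<in> W" "smooth_on S h" "open S" "f ` W \<subseteq> S"
    and "(h has_real_derivative h') (at (f p))"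
  shows "v (\<lambda>x. h (f x)) = h' * v f"
proof -
  obtain U and \<phi> :: "'a \<Rightarrow> 'e" where U: "coords M U \<phi>" "p \<in> U"
    by (rule atlas_chart_at[OF assms(1) tangent_points[OF assms(2)]]) (rule that; assumption)
  let ?i = "inv_into U \<phi>"
  have f: "smooth_near M p f" by (rule smooth_fun_imp_near[OF assms(3,4)])
  have hf: "smooth_near M p (\<lambda>x. h (f x))"
    by (rule smooth_fun_imp_near[OF smooth_fun_compose[OF assms(1,3,5,6,7)] assms(4)])
  have "((h \<circ> (f \<circ> ?i)) has_derivative
      ((\<lambda>s. h' * s) \<circ> frechet_derivative (f \<circ> ?i) (at (\<phi> p)))) (at (\<phi> p))"
    by (rule diff_chain_at[OF smooth_near_coords_derivative[OF assms(1) U f]])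
       (use assms(8) coords_inv[OF U] in \<open>simp add: has_field_derivative_def\<close>)
  from frechet_derivative_at[OF this, symmetric]
  have "frechet_derivative ((\<lambda>x. h (f x)) \<circ> ?i) (at (\<phi> p)) b
      = h' * frechet_derivative (f \<circ> ?i) (at (\<phi> p)) b" for b by (simp add: o_def)
  then show ?thesis
    using tangent_coords[OF assms(1) U assms(2) f] tangent_coords[OF assms(1) U assms(2) hf]
    by (simp add: sum_distrib_left mult_ac)
qed

section \<open>Vector fields\<close>

lemma vfield_open: "vfield_on M U X \<Longrightarrow> openin (mtop M) U"
  by (simp add: vfield_on_def)

lemma vfield_tangent: "vfield_on M U X \<Longrightarrow> x \<in> U \<Longrightarrow> X x \<in> tangent M x"
  by (simp add: vfield_on_def)

lemma vfield_smooth: "vfield_on M U X \<Longrightarrow> V \<subseteq> U \<Longrightarrow> smooth_fun M V f \<Longrightarrow> smooth_fun M V (\<lambda>x. X x f)"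
  by (simp add: vfield_on_def)

lemma vfield_subset: "vfield_on M U X \<Longrightarrow> openin (mtop M) V \<Longrightarrow> V \<subseteq> U \<Longrightarrow> vfield_on M V X"
  unfolding vfield_on_def by (meson subset_iff)

lemma vfield_smooth_near:
  assumes "vfield_on M U X" "x \<in> U" "smooth_near M x f"
  shows "smooth_near M x (\<lambda>y. X y f)"
proof -
  obtain W where W: "x \<in> W" "smooth_fun M W f" using assms(3) by (auto simp: smooth_near_def)
  have o: "openin (mtop M) (U \<inter> W)"
    by (rule openin_Int[OF vfield_open[OF assms(1)] smooth_fun_open[OF W(2)]])
  have "smooth_fun M (U \<inter> W) (\<lambda>y. X y f)"
    by (rule vfield_smooth[OF assms(1) _ smooth_fun_subset[OF W(2) o]]) auto
  then show ?thesis using assms(2) W(1) by (auto simp: smooth_near_def)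
qed

lemma smooth_near_nbhd:
  assumes "smooth_near M p f"
  obtains W where "openin (mtop M) W" "p \<in> W" "\<And>x. x \<in> W \<Longrightarrow> smooth_near M x f"
proof -
  obtain W where W: "p \<in> W" "smooth_fun M W f" using assms by (auto simp: smooth_near_def)
  show thesis by (rule that[OF smooth_fun_open[OF W(2)] W(1) smooth_fun_imp_near[OF W(2)]])
qed

lemma vfield_local:
  assumes "atlas M" "\<And>x. x \<in> W \<Longrightarrow> \<exists>V. x \<in> V \<and> V \<subseteq> W \<and> vfield_on M V X"
  shows "vfield_on M W X"
  unfolding vfield_on_def
proof (intro conjI ballI allI impI)
  show "openin (mtop M) W"
  proof (subst openin_subopen, rule ballI)
    fix x assume "x \<in> W"
    from assms(2)[OF this] obtain V where "x \<in> V" "V \<subseteq> W" "vfield_on M V X" by blast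
    then show "\<exists>T. openin (mtop M) T \<and> x \<in> T \<and> T \<subseteq> W" using vfield_open[of M V X] by blast
  qed
  show "X x \<in> tangent M x" if x: "x \<in> W" for x
  proof -
    obtain V where "x \<in> V" "vfield_on M V X" using assms(2)[OF x] by blast
    then show ?thesis by (rule vfield_tangent[rotated])
  qed
  fix V f assume Vf: "V \<subseteq> W \<and> smooth_fun M V f"
  show "smooth_fun M V (\<lambda>x. X x f)"
  proof (rule smooth_fun_local[OF assms(1)])
    fix x assume x: "x \<in> V"
    then have "x \<in> W" using Vf by blast
    from assms(2)[OF this] obtain V' where V': "x \<in> V'" "vfield_on M V' X" by blast
    have o: "openin (mtop M) (V \<inter> V')"
      by (rule openin_Int[OF smooth_fun_open[OF conjunct2[OF Vf]] vfield_open[OF V'(2)]])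
    have "smooth_fun M (V \<inter> V') (\<lambda>x. X x f)"
      by (rule vfield_smooth[OF V'(2) _ smooth_fun_subset[OF _ o]]) (use Vf in auto)
    then show "\<exists>V'. x \<in> V' \<and> V' \<subseteq> V \<and> smooth_fun M V' (\<lambda>x. X x f)" using x V'(1) by blast
  qed
qed

text \<open>By \<open>tangent_coords\<close> the function \<open>X f\<close> is a combination of the
  components of \<open>X\<close> with smooth coefficients, so the coordinate functions are enough as
  test functions.\<close>

lemma vfield_onI_coords:
  assumes "atlas M" "coords M U \<kappa>" "openin (mtop M) W" "W \<subseteq> U"
    and tan: "\<And>x. x \<in> W \<Longrightarrow> X x \<in> tangent M x"
    and sm: "\<And>b. b \<in> Basis \<Longrightarrow> smooth_fun M W (\<lambda>x. X x (\<lambda>y. \<kappa> y \<bullet> b))"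
  shows "vfield_on M W X"
  unfolding vfield_on_def
proof (intro conjI ballI allI impI)
  fix V f assume "V \<subseteq> W \<and> smooth_fun M V f"
  then have V: "V \<subseteq> W" "V \<subseteq> U" and f: "smooth_fun M V f" using assms(4) by auto
  have oV: "openin (mtop M) V" by (rule smooth_fun_open[OF f])
  have "smooth_on (\<kappa> ` V) (f \<circ> inv_into U \<kappa>)"
    using smooth_fun_coords[OF assms(1,2) f] V(2) by (simp add: Int_absorb1)
  then have D: "smooth_fun M V (\<lambda>x. frechet_derivative (f \<circ> inv_into U \<kappa>) (at (\<kappa> x)) b)" for b
    by (rule smooth_fun_of_coords[OF assms(1,2) oV V(2) smooth_on_frechet]) simp
  have "smooth_fun M V (\<lambda>x. \<Sum>b\<in>Basis. X x (\<lambda>y. \<kappa> y \<bullet> b) *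
      frechet_derivative (f \<circ> inv_into U \<kappa>) (at (\<kappa> x)) b)"
    by (intro smooth_fun_sum[OF assms(1) oV] smooth_fun_mult[OF assms(1)] D
        smooth_fun_subset[OF sm oV V(1)])
  then show "smooth_fun M V (\<lambda>x. X x f)"
    by (rule smooth_fun_cong[OF assms(1)])
       (rule tangent_coords[OF assms(1,2) subsetD[OF V(2)] tan[OF subsetD[OF V(1)]] smooth_fun_imp_near[OF f]])
qed (fact assms(3), fact tan)

lemma cv_vfield:
  assumes "atlas M" "coords M U \<kappa>"
  shows "vfield_on M U (\<lambda>x. cv M U \<kappa> x w)"
proof (rule vfield_onI_coords[OF assms coordsD(1)[OF assms(2)] order_refl])
  show "cv M U \<kappa> x w \<in> tangent M x" if "x \<in> U" for x by (rule cv_tangent[OF assms that])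
  fix b :: 'c
  show "smooth_fun M U (\<lambda>x. cv M U \<kappa> x w (\<lambda>y. \<kappa> y \<bullet> b))"
    by (rule smooth_fun_cong[OF assms(1) smooth_fun_const[OF assms(1) coordsD(1)[OF assms(2)]]])
       (rule cv_coord[OF assms])
qed

lemma vfield_lcomb:
  assumes "atlas M" "vfield_on M U X" "vfield_on M U Y" "smooth_fun M U a" "smooth_fun M U b"
  shows "vfield_on M U (\<lambda>x. lcomb (a x) (X x) (b x) (Y x))"
  unfolding vfield_on_def
proof (intro conjI ballI allI impI)
  show "openin (mtop M) U" by (rule vfield_open[OF assms(2)])
  show "lcomb (a x) (X x) (b x) (Y x) \<in> tangent M x" if "x \<in> U" for x
    by (rule lcomb_tangent[OF assms(1) vfield_tangent[OF assms(2) that] vfield_tangent[OF assms(3) that]])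
  fix V f assume "V \<subseteq> U \<and> smooth_fun M V f"
  then have V: "V \<subseteq> U" and f: "smooth_fun M V f" by auto
  show "smooth_fun M V (\<lambda>x. lcomb (a x) (X x) (b x) (Y x) f)"
    unfolding lcomb_def
    by (intro smooth_fun_add[OF assms(1)] smooth_fun_mult[OF assms(1)] vfield_smooth[OF assms(2) V f]
        vfield_smooth[OF assms(3) V f] smooth_fun_subset[OF assms(4) smooth_fun_open[OF f] V]
        smooth_fun_subset[OF assms(5) smooth_fun_open[OF f] V])
qed

lemma cv_representation:
  assumes "atlas M" "coords M U \<kappa>" "p \<in> U" "v \<in> tangent M p"
  shows "v = cv M U \<kappa> p (\<Sum>b\<in>Basis. v (\<lambda>x. \<kappa> x \<bullet> b) *\<^sub>R b)"
proof (rule tangent_eqI[OF assms(1-4) cv_tangent[OF assms(1-3)]])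
  fix b :: 'c assume "b \<in> Basis"
  then show "v (\<lambda>x. \<kappa> x \<bullet> b) = cv M U \<kappa> p (\<Sum>b\<in>Basis. v (\<lambda>x. \<kappa> x \<bullet> b) *\<^sub>R b) (\<lambda>x. \<kappa> x \<bullet> b)"
    by (simp add: cv_coord[OF assms(1-3)] inner_sum_left inner_Basis if_distrib cong: if_cong)
qed

lemma cv_lcomb:
  assumes "atlas M" "coords M U \<kappa>" "p \<in> U"
  shows "cv M U \<kappa> p (a *\<^sub>R u + b *\<^sub>R w) = lcomb a (cv M U \<kappa> p u) b (cv M U \<kappa> p w)"
  by (rule tangent_eqI[OF assms cv_tangent[OF assms] lcomb_tangent[OF assms(1) cv_tangent[OF assms] cv_tangent[OF assms]]])
     (simp add: cv_coord[OF assms] lcomb_def inner_add_left)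

lemma tangent_extend:
  assumes "atlas M" "u \<in> tangent M p" "v \<in> tangent M p"
  obtains U X Y where "p \<in> U" "vfield_on M U X" "vfield_on M U Y" "X p = u" "Y p = v"
proof (rule atlas_chart_at[OF assms(1) tangent_points[OF assms(2)]])
  fix U \<phi> assume U: "coords M U \<phi>" "p \<in> U"
  show thesis
    by (rule that[OF U(2) cv_vfield[OF assms(1) U(1)] cv_vfield[OF assms(1) U(1)]
          cv_representation[OF assms(1) U assms(2), symmetric] cv_representation[OF assms(1) U assms(3), symmetric]])
qed

lemma lie_bracket_tangent:
  assumes "atlas M" "vfield_on M U X" "vfield_on M U Y" "x \<in> U"
  shows "lie_bracket M X Y x \<in> tangent M x"
proof -
  have X: "X x \<in> tangent M x" and Y: "Y x \<in> tangent M x"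
    by (rule vfield_tangent[OF assms(2,4)]) (rule vfield_tangent[OF assms(3,4)])
  note XS = vfield_smooth_near[OF assms(2,4)] and YS = vfield_smooth_near[OF assms(3,4)]
  have lin: "lie_bracket M X Y x (lcomb a f b g) = a * lie_bracket M X Y x f + b * lie_bracket M X Y x g"
    if f: "smooth_near M x f" and g: "smooth_near M x g" for a f b g
  proof -
    obtain W where W: "x \<in> W" "smooth_fun M W f" "smooth_fun M W g" by (rule smooth_near2E[OF f g])
    have o: "openin (mtop M) (U \<inter> W)"
      by (rule openin_Int[OF vfield_open[OF assms(2)] smooth_fun_open[OF W(2)]])
    have xW: "x \<in> U \<inter> W" using W(1) assms(4) by simp
    have 1: "X x (\<lambda>y. Y y (lcomb a f b g)) = X x (lcomb a (\<lambda>y. Y y f) b (\<lambda>y. Y y g))"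
      by (rule tangent_germ[OF assms(1) X o xW],
          simp add: tangent_lcomb[OF vfield_tangent[OF assms(3)] smooth_fun_imp_near[OF W(2)] smooth_fun_imp_near[OF W(3)]],
          simp add: lcomb_def)
    have 2: "Y x (\<lambda>y. X y (lcomb a f b g)) = Y x (lcomb a (\<lambda>y. X y f) b (\<lambda>y. X y g))"
      by (rule tangent_germ[OF assms(1) Y o xW],
          simp add: tangent_lcomb[OF vfield_tangent[OF assms(2)] smooth_fun_imp_near[OF W(2)] smooth_fun_imp_near[OF W(3)]],
          simp add: lcomb_def)
    show ?thesis
      using f g smooth_near_lcomb[OF assms(1) f g]
      by (simp add: lie_bracket_def 1 2 tangent_lcomb[OF X YS[OF f] YS[OF g]]
          tangent_lcomb[OF Y XS[OF f] XS[OF g]] algebra_simps)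
  qed
  have mul: "lie_bracket M X Y x (\<lambda>y. f y * g y) = lie_bracket M X Y x f * g x + f x * lie_bracket M X Y x g"
    if f: "smooth_near M x f" and g: "smooth_near M x g" for f g
  proof -
    obtain W where W: "x \<in> W" "smooth_fun M W f" "smooth_fun M W g" by (rule smooth_near2E[OF f g])
    have o: "openin (mtop M) (U \<inter> W)"
      by (rule openin_Int[OF vfield_open[OF assms(2)] smooth_fun_open[OF W(2)]])
    have xW: "x \<in> U \<inter> W" using W(1) assms(4) by simp
    have 1: "X x (\<lambda>y. Y y (\<lambda>y. f y * g y)) = X x (\<lambda>y. Y y f * g y + f y * Y y g)"
      by (rule tangent_germ[OF assms(1) X o xW])
         (simp add: tangent_mult[OF vfield_tangent[OF assms(3)] smooth_fun_imp_near[OF W(2)] smooth_fun_imp_near[OF W(3)]])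
    have 2: "Y x (\<lambda>y. X y (\<lambda>y. f y * g y)) = Y x (\<lambda>y. X y f * g y + f y * X y g)"
      by (rule tangent_germ[OF assms(1) Y o xW])
         (simp add: tangent_mult[OF vfield_tangent[OF assms(2)] smooth_fun_imp_near[OF W(2)] smooth_fun_imp_near[OF W(3)]])
    \<comment> \<open>The mixed products \<open>Y x f * X x g\<close> and
      \<open>X x f * Y x g\<close> occur in both expansions and cancel in the bracket, which leaves
      the Leibniz rule.\<close>
    have 3: "X x (\<lambda>y. Y y f * g y + f y * Y y g) = X x (\<lambda>y. Y y f) * g x + Y x f * X x g
        + (X x f * Y x g + f x * X x (\<lambda>y. Y y g))"
      by (subst tangent_add[OF X smooth_near_mult[OF assms(1) YS[OF f] g] smooth_near_mult[OF assms(1) f YS[OF g]]])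
         (simp add: tangent_mult[OF X YS[OF f] g] tangent_mult[OF X f YS[OF g]])
    have 4: "Y x (\<lambda>y. X y f * g y + f y * X y g) = Y x (\<lambda>y. X y f) * g x + X x f * Y x g
        + (Y x f * X x g + f x * Y x (\<lambda>y. X y g))"
      by (subst tangent_add[OF Y smooth_near_mult[OF assms(1) XS[OF f] g] smooth_near_mult[OF assms(1) f XS[OF g]]])
         (simp add: tangent_mult[OF Y XS[OF f] g] tangent_mult[OF Y f XS[OF g]])
    show ?thesis
      by (simp only: lie_bracket_def f g smooth_near_mult[OF assms(1) f g] if_True 1 2 3 4)
         (simp add: algebra_simps)
  qed
  show ?thesis
    using lin mul tangent_points[OF X] unfolding tangent_def by (auto simp: lie_bracket_def)
qed

section \<open>Linear forms and exterior derivatives\<close>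

lemma linear_form_lcomb:
  "linear_form_on T \<alpha> \<Longrightarrow> u \<in> T \<Longrightarrow> v \<in> T \<Longrightarrow> \<alpha> (lcomb a u b v) = a * \<alpha> u + b * \<alpha> v"
  by (simp add: linear_form_on_def)

lemma linear_form_zero:
  assumes "linear_form_on T \<alpha>" "(\<lambda>f. 0) \<in> T"
  shows "\<alpha> (\<lambda>f. 0) = 0"
  using linear_form_lcomb[OF assms(1,2,2), of 0 0] by (simp add: lcomb_def)

lemma linear_form_uminus:
  assumes "linear_form_on T \<alpha>" "u \<in> T"
  shows "\<alpha> (\<lambda>f. - u f) = - \<alpha> u"
  using linear_form_lcomb[OF assms(1,2,2), of "-1" 0] by (simp add: lcomb_def)

lemma linear_form_coords:
  assumes "atlas M" "coords M U \<kappa>" "p \<in> U" "linear_form_on (tangent M p) \<alpha>" "v \<in> tangent M p"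
  shows "\<alpha> v = (\<Sum>b\<in>Basis. \<alpha> (cv M U \<kappa> p b) * v (\<lambda>x. \<kappa> x \<bullet> b))"
proof -
  have "linear (\<lambda>w. \<alpha> (cv M U \<kappa> p w))"
  proof (rule linearI)
    show "\<alpha> (cv M U \<kappa> p (u + w)) = \<alpha> (cv M U \<kappa> p u) + \<alpha> (cv M U \<kappa> p w)" for u w
      using cv_lcomb[OF assms(1-3), of 1 u 1 w] linear_form_lcomb[OF assms(4) cv_tangent[OF assms(1-3)] cv_tangent[OF assms(1-3)]]
      by simp
    show "\<alpha> (cv M U \<kappa> p (r *\<^sub>R u)) = r *\<^sub>R \<alpha> (cv M U \<kappa> p u)" for r u
      using cv_lcomb[OF assms(1-3), of r u 0 u] linear_form_lcomb[OF assms(4) cv_tangent[OF assms(1-3)] cv_tangent[OF assms(1-3)]]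
      by simp
  qed
  from linear_basis_sum[OF this, of "\<Sum>b\<in>Basis. v (\<lambda>x. \<kappa> x \<bullet> b) *\<^sub>R b"] show ?thesis
    unfolding cv_representation[OF assms(1,2,3,5), symmetric]
    by (simp add: inner_sum_left inner_Basis if_distrib mult.commute cong: if_cong)
qed

text \<open>Local expressions \<open>\<eta> = \<Sum>\<^sub>c a\<^sub>c dk\<^sub>c\<close> make all exterior derivatives computable: exterior
  derivatives of pullbacks, products and sums are read off such expressions.\<close>

definition form_expr :: "('a, 'e::euclidean_space) mfd \<Rightarrow> 'a set \<Rightarrow> ('a \<Rightarrow> 'a tv \<Rightarrow> real) \<Rightarrow>
    'c set \<Rightarrow> ('c \<Rightarrow> 'a \<Rightarrow> real) \<Rightarrow> ('c \<Rightarrow> 'a \<Rightarrow> real) \<Rightarrow> bool" where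
  "form_expr M W \<eta> C a k \<longleftrightarrow> finite C \<and> openin (mtop M) W \<and>
     (\<forall>c\<in>C. smooth_fun M W (a c) \<and> smooth_fun M W (k c)) \<and>
     (\<forall>y\<in>W. \<forall>v\<in>tangent M y. \<eta> y v = (\<Sum>c\<in>C. a c y * v (k c)))"

text \<open>This is \<open>d(a dk) = da\<close> wedge \<open>dk\<close>: the second-order terms
  \<open>a * A (B k)\<close> and \<open>a * B (A k)\<close> are cancelled by the value on the Lie
  bracket.\<close>

lemma form_expr_exterior:
  assumes "atlas M" "form_expr M W \<eta> C a k" "x \<in> W" "vfield_on M U A" "vfield_on M U B" "x \<in> U"
  shows "A x (\<lambda>y. \<eta> y (B y)) - B x (\<lambda>y. \<eta> y (A y)) - \<eta> x (lie_bracket M A B x)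
    = (\<Sum>c\<in>C. A x (a c) * B x (k c) - B x (a c) * A x (k c))"
proof -
  have fin: "finite C" and oW: "openin (mtop M) W"
    and sm: "\<And>c. c \<in> C \<Longrightarrow> smooth_near M x (a c)" "\<And>c. c \<in> C \<Longrightarrow> smooth_near M x (k c)"
    and eta: "\<And>y v. y \<in> W \<Longrightarrow> v \<in> tangent M y \<Longrightarrow> \<eta> y v = (\<Sum>c\<in>C. a c y * v (k c))"
    using assms(2,3) unfolding form_expr_def by (auto intro: smooth_fun_imp_near)
  have o: "openin (mtop M) (U \<inter> W)" by (rule openin_Int[OF vfield_open[OF assms(4)] oW])
  have x: "x \<in> U \<inter> W" using assms(3,6) by simp
  have key: "A x (\<lambda>y. \<eta> y (B y)) = (\<Sum>c\<in>C. A x (a c) * B x (k c) + a c x * A x (\<lambda>y. B y (k c)))"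
    if A: "vfield_on M U A" and B: "vfield_on M U B" for A B
  proof -
    have Ax: "A x \<in> tangent M x" by (rule vfield_tangent[OF A assms(6)])
    have sB: "smooth_near M x (\<lambda>y. B y (k c))" if "c \<in> C" for c
      by (rule vfield_smooth_near[OF B assms(6) sm(2)[OF that]])
    have "A x (\<lambda>y. \<eta> y (B y)) = A x (\<lambda>y. \<Sum>c\<in>C. a c y * B y (k c))"
      by (rule tangent_germ[OF assms(1) Ax o x]) (simp add: eta vfield_tangent[OF B])
    also have "\<dots> = (\<Sum>c\<in>C. A x (\<lambda>y. a c y * B y (k c)))"
      by (rule tangent_sum[OF assms(1) Ax smooth_near_mult[OF assms(1) sm(1) sB]])
    also have "\<dots> = (\<Sum>c\<in>C. A x (a c) * B x (k c) + a c x * A x (\<lambda>y. B y (k c)))"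
      by (rule sum.cong[OF refl]) (rule tangent_mult[OF Ax sm(1) sB])
    finally show ?thesis .
  qed
  have "\<eta> x (lie_bracket M A B x) = (\<Sum>c\<in>C. a c x * (A x (\<lambda>y. B y (k c)) - B x (\<lambda>y. A y (k c))))"
    by (subst eta[OF assms(3) lie_bracket_tangent[OF assms(1,4,5,6)]])
       (rule sum.cong[OF refl], simp add: lie_bracket_def sm(2))
  then show ?thesis
    by (simp add: key[OF assms(4,5)] key[OF assms(5,4)] sum_subtractf[symmetric] algebra_simps)
qed

lemma form_expr_ext_deriv1:
  assumes "atlas M" "form_expr M W \<eta> C a k" "x \<in> W" "u \<in> tangent M x" "v \<in> tangent M x"
  shows "ext_deriv1 M \<eta> x u v = (\<Sum>c\<in>C. u (a c) * v (k c) - v (a c) * u (k c))"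
  unfolding ext_deriv1_def
proof (rule the_equality)
  show "\<forall>U X Y. x \<in> U \<and> vfield_on M U X \<and> vfield_on M U Y \<and> X x = u \<and> Y x = v \<longrightarrow>
      (\<Sum>c\<in>C. u (a c) * v (k c) - v (a c) * u (k c))
      = X x (\<lambda>y. \<eta> y (Y y)) - Y x (\<lambda>y. \<eta> y (X y)) - \<eta> x (lie_bracket M X Y x)"
    using form_expr_exterior[OF assms(1-3)] by auto
next
  fix r assume r: "\<forall>U X Y. x \<in> U \<and> vfield_on M U X \<and> vfield_on M U Y \<and> X x = u \<and> Y x = v \<longrightarrow>
      r = X x (\<lambda>y. \<eta> y (Y y)) - Y x (\<lambda>y. \<eta> y (X y)) - \<eta> x (lie_bracket M X Y x)"
  \<comment> \<open>Without an extension of \<open>u\<close> and \<open>v\<close> the condition on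
    \<open>r\<close> would be vacuous and the description in \<open>ext_deriv1\<close> not
    definite.\<close>
  obtain U X Y where U: "x \<in> U" "vfield_on M U X" "vfield_on M U Y" "X x = u" "Y x = v"
    by (rule tangent_extend[OF assms(1,4,5)])
  then show "r = (\<Sum>c\<in>C. u (a c) * v (k c) - v (a c) * u (k c))"
    using r form_expr_exterior[OF assms(1-3) U(2,3,1)] by auto
qed

lemma ext_deriv1_vfields:
  assumes "atlas M" "form_expr M W \<eta> C a k" "x \<in> W" "vfield_on M U A" "vfield_on M U B" "x \<in> U"
  shows "ext_deriv1 M \<eta> x (A x) (B x)
    = A x (\<lambda>y. \<eta> y (B y)) - B x (\<lambda>y. \<eta> y (A y)) - \<eta> x (lie_bracket M A B x)"
  using form_expr_exterior[OF assms]
    form_expr_ext_deriv1[OF assms(1-3) vfield_tangent[OF assms(4,6)] vfield_tangent[OF assms(5,6)]] by simp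

lemma form_expr_coords:
  assumes "atlas M" "coords M U \<kappa>" "V \<subseteq> U" "openin (mtop M) V"
    and lin: "\<And>y. y \<in> V \<Longrightarrow> linear_form_on (tangent M y) (\<eta> y)"
    and sm: "\<And>b. b \<in> Basis \<Longrightarrow> smooth_fun M V (\<lambda>y. \<eta> y (cv M U \<kappa> y b))"
  shows "form_expr M V \<eta> Basis (\<lambda>b y. \<eta> y (cv M U \<kappa> y b)) (\<lambda>b y. \<kappa> y \<bullet> b)"
  unfolding form_expr_def
  using sm smooth_fun_subset[OF coord_fun_smooth[OF assms(1,2)] assms(4,3)] assms(3,4)
  by (auto intro!: linear_form_coords[OF assms(1,2)] lin)

lemma one_form_expr:
  fixes M :: "('a, 'e::euclidean_space) mfd"
  assumes "atlas M" "one_form_on M W \<eta>" "x \<in> W"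
  obtains V a k where "x \<in> V" "V \<subseteq> W" "form_expr M V \<eta> (Basis :: 'e set) a k"
proof -
  have W: "openin (mtop M) W" and lin: "\<And>y. y \<in> W \<Longrightarrow> linear_form_on (tangent M y) (\<eta> y)"
    and sm: "\<And>V X. V \<subseteq> W \<Longrightarrow> vfield_on M V X \<Longrightarrow> smooth_fun M V (\<lambda>x. \<eta> x (X x))"
    using assms(2) by (auto simp: one_form_on_def cotangent_def)
  have "x \<in> points M" using openin_subset[OF W] assms(3) by blast
  then obtain U and \<phi> :: "'a \<Rightarrow> 'e" where U: "coords M U \<phi>" "x \<in> U" by (rule atlas_chart_at[OF assms(1)])
  have o: "openin (mtop M) (U \<inter> W)" by (rule openin_Int[OF coordsD(1)[OF U(1)] W])
  have "form_expr M (U \<inter> W) \<eta> Basis (\<lambda>b y. \<eta> y (cv M U \<phi> y b)) (\<lambda>b y. \<phi> y \<bullet> b)"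
    by (rule form_expr_coords[OF assms(1) U(1) _ o])
       (auto intro!: lin sm vfield_subset[OF cv_vfield[OF assms(1) U(1)] o])
  then show thesis using that[of "U \<inter> W"] U(2) assms(3) by blast
qed

section \<open>Dimension of the tangent space\<close>

text \<open>The linear map from a basis to the family is injective, hence surjective. A family
  indexed by numbers, rather than a set, matches the form of
  \<open>locally_homogeneous\<close>.\<close>

lemma independent_family_spans:
  fixes T :: "nat \<Rightarrow> 'e::euclidean_space"
  assumes "\<And>a. (\<Sum>i<DIM('e). a i *\<^sub>R T i) = 0 \<Longrightarrow> \<forall>i<DIM('e). a i = 0"
  obtains a where "w = (\<Sum>i<DIM('e). a i *\<^sub>R T i)"
proof -
  obtain e :: "nat \<Rightarrow> 'e" where e: "bij_betw e {..<DIM('e)} Basis"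
    using ex_bij_betw_nat_finite[OF finite_Basis] by (metis atLeast0LessThan)
  define f where "f z = (\<Sum>i<DIM('e). (z \<bullet> e i) *\<^sub>R T i)" for z
  have lin: "linear f"
    unfolding f_def by (intro linearI)
      (simp_all add: inner_add_left scaleR_add_left sum.distrib scaleR_sum_right)
  have "inj f"
  proof (rule injI)
    fix y z assume "f y = f z"
    then have "(\<Sum>i<DIM('e). ((y - z) \<bullet> e i) *\<^sub>R T i) = 0"
      by (simp add: f_def inner_diff_left scaleR_diff_left sum_subtractf)
    from assms[OF this] have "(y - z) \<bullet> b = 0" if "b \<in> Basis" for b
      using that e by (metis bij_betw_imp_surj_on imageE lessThan_iff)
    then show "y = z" by (metis euclidean_all_zero_iff right_minus_eq)
  qed
  then have "surj f" using linear_injective_imp_surjective[OF lin] by blast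
  then obtain z where "w = f z" by (metis surjD)
  then show thesis using that[of "\<lambda>i. z \<bullet> e i"] by (simp add: f_def)
qed

text \<open>Independence is tested on arbitrary functions, as in \<open>locally_homogeneous\<close>.
  It passes to coordinate vectors because at functions not smooth near \<open>p\<close> all tangent
  vectors take the value 0.\<close>

lemma tangent_spanning:
  fixes M :: "('a, 'e::euclidean_space) mfd"
  assumes "atlas M" "\<And>i. i < DIM('e) \<Longrightarrow> K i \<in> tangent M p"
    and indep: "\<And>a. \<forall>f. (\<Sum>i<DIM('e). a i * K i f) = 0 \<Longrightarrow> \<forall>i<DIM('e). a i = 0"
    and v: "v \<in> tangent M p"
  obtains a where "\<And>f. v f = (\<Sum>i<DIM('e). a i * K i f)"
proof -
  obtain U and \<phi> :: "'a \<Rightarrow> 'e" where U: "coords M U \<phi>" "p \<in> U"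
    by (rule atlas_chart_at[OF assms(1) tangent_points[OF v]])
  define T where "T u = (\<Sum>b\<in>Basis. u (\<lambda>x. \<phi> x \<bullet> b) *\<^sub>R b)" for u
  have T_inner: "T u \<bullet> b = u (\<lambda>x. \<phi> x \<bullet> b)" if "b \<in> Basis" for u b
    using that by (simp add: T_def inner_sum_left inner_Basis if_distrib cong: if_cong)
  have rep: "u f = (\<Sum>b\<in>Basis. (T u \<bullet> b) * frechet_derivative (f \<circ> inv_into U \<phi>) (at (\<phi> p)) b)"
    if "u \<in> tangent M p" "smooth_near M p f" for u f
    using tangent_coords[OF assms(1) U that] by (simp add: T_inner)
  have "\<forall>i<DIM('e). a i = 0" if a: "(\<Sum>i<DIM('e). a i *\<^sub>R T (K i)) = 0" for a
  proof (rule indep, rule allI)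
    fix f
    show "(\<Sum>i<DIM('e). a i * K i f) = 0"
    proof (cases "smooth_near M p f")
      case True
      have "(\<Sum>i<DIM('e). a i * K i f) = (\<Sum>i<DIM('e). \<Sum>b\<in>Basis. (a i *\<^sub>R T (K i)) \<bullet> b *
          frechet_derivative (f \<circ> inv_into U \<phi>) (at (\<phi> p)) b)"
        using assms(2) True by (simp add: rep sum_distrib_left mult.assoc)
      also have "\<dots> = (\<Sum>b\<in>Basis. ((\<Sum>i<DIM('e). a i *\<^sub>R T (K i)) \<bullet> b) *
          frechet_derivative (f \<circ> inv_into U \<phi>) (at (\<phi> p)) b)"
        by (subst sum.swap) (simp only: inner_sum_left sum_distrib_right)
      finally show ?thesis using a by simp
    next
      case False
      then show ?thesis using tangent_outside[OF assms(2)] by simp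
    qed
  qed
  then obtain a where a: "T v = (\<Sum>i<DIM('e). a i *\<^sub>R T (K i))"
    by (rule independent_family_spans)
  have "v f = (\<Sum>i<DIM('e). a i * K i f)" for f
  proof (cases "smooth_near M p f")
    case True
    have "v f = (\<Sum>b\<in>Basis. ((\<Sum>i<DIM('e). a i *\<^sub>R T (K i)) \<bullet> b) *
          frechet_derivative (f \<circ> inv_into U \<phi>) (at (\<phi> p)) b)"
      unfolding a[symmetric] by (rule rep[OF v True])
    also have "\<dots> = (\<Sum>i<DIM('e). \<Sum>b\<in>Basis. (a i *\<^sub>R T (K i)) \<bullet> b *
          frechet_derivative (f \<circ> inv_into U \<phi>) (at (\<phi> p)) b)"
      by (subst sum.swap) (simp only: inner_sum_left sum_distrib_right)
    also have "\<dots> = (\<Sum>i<DIM('e). a i * K i f)"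
      using assms(2) True by (simp add: rep sum_distrib_left mult.assoc)
    finally show ?thesis .
  next
    case False
    then show ?thesis using tangent_outside[OF assms(2)] tangent_outside[OF v] by simp
  qed
  then show thesis using that by blast
qed

section \<open>Killing fields of a metric with a transnormal function\<close>

lemma smooth_on_real_rational:
  fixes c :: real
  assumes "c > 0"
  shows "smooth_on {c<..} (\<lambda>s. inverse (s - c))" "smooth_on {c<..} (\<lambda>s. inverse (s + c))"
    "smooth_on {c<..} (\<lambda>s. inverse s)" "smooth_on {c<..} (\<lambda>s. s)"
proof -
  have id: "smooth_on {c<..} (\<lambda>s::real. s)" by (rule smooth_on_linear[OF bounded_linear_ident]) simp
  show "smooth_on {c<..} (\<lambda>s::real. s)" by (fact id)
  have sh: "smooth_on {c<..} (\<lambda>s. s + d)" for d :: real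
    by (rule smooth_on_add[OF id smooth_on_const]) simp_all
  show "smooth_on {c<..} (\<lambda>s. inverse (s - c))"
    using smooth_on_inverse[OF sh[of "- c"]] by simp
  show "smooth_on {c<..} (\<lambda>s. inverse (s + c))"
    by (rule smooth_on_inverse[OF sh]) (use assms in auto)
  show "smooth_on {c<..} (\<lambda>s. inverse s)"
    by (rule smooth_on_inverse[OF id]) (use assms in auto)
qed

lemma tangent_of_function:
  fixes G :: "real \<Rightarrow> real" and M :: "('a, 'e::euclidean_space) mfd"
  assumes "atlas M" "v \<in> tangent M p" "smooth_fun M W f" "p \<in> W" "smooth_on {c<..} G" "f ` W \<subseteq> {c<..}"
    and "(G has_real_derivative G') (at (f p))"
  shows "v (\<lambda>x. G (f x)) = G' * v f"
  by (rule tangent_compose[OF assms(1-5) _ assms(6,7)]) simp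

text \<open>The functions \<open>\<alpha>(s) = 2s\<close>, \<open>\<beta>\<close> and \<open>\<gamma>\<close> are those of the deformed supergravity c-map, in
  terms of \<open>s = 2 f\<^sub>Z\<close>. With \<open>u = K s\<close> and \<open>w = \<theta>(K)\<close>, the components of the Killing equation in
  the directions \<open>R\<close> and \<open>X\<close> give \<open>R u = a u\<close>, \<open>X w = - b u\<close> and \<open>R w = - (\<beta> / \<gamma>) X u\<close>. As \<open>R\<close> and
  \<open>X\<close> commute, this yields \<open>X X u = \<kappa> u\<close>, and differentiating along \<open>R\<close> leaves \<open>(R \<kappa>) u = 0\<close>. For
  \<open>c = 0\<close> the function \<open>\<kappa>\<close> vanishes identically.\<close>

lemma killing_annihilates_function:
  fixes B :: "('b, 'h::euclidean_space) mfd" and c :: real and y :: "'b \<Rightarrow> real"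
  defines "\<beta> \<equiv> \<lambda>s. (s + c) / (s - c)\<^sup>2" and "\<gamma> \<equiv> \<lambda>s. 8 * s / ((s - c)\<^sup>2 * (s + c))"
  assumes at: "atlas B" and c: "c > 0"
    and R: "vfield_on B V R" and X: "vfield_on B V X" and K: "killing_on B h V K"
    and y: "smooth_fun B V y" "y ` V \<subseteq> {c<..}"
    and sym: "\<And>x u v. x \<in> V \<Longrightarrow> u \<in> tangent B x \<Longrightarrow> v \<in> tangent B x \<Longrightarrow> h x u v = h x v u"
    and hR: "\<And>x v. x \<in> V \<Longrightarrow> v \<in> tangent B x \<Longrightarrow> h x (R x) v = \<beta> (y x) * v y"
    and hX: "\<And>x v. x \<in> V \<Longrightarrow> v \<in> tangent B x \<Longrightarrow> h x (X x) v = \<gamma> (y x) * \<theta> x v"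
    and Ry: "\<And>x. x \<in> V \<Longrightarrow> R x y = 2 * y x" and Xy: "\<And>x. x \<in> V \<Longrightarrow> X x y = 0"
    and \<theta>X: "\<And>x. x \<in> V \<Longrightarrow> \<theta> x (X x) = 1"
    and \<theta>: "form_expr B V \<theta> C a k"
    and d\<theta>R: "\<And>x v. x \<in> V \<Longrightarrow> v \<in> tangent B x \<Longrightarrow> ext_deriv1 B \<theta> x (R x) v = 0"
    and d\<theta>X: "\<And>x v. x \<in> V \<Longrightarrow> v \<in> tangent B x \<Longrightarrow> ext_deriv1 B \<theta> x (X x) v = 0"
    and RX: "\<And>x f. x \<in> V \<Longrightarrow> lie_bracket B R X x f = 0"
    and x: "x \<in> V"
  shows "K x y = 0"
proof -
  have Kv: "vfield_on B V K" using K by (simp add: killing_on_def)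
  have oV: "openin (mtop B) V" by (rule vfield_open[OF R])
  have Kill: "K x (\<lambda>z. h z (S z) (T z)) = h x (lie_bracket B K S x) (T x) + h x (S x) (lie_bracket B K T x)"
    if "vfield_on B V S" "vfield_on B V T" "x \<in> V" for S T x
    using K that unfolding killing_on_def by blast
  note tR = vfield_tangent[OF R] and tX = vfield_tangent[OF X] and tK = vfield_tangent[OF Kv]
  have ypos: "y x > c" "y x > 0" if "x \<in> V" for x using y(2) c that by fastforce+
  have lbt: "lie_bracket B S T x \<in> tangent B x" if "vfield_on B V S" "vfield_on B V T" "x \<in> V" for S T x
    by (rule lie_bracket_tangent[OF at that])
  have lin\<theta>: "\<theta> x v = (\<Sum>i\<in>C. a i x * v (k i))" if "x \<in> V" "v \<in> tangent B x" for x v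
    using \<theta> that by (simp add: form_expr_def)
  have lb_swap: "\<theta> x (lie_bracket B S T x) = - \<theta> x (lie_bracket B T S x)"
    if "vfield_on B V S" "vfield_on B V T" "x \<in> V" for S T x
  proof -
    have *: "lie_bracket B S T x f = - lie_bracket B T S x f" for f by (simp add: lie_bracket_def)
    show ?thesis
      unfolding lin\<theta>[OF that(3) lbt[OF that]] lin\<theta>[OF that(3) lbt[OF that(2,1,3)]]
      by (subst *) (simp add: sum_negf)
  qed
  define u where "u x = K x y" for x
  define w where "w x = \<theta> x (K x)" for x
  have su: "smooth_fun B V u" unfolding u_def by (rule vfield_smooth[OF Kv order_refl y(1)])
  have sw: "smooth_fun B V w"
  proof (rule smooth_fun_cong[OF at])
    show "smooth_fun B V (\<lambda>x. \<Sum>i\<in>C. a i x * K x (k i))"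
      using \<theta> by (intro smooth_fun_sum smooth_fun_mult at oV vfield_smooth[OF Kv order_refl]) (auto simp: form_expr_def)
    show "w x = (\<Sum>i\<in>C. a i x * K x (k i))" if "x \<in> V" for x
      unfolding w_def by (rule lin\<theta>[OF that tK[OF that]])
  qed
  have sXu: "smooth_fun B V (\<lambda>x. X x u)" by (rule vfield_smooth[OF X order_refl su])
  have near: "smooth_near B x f" if "smooth_fun B V f" "x \<in> V" for f x by (rule smooth_fun_imp_near[OF that])
  have germ: "v f = v g" if "v \<in> tangent B x" "x \<in> V" "\<And>z. z \<in> V \<Longrightarrow> f z = g z" for v x f g
    by (rule tangent_germ[OF at that(1) oV that(2,3)])
  have comm: "R x (\<lambda>z. X z f) = X x (\<lambda>z. R z f)" if "smooth_fun B V f" "x \<in> V" for f x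
    using RX[OF that(2), of f] near[OF that] by (simp add: lie_bracket_def)
  have lb_y: "lie_bracket B S T x y = S x (\<lambda>z. T z y) - T x (\<lambda>z. S z y)" if "x \<in> V" for S T x
    using near[OF y(1) that] by (simp add: lie_bracket_def)
  note rat = smooth_on_real_rational[OF c]
  have pos: "s - c \<noteq> 0" "s + c \<noteq> 0" "s \<noteq> 0" if "s > c" for s using that c by auto
  have op: "open {c<..}" by simp
  note si = smooth_on_mult smooth_on_add smooth_on_const rat op

  \<comment> \<open>All these functions are dictated by \<beta> and \<gamma>. \<open>G(y)\<close> is
    \<open>h(R, R)\<close>; \<open>a' = 1 - s \<beta>'/\<beta>\<close> and
    \<open>b' = \<gamma>'/(2 \<gamma>)\<close> are the logarithmic derivatives that the Killing
    equation produces; \<open>\<delta> = \<beta>/\<gamma>\<close>; and \<kappa> is the solution of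
    \<open>2 s (db'/ds) + a' b' = \<kappa> \<delta>\<close>, recorded in
    \<open>derb\<close>.\<close>
  define a' where "a' s = (2 * s\<^sup>2 + 3 * c * s - c\<^sup>2) / ((s + c) * (s - c))" for s
  define b' where "b' s = - ((2 * s\<^sup>2 + c * s + c\<^sup>2) / (2 * s * (s + c) * (s - c)))" for s
  define \<delta> where "\<delta> s = (s + c)\<^sup>2 / (8 * s)" for s
  define \<kappa> where "\<kappa> s = - (4 * c * (4 * s + c) / (s + c) ^ 4)" for s
  define G where "G s = 2 * s * \<beta> s" for s

  \<comment> \<open>The rules for smoothness treat sums, products and inverses, so each rational
    function is first rewritten in these terms.\<close>
  have smG: "smooth_on {c<..} G"
    by (rule smooth_on_cong[of _ "\<lambda>s. 2 * s * ((s + c) * (inverse (s - c) * inverse (s - c)))"], intro si)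
       (auto simp: G_def \<beta>_def divide_simps power2_eq_square)
  have sm\<gamma>: "smooth_on {c<..} \<gamma>"
    by (rule smooth_on_cong[of _ "\<lambda>s. 8 * s * (inverse (s + c) * (inverse (s - c) * inverse (s - c)))"], intro si)
       (auto simp: \<gamma>_def divide_simps power2_eq_square)
  have sma: "smooth_on {c<..} a'"
    by (rule smooth_on_cong[of _ "\<lambda>s. (2 * (s * s) + 3 * c * s + - (c * c)) * (inverse (s + c) * inverse (s - c))"], intro si)
       (auto simp: a'_def divide_simps power2_eq_square)
  have smb: "smooth_on {c<..} b'"
    by (rule smooth_on_cong[of _ "\<lambda>s. (- 1) * ((2 * (s * s) + c * s + c * c) * ((1/2) * inverse s * (inverse (s + c) * inverse (s - c))))"], intro si)
       (auto simp: b'_def divide_simps power2_eq_square)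
  have sm\<delta>: "smooth_on {c<..} \<delta>"
    by (rule smooth_on_cong[of _ "\<lambda>s. (s + c) * (s + c) * (1 / 8 * inverse s)"], intro si)
       (auto simp: \<delta>_def divide_simps power2_eq_square)
  have sm\<kappa>: "smooth_on {c<..} \<kappa>"
    by (rule smooth_on_cong[of _ "\<lambda>s. - 4 * c * (4 * s + c) * (inverse (s + c) * inverse (s + c) * (inverse (s + c) * inverse (s + c)))"], intro si)
       (auto simp: \<kappa>_def divide_simps eval_nat_numeral)
  have derG: "(G has_real_derivative 2 * \<beta> s * (2 - a' s)) (at s)" if "s > c" for s
    unfolding G_def \<beta>_def a'_def
    by (rule derivative_eq_intros refl | use pos[OF that] in \<open>simp; fail\<close>)+
       (use pos[OF that] in \<open>simp add: divide_simps, simp add: algebra_simps eval_nat_numeral\<close>)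
  have der\<gamma>: "(\<gamma> has_real_derivative 2 * \<gamma> s * b' s) (at s)" if "s > c" for s
    unfolding \<gamma>_def b'_def
    by (rule derivative_eq_intros refl | use pos[OF that] in \<open>simp; fail\<close>)+
       (use pos[OF that] in \<open>simp add: divide_simps, simp add: algebra_simps eval_nat_numeral\<close>)
  have derb: "(b' has_real_derivative (\<kappa> s * \<delta> s - a' s * b' s) / (2 * s)) (at s)" if "s > c" for s
    unfolding a'_def b'_def \<kappa>_def \<delta>_def
    by (rule derivative_eq_intros refl | use pos[OF that] in \<open>simp; fail\<close>)+
       (use pos[OF that] in \<open>simp add: divide_simps, simp add: algebra_simps eval_nat_numeral\<close>)
  have der\<kappa>: "(\<kappa> has_real_derivative 48 * c * s / (s + c) ^ 5) (at s)" if "s > c" for s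
    unfolding \<kappa>_def
    by (rule derivative_eq_intros refl | use pos[OF that] in \<open>simp; fail\<close>)+
       (use pos[OF that] in \<open>simp add: divide_simps, simp add: algebra_simps eval_nat_numeral\<close>)
  have der: "(F has_real_derivative deriv F s) (at s)" if "smooth_on {c<..} F" "s > c" for F s
  proof -
    have "F differentiable (at s)"
      using smooth_on_has_derivative[OF that(1), of s] that(2) by (auto simp: differentiable_def)
    then show ?thesis
      using DERIV_deriv_iff_real_differentiable by blast
  qed
  have sF: "smooth_fun B V (\<lambda>x. F (y x))" if "smooth_on {c<..} F" for F
    by (rule smooth_fun_compose[OF at y(1) that op y(2)])
  have vF: "v (\<lambda>x. F (y x)) = F' * v y"
    if "smooth_on {c<..} F" "(F has_real_derivative F') (at (y x))" "v \<in> tangent B x" "x \<in> V" for v x F F'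
    by (rule tangent_of_function[OF at that(3) y(1) that(4) that(1) y(2) that(2)])
  have vFf: "v (\<lambda>z. F (y z) * f z) = F' * v y * f x + F (y x) * v f"
    if "smooth_on {c<..} F" "(F has_real_derivative F') (at (y x))" "v \<in> tangent B x" "x \<in> V" "smooth_fun B V f" for v x F F' f
    using tangent_mult[OF that(3) near[OF sF[OF that(1)] that(4)] near[OF that(5,4)]] vF[OF that(1-4)] by simp
  have XF: "X x (\<lambda>z. F (y z) * f z) = F (y x) * X x f"
    if "smooth_on {c<..} F" "x \<in> V" "smooth_fun B V f" for F f x
    using vFf[OF that(1) der[OF that(1) ypos(1)[OF that(2)]] tX[OF that(2)] that(2,3)] Xy[OF that(2)] by simp
  have \<beta>0: "\<beta> s \<noteq> 0" and \<gamma>0: "\<gamma> s \<noteq> 0" and \<delta>0: "\<delta> s \<noteq> 0" and \<delta>_eq: "\<beta> s = \<delta> s * \<gamma> s" if "s > c" for s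
    using pos[OF that] that c by (auto simp: \<beta>_def \<gamma>_def \<delta>_def divide_simps power2_eq_square)

  \<comment> \<open>The Killing equation for the pair (R, R): one side is K applied to
    \<open>G(y)\<close>, the other is \<open>2 \<beta> ([K, R] y)\<close>, and
    \<open>[K, R] y = 2 u - R u\<close>.\<close>
  have Ru: "R x u = a' (y x) * u x" if xV: "x \<in> V" for x
  proof -
    have "K x (\<lambda>z. h z (R z) (R z)) = K x (\<lambda>z. G (y z))"
      by (rule germ[OF tK[OF xV] xV]) (simp add: hR tR Ry G_def)
    also have "\<dots> = 2 * \<beta> (y x) * (2 - a' (y x)) * u x"
      unfolding u_def by (rule vF[OF smG derG[OF ypos(1)[OF xV]] tK[OF xV] xV])
    finally have 1: "2 * h x (R x) (lie_bracket B K R x) = 2 * \<beta> (y x) * (2 - a' (y x)) * u x"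
      using Kill[OF R R xV] sym[OF xV lbt[OF Kv R xV] tR[OF xV]] by simp
    have "K x (\<lambda>z. R z y) = K x (\<lambda>z. 2 * y z)" by (rule germ[OF tK[OF xV] xV]) (rule Ry)
    also have "\<dots> = 2 * u x" unfolding u_def by (rule tangent_cmult[OF at tK[OF xV] near[OF y(1) xV]])
    finally have "lie_bracket B K R x y = 2 * u x - R x u" by (simp add: lb_y[OF xV] u_def[abs_def])
    then have "\<beta> (y x) * (2 * u x - R x u) = \<beta> (y x) * ((2 - a' (y x)) * u x)"
      using 1 hR[OF xV lbt[OF Kv R xV]] by simp
    then show ?thesis using \<beta>0[OF ypos(1)[OF xV]] by (simp add: algebra_simps)
  qed
  \<comment> \<open>The pair (X, X) gives \<open>\<theta>([K, X]) = b' u\<close>. Since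
    \<open>\<theta>(X)\<close> is constant, \<open>d\<theta>(X, K) = 0\<close> identifies
    \<open>\<theta>([K, X])\<close> with \<open>- X w\<close>.\<close>
  have Xw: "X x w = (-1) * (b' (y x) * u x)" if xV: "x \<in> V" for x
  proof -
    have "K x (\<lambda>z. h z (X z) (X z)) = K x (\<lambda>z. \<gamma> (y z))"
      by (rule germ[OF tK[OF xV] xV]) (simp add: hX tX \<theta>X)
    also have "\<dots> = 2 * \<gamma> (y x) * b' (y x) * u x"
      unfolding u_def by (rule vF[OF sm\<gamma> der\<gamma>[OF ypos(1)[OF xV]] tK[OF xV] xV])
    finally have "2 * h x (X x) (lie_bracket B K X x) = 2 * \<gamma> (y x) * b' (y x) * u x"
      using Kill[OF X X xV] sym[OF xV lbt[OF Kv X xV] tX[OF xV]] by simp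
    then have 1: "\<theta> x (lie_bracket B K X x) = b' (y x) * u x"
      using hX[OF xV lbt[OF Kv X xV]] \<gamma>0[OF ypos(1)[OF xV]] by simp
    have "K x (\<lambda>z. \<theta> z (X z)) = K x (\<lambda>z. 1)" by (rule germ[OF tK[OF xV] xV]) (rule \<theta>X)
    then have "K x (\<lambda>z. \<theta> z (X z)) = 0" by (simp add: tangent_const[OF at tK[OF xV]])
    then show ?thesis
      using ext_deriv1_vfields[OF at \<theta> xV X Kv xV] d\<theta>X[OF xV tK[OF xV]] 1 lb_swap[OF X Kv xV]
      by (simp add: w_def[abs_def])
  qed
  \<comment> \<open>The mixed pair: \<open>h(R, X)\<close> vanishes because \<open>X y = 0\<close>,
    and hence so does \<open>\<theta>(R)\<close>. The equation links \<open>\<theta>([K, R])\<close>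
    with \<open>[K, X] y = - X u\<close>, and \<open>d\<theta>(R, K) = 0\<close> turns the former
    into \<open>- R w\<close>.\<close>
  have Rw: "R x w = (-1) * (\<delta> (y x) * X x u)" if xV: "x \<in> V" for x
  proof -
    have hRX: "h z (R z) (X z) = 0" if "z \<in> V" for z
      using hR[OF that tX[OF that]] Xy[OF that] by simp
    have \<theta>R: "\<theta> z (R z) = 0" if "z \<in> V" for z
      using hX[OF that tR[OF that]] sym[OF that tR[OF that] tX[OF that]] hRX[OF that] \<gamma>0[OF ypos(1)[OF that]] by simp
    have "K x (\<lambda>z. h z (R z) (X z)) = K x (\<lambda>z. 0)" by (rule germ[OF tK[OF xV] xV]) (rule hRX)
    then have 1: "h x (X x) (lie_bracket B K R x) + h x (R x) (lie_bracket B K X x) = 0"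
      using Kill[OF R X xV] sym[OF xV lbt[OF Kv R xV] tX[OF xV]] tangent_const[OF at tK[OF xV]] by simp
    have "K x (\<lambda>z. X z y) = K x (\<lambda>z. 0)" by (rule germ[OF tK[OF xV] xV]) (rule Xy)
    then have "lie_bracket B K X x y = - X x u"
      by (simp add: lb_y[OF xV] u_def[abs_def] tangent_const[OF at tK[OF xV]])
    then have "\<gamma> (y x) * \<theta> x (lie_bracket B K R x) = \<gamma> (y x) * (\<delta> (y x) * X x u)"
      using 1 hX[OF xV lbt[OF Kv R xV]] hR[OF xV lbt[OF Kv X xV]] \<delta>_eq[OF ypos(1)[OF xV]] by simp
    then have 2: "\<theta> x (lie_bracket B K R x) = \<delta> (y x) * X x u"
      using \<gamma>0[OF ypos(1)[OF xV]] by simp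
    have "K x (\<lambda>z. \<theta> z (R z)) = K x (\<lambda>z. 0)" by (rule germ[OF tK[OF xV] xV]) (rule \<theta>R)
    then have "K x (\<lambda>z. \<theta> z (R z)) = 0" by (simp add: tangent_const[OF at tK[OF xV]])
    then show ?thesis
      using ext_deriv1_vfields[OF at \<theta> xV R Kv xV] d\<theta>R[OF xV tK[OF xV]] 2 lb_swap[OF R Kv xV]
      by (simp add: w_def[abs_def])
  qed
  \<comment> \<open>Integrability of the system for \<open>w\<close>: \<open>R (X w)\<close> and
    \<open>X (R w)\<close> agree. The first involves \<open>u\<close> alone, the second is
    \<open>- \<delta> X X u\<close> because X annihilates functions of y.\<close>
  have XXu: "X x (\<lambda>z. X z u) = \<kappa> (y x) * u x" if xV: "x \<in> V" for x
  proof -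
    let ?s = "y x"
    have s: "?s > c" "?s > 0" by (rule ypos[OF xV])+
    have sbu: "smooth_fun B V (\<lambda>z. b' (y z) * u z)" by (rule smooth_fun_mult[OF at sF[OF smb] su])
    have s\<delta>: "smooth_fun B V (\<lambda>z. \<delta> (y z) * X z u)" by (rule smooth_fun_mult[OF at sF[OF sm\<delta>] sXu])
    have "R x (\<lambda>z. X z w) = R x (\<lambda>z. (-1) * (b' (y z) * u z))" by (rule germ[OF tR[OF xV] xV]) (rule Xw)
    also have "\<dots> = (-1) * ((\<kappa> ?s * \<delta> ?s - a' ?s * b' ?s) / (2 * ?s) * (2 * ?s) * u x + b' ?s * (a' ?s * u x))"
      by (simp only: tangent_cmult[OF at tR[OF xV] near[OF sbu xV]]
          vFf[OF smb derb[OF s(1)] tR[OF xV] xV su] Ry[OF xV] Ru[OF xV])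
    also have "\<dots> = - (\<kappa> ?s * \<delta> ?s * u x)" using s by (simp add: field_simps)
    finally have 1: "R x (\<lambda>z. X z w) = - (\<kappa> ?s * \<delta> ?s * u x)" .
    have "X x (\<lambda>z. R z w) = X x (\<lambda>z. (-1) * (\<delta> (y z) * X z u))" by (rule germ[OF tX[OF xV] xV]) (rule Rw)
    also have "\<dots> = - (\<delta> ?s * X x (\<lambda>z. X z u))"
      by (simp only: tangent_cmult[OF at tX[OF xV] near[OF s\<delta> xV]] XF[OF sm\<delta> xV sXu])
    finally show ?thesis using 1 comm[OF sw xV] \<delta>0[OF s(1)] by simp
  qed
  \<comment> \<open>Now R is moved past both factors X. As \<open>a'(y)\<close> is constant along X,
    the two evaluations share the term \<open>a' \<kappa> u\<close>, and what remains is the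
    derivative of \<kappa> along R times \<open>u\<close>.\<close>
  have "R x (\<lambda>z. X z (\<lambda>z. X z u)) = R x (\<lambda>z. \<kappa> (y z) * u z)"
    by (rule germ[OF tR[OF x] x]) (rule XXu)
  also have "\<dots> = 48 * c * y x / (y x + c) ^ 5 * (2 * y x) * u x + \<kappa> (y x) * (a' (y x) * u x)"
    by (simp only: vFf[OF sm\<kappa> der\<kappa>[OF ypos(1)[OF x]] tR[OF x] x su] Ry[OF x] Ru[OF x])
  finally have 1: "R x (\<lambda>z. X z (\<lambda>z. X z u))
      = 48 * c * y x / (y x + c) ^ 5 * (2 * y x) * u x + \<kappa> (y x) * (a' (y x) * u x)" .
  have RXu: "R z (\<lambda>z. X z u) = a' (y z) * X z u" if zV: "z \<in> V" for z
  proof -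
    have "R z (\<lambda>z. X z u) = X z (\<lambda>z. R z u)" by (rule comm[OF su zV])
    also have "\<dots> = X z (\<lambda>z. a' (y z) * u z)" by (rule germ[OF tX[OF zV] zV]) (rule Ru)
    also have "\<dots> = a' (y z) * X z u" by (rule XF[OF sma zV su])
    finally show ?thesis .
  qed
  have "R x (\<lambda>z. X z (\<lambda>z. X z u)) = X x (\<lambda>z. R z (\<lambda>z. X z u))" by (rule comm[OF sXu x])
  also have "\<dots> = X x (\<lambda>z. a' (y z) * X z u)" by (rule germ[OF tX[OF x] x]) (rule RXu)
  also have "\<dots> = a' (y x) * (\<kappa> (y x) * u x)"
    by (simp only: XF[OF sma x sXu] XXu[OF x])
  finally have "48 * c * y x / (y x + c) ^ 5 * (2 * y x) * u x = 0" using 1 by simp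
  \<comment> \<open>The coefficient of \<open>u\<close> is \<open>96 c y^2 / (y + c)^5\<close>,
    which is positive.\<close>
  then show ?thesis using ypos[OF x] c by (simp add: u_def)
qed

section \<open>Smooth maps\<close>

lemma smooth_map_points: "smooth_map M N F \<Longrightarrow> x \<in> points M \<Longrightarrow> F x \<in> points N"
  unfolding smooth_map_def continuous_map_def by blast

lemma smooth_map_preimage_open:
  "smooth_map M N F \<Longrightarrow> openin (mtop N) W \<Longrightarrow> openin (mtop M) {x \<in> points M. F x \<in> W}"
  unfolding smooth_map_def by (blast intro: openin_continuous_map_preimage)

lemma smooth_map_charts:
  assumes "smooth_map M N F" "(U, \<phi>) \<in> charts M" "(V, \<psi>) \<in> charts N"
  shows "smooth_on (\<phi> ` (U \<inter> F -` V)) (\<psi> \<circ> F \<circ> inv_into U \<phi>)"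
  using assms unfolding smooth_map_def by fast

lemma smooth_map_smooth_fun:
  assumes "atlas M" "atlas N" "smooth_map M N F" "smooth_fun N W f"
  shows "smooth_fun M {x \<in> points M. F x \<in> W} (f \<circ> F)"
proof (rule smooth_fun_local[OF assms(1)])
  fix x assume x: "x \<in> {x \<in> points M. F x \<in> W}"
  then have xM: "x \<in> points M" and xW: "F x \<in> W" by auto
  have oW: "openin (mtop N) W" by (rule smooth_fun_open[OF assms(4)])
  obtain U \<phi> where U: "(U, \<phi>) \<in> charts M" "coords M U \<phi>" "x \<in> U" by (rule atlas_chart_at[OF assms(1) xM])
  obtain V \<psi> where V: "(V, \<psi>) \<in> charts N" "coords N V \<psi>" "F x \<in> V"
    by (rule atlas_chart_at[OF assms(2) smooth_map_points[OF assms(3) xM]])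
  let ?T = "U \<inter> {x \<in> points M. F x \<in> V \<inter> W}"
  have oT: "openin (mtop M) ?T"
    by (rule openin_Int[OF coordsD(1)[OF U(2)] smooth_map_preimage_open[OF assms(3) openin_Int[OF coordsD(1)[OF V(2)] oW]]])
  have o: "open (\<phi> ` ?T)" using coordsD(3)[OF U(2), of ?T] oT by blast
  have 1: "smooth_on (\<phi> ` ?T) (\<psi> \<circ> F \<circ> inv_into U \<phi>)"
    by (rule smooth_on_subset[OF smooth_map_charts[OF assms(3) U(1) V(1)]]) auto
  have 2: "smooth_on (\<psi> ` (V \<inter> W)) (f \<circ> inv_into V \<psi>)" by (rule smooth_funD[OF assms(4) V(1)])
  have "smooth_on (\<phi> ` ?T) (\<lambda>z. (f \<circ> inv_into V \<psi>) ((\<psi> \<circ> F \<circ> inv_into U \<phi>) z))"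
    by (rule smooth_on_compose[OF 1 2 o coords_open[OF V(2) oW]]) (auto simp: coords_inv[OF U(2)])
  then have "smooth_on (\<phi> ` ?T) ((f \<circ> F) \<circ> inv_into U \<phi>)"
    by (rule smooth_on_cong[OF _ o]) (auto simp: coords_inv[OF U(2)] coords_inv[OF V(2)])
  then have "smooth_fun M ?T (f \<circ> F)"
    by (intro smooth_fun_coordsI[OF assms(1) U(2) oT]) auto
  then show "\<exists>V. x \<in> V \<and> V \<subseteq> {x \<in> points M. F x \<in> W} \<and> smooth_fun M V (f \<circ> F)"
    using U(3) V(3) xM xW by (intro exI[of _ ?T]) auto
qed

lemma smooth_map_smooth_near:
  assumes "atlas M" "atlas N" "smooth_map M N F" "p \<in> points M" "smooth_near N (F p) f"
  shows "smooth_near M p (f \<circ> F)"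
proof -
  obtain W where "F p \<in> W" "smooth_fun N W f" using assms(5) by (auto simp: smooth_near_def)
  then show ?thesis
    by (intro smooth_fun_imp_near[OF smooth_map_smooth_fun[OF assms(1-3)]]) (use assms(4) in auto)
qed

lemma push_apply: "smooth_near N (F p) f \<Longrightarrow> push M N F p v f = v (f \<circ> F)"
  by (simp add: push_def)

lemma push_lcomb: "push M N F p (lcomb a u b v) = lcomb a (push M N F p u) b (push M N F p v)"
  by (auto simp: push_def lcomb_def)

text \<open>Stated for maps that pull back functions smooth near \<open>F p\<close> to functions smooth near \<open>p\<close>, so as
  to cover local sections.\<close>

lemma push_tangent_local:
  assumes "atlas N" "\<And>f. smooth_near N (F p) f \<Longrightarrow> smooth_near M p (f \<circ> F)" "F p \<in> points N" "v \<in> tangent M p"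
  shows "push M N F p v \<in> tangent N (F p)"
proof -
  have "push M N F p v (lcomb a f b g) = a * push M N F p v f + b * push M N F p v g"
    if f: "smooth_near N (F p) f" and g: "smooth_near N (F p) g" for a f b g
  proof -
    have "lcomb a f b g \<circ> F = lcomb a (f \<circ> F) b (g \<circ> F)" by (auto simp: lcomb_def)
    then show ?thesis
      using tangent_lcomb[OF assms(4) assms(2)[OF f] assms(2)[OF g]] f g smooth_near_lcomb[OF assms(1) f g]
      by (simp add: push_def)
  qed
  moreover have "push M N F p v (\<lambda>x. f x * g x) = push M N F p v f * g (F p) + f (F p) * push M N F p v g"
    if f: "smooth_near N (F p) f" and g: "smooth_near N (F p) g" for f g
    using tangent_mult[OF assms(4) assms(2)[OF f] assms(2)[OF g]] f g smooth_near_mult[OF assms(1) f g]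
    by (simp add: push_def o_def)
  moreover have "push M N F p v f = 0" if "\<not> smooth_near N (F p) f" for f
    using that by (simp add: push_def)
  ultimately show ?thesis using assms(3) unfolding tangent_def by blast
qed

lemma push_tangent:
  assumes "atlas M" "atlas N" "smooth_map M N F" "v \<in> tangent M p"
  shows "push M N F p v \<in> tangent N (F p)"
  by (rule push_tangent_local[OF assms(2) smooth_map_smooth_near[OF assms(1-3) tangent_points[OF assms(4)]]
        smooth_map_points[OF assms(3) tangent_points[OF assms(4)]] assms(4)])

lemma form_expr_pullback:
  assumes "atlas M" "atlas N" "smooth_map M N F" "form_expr N V \<eta> C a k"
  shows "form_expr M {x \<in> points M. F x \<in> V} (\<lambda>x v. \<eta> (F x) (push M N F x v)) C (\<lambda>c. a c \<circ> F) (\<lambda>c. k c \<circ> F)"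
  unfolding form_expr_def
proof (intro conjI ballI)
  have V: "openin (mtop N) V" and k: "\<And>c. c \<in> C \<Longrightarrow> smooth_fun N V (k c)" and a: "\<And>c. c \<in> C \<Longrightarrow> smooth_fun N V (a c)"
    and eta: "\<And>y v. y \<in> V \<Longrightarrow> v \<in> tangent N y \<Longrightarrow> \<eta> y v = (\<Sum>c\<in>C. a c y * v (k c))"
    using assms(4) by (simp_all add: form_expr_def)
  show "finite C" using assms(4) by (simp add: form_expr_def)
  show "openin (mtop M) {x \<in> points M. F x \<in> V}" by (rule smooth_map_preimage_open[OF assms(3) V])
  show "smooth_fun M {x \<in> points M. F x \<in> V} (a c \<circ> F)" "smooth_fun M {x \<in> points M. F x \<in> V} (k c \<circ> F)"
    if "c \<in> C" for c
    by (rule smooth_map_smooth_fun[OF assms(1-3)], rule a k, rule that)+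
  fix x v assume x: "x \<in> {x \<in> points M. F x \<in> V}" and v: "v \<in> tangent M x"
  have "\<eta> (F x) (push M N F x v) = (\<Sum>c\<in>C. a c (F x) * push M N F x v (k c))"
    by (rule eta[OF _ push_tangent[OF assms(1-3) v]]) (use x in simp)
  also have "\<dots> = (\<Sum>c\<in>C. (a c \<circ> F) x * v (k c \<circ> F))"
    by (rule sum.cong[OF refl]) (use x in \<open>simp add: push_apply smooth_fun_imp_near[OF k]\<close>)
  finally show "\<eta> (F x) (push M N F x v) = (\<Sum>c\<in>C. (a c \<circ> F) x * v (k c \<circ> F))" .
qed

lemma ext_deriv1_pullback:
  assumes "atlas M" "atlas N" "smooth_map M N F" "form_expr N V \<eta> C a k"
    and "F x \<in> V" "u \<in> tangent M x" "v \<in> tangent M x"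
  shows "ext_deriv1 M (\<lambda>x v. \<eta> (F x) (push M N F x v)) x u v
    = ext_deriv1 N \<eta> (F x) (push M N F x u) (push M N F x v)"
proof -
  have x: "x \<in> {x \<in> points M. F x \<in> V}" using assms(5) tangent_points[OF assms(6)] by simp
  have near: "smooth_near N (F x) (a c)" "smooth_near N (F x) (k c)" if "c \<in> C" for c
    using assms(4,5) that by (auto simp: form_expr_def intro: smooth_fun_imp_near)
  show ?thesis
    using form_expr_ext_deriv1[OF assms(1) form_expr_pullback[OF assms(1-4)] x assms(6,7)]
      form_expr_ext_deriv1[OF assms(2,4,5) push_tangent[OF assms(1-3,6)] push_tangent[OF assms(1-3,7)]]
    by (simp add: push_apply near)
qed

lemma form_expr_subset:
  assumes "form_expr M W \<eta> C a k" "openin (mtop M) V" "V \<subseteq> W"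
  shows "form_expr M V \<eta> C a k"
  using assms smooth_fun_subset unfolding form_expr_def by blast

lemma form_expr_scale:
  assumes "atlas M" "form_expr M W \<eta> C a k" "smooth_fun M W f"
  shows "form_expr M W (\<lambda>x v. f x * \<eta> x v) C (\<lambda>c x. f x * a c x) k"
  using assms(2) unfolding form_expr_def
  by (auto simp: sum_distrib_left mult.assoc intro!: smooth_fun_mult[OF assms(1,3)])

lemma ext_deriv1_scale:
  assumes "atlas M" "form_expr M W \<eta> C a k" "smooth_fun M W f" "x \<in> W" "u \<in> tangent M x" "v \<in> tangent M x"
  shows "ext_deriv1 M (\<lambda>x v. f x * \<eta> x v) x u v
    = f x * ext_deriv1 M \<eta> x u v + u f * \<eta> x v - v f * \<eta> x u"
proof -
  have near: "smooth_near M x (a c)" if "c \<in> C" for c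
    using assms(2,4) that by (auto simp: form_expr_def intro: smooth_fun_imp_near)
  have eta: "\<eta> x w = (\<Sum>c\<in>C. a c x * w (k c))" if "w \<in> tangent M x" for w
    using assms(2,4) that by (simp add: form_expr_def)
  have mul: "w (\<lambda>x. f x * a c x) = w f * a c x + f x * w (a c)" if "w \<in> tangent M x" "c \<in> C" for w c
    by (rule tangent_mult[OF that(1) smooth_fun_imp_near[OF assms(3,4)] near[OF that(2)]])
  have "ext_deriv1 M (\<lambda>x v. f x * \<eta> x v) x u v
      = (\<Sum>c\<in>C. (u f * a c x + f x * u (a c)) * v (k c) - (v f * a c x + f x * v (a c)) * u (k c))"
    unfolding form_expr_ext_deriv1[OF assms(1) form_expr_scale[OF assms(1-3)] assms(4-6)]
    by (rule sum.cong) (simp_all add: mul assms(5,6))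
  also have "\<dots> = f x * ext_deriv1 M \<eta> x u v + u f * \<eta> x v - v f * \<eta> x u"
    unfolding form_expr_ext_deriv1[OF assms(1,2,4-6)] eta[OF assms(5)] eta[OF assms(6)]
    by (simp add: sum_distrib_left sum.distrib[symmetric] sum_subtractf[symmetric] algebra_simps)
  finally show ?thesis .
qed

text \<open>The two expressions may be indexed by different types, hence the disjoint sum as index
  set.\<close>

lemma form_expr_add:
  fixes C :: "'c set" and D :: "'d set"
  assumes "atlas M" "form_expr M W \<eta> C a k" "form_expr M W \<eta>' D b l"
  shows "form_expr M W (\<lambda>x v. \<eta> x v + \<eta>' x v) (C <+> D) (case_sum a b) (case_sum k l)"
  using assms(2,3) unfolding form_expr_def by (auto simp: sum.Plus)

lemma ext_deriv1_add:
  assumes "atlas M" "form_expr M W \<eta> C a k" "form_expr M W \<eta>' D b l" "x \<in> W" "u \<in> tangent M x" "v \<in> tangent M x"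
  shows "ext_deriv1 M (\<lambda>x v. \<eta> x v + \<eta>' x v) x u v = ext_deriv1 M \<eta> x u v + ext_deriv1 M \<eta>' x u v"
proof -
  have fin: "finite C" "finite D" using assms(2,3) by (simp_all add: form_expr_def)
  show ?thesis
    unfolding form_expr_ext_deriv1[OF assms(1) form_expr_add[OF assms(1-3)] assms(4-6)]
      form_expr_ext_deriv1[OF assms(1,2,4-6)] form_expr_ext_deriv1[OF assms(1,3,4-6)]
    by (simp add: sum.Plus[OF fin])
qed

text \<open>\<open>ext_deriv1\<close> takes a total function, while two descriptions of one form
  agree only on tangent vectors over an open set.\<close>

lemma ext_deriv1_cong:
  assumes "atlas M" "form_expr M W \<eta> C a k" "x \<in> W" "u \<in> tangent M x" "v \<in> tangent M x"
    and "openin (mtop M) V" "x \<in> V" and "\<And>y v. y \<in> V \<Longrightarrow> v \<in> tangent M y \<Longrightarrow> \<eta>' y v = \<eta> y v"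
  shows "ext_deriv1 M \<eta>' x u v = ext_deriv1 M \<eta> x u v"
proof -
  have oW: "openin (mtop M) W" using assms(2) by (simp add: form_expr_def)
  have o: "openin (mtop M) (W \<inter> V)" by (rule openin_Int[OF oW assms(6)])
  have 1: "form_expr M (W \<inter> V) \<eta> C a k" by (rule form_expr_subset[OF assms(2) o]) simp
  then have "form_expr M (W \<inter> V) \<eta>' C a k" using assms(8) unfolding form_expr_def by simp
  from form_expr_ext_deriv1[OF assms(1) this _ assms(4,5)] form_expr_ext_deriv1[OF assms(1,2,3,4,5)] assms(3,7)
  show ?thesis by simp
qed

lemma smooth_fun_preimage_open:
  assumes "atlas M" "smooth_fun M W f" "open S"
  shows "openin (mtop M) {x \<in> W. f x \<in> S}"
proof (subst openin_subopen, rule ballI)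
  fix x assume x: "x \<in> {x \<in> W. f x \<in> S}"
  have oW: "openin (mtop M) W" by (rule smooth_fun_open[OF assms(2)])
  have "x \<in> points M" using x openin_subset[OF oW] by blast
  then obtain U \<phi> where U: "(U, \<phi>) \<in> charts M" "coords M U \<phi>" "x \<in> U" by (rule atlas_chart_at[OF assms(1)])
  let ?A = "{x \<in> U \<inter> W. f x \<in> S}"
  have "\<phi> ` ?A = (f \<circ> inv_into U \<phi>) -` S \<inter> \<phi> ` (U \<inter> W)"
    by (auto simp: coords_inv[OF U(2)] image_iff)
  also have "open \<dots>"
    using continuous_open_preimage[OF smooth_on_imp_continuous_on[OF smooth_funD[OF assms(2) U(1)]] coords_open[OF U(2) oW] assms(3)]
    by (simp add: Int_commute)
  finally have "openin (mtop M) ?A" using coordsD(3)[OF U(2), of ?A] by blast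
  then show "\<exists>T. openin (mtop M) T \<and> x \<in> T \<and> T \<subseteq> {x \<in> W. f x \<in> S}" using x U(3) by blast
qed

text \<open>The coordinate functions of the target are among the functions pulled back, which gives
  smoothness in charts. Constants give continuity, since a constant is smooth exactly on open
  sets.\<close>

lemma smooth_mapI:
  assumes "atlas M" "atlas N" "\<And>x. x \<in> points M \<Longrightarrow> F x \<in> points N"
    and pull: "\<And>W f. smooth_fun N W f \<Longrightarrow> smooth_fun M {x \<in> points M. F x \<in> W} (f \<circ> F)"
  shows "smooth_map M N F"
  unfolding smooth_map_def
proof (intro conjI ballI)
  show "continuous_map (mtop M) (mtop N) F"
    unfolding continuous_map_def
  proof (intro conjI allI impI)
    fix W assume "openin (mtop N) W"
    from pull[OF smooth_fun_const[OF assms(2) this]] show "openin (mtop M) {x \<in> points M. F x \<in> W}"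
      by (rule smooth_fun_open)
  qed (use assms(3) in auto)
  fix c assume c: "c \<in> charts M"
  obtain U \<phi> where [simp]: "c = (U, \<phi>)" by fastforce
  have U: "coords M U \<phi>" using atlas_chart[OF assms(1)] c by simp
  have key: "smooth_on (\<phi> ` (U \<inter> F -` V)) (\<psi> \<circ> F \<circ> inv_into U \<phi>)" if d: "(V, \<psi>) \<in> charts N" for V \<psi>
  proof -
    note V = atlas_chart[OF assms(2) d]
    have eq: "U \<inter> {x \<in> points M. F x \<in> V} = U \<inter> F -` V" using coordsD(4)[OF U] by auto
    have sm: "smooth_fun M {x \<in> points M. F x \<in> V} ((\<lambda>y. \<psi> y \<bullet> b) \<circ> F)" for b
      by (rule pull[OF coord_fun_smooth[OF assms(2) V]])
    have o: "open (\<phi> ` (U \<inter> F -` V))" using coords_open[OF U smooth_fun_open[OF sm]] by (simp add: eq)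
    show ?thesis
      by (rule smooth_on_componentwise[OF _ o])
         (use smooth_fun_coords[OF assms(1) U sm] in \<open>simp add: eq o_def\<close>)
  qed
  show "case c of (U, \<phi>) \<Rightarrow> \<forall>(V, \<psi>) \<in> charts N. smooth_on (\<phi> ` (U \<inter> F -` V)) (\<psi> \<circ> F \<circ> inv_into U \<phi>)"
    using key by (simp add: split_beta)
qed

lemma smooth_map_compose:
  assumes "atlas M" "atlas N" "atlas L" "smooth_map M N F" "smooth_map N L G"
  shows "smooth_map M L (G \<circ> F)"
proof (rule smooth_mapI[OF assms(1,3)])
  show "(G \<circ> F) x \<in> points L" if "x \<in> points M" for x
    using smooth_map_points[OF assms(5) smooth_map_points[OF assms(4) that]] by simp
  fix W f assume "smooth_fun L W f"
  from smooth_map_smooth_fun[OF assms(1,2,4) smooth_map_smooth_fun[OF assms(2,3,5) this]]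
  have "smooth_fun M {x \<in> points M. F x \<in> {y \<in> points N. G y \<in> W}} (f \<circ> G \<circ> F)" .
  moreover have "{x \<in> points M. F x \<in> {y \<in> points N. G y \<in> W}} = {x \<in> points M. (G \<circ> F) x \<in> W}"
    using smooth_map_points[OF assms(4)] by auto
  ultimately show "smooth_fun M {x \<in> points M. (G \<circ> F) x \<in> W} (f \<circ> (G \<circ> F))" by (simp add: o_assoc)
qed

lemma push_compose:
  assumes "atlas N" "atlas L" "smooth_map N L G" "F p \<in> points N"
  shows "push N L G (F p) (push M N F p v) = push M L (G \<circ> F) p v"
  using smooth_map_smooth_near[OF assms] by (auto simp: push_def o_assoc)

section \<open>Functions and vector fields on quotients\<close>

text \<open>Surjectivity of \<open>push\<close> is surjectivity of the derivative in charts, so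
  \<open>smooth_local_section\<close> applies there. As \<open>\<sigma>\<close> is meaningful on
  \<open>T\<close> only, its smoothness is expressed by pulling back functions.\<close>

lemma submersion_section:
  fixes P :: "('p, 'f::euclidean_space) mfd" and B :: "('b, 'h::euclidean_space) mfd"
  assumes "atlas P" "atlas B" "smooth_map P B q" "x0 \<in> points P"
    and surj: "push P B q x0 ` tangent P x0 = tangent B (q x0)"
  obtains T \<sigma> where "openin (mtop B) T" "q x0 \<in> T" "\<sigma> ` T \<subseteq> points P" "\<And>y. y \<in> T \<Longrightarrow> q (\<sigma> y) = y"
    "\<And>A W G. smooth_fun P W G \<Longrightarrow> openin (mtop B) A \<Longrightarrow> A \<subseteq> T \<Longrightarrow> \<sigma> ` A \<subseteq> W \<Longrightarrow> smooth_fun B A (G \<circ> \<sigma>)"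
proof -
  obtain U \<phi> where U: "(U, \<phi>) \<in> charts P" "coords P U \<phi>" "x0 \<in> U" by (rule atlas_chart_at[OF assms(1,4)])
  obtain V \<psi> where V: "(V, \<psi>) \<in> charts B" "coords B V \<psi>" "q x0 \<in> V"
    by (rule atlas_chart_at[OF assms(2) smooth_map_points[OF assms(3,4)]])
  define A where "A = U \<inter> {x \<in> points P. q x \<in> V}"
  define F where "F = \<psi> \<circ> q \<circ> inv_into U \<phi>"
  have oA: "openin (mtop P) A"
    unfolding A_def by (rule openin_Int[OF coordsD(1)[OF U(2)] smooth_map_preimage_open[OF assms(3) coordsD(1)[OF V(2)]]])
  have AU: "A \<subseteq> U" by (auto simp: A_def)
  have x0A: "x0 \<in> A" using U(3) V(3) assms(4) by (simp add: A_def)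
  have o: "open (\<phi> ` A)" using coordsD(3)[OF U(2) AU] oA by simp
  have sF: "smooth_on (\<phi> ` A) F"
    unfolding F_def by (rule smooth_on_subset[OF smooth_map_charts[OF assms(3) U(1) V(1)]]) (auto simp: A_def)
  have derF: "(F has_derivative frechet_derivative F (at (\<phi> x0))) (at (\<phi> x0))"
    by (rule smooth_on_has_derivative[OF sF]) (use x0A in auto)
  have Fx0: "F (\<phi> x0) = \<psi> (q x0)" using coords_inv[OF U(2,3)] by (simp add: F_def)
  have "surj (frechet_derivative F (at (\<phi> x0)))"
  proof (rule surjI)
    fix w
    have "cv B V \<psi> (q x0) w \<in> push P B q x0 ` tangent P x0"
      unfolding surj by (rule cv_tangent[OF assms(2) V(2,3)])
    then have "\<exists>v. v \<in> tangent P x0 \<and> push P B q x0 v = cv B V \<psi> (q x0) w" by force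
    \<comment> \<open>\<open>surjI\<close> asks for a preimage as an explicit function of
      \<open>w\<close>; the choice operator supplies the tangent vector whose coordinates form
      it.\<close>
    then have v: "(SOME v. v \<in> tangent P x0 \<and> push P B q x0 v = cv B V \<psi> (q x0) w) \<in> tangent P x0"
      "push P B q x0 (SOME v. v \<in> tangent P x0 \<and> push P B q x0 v = cv B V \<psi> (q x0) w) = cv B V \<psi> (q x0) w"
      using someI_ex by (metis (mono_tags, lifting))+
    define v where "v = (SOME v. v \<in> tangent P x0 \<and> push P B q x0 v = cv B V \<psi> (q x0) w)"
    have v: "v \<in> tangent P x0" "push P B q x0 v = cv B V \<psi> (q x0) w" using v by (simp_all add: v_def)
    show "frechet_derivative F (at (\<phi> x0)) (\<Sum>b\<in>Basis.
        (SOME v. v \<in> tangent P x0 \<and> push P B q x0 v = cv B V \<psi> (q x0) w) (\<lambda>x. \<phi> x \<bullet> b) *\<^sub>R b) = w"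
      unfolding v_def[symmetric]
    proof (rule euclidean_eqI)
      fix c :: 'h assume "c \<in> Basis"
      have near: "smooth_near B (q x0) (\<lambda>y. \<psi> y \<bullet> c)"
        by (rule smooth_fun_imp_near[OF coord_fun_smooth[OF assms(2) V(2)] V(3)])
      have "((\<lambda>z. F z \<bullet> c) has_derivative (\<lambda>h. frechet_derivative F (at (\<phi> x0)) h \<bullet> c)) (at (\<phi> x0))"
        by (rule has_derivative_inner_left[OF derF])
      from frechet_derivative_at[OF this]
      have D: "frechet_derivative (((\<lambda>y. \<psi> y \<bullet> c) \<circ> q) \<circ> inv_into U \<phi>) (at (\<phi> x0))
          = (\<lambda>h. frechet_derivative F (at (\<phi> x0)) h \<bullet> c)"
        by (simp add: F_def o_def)
      have "w \<bullet> c = v ((\<lambda>y. \<psi> y \<bullet> c) \<circ> q)"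
        using push_apply[where N=B and F=q and p=x0 and M=P and v=v, OF near] v(2) cv_coord[OF assms(2) V(2,3)] by metis
      also have "\<dots> = (\<Sum>b\<in>Basis. v (\<lambda>x. \<phi> x \<bullet> b) * (frechet_derivative F (at (\<phi> x0)) b \<bullet> c))"
        unfolding tangent_coords[OF assms(1) U(2,3) v(1) smooth_map_smooth_near[OF assms(1-4) near]] D ..
      also have "\<dots> = frechet_derivative F (at (\<phi> x0)) (\<Sum>b\<in>Basis. v (\<lambda>x. \<phi> x \<bullet> b) *\<^sub>R b) \<bullet> c"
        by (simp add: linear_sum[OF has_derivative_linear[OF derF]] linear_cmul[OF has_derivative_linear[OF derF]] inner_sum_left)
      finally show "frechet_derivative F (at (\<phi> x0)) (\<Sum>b\<in>Basis. v (\<lambda>x. \<phi> x \<bullet> b) *\<^sub>R b) \<bullet> c = w \<bullet> c" by simp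
    qed
  qed
  from smooth_local_section[OF o _ sF this] x0A
  obtain T s where T: "open T" "\<psi> (q x0) \<in> T" "smooth_on T s" "s ` T \<subseteq> \<phi> ` A" "\<And>y. y \<in> T \<Longrightarrow> F (s y) = y"
    unfolding Fx0 by (metis imageI)
  define T' where "T' = {y \<in> V. \<psi> y \<in> T}"
  define \<sigma> where "\<sigma> y = inv_into U \<phi> (s (\<psi> y))" for y
  have oT': "openin (mtop B) T'"
    unfolding T'_def by (rule coords_preimage_open[OF V(2) T(1) coordsD(1)[OF V(2)] order_refl])
  have \<sigma>A: "\<sigma> y \<in> A" "\<phi> (\<sigma> y) = s (\<psi> y)" if "y \<in> T'" for y
  proof -
    have "s (\<psi> y) \<in> \<phi> ` A" using T(4) that by (auto simp: T'_def)
    then obtain x where "x \<in> A" "s (\<psi> y) = \<phi> x" by auto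
    then show "\<sigma> y \<in> A" "\<phi> (\<sigma> y) = s (\<psi> y)" using AU coords_inv[OF U(2)] by (auto simp: \<sigma>_def)
  qed
  show thesis
  proof (rule that[of T' \<sigma>])
    show "openin (mtop B) T'" by (fact oT')
    show "q x0 \<in> T'" using V(3) T(2) by (simp add: T'_def)
    show "\<sigma> ` T' \<subseteq> points P" using \<sigma>A by (auto simp: A_def)
    show "q (\<sigma> y) = y" if y: "y \<in> T'" for y
    proof -
      have "\<psi> (q (\<sigma> y)) = F (s (\<psi> y))" by (simp add: F_def \<sigma>_def)
      also have "\<dots> = \<psi> y" using T(5) y by (simp add: T'_def)
      finally show ?thesis
        using \<sigma>A(1)[OF y] y inj_onD[OF coordsD(2)[OF V(2)]] by (auto simp: A_def T'_def)
    qed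
    fix A' W G assume G: "smooth_fun P W G" and oA': "openin (mtop B) A'" and A'T: "A' \<subseteq> T'" and sub: "\<sigma> ` A' \<subseteq> W"
    have A'V: "A' \<subseteq> V" using A'T by (auto simp: T'_def)
    have smG: "smooth_on (\<phi> ` (U \<inter> W)) (G \<circ> inv_into U \<phi>)" by (rule smooth_funD[OF G U(1)])
    have oT: "open (\<psi> ` A')" using coordsD(3)[OF V(2) A'V] oA' by simp
    have s: "smooth_on (\<psi> ` A') s" by (rule smooth_on_subset[OF T(3)]) (use A'T in \<open>auto simp: T'_def\<close>)
    have im: "s ` (\<psi> ` A') \<subseteq> \<phi> ` (U \<inter> W)"
    proof clarify
      fix y assume y: "y \<in> A'"
      then have y': "y \<in> T'" using A'T by blast
      show "s (\<psi> y) \<in> \<phi> ` (U \<inter> W)" using \<sigma>A[OF y'] AU sub y by (metis IntI image_eqI image_subset_iff subsetD)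
    qed
    have "smooth_on (\<psi> ` A') (\<lambda>z. (G \<circ> inv_into U \<phi>) (s z))"
      by (rule smooth_on_compose[OF s smG oT coords_open[OF U(2) smooth_fun_open[OF G]] im])
    then have "smooth_on (\<psi> ` A') ((G \<circ> \<sigma>) \<circ> inv_into V \<psi>)"
      by (rule smooth_on_cong[OF _ oT]) (use A'V in \<open>auto simp: \<sigma>_def coords_inv[OF V(2)] subset_iff\<close>)
    then show "smooth_fun B A' (G \<circ> \<sigma>)"
      by (rule smooth_fun_coordsI[OF assms(2) V(2) oA' A'V])
  qed
qed

section \<open>Open submanifolds\<close>

lemma restrict_smooth_fun:
  assumes "atlas M" "openin (mtop M) W0" "W \<subseteq> W0"
  shows "smooth_fun (restrict_mfd M W0) W f \<longleftrightarrow> smooth_fun M W f"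
proof -
  have o: "openin (mtop (restrict_mfd M W0)) W \<longleftrightarrow> openin (mtop M) W"
    using assms(2,3) openin_open_subtopology[OF assms(2)] by (auto simp: restrict_mfd_def)
  have eq: "smooth_on (\<phi> ` (U \<inter> W)) (f \<circ> inv_into (U \<inter> W0) \<phi>) \<longleftrightarrow> smooth_on (\<phi> ` (U \<inter> W)) (f \<circ> inv_into U \<phi>)"
    if c: "(U, \<phi>) \<in> charts M" and W: "openin (mtop M) W" for U \<phi>
  proof -
    note U = atlas_chart[OF assms(1) c]
    have 1: "open (\<phi> ` (U \<inter> W))" by (rule coords_open[OF U W])
    \<comment> \<open>A restricted chart keeps its coordinate map, but \<open>inv_into\<close>
      refers to the smaller domain; on the image of that domain the two inverses agree.\<close>
    have 2: "inv_into (U \<inter> W0) \<phi> y = inv_into U \<phi> y" if y: "y \<in> \<phi> ` (U \<inter> W)" for y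
    proof -
      obtain x where x: "x \<in> U" "x \<in> W" "y = \<phi> x" using y by auto
      have inj: "inj_on \<phi> (U \<inter> W0)" by (rule inj_on_subset[OF coordsD(2)[OF U]]) simp
      show ?thesis using inv_into_f_f[OF inj, of x] coords_inv[OF U, of x] x assms(3) by auto
    qed
    show ?thesis
      using smooth_on_cong[OF _ 1, of "f \<circ> inv_into (U \<inter> W0) \<phi>" "f \<circ> inv_into U \<phi>"]
        smooth_on_cong[OF _ 1, of "f \<circ> inv_into U \<phi>" "f \<circ> inv_into (U \<inter> W0) \<phi>"] 2 by auto
  qed
  have int: "U \<inter> W0 \<inter> W = U \<inter> W" for U using assms(3) by auto
  show ?thesis
  proof
    assume L: "smooth_fun (restrict_mfd M W0) W f"
    show "smooth_fun M W f"
    proof (rule smooth_funI)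
      show W: "openin (mtop M) W" using L o smooth_fun_open by blast
      fix U \<phi> assume c: "(U, \<phi>) \<in> charts M"
      have "(U \<inter> W0, \<phi>) \<in> charts (restrict_mfd M W0)" using c by (auto simp: restrict_mfd_def)
      from smooth_funD[OF L this] show "smooth_on (\<phi> ` (U \<inter> W)) (f \<circ> inv_into U \<phi>)"
        using eq[OF c W] by (simp add: int)
    qed
  next
    assume R: "smooth_fun M W f"
    show "smooth_fun (restrict_mfd M W0) W f"
    proof (rule smooth_funI)
      have W: "openin (mtop M) W" by (rule smooth_fun_open[OF R])
      then show "openin (mtop (restrict_mfd M W0)) W" using o by simp
      fix U' \<phi> assume "(U', \<phi>) \<in> charts (restrict_mfd M W0)"
      then obtain U where U: "U' = U \<inter> W0" "(U, \<phi>) \<in> charts M" by (auto simp: restrict_mfd_def)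
      show "smooth_on (\<phi> ` (U' \<inter> W)) (f \<circ> inv_into U' \<phi>)"
        using smooth_funD[OF R U(2)] eq[OF U(2) W] by (simp add: int U(1))
    qed
  qed
qed

lemma restrict_smooth_near:
  assumes "atlas M" "openin (mtop M) W0" "p \<in> W0"
  shows "smooth_near (restrict_mfd M W0) p f \<longleftrightarrow> smooth_near M p f"
proof
  assume "smooth_near (restrict_mfd M W0) p f"
  then obtain W where W: "p \<in> W" "smooth_fun (restrict_mfd M W0) W f" by (auto simp: smooth_near_def)
  have "W \<subseteq> W0" using openin_subset[OF smooth_fun_open[OF W(2)]] by (auto simp: restrict_mfd_def)
  from restrict_smooth_fun[OF assms(1,2) this, of f] W
  show "smooth_near M p f" by (auto simp: smooth_near_def)
next
  assume "smooth_near M p f"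
  then obtain W where W: "p \<in> W" "smooth_fun M W f" by (auto simp: smooth_near_def)
  have "smooth_fun M (W \<inter> W0) f"
    by (rule smooth_fun_subset[OF W(2) openin_Int[OF smooth_fun_open[OF W(2)] assms(2)]]) simp
  then have "smooth_fun (restrict_mfd M W0) (W \<inter> W0) f" using restrict_smooth_fun[OF assms(1,2)] by simp
  then show "smooth_near (restrict_mfd M W0) p f" using W(1) assms(3) by (auto simp: smooth_near_def)
qed

lemma restrict_tangent:
  assumes "atlas M" "openin (mtop M) W0" "p \<in> W0"
  shows "tangent (restrict_mfd M W0) p = tangent M p"
  using assms(3) openin_subset[OF assms(2)] unfolding tangent_def restrict_smooth_near[OF assms]
  by (auto simp: restrict_mfd_def)

lemma restrict_push:
  assumes "atlas M" "openin (mtop M) W0" "F p \<in> W0"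
  shows "push P (restrict_mfd M W0) F p v = push P M F p v"
  unfolding push_def restrict_smooth_near[OF assms] ..

section \<open>Conical affine special Kaehler manifolds\<close>

locale cask = cask_data M g J om nab xi
  for M :: "('m, 'e::euclidean_space) mfd" and g J om nab xi +
  assumes cask: "cask_manifold M g J om nab xi"
begin

lemma ask: "ask_manifold M g J om nab"
  using cask unfolding cask_manifold_def by (rule conjunct1)

lemma kaehler: "pseudo_kaehler M g J om"
  using ask unfolding ask_manifold_def by (rule conjunct1)

lemma riem: "pseudo_riemannian M g" and cplx: "complex_structure M J"
  using kaehler unfolding pseudo_kaehler_def by simp_all

lemma atlasM: "atlas M"
  using riem by (intro smooth_manifold_imp_atlas) (simp add: pseudo_riemannian_def)

text \<open>The CASK condition asserts the existence of such a connection without naming it, hence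
  the choice.\<close>

definition LC :: "'m conn" where
  "LC = (SOME D. levi_civita M g D \<and> (\<forall>x\<in>points M. \<forall>v\<in>tangent M x. D x v xi = v \<and> nab x v xi = v))"

lemma LC: "levi_civita M g LC" "v \<in> tangent M x \<Longrightarrow> LC x v xi = v" "v \<in> tangent M x \<Longrightarrow> nab x v xi = v"
proof -
  have "\<exists>D. levi_civita M g D \<and> (\<forall>x\<in>points M. \<forall>v\<in>tangent M x. D x v xi = v \<and> nab x v xi = v)"
    using cask unfolding cask_manifold_def by (elim conjE)
  from someI_ex[OF this]
  have *: "levi_civita M g LC \<and> (\<forall>x\<in>points M. \<forall>v\<in>tangent M x. LC x v xi = v \<and> nab x v xi = v)"
    unfolding LC_def .
  then show "levi_civita M g LC" by (rule conjunct1)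
  show "LC x v xi = v" "nab x v xi = v" if "v \<in> tangent M x"
    using conjunct2[OF *] tangent_points[OF that] that by simp_all
qed

lemma xi_complete: "complete_vfield M xi"
  using cask unfolding cask_manifold_def by (elim conjE)

lemma xi_vfield: "vfield_on M (points M) xi"
  using xi_complete by (simp add: complete_vfield_def)

lemma J_vfield: "vfield_on M U X \<Longrightarrow> vfield_on M U (\<lambda>x. J x (X x))"
  using cplx by (simp add: complex_structure_def endo_field_def)

lemmas Jxi_vfield = J_vfield[OF xi_vfield]

lemma tangent_neg: "v \<in> tangent M x \<Longrightarrow> (\<lambda>f. - v f) \<in> tangent M x"
  using lcomb_tangent[OF atlasM, of v x v "-1" 0] by (simp add: lcomb_def)

lemma linear_J: "x \<in> points M \<Longrightarrow> linear_endo_on (tangent M x) (J x)"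
  using cplx by (simp add: complex_structure_def endo_field_def)

lemma J_tangent [simp]: "v \<in> tangent M x \<Longrightarrow> J x v \<in> tangent M x"
  using linear_J[OF tangent_points] by (simp add: linear_endo_on_def)

lemma J_lcomb: "u \<in> tangent M x \<Longrightarrow> v \<in> tangent M x \<Longrightarrow> J x (lcomb a u b v) = lcomb a (J x u) b (J x v)"
  using linear_J[OF tangent_points] by (simp add: linear_endo_on_def)

lemma J_neg: "v \<in> tangent M x \<Longrightarrow> J x (\<lambda>f. - v f) = (\<lambda>f. - J x v f)"
  using J_lcomb[of v x v "-1" 0] by (simp add: lcomb_def)

lemma J_zero: "x \<in> points M \<Longrightarrow> J x (\<lambda>f. 0) = (\<lambda>f. 0)"
  using J_lcomb[OF zero_tangent zero_tangent, of x 0 0] by (simp add: lcomb_def)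

lemma JJ: "v \<in> tangent M x \<Longrightarrow> J x (J x v) = (\<lambda>f. - v f)"
  using cplx tangent_points[of v M x] by (simp add: complex_structure_def)

lemma linear_g: "u \<in> tangent M x \<Longrightarrow> linear_form_on (tangent M x) (g x u)"
  using riem tangent_points[of u M x] by (simp add: pseudo_riemannian_def tensor2_field_def)

lemma g_sym: "u \<in> tangent M x \<Longrightarrow> v \<in> tangent M x \<Longrightarrow> g x u v = g x v u"
  using riem tangent_points[of u M x] by (simp add: pseudo_riemannian_def)

lemma g_smooth: "vfield_on M V X \<Longrightarrow> vfield_on M V Y \<Longrightarrow> smooth_fun M V (\<lambda>x. g x (X x) (Y x))"
  using riem by (simp add: pseudo_riemannian_def tensor2_field_def)

lemma g_nondeg:
  "u \<in> tangent M x \<Longrightarrow> (\<And>v. v \<in> tangent M x \<Longrightarrow> g x u v = 0) \<Longrightarrow> u = (\<lambda>_. 0)"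
  using riem tangent_points[of u M x] by (simp add: pseudo_riemannian_def)

lemma g_lcomb_right: "u \<in> tangent M x \<Longrightarrow> v \<in> tangent M x \<Longrightarrow> w \<in> tangent M x \<Longrightarrow>
    g x u (lcomb a v b w) = a * g x u v + b * g x u w"
  by (rule linear_form_lcomb[OF linear_g])

lemma g_lcomb_left: "u \<in> tangent M x \<Longrightarrow> v \<in> tangent M x \<Longrightarrow> w \<in> tangent M x \<Longrightarrow>
    g x (lcomb a v b w) u = a * g x v u + b * g x w u"
  using g_lcomb_right[of u x v w a b] g_sym[of u x] lcomb_tangent[OF atlasM, of v x w a b] by simp

lemma g_neg_right: "u \<in> tangent M x \<Longrightarrow> v \<in> tangent M x \<Longrightarrow> g x u (\<lambda>f. - v f) = - g x u v"
  by (rule linear_form_uminus[OF linear_g])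

lemma g_neg_left: "u \<in> tangent M x \<Longrightarrow> v \<in> tangent M x \<Longrightarrow> g x (\<lambda>f. - v f) u = - g x v u"
  using g_neg_right[of u x v] g_sym[of u x] tangent_neg[of v x] by simp

lemma g_zero_right: "u \<in> tangent M x \<Longrightarrow> g x u (\<lambda>f. 0) = 0"
  by (rule linear_form_zero[OF linear_g zero_tangent[OF tangent_points]])

lemma g_zero_left: "u \<in> tangent M x \<Longrightarrow> g x (\<lambda>f. 0) u = 0"
  using g_zero_right[of u x] g_sym[of u x "\<lambda>f. 0"] zero_tangent[OF tangent_points, of u M x] by simp

lemma g_J: "u \<in> tangent M x \<Longrightarrow> v \<in> tangent M x \<Longrightarrow> g x (J x u) (J x v) = g x u v"
  and om_g: "u \<in> tangent M x \<Longrightarrow> v \<in> tangent M x \<Longrightarrow> om x u v = g x (J x u) v"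
  using kaehler tangent_points[of u M x] by (simp_all add: pseudo_kaehler_def)

lemma g_J_right: "u \<in> tangent M x \<Longrightarrow> v \<in> tangent M x \<Longrightarrow> g x u (J x v) = - g x (J x u) v"
  using g_J[of "J x u" x v] JJ[of u x] g_neg_left[of "J x v" x u] by simp

lemma om_skew: "u \<in> tangent M x \<Longrightarrow> v \<in> tangent M x \<Longrightarrow> om x u v = - om x v u"
  using om_g[of u x v] om_g[of v x u] g_J_right[of v x u] g_sym[of v x "J x u"] by simp

lemma om_nondeg:
  assumes "u \<in> tangent M x" "\<And>v. v \<in> tangent M x \<Longrightarrow> om x u v = 0"
  shows "u = (\<lambda>_. 0)"
proof -
  have "J x u = (\<lambda>_. 0)"
    by (rule g_nondeg[OF J_tangent[OF assms(1)]]) (use assms om_g in auto)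
  then have "(\<lambda>f. - u f) = (\<lambda>_. 0)" using JJ[OF assms(1)] J_zero[OF tangent_points[OF assms(1)]] by simp
  then show ?thesis by (metis neg_equal_0_iff_equal)
qed

lemma om_lcomb_left: "u \<in> tangent M x \<Longrightarrow> v \<in> tangent M x \<Longrightarrow> w \<in> tangent M x \<Longrightarrow>
    om x (lcomb a v b w) u = a * om x v u + b * om x w u"
  by (simp add: om_g lcomb_tangent[OF atlasM] J_lcomb g_lcomb_left)

lemma om_lcomb_right: "u \<in> tangent M x \<Longrightarrow> v \<in> tangent M x \<Longrightarrow> w \<in> tangent M x \<Longrightarrow>
    om x u (lcomb a v b w) = a * om x u v + b * om x u w"
  by (simp add: om_g lcomb_tangent[OF atlasM] g_lcomb_right)

lemma xi_tangent [simp]: "x \<in> points M \<Longrightarrow> xi x \<in> tangent M x"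
  by (rule vfield_tangent[OF xi_vfield])

lemma g_xi_Jxi: "x \<in> points M \<Longrightarrow> g x (xi x) (J x (xi x)) = 0" "x \<in> points M \<Longrightarrow> g x (J x (xi x)) (xi x) = 0"
proof -
  assume x: "x \<in> points M"
  have "om x (xi x) (xi x) = 0" using om_skew[of "xi x" x "xi x"] x by simp
  then show 1: "g x (J x (xi x)) (xi x) = 0" using om_g[of "xi x" x "xi x"] x by simp
  show "g x (xi x) (J x (xi x)) = 0" using 1 g_sym[of "xi x" x "J x (xi x)"] x by simp
qed

section \<open>The function y and its conjugate 1-form on the base\<close>

definition yM :: "'m \<Rightarrow> real" where
  "yM x = - g x (xi x) (xi x)"

lemma yM_smooth: "smooth_fun M (points M) yM"
proof (rule smooth_fun_cong[OF atlasM])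
  show "smooth_fun M (points M) (\<lambda>x. (-1) * g x (xi x) (xi x))"
    by (intro smooth_fun_mult smooth_fun_const atlasM g_smooth xi_vfield openin_topspace)
qed (simp add: yM_def)

lemma yM_near: "x \<in> points M \<Longrightarrow> smooth_near M x yM"
  by (rule smooth_fun_imp_near[OF yM_smooth])

lemma parallel2D: "parallel2 M D h \<Longrightarrow> vfield_on M U Y \<Longrightarrow> vfield_on M U X \<Longrightarrow> x \<in> U \<Longrightarrow> v \<in> tangent M x \<Longrightarrow>
    v (\<lambda>y. h y (Y y) (X y)) = h x (D x v Y) (X x) + h x (Y x) (D x v X)"
  by (simp add: parallel2_def)

lemma torsion_freeD: "torsion_free M D \<Longrightarrow> vfield_on M U X \<Longrightarrow> vfield_on M U Y \<Longrightarrow> x \<in> U \<Longrightarrow>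
    lie_bracket M X Y x = lcomb 1 (D x (X x) Y) (- 1) (D x (Y x) X)"
  by (simp add: torsion_free_def)

lemma parallel_LC: "parallel2 M LC g" and torsion_LC: "torsion_free M LC"
  and affine_LC: "affine_connection M LC"
  using LC(1) by (simp_all add: levi_civita_def)

lemma parallel_nab: "parallel2 M nab om" and torsion_nab: "torsion_free M nab"
  and affine_nab: "affine_connection M nab" and flat_nab: "flat_connection M nab"
  using ask by (simp_all only: ask_manifold_def)

lemma connection_tangent: "affine_connection M D \<Longrightarrow> vfield_on M U Y \<Longrightarrow> x \<in> U \<Longrightarrow> v \<in> tangent M x \<Longrightarrow>
    D x v Y \<in> tangent M x"
  by (simp add: affine_connection_def)

lemma connection_lcomb: "affine_connection M D \<Longrightarrow> vfield_on M U Y \<Longrightarrow> x \<in> U \<Longrightarrow> u \<in> tangent M x \<Longrightarrow>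
    v \<in> tangent M x \<Longrightarrow> D x (lcomb a u b v) Y = lcomb a (D x u Y) b (D x v Y)"
  by (simp add: affine_connection_def)

text \<open>Metric compatibility together with \<open>D xi = id\<close>: up to the factor -2, the
  field \<open>xi\<close> is the gradient of y.\<close>

lemma yM_derivative:
  assumes "v \<in> tangent M x"
  shows "v yM = - 2 * g x (xi x) v"
proof -
  have x: "x \<in> points M" by (rule tangent_points[OF assms])
  have sm: "smooth_near M x (\<lambda>x. g x (xi x) (xi x))"
    by (rule smooth_fun_imp_near[OF g_smooth[OF xi_vfield xi_vfield] x])
  have "v yM = v (\<lambda>x. (-1) * g x (xi x) (xi x))"
    by (rule arg_cong[of _ _ v]) (auto simp: yM_def)
  also have "\<dots> = (-1) * v (\<lambda>x. g x (xi x) (xi x))" by (rule tangent_cmult[OF atlasM assms sm])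
  also have "v (\<lambda>x. g x (xi x) (xi x)) = 2 * g x (xi x) v"
    using parallel2D[OF parallel_LC xi_vfield xi_vfield x assms] LC(2)[OF assms] g_sym[OF assms xi_tangent[OF x]]
    by simp
  finally show ?thesis by simp
qed

text \<open>Contraction of \<open>om\<close> with \<open>xi\<close>. Its pullback to
  \<open>N\<close> is minus the contraction of \<open>gN\<close> with \<open>Z\<close>, which links
  it to \<open>omegaH\<close>.\<close>

definition lam :: "'m \<Rightarrow> 'm tv \<Rightarrow> real" where
  "lam x v = g x (J x (xi x)) v"

lemma lam_om: "v \<in> tangent M x \<Longrightarrow> lam x v = om x (xi x) v"
  using om_g[OF xi_tangent[OF tangent_points]] by (simp add: lam_def)

lemma lam_expr:
  assumes "x \<in> points M"
  obtains V and a k :: "'e \<Rightarrow> 'm \<Rightarrow> real" where "x \<in> V" "form_expr M V lam Basis a k"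
proof -
  obtain U and \<phi> :: "'m \<Rightarrow> 'e" where U: "coords M U \<phi>" "x \<in> U" by (rule atlas_chart_at[OF atlasM assms])
  have sub: "U \<subseteq> points M" by (rule coordsD(4)[OF U(1)])
  have "form_expr M U lam Basis (\<lambda>b y. lam y (cv M U \<phi> y b)) (\<lambda>b y. \<phi> y \<bullet> b)"
  proof (rule form_expr_coords[OF atlasM U(1) order_refl coordsD(1)[OF U(1)]])
    show "linear_form_on (tangent M y) (lam y)" if "y \<in> U" for y
      unfolding lam_def using sub that linear_g[OF J_tangent[OF xi_tangent]] by blast
    show "smooth_fun M U (\<lambda>y. lam y (cv M U \<phi> y b))" for b
      unfolding lam_def
      by (rule g_smooth[OF vfield_subset[OF Jxi_vfield coordsD(1)[OF U(1)] sub] cv_vfield[OF atlasM U(1)]])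
  qed
  then show thesis using that U(2) by blast
qed

text \<open>For a torsion-free connection with \<open>nab om = 0\<close> and
  \<open>nab xi = id\<close>, the two terms of the exterior derivative of the contraction are
  \<open>om u v\<close> and \<open>- om v u\<close>.\<close>

lemma ext_deriv_lam:
  assumes "u \<in> tangent M x" "v \<in> tangent M x"
  shows "ext_deriv1 M lam x u v = 2 * om x u v"
proof -
  have x: "x \<in> points M" by (rule tangent_points[OF assms(1)])
  obtain V and a k :: "'e \<Rightarrow> 'm \<Rightarrow> real" where V: "x \<in> V" "form_expr M V lam Basis a k" by (rule lam_expr[OF x])
  obtain U X Y where U: "x \<in> U" "vfield_on M U X" "vfield_on M U Y" "X x = u" "Y x = v"
    by (rule tangent_extend[OF atlasM assms])
  have oU: "openin (mtop M) U" by (rule vfield_open[OF U(2)])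
  have sub: "U \<subseteq> points M" by (rule openin_subset[OF oU])
  note xiU = vfield_subset[OF xi_vfield oU sub]
  have key: "X x (\<lambda>y. lam y (Y y)) = om x (X x) (Y x) + om x (xi x) (nab x (X x) Y)"
    if "vfield_on M U X" "vfield_on M U Y" for X Y
  proof -
    have Xx: "X x \<in> tangent M x" by (rule vfield_tangent[OF that(1) U(1)])
    have "X x (\<lambda>y. lam y (Y y)) = X x (\<lambda>y. om y (xi y) (Y y))"
      by (rule tangent_germ[OF atlasM Xx oU U(1)]) (rule lam_om[OF vfield_tangent[OF that(2)]])
    then show ?thesis
      using parallel2D[OF parallel_nab xiU that(2) U(1) Xx] LC(3)[OF Xx] by simp
  qed
  have t: "nab x (X x) Y \<in> tangent M x" "nab x (Y x) X \<in> tangent M x"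
    by (rule connection_tangent[OF affine_nab U(3,1) vfield_tangent[OF U(2,1)]])
       (rule connection_tangent[OF affine_nab U(2,1) vfield_tangent[OF U(3,1)]])
  have "lam x (lie_bracket M X Y x) = om x (xi x) (nab x (X x) Y) - om x (xi x) (nab x (Y x) X)"
    using lam_om[OF lie_bracket_tangent[OF atlasM U(2,3,1)]] torsion_freeD[OF torsion_nab U(2,3,1)]
      om_lcomb_right[OF xi_tangent[OF x] t, of 1 "-1"] by simp
  then show ?thesis
    using ext_deriv1_vfields[OF atlasM V(2,1) U(2,3,1)] key[OF U(2,3)] key[OF U(3,2)] U(4,5)
      om_skew[OF assms] by simp
qed

text \<open>Both connections are torsion-free and send \<open>xi\<close> to the identity, so they
  agree in the direction of \<open>xi\<close>. Testing against \<open>om\<close>, which is parallel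
  for \<open>nab\<close>, reduces the claim to the derivative of \<open>g(xi, Y)\<close> along
  \<open>xi\<close>, and this is computed with the Levi-Civita connection.\<close>

lemma nab_xi_Jxi:
  assumes "x \<in> points M"
  shows "nab x (xi x) (\<lambda>y. J y (xi y)) = J x (xi x)"
proof -
  note xix = xi_tangent[OF assms]
  have t: "nab x (xi x) (\<lambda>y. J y (xi y)) \<in> tangent M x"
    by (rule connection_tangent[OF affine_nab Jxi_vfield assms xix])
  have "om x (lcomb 1 (nab x (xi x) (\<lambda>y. J y (xi y))) (-1) (J x (xi x))) v = 0" if v: "v \<in> tangent M x" for v
  proof -
    obtain U Y Y' where U: "x \<in> U" "vfield_on M U Y" "vfield_on M U Y'" "Y x = v" "Y' x = v"
      by (rule tangent_extend[OF atlasM v v])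
    have oU: "openin (mtop M) U" by (rule vfield_open[OF U(2)])
    have sub: "U \<subseteq> points M" by (rule openin_subset[OF oU])
    note xiU = vfield_subset[OF xi_vfield oU sub] and JxiU = vfield_subset[OF Jxi_vfield oU sub]
    have tn: "nab x (xi x) Y \<in> tangent M x" "LC x (xi x) Y \<in> tangent M x"
      by (rule connection_tangent[OF affine_nab U(2,1) xix], rule connection_tangent[OF affine_LC U(2,1) xix])
    \<comment> \<open>Both sides are the bracket of \<open>xi\<close> and \<open>Y\<close>.\<close>
    have "lcomb 1 (LC x (xi x) Y) (-1) v = lcomb 1 (nab x (xi x) Y) (-1) v"
      using torsion_freeD[OF torsion_nab xiU U(2,1)] torsion_freeD[OF torsion_LC xiU U(2,1)]
        LC(2)[OF v] LC(3)[OF v] U(4) by simp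
    then have eq: "LC x (xi x) Y = nab x (xi x) Y" by (auto simp: lcomb_def fun_eq_iff)
    have sm: "smooth_near M x (\<lambda>y. g y (xi y) (Y y))"
      by (rule smooth_fun_imp_near[OF g_smooth[OF xiU U(2)] U(1)])
    have omJ: "om y (J y (xi y)) w = (-1) * g y (xi y) w" if "w \<in> tangent M y" for y w
      using om_g[OF J_tangent[OF xi_tangent[OF tangent_points[OF that]]] that]
        JJ[OF xi_tangent[OF tangent_points[OF that]]] g_neg_left[OF that xi_tangent[OF tangent_points[OF that]]] by simp
    have "xi x (\<lambda>y. om y (J y (xi y)) (Y y)) = xi x (\<lambda>y. (-1) * g y (xi y) (Y y))"
      by (rule tangent_germ[OF atlasM xix oU U(1)]) (rule omJ[OF vfield_tangent[OF U(2)]])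
    also have "\<dots> = (-1) * xi x (\<lambda>y. g y (xi y) (Y y))" by (rule tangent_cmult[OF atlasM xix sm])
    also have "\<dots> = - (g x (xi x) v + g x (xi x) (nab x (xi x) Y))"
      using parallel2D[OF parallel_LC xiU U(2,1) xix] LC(2)[OF xix] eq U(4) by simp
    finally have "om x (nab x (xi x) (\<lambda>y. J y (xi y))) v - g x (xi x) (nab x (xi x) Y)
        = - (g x (xi x) v + g x (xi x) (nab x (xi x) Y))"
      using parallel2D[OF parallel_nab JxiU U(2,1) xix] omJ[OF tn(1)] U(4) by simp
    then show ?thesis
      using om_lcomb_left[OF v t J_tangent[OF xix], of 1 "-1"] omJ[OF v] by simp
  qed
  then have "lcomb 1 (nab x (xi x) (\<lambda>y. J y (xi y))) (-1) (J x (xi x)) = (\<lambda>_. 0)"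
    by (rule om_nondeg[OF lcomb_tangent[OF atlasM t J_tangent[OF xix]]])
  then show ?thesis by (auto simp: lcomb_def fun_eq_iff)
qed

text \<open>Both terms of the torsion-free formula equal \<open>J xi\<close>. Lifted to
  \<open>N\<close>, this becomes the commutation of \<open>Z\<close> and \<open>xit\<close>.\<close>

lemma bracket_xi_Jxi:
  assumes "x \<in> points M"
  shows "lie_bracket M xi (\<lambda>y. J y (xi y)) x = (\<lambda>_. 0)"
  using torsion_freeD[OF torsion_nab xi_vfield Jxi_vfield assms] nab_xi_Jxi[OF assms]
    LC(3)[OF J_tangent[OF xi_tangent[OF assms]]] by (simp add: lcomb_def)

lemma nab_zero:
  assumes "vfield_on M U X" "x \<in> U" "v \<in> tangent M x" and "\<And>y. y \<in> U \<Longrightarrow> X y = (\<lambda>_. 0)"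
  shows "nab x v (\<lambda>y h. 0) = (\<lambda>_. 0)"
proof -
  have "\<forall>U Y f. vfield_on M U Y \<and> smooth_fun M U f \<longrightarrow> (\<forall>x\<in>U. \<forall>v\<in>tangent M x.
        nab x v (\<lambda>y h. f y * Y y h) = lcomb (v f) (Y x) (f x) (nab x v Y))"
    using affine_nab unfolding affine_connection_def by blast
  then have "nab x v (\<lambda>y h. (0::real) * X y h) = lcomb (v (\<lambda>_. 0)) (X x) 0 (nab x v X)"
    using assms(1-3) smooth_fun_const[OF atlasM vfield_open[OF assms(1)], of 0] by blast
  then show ?thesis using tangent_const[OF atlasM assms(3), of 0] by (simp add: lcomb_def)
qed

end

section \<open>The cotangent bundle\<close>

lemma vfield_zero:
  assumes "atlas M" "openin (mtop M) W"
  shows "vfield_on M W (\<lambda>x f. 0)"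
  unfolding vfield_on_def
proof (intro conjI ballI allI impI)
  show "(\<lambda>f. 0) \<in> tangent M x" if "x \<in> W" for x
    by (rule zero_tangent[OF subsetD[OF openin_subset[OF assms(2)] that]])
  fix V f assume "V \<subseteq> W \<and> smooth_fun M V f"
  then show "smooth_fun M V (\<lambda>x. 0)" using smooth_fun_const[OF assms(1) smooth_fun_open] by blast
qed (fact assms(2))

lemma vfield_cong:
  assumes "atlas M" "vfield_on M W X" "\<And>x. x \<in> W \<Longrightarrow> Y x = X x"
  shows "vfield_on M W Y"
  unfolding vfield_on_def
proof (intro conjI ballI allI impI)
  show "openin (mtop M) W" by (rule vfield_open[OF assms(2)])
  show "Y x \<in> tangent M x" if "x \<in> W" for x
    unfolding assms(3)[OF that] by (rule vfield_tangent[OF assms(2) that])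
  fix V f assume V: "V \<subseteq> W \<and> smooth_fun M V f"
  show "smooth_fun M V (\<lambda>x. Y x f)"
    by (rule smooth_fun_cong[OF assms(1) vfield_smooth[OF assms(2), of V f]]) (use V assms(3) in auto)
qed

lemma linear_form_sum:
  assumes "atlas M" "linear_form_on (tangent M p) \<alpha>" "p \<in> points M" "\<And>b. b \<in> B \<Longrightarrow> u b \<in> tangent M p" "finite B"
  shows "(\<lambda>h. \<Sum>b\<in>B. c b * u b h) \<in> tangent M p \<and> \<alpha> (\<lambda>h. \<Sum>b\<in>B. c b * u b h) = (\<Sum>b\<in>B. c b * \<alpha> (u b))"
  using assms(5,4)
proof (induction B rule: finite_induct)
  case empty
  show ?case using zero_tangent[OF assms(3)] linear_form_zero[OF assms(2)] by simp
next
  case (insert b B)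
  have eq: "(\<lambda>h. \<Sum>b\<in>insert b B. c b * u b h) = lcomb (c b) (u b) 1 (\<lambda>h. \<Sum>b\<in>B. c b * u b h)"
    using insert(1,2) by (simp add: lcomb_def)
  have b: "u b \<in> tangent M p" and IH: "(\<lambda>h. \<Sum>b\<in>B. c b * u b h) \<in> tangent M p"
    "\<alpha> (\<lambda>h. \<Sum>b\<in>B. c b * u b h) = (\<Sum>b\<in>B. c b * \<alpha> (u b))"
    using insert by auto
  show ?case
    unfolding eq linear_form_lcomb[OF assms(2) b IH(1)] IH(2)
    using lcomb_tangent[OF assms(1) b IH(1)] insert(1,2) by simp
qed

lemma smooth_fun_vec:
  assumes "atlas M" "coords M U \<kappa>" "W \<subseteq> U" "\<And>b. b \<in> Basis \<Longrightarrow> smooth_fun M W (a b)"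
    and "openin (mtop M) W"
  shows "smooth_on (\<kappa> ` W) (\<lambda>y. \<Sum>b\<in>Basis. a b (inv_into U \<kappa> y) *\<^sub>R b)"
proof -
  have o: "open (\<kappa> ` W)" using coordsD(3)[OF assms(2,3)] assms(5) by simp
  have "smooth_on (\<kappa> ` W) (\<lambda>y. a b (inv_into U \<kappa> y))" if "b \<in> Basis" for b
    using smooth_fun_coords[OF assms(1,2) assms(4)[OF that]] assms(3) by (simp add: o_def Int_absorb1)
  then show ?thesis by (intro smooth_on_sum smooth_on_scaleR smooth_on_const o) auto
qed

context cask
begin

lemma nab_leibniz:
  assumes "vfield_on M U Y" "smooth_fun M U f" "x \<in> U" "v \<in> tangent M x"
  shows "nab x v (\<lambda>y h. f y * Y y h) = lcomb (v f) (Y x) (f x) (nab x v Y)"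
proof -
  have "\<forall>U Y f. vfield_on M U Y \<and> smooth_fun M U f \<longrightarrow> (\<forall>x\<in>U. \<forall>v\<in>tangent M x.
        nab x v (\<lambda>y h. f y * Y y h) = lcomb (v f) (Y x) (f x) (nab x v Y))"
    using affine_nab unfolding affine_connection_def by (elim conjE)
  then show ?thesis using assms by simp
qed

lemma nab_add:
  assumes "vfield_on M U X" "vfield_on M U Y" "x \<in> U" "v \<in> tangent M x"
  shows "nab x v (\<lambda>y. lcomb 1 (X y) 1 (Y y)) = lcomb 1 (nab x v X) 1 (nab x v Y)"
  using affine_nab assms by (simp add: affine_connection_def)

lemma nab_vfield:
  assumes "vfield_on M U X" "vfield_on M U Y"
  shows "vfield_on M U (\<lambda>x. nab x (X x) Y)"
  using affine_nab assms by (simp add: affine_connection_def)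

lemmas nab_tangent = connection_tangent[OF affine_nab]
  and nab_lcomb = connection_lcomb[OF affine_nab]

text \<open>Multiplied by the indicator of \<open>W\<close> the two fields coincide literally, and
  in the Leibniz rule this factor has value 1 and derivative 0 at \<open>x\<close>.\<close>

lemma nab_germ:
  assumes "vfield_on M W Y" "\<And>y. y \<in> W \<Longrightarrow> Y y = Y' y" "x \<in> W" "v \<in> tangent M x"
  shows "nab x v Y = nab x v Y'"
proof -
  let ?i = "\<lambda>y. if y \<in> W then 1 else (0::real)"
  have oW: "openin (mtop M) W" by (rule vfield_open[OF assms(1)])
  have Y': "vfield_on M W Y'" by (rule vfield_cong[OF atlasM assms(1)]) (simp add: assms(2))
  have i: "smooth_fun M W ?i"
    by (rule smooth_fun_cong[OF atlasM smooth_fun_const[OF atlasM oW, of 1]]) simp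
  have "v ?i = v (\<lambda>y. 1)" by (rule tangent_germ[OF atlasM assms(4) oW assms(3)]) simp
  then have vi: "v ?i = 0" by (simp add: tangent_const[OF atlasM assms(4)])
  have "nab x v (\<lambda>y h. ?i y * Y y h) = nab x v Z" if "vfield_on M W Z" "\<And>y. y \<in> W \<Longrightarrow> Y y = Z y" for Z
  proof -
    have "(\<lambda>y h. ?i y * Y y h) = (\<lambda>y h. ?i y * Z y h)" using that(2) by (auto simp: fun_eq_iff)
    then show ?thesis
      using nab_leibniz[OF that(1) i assms(3,4)] vi assms(3) by (simp add: lcomb_def)
  qed
  from this[OF assms(1)] this[OF Y' assms(2)] show ?thesis by simp
qed

lemma nab_sum:
  assumes "finite B" "x \<in> W" "v \<in> tangent M x" "openin (mtop M) W"
    and "\<And>b. b \<in> B \<Longrightarrow> vfield_on M W (Y b)" "\<And>b. b \<in> B \<Longrightarrow> smooth_fun M W (f b)"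
  shows "vfield_on M W (\<lambda>y h. \<Sum>b\<in>B. f b y * Y b y h) \<and>
    nab x v (\<lambda>y h. \<Sum>b\<in>B. f b y * Y b y h) = (\<lambda>h. \<Sum>b\<in>B. v (f b) * Y b x h + f b x * nab x v (Y b) h)"
  using assms(1,5,6)
proof (induction B rule: finite_induct)
  case empty
  show ?case
    using vfield_zero[OF atlasM assms(4)] nab_zero[OF vfield_zero[OF atlasM assms(4)] assms(2,3)] by simp
next
  case (insert b B)
  let ?Z = "\<lambda>y h. \<Sum>b\<in>B. f b y * Y b y h" and ?b = "\<lambda>y h. f b y * Y b y h"
  have Yb: "vfield_on M W (Y b)" and fb: "smooth_fun M W (f b)" using insert by auto
  have IH: "vfield_on M W ?Z" "nab x v ?Z = (\<lambda>h. \<Sum>b\<in>B. v (f b) * Y b x h + f b x * nab x v (Y b) h)"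
    using insert by auto
  have bv: "vfield_on M W ?b"
    using vfield_lcomb[OF atlasM Yb Yb fb smooth_fun_const[OF atlasM assms(4), of 0]] by (simp add: lcomb_def)
  have eq: "(\<lambda>y h. \<Sum>b\<in>insert b B. f b y * Y b y h) = (\<lambda>y. lcomb 1 (?b y) 1 (?Z y))"
    using insert(1,2) by (simp add: lcomb_def)
  show ?case
    unfolding eq nab_add[OF bv IH(1) assms(2,3)] IH(2) nab_leibniz[OF Yb fb assms(2,3)]
    using vfield_lcomb[OF atlasM bv IH(1) smooth_fun_const[OF atlasM assms(4), of 1] smooth_fun_const[OF atlasM assms(4), of 1]]
      insert(1,2)
    by (simp add: lcomb_def)
qed

text \<open>The Christoffel expansion in a coordinate frame. It reduces parallelism of a form, which
  is tested on all vector fields, to the frame.\<close>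

lemma nab_expansion:
  assumes "coords M U \<kappa>" "x \<in> U" "vfield_on M V Y" "x \<in> V" "v \<in> tangent M x"
  shows "nab x v Y = (\<lambda>h. \<Sum>b\<in>Basis. v (\<lambda>y. Y y (\<lambda>z. \<kappa> z \<bullet> b)) * cv M U \<kappa> x b h
    + Y x (\<lambda>z. \<kappa> z \<bullet> b) * nab x v (\<lambda>y. cv M U \<kappa> y b) h)"
proof -
  let ?W = "U \<inter> V" and ?f = "\<lambda>b y. Y y (\<lambda>z. \<kappa> z \<bullet> b)"
  have o: "openin (mtop M) ?W" by (rule openin_Int[OF coordsD(1)[OF assms(1)] vfield_open[OF assms(3)]])
  have x: "x \<in> ?W" using assms by simp
  have cf: "vfield_on M ?W (\<lambda>y. cv M U \<kappa> y b)" for b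
    by (rule vfield_subset[OF cv_vfield[OF atlasM assms(1)] o]) simp
  have sf: "smooth_fun M ?W (?f b)" for b
    by (rule vfield_smooth[OF assms(3) _ smooth_fun_subset[OF coord_fun_smooth[OF atlasM assms(1)] o]]) auto
  note s = nab_sum[where f="?f", OF finite_Basis x assms(5) o cf sf]
  have eq: "(\<lambda>h. \<Sum>b\<in>Basis. ?f b y * cv M U \<kappa> y b h) = Y y" if "y \<in> ?W" for y
  proof (rule ext)
    fix h
    have t: "Y y \<in> tangent M y" by (rule vfield_tangent[OF assms(3)]) (use that in simp)
    show "(\<Sum>b\<in>Basis. ?f b y * cv M U \<kappa> y b h) = Y y h"
    proof (cases "smooth_near M y h")
      case True
      from tangent_coords[OF atlasM assms(1) _ t True] that True show ?thesis by (simp add: cv_def)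
    next
      case False
      then show ?thesis using tangent_outside[OF t False] by (simp add: cv_def)
    qed
  qed
  show ?thesis using nab_germ[OF conjunct1[OF s] eq x assms(5)] conjunct2[OF s] by simp
qed

subsection \<open>Charts\<close>

abbreviation kap :: "'m set \<Rightarrow> ('m \<Rightarrow> 'e) \<Rightarrow> 'm \<times> ('m tv \<Rightarrow> real) \<Rightarrow> 'e \<times> 'e" where
  "kap \<equiv> cotangent_chart M"

abbreviation cotb :: "'m set \<Rightarrow> ('m \<times> ('m tv \<Rightarrow> real)) set" where
  "cotb U \<equiv> Sigma U (cotangent M)"

lemma cotangentD:
  assumes "\<alpha> \<in> cotangent M p"
  shows "p \<in> points M" "linear_form_on (tangent M p) \<alpha>" "\<And>v. v \<notin> tangent M p \<Longrightarrow> \<alpha> v = 0"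
  using assms by (simp_all add: cotangent_def)

lemma cotangent_eqI:
  "\<alpha> \<in> cotangent M p \<Longrightarrow> \<beta> \<in> cotangent M p \<Longrightarrow> (\<And>v. v \<in> tangent M p \<Longrightarrow> \<alpha> v = \<beta> v) \<Longrightarrow> \<alpha> = \<beta>"
  by (rule ext) (metis cotangentD(3))

lemma form_restrict_cotangent:
  "p \<in> points M \<Longrightarrow> linear_form_on (tangent M p) \<alpha> \<Longrightarrow> form_restrict p \<alpha> \<in> cotangent M p"
  using lcomb_tangent[OF atlasM] by (simp add: cotangent_def form_restrict_def linear_form_on_def)

lemma form_restrict_apply: "v \<in> tangent M p \<Longrightarrow> form_restrict p \<alpha> v = \<alpha> v"
  by (simp add: form_restrict_def)

lemma form_restrict_cong: "(\<And>v. v \<in> tangent M p \<Longrightarrow> \<alpha> v = \<beta> v) \<Longrightarrow> form_restrict p \<alpha> = form_restrict p \<beta>"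
  by (auto simp: form_restrict_def)

lemma points_N: "points N = Sigma (points M) (cotangent M)"
proof -
  have "points N = \<Union> {{z \<in> cotb U. kap U \<phi> z \<in> W} | U \<phi> W. (U, \<phi>) \<in> charts M \<and> open W}" (is "_ = \<Union> ?G")
    by (simp add: N_def cotangent_mfd_def)
  also have "\<dots> = cotb (\<Union> (fst ` charts M))"
  proof (intro set_eqI iffI)
    fix z assume "z \<in> cotb (\<Union> (fst ` charts M))"
    then obtain U \<phi> where c: "(U, \<phi>) \<in> charts M" "z \<in> cotb U" by force
    have "cotb U = {z \<in> cotb U. kap U \<phi> z \<in> UNIV}" by simp
    then have "cotb U \<in> ?G" using c(1) open_UNIV by blast
    then show "z \<in> \<Union> ?G" using c(2) by (rule UnionI)
  next
    fix z assume "z \<in> \<Union> ?G"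
    then show "z \<in> cotb (\<Union> (fst ` charts M))" by force
  qed
  also have "\<Union> (fst ` charts M) = points M" using atlasM by (simp add: atlas_def)
  finally show ?thesis .
qed

lemma points_ND: "z \<in> points N \<Longrightarrow> fst z \<in> points M" "z \<in> points N \<Longrightarrow> snd z \<in> cotangent M (fst z)"
  by (auto simp: points_N)

lemma fst_kap [simp]: "fst (kap U \<phi> z) = \<phi> (fst z)"
  by (simp add: cotangent_chart_def)

lemma snd_kap [simp]: "b \<in> Basis \<Longrightarrow> snd (kap U \<phi> z) \<bullet> b = snd z (cv M U \<phi> (fst z) b)"
  by (simp add: cotangent_chart_def coord_vector_def cv_def inner_sum_left inner_Basis if_distrib cong: if_cong)

text \<open>The covector with components \<open>a\<close> in the coframe of \<open>\<phi>\<close>,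
  cut off outside the tangent space as \<open>cotangent\<close> demands. It inverts the fibre part
  of \<open>kap\<close>.\<close>

definition cf :: "('m \<Rightarrow> 'e) \<Rightarrow> 'm \<Rightarrow> 'e \<Rightarrow> 'm tv \<Rightarrow> real" where
  "cf \<phi> p a = form_restrict p (\<lambda>v. \<Sum>b\<in>Basis. (a \<bullet> b) * v (\<lambda>x. \<phi> x \<bullet> b))"

lemma cf_cotangent:
  assumes "p \<in> points M"
  shows "cf \<phi> p a \<in> cotangent M p"
  unfolding cf_def
  by (rule form_restrict_cotangent[OF assms])
     (simp add: linear_form_on_def lcomb_def sum_distrib_left sum.distrib[symmetric] algebra_simps)

lemma cf_apply: "v \<in> tangent M p \<Longrightarrow> cf \<phi> p a v = (\<Sum>b\<in>Basis. (a \<bullet> b) * v (\<lambda>x. \<phi> x \<bullet> b))"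
  by (simp add: cf_def form_restrict_apply)

lemma kap_cf:
  assumes "coords M U \<phi>" "p \<in> U"
  shows "kap U \<phi> (p, cf \<phi> p a) = (\<phi> p, a)"
proof (rule prod_eqI)
  show "snd (kap U \<phi> (p, cf \<phi> p a)) = snd (\<phi> p, a)"
  proof (rule euclidean_eqI)
    fix b :: 'e assume "b \<in> Basis"
    then show "snd (kap U \<phi> (p, cf \<phi> p a)) \<bullet> b = snd (\<phi> p, a) \<bullet> b"
      by (simp add: cf_apply[OF cv_tangent[OF atlasM assms]] cv_coord[OF atlasM assms] inner_Basis if_distrib cong: if_cong)
  qed
qed simp

lemma cf_kap:
  assumes "coords M U \<phi>" "fst z \<in> U" "snd z \<in> cotangent M (fst z)"
  shows "cf \<phi> (fst z) (snd (kap U \<phi> z)) = snd z"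
proof (rule cotangent_eqI[OF cf_cotangent assms(3)])
  show "fst z \<in> points M" using cotangentD(1)[OF assms(3)] .
  fix v assume v: "v \<in> tangent M (fst z)"
  show "cf \<phi> (fst z) (snd (kap U \<phi> z)) v = snd z v"
    unfolding cf_apply[OF v] linear_form_coords[OF atlasM assms(1,2) cotangentD(2)[OF assms(3)] v] by simp
qed

lemma kap_inj:
  assumes "coords M U \<phi>"
  shows "inj_on (kap U \<phi>) (cotb U)"
proof (rule inj_onI)
  fix z w assume z: "z \<in> cotb U" and w: "w \<in> cotb U" and eq: "kap U \<phi> z = kap U \<phi> w"
  have zz: "fst z \<in> U" "snd z \<in> cotangent M (fst z)" and ww: "fst w \<in> U" "snd w \<in> cotangent M (fst w)"
    using z w by auto
  have "\<phi> (fst z) = \<phi> (fst w)" using arg_cong[OF eq, of fst] by simp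
  then have f: "fst z = fst w" using inj_onD[OF coordsD(2)[OF assms]] zz(1) ww(1) by metis
  have "snd z = snd w" using cf_kap[OF assms zz] cf_kap[OF assms ww] f eq by simp
  then show "z = w" using f by (simp add: prod_eq_iff)
qed

lemma inv_kap:
  assumes "coords M U \<phi>" "p \<in> U"
  shows "inv_into (cotb U) (kap U \<phi>) (\<phi> p, a) = (p, cf \<phi> p a)"
proof -
  have "(p, cf \<phi> p a) \<in> cotb U" using assms(2) cf_cotangent coordsD(4)[OF assms(1)] by auto
  from inv_into_f_f[OF kap_inj[OF assms(1)] this] show ?thesis by (simp add: kap_cf[OF assms])
qed

lemma kap_image:
  assumes "coords M U \<phi>" "W \<subseteq> U"
  shows "kap U \<phi> ` cotb W = \<phi> ` W \<times> (UNIV :: 'e set)"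
proof
  show "kap U \<phi> ` cotb W \<subseteq> \<phi> ` W \<times> (UNIV :: 'e set)"
  proof
    fix y assume "y \<in> kap U \<phi> ` cotb W"
    then obtain z where "z \<in> cotb W" "y = kap U \<phi> z" by blast
    then show "y \<in> \<phi> ` W \<times> (UNIV :: 'e set)" by (auto simp: mem_Times_iff)
  qed
  show "\<phi> ` W \<times> (UNIV :: 'e set) \<subseteq> kap U \<phi> ` cotb W"
  proof
    fix y assume "y \<in> \<phi> ` W \<times> (UNIV :: 'e set)"
    then obtain p a where p: "p \<in> W" "y = (\<phi> p, a)" by auto
    have "(p, cf \<phi> p a) \<in> cotb W" using p(1) assms(2) cf_cotangent coordsD(4)[OF assms(1)] by auto
    then show "y \<in> kap U \<phi> ` cotb W" using kap_cf[OF assms(1), of p a] p assms(2) by (metis image_eqI subsetD)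
  qed
qed

lemma kap_transition_smooth:
  assumes "(U, \<phi>) \<in> charts M" "(V, \<psi>) \<in> charts M"
  shows "smooth_on (\<phi> ` (U \<inter> V) \<times> (UNIV :: 'e set)) (kap V \<psi> \<circ> inv_into (cotb U) (kap U \<phi>))"
proof -
  note U = atlas_chart[OF atlasM assms(1)] and V = atlas_chart[OF atlasM assms(2)]
  let ?S = "\<phi> ` (U \<inter> V)"
  have oUV: "openin (mtop M) (U \<inter> V)" by (rule openin_Int[OF coordsD(1)[OF U] coordsD(1)[OF V]])
  have oS: "open ?S" by (rule coords_open[OF U coordsD(1)[OF V]])
  have oS': "open (?S \<times> (UNIV :: 'e set))" by (rule open_Times[OF oS open_UNIV])
  have pull: "smooth_on (?S \<times> (UNIV :: 'e set)) (\<lambda>y. F (fst y))" if "smooth_on ?S F" for F :: "'e \<Rightarrow> 'a::euclidean_space"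
    by (rule smooth_on_compose[OF smooth_on_linear[OF bounded_linear_fst oS'] that oS' oS]) auto
  \<comment> \<open>The Jacobian matrix of the change of coordinates on the base; fibre coordinates
    transform linearly by it, with coefficients that are smooth functions of the base point.\<close>
  define T where "T b c p = cv M V \<psi> p b (\<lambda>x. \<phi> x \<bullet> c)" for b c p
  have "smooth_fun M (U \<inter> V) (T b c)" for b c
    unfolding T_def
    by (rule vfield_smooth[OF cv_vfield[OF atlasM V] _ smooth_fun_subset[OF coord_fun_smooth[OF atlasM U] oUV]]) auto
  from smooth_fun_coords[OF atlasM U this]
  have sT: "smooth_on ?S (\<lambda>y. T b c (inv_into U \<phi> y))" for b c by (simp add: o_def Int_assoc[symmetric])
  have s\<psi>: "smooth_on ?S (\<lambda>y. \<psi> (inv_into U \<phi> y))"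
    using coordsD(6)[OF U assms(2)] by (simp add: o_def)
  have "bounded_linear (\<lambda>y::'e \<times> 'e. snd y \<bullet> c)" for c
    by (intro bounded_linear_inner_left_comp bounded_linear_snd)
  from smooth_on_linear[OF this oS']
  have "smooth_on (?S \<times> UNIV) (\<lambda>y. (\<psi> (inv_into U \<phi> (fst y)),
      \<Sum>b\<in>Basis. (\<Sum>c\<in>Basis. (snd y \<bullet> c) * T b c (inv_into U \<phi> (fst y))) *\<^sub>R b))"
    by (intro smooth_on_Pair smooth_on_sum smooth_on_scaleR smooth_on_mult smooth_on_const oS' pull[OF s\<psi>] pull[OF sT]) auto
  then show ?thesis
  proof (rule smooth_on_cong[OF _ oS'])
    fix y :: "'e \<times> 'e" assume "y \<in> ?S \<times> UNIV"
    then obtain p a where p: "p \<in> U" "p \<in> V" "y = (\<phi> p, a)" by auto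
    show "(kap V \<psi> \<circ> inv_into (cotb U) (kap U \<phi>)) y = (\<psi> (inv_into U \<phi> (fst y)),
      \<Sum>b\<in>Basis. (\<Sum>c\<in>Basis. (snd y \<bullet> c) * T b c (inv_into U \<phi> (fst y))) *\<^sub>R b)"
    proof (rule prod_eqI)
      show "snd ((kap V \<psi> \<circ> inv_into (cotb U) (kap U \<phi>)) y) = snd (\<psi> (inv_into U \<phi> (fst y)),
        \<Sum>b\<in>Basis. (\<Sum>c\<in>Basis. (snd y \<bullet> c) * T b c (inv_into U \<phi> (fst y))) *\<^sub>R b)"
        by (rule euclidean_eqI)
           (simp add: p inv_kap[OF U p(1)] coords_inv[OF U p(1)] cf_apply[OF cv_tangent[OF atlasM V p(2)]] T_def
             inner_sum_left inner_Basis if_distrib cong: if_cong)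
    qed (simp add: p inv_kap[OF U p(1)] coords_inv[OF U p(1)])
  qed
qed

text \<open>The topology is generated by preimages under all charts. Openness of a chart image
  therefore means continuity of the inverse chart, which is tested on generators and there reduces
  to transition maps.\<close>

lemma kap_open_iff:
  assumes c: "(U, \<phi>) \<in> charts M" and W: "W \<subseteq> cotb U"
  shows "openin (mtop N) W \<longleftrightarrow> open (kap U \<phi> ` W)"
proof
  note U = atlas_chart[OF atlasM c]
  let ?G = "{{z \<in> cotb U. kap U \<phi> z \<in> W} | U \<phi> W. (U, \<phi>) \<in> charts M \<and> open W}"
  have top: "mtop N = topology_generated_by ?G" by (simp add: N_def cotangent_mfd_def)
  {
    assume o: "open (kap U \<phi> ` W)"
    have "W = {z \<in> cotb U. kap U \<phi> z \<in> kap U \<phi> ` W}"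
      using W inj_onD[OF kap_inj[OF U]] by blast
    then have "W \<in> ?G" using c o by blast
    then show "openin (mtop N) W" unfolding top by (rule topology_generated_by_Basis)
  next
    assume o: "openin (mtop N) W"
    let ?S = "\<phi> ` U \<times> (UNIV :: 'e set)" and ?i = "inv_into (cotb U) (kap U \<phi>)"
    have oS: "open ?S" using open_Times[OF _ open_UNIV] coords_open[OF U coordsD(1)[OF U]] by auto
    have im: "?i y \<in> cotb U" if "y \<in> ?S" for y
      using that inv_kap[OF U] cf_cotangent coordsD(4)[OF U] by fastforce
    have "continuous_map (top_of_set ?S) (mtop N) ?i"
      unfolding top continuous_on_generated_topo_iff
    proof (intro conjI allI impI)
      fix A assume "A \<in> ?G"
      then obtain V \<psi> O' where A: "A = {z \<in> cotb V. kap V \<psi> z \<in> O'}" "(V, \<psi>) \<in> charts M" "open O'" by blast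
      note V = atlas_chart[OF atlasM A(2)]
      let ?T = "\<phi> ` (U \<inter> V) \<times> (UNIV :: 'e set)"
      have oT: "open ?T" by (rule open_Times[OF coords_open[OF U coordsD(1)[OF V]] open_UNIV])
      have "?i -` A \<inter> ?S = {y \<in> ?T. (kap V \<psi> \<circ> ?i) y \<in> O'}"
      proof (intro set_eqI)
        fix y :: "'e \<times> 'e"
        show "y \<in> ?i -` A \<inter> ?S \<longleftrightarrow> y \<in> {y \<in> ?T. (kap V \<psi> \<circ> ?i) y \<in> O'}"
        proof (cases "y \<in> ?S")
          case True
          then obtain p a where p: "p \<in> U" "y = (\<phi> p, a)" by auto
          have "y \<in> ?T \<longleftrightarrow> p \<in> V" using p inj_onD[OF coordsD(2)[OF U]] by auto
          moreover have "?i y \<in> cotb V \<longleftrightarrow> p \<in> V"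
            using inv_kap[OF U p(1)] p cf_cotangent coordsD(4)[OF V] by auto
          ultimately show ?thesis using True by (auto simp: A(1))
        next
          case False
          then show ?thesis by auto
        qed
      qed
      also have "open \<dots>"
        using continuous_open_preimage[OF smooth_on_imp_continuous_on[OF kap_transition_smooth[OF c A(2)]] oT A(3)]
        by (simp add: vimage_def Int_def conj_commute)
      finally show "openin (top_of_set ?S) (?i -` A \<inter> topspace (top_of_set ?S))"
        using openin_open_eq[OF oS] by simp
    next
      show "?i ` topspace (top_of_set ?S) \<subseteq> \<Union> ?G"
      proof (rule image_subsetI)
        fix y assume "y \<in> topspace (top_of_set ?S)"
        then have "?i y \<in> cotb U" by (intro im) simp
        moreover have "cotb U = {z \<in> cotb U. kap U \<phi> z \<in> UNIV}" by simp
        then have "cotb U \<in> ?G" using c open_UNIV by blast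
        ultimately show "?i y \<in> \<Union> ?G" by (rule UnionI[rotated])
      qed
    qed
    from openin_continuous_map_preimage[OF this o]
    have "open {y \<in> ?S. ?i y \<in> W}" using openin_open_eq[OF oS] by auto
    moreover have "{y \<in> ?S. ?i y \<in> W} = kap U \<phi> ` W"
    proof (intro set_eqI iffI)
      fix y assume "y \<in> {y \<in> ?S. ?i y \<in> W}"
      then have y: "y \<in> kap U \<phi> ` cotb U" "?i y \<in> W" using kap_image[OF U order_refl] by auto
      have "kap U \<phi> (?i y) \<in> kap U \<phi> ` W" by (rule imageI[OF y(2)])
      then show "y \<in> kap U \<phi> ` W" unfolding f_inv_into_f[OF y(1)] .
    next
      fix y assume "y \<in> kap U \<phi> ` W"
      then obtain z where z: "z \<in> W" "y = kap U \<phi> z" by blast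
      then have "?i y = z" using inv_into_f_f[OF kap_inj[OF U]] W by blast
      moreover have "y \<in> ?S" using kap_image[OF U order_refl] z W by blast
      ultimately show "y \<in> {y \<in> ?S. ?i y \<in> W}" using z(1) by simp
    qed
    ultimately show "open (kap U \<phi> ` W)" by simp
  }
qed

lemma kap_coords:
  assumes c: "(U, \<phi>) \<in> charts M"
  shows "coords N (cotb U) (kap U \<phi>)"
  unfolding coords_def
proof (intro conjI allI impI ballI)
  note U = atlas_chart[OF atlasM c]
  show "openin (mtop N) (cotb U)"
    unfolding kap_open_iff[OF c order_refl] kap_image[OF U order_refl]
    using coords_open[OF U coordsD(1)[OF U]] by (simp add: open_Times)
  show "inj_on (kap U \<phi>) (cotb U)" by (rule kap_inj[OF U])
  show "openin (mtop N) W = open (kap U \<phi> ` W)" if "W \<subseteq> cotb U" for W by (rule kap_open_iff[OF c that])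
  fix d assume "d \<in> charts N"
  then obtain V \<psi> where d: "d = (cotb V, kap V \<psi>)" "(V, \<psi>) \<in> charts M"
    by (auto simp: N_def cotangent_mfd_def)
  note V = atlas_chart[OF atlasM d(2)]
  have int: "cotb U \<inter> cotb V = cotb (U \<inter> V)" by auto
  show "case d of (V, \<psi>) \<Rightarrow> smooth_on (\<psi> ` (cotb U \<inter> V)) (kap U \<phi> \<circ> inv_into V \<psi>) \<and>
      smooth_on (kap U \<phi> ` (cotb U \<inter> V)) (\<psi> \<circ> inv_into (cotb U) (kap U \<phi>))"
    using kap_transition_smooth[OF c d(2)] kap_transition_smooth[OF d(2) c]
    by (simp add: d(1) int kap_image[OF U] kap_image[OF V] Int_commute)
qed

lemma charts_N: "d \<in> charts N \<longleftrightarrow> (\<exists>U \<phi>. d = (cotb U, kap U \<phi>) \<and> (U, \<phi>) \<in> charts M)"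
  by (simp add: N_def cotangent_mfd_def)

lemma chart_N_at:
  assumes "z \<in> points N"
  obtains U and \<phi> :: "'m \<Rightarrow> 'e" where "(U, \<phi>) \<in> charts M" "coords M U \<phi>" "fst z \<in> U"
    "coords N (cotb U) (kap U \<phi>)" "z \<in> cotb U"
proof -
  obtain U and \<phi> :: "'m \<Rightarrow> 'e" where U: "(U, \<phi>) \<in> charts M" "coords M U \<phi>" "fst z \<in> U"
    by (rule atlas_chart_at[OF atlasM points_ND(1)[OF assms]])
  have "z \<in> cotb U" using U(3) points_ND(2)[OF assms] by (cases z) simp
  then show thesis by (rule that[OF U kap_coords[OF U(1)]])
qed

text \<open>\<open>N\<close> is a construction, so its charts must be verified before the calculus
  on manifolds applies to it.\<close>

lemma atlasN: "atlas N"
  unfolding atlas_def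
proof (intro conjI ballI)
  show "\<Union> (fst ` charts N) = points N"
  proof (intro set_eqI iffI)
    fix z assume "z \<in> \<Union> (fst ` charts N)"
    then obtain d where d: "d \<in> charts N" "z \<in> fst d" by blast
    then obtain U \<phi> where "d = (cotb U, kap U \<phi>)" "(U, \<phi>) \<in> charts M" unfolding charts_N by blast
    then show "z \<in> points N" using d(2) coordsD(4)[OF kap_coords, of U \<phi>] by auto
  next
    fix z assume "z \<in> points N"
    then obtain U and \<phi> :: "'m \<Rightarrow> 'e" where U: "(U, \<phi>) \<in> charts M" "z \<in> cotb U" by (rule chart_N_at)
    have "(cotb U, kap U \<phi>) \<in> charts N" unfolding charts_N using U(1) by blast
    from UnionI[OF imageI[OF this], of z fst] U(2) show "z \<in> \<Union> (fst ` charts N)" by simp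
  qed
  fix d assume "d \<in> charts N"
  then obtain V \<psi> where d: "d = (cotb V, kap V \<psi>)" "(V, \<psi>) \<in> charts M" unfolding charts_N by blast
  show "case d of (U, \<phi>) \<Rightarrow> coords N U \<phi>" using kap_coords[OF d(2)] by (simp add: d(1))
qed


section \<open>The projection to the base and test functions on the total space\<close>

lemma fst_preimage_open:
  assumes "openin (mtop M) W"
  shows "openin (mtop N) {z \<in> points N. fst z \<in> W}"
proof (subst openin_subopen, rule ballI)
  fix z assume "z \<in> {z \<in> points N. fst z \<in> W}"
  then have z: "z \<in> points N" "fst z \<in> W" by auto
  obtain U and \<phi> :: "'m \<Rightarrow> 'e" where U: "(U, \<phi>) \<in> charts M" "coords M U \<phi>" "fst z \<in> U"
    "coords N (cotb U) (kap U \<phi>)" "z \<in> cotb U" by (rule chart_N_at[OF z(1)])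
  have sub: "U \<inter> W \<subseteq> U" by simp
  have "open (\<phi> ` (U \<inter> W) \<times> (UNIV :: 'e set))" by (rule open_Times[OF coords_open[OF U(2) assms] open_UNIV])
  then have "openin (mtop N) (cotb (U \<inter> W))"
    using coordsD(3)[OF U(4), of "cotb (U \<inter> W)"] kap_image[OF U(2) sub] by auto
  moreover have "z \<in> cotb (U \<inter> W)" using U(5) z(2) by auto
  moreover have "cotb (U \<inter> W) \<subseteq> {z \<in> points N. fst z \<in> W}" using coordsD(4)[OF U(2)] by (auto simp: points_N)
  ultimately show "\<exists>T. openin (mtop N) T \<and> z \<in> T \<and> T \<subseteq> {z \<in> points N. fst z \<in> W}" by blast
qed

lemma fst_smooth: "smooth_map N M fst"
  unfolding smooth_map_def
proof (intro conjI ballI)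
  show "continuous_map (mtop N) (mtop M) fst"
    unfolding continuous_map_def using fst_preimage_open points_ND(1) by auto
  fix c assume c: "c \<in> charts N"
  obtain U \<phi> where cU: "c = (cotb U, kap U \<phi>)" "(U, \<phi>) \<in> charts M" using c unfolding charts_N by blast
  note U = atlas_chart[OF atlasM cU(2)]
  have key: "smooth_on (kap U \<phi> ` (cotb U \<inter> fst -` V)) (\<psi> \<circ> fst \<circ> inv_into (cotb U) (kap U \<phi>))"
    if d: "(V, \<psi>) \<in> charts M" for V \<psi>
  proof -
    note V = atlas_chart[OF atlasM d]
    let ?S = "\<phi> ` (U \<inter> V)"
    have oS: "open ?S" by (rule coords_open[OF U coordsD(1)[OF V]])
    have oS': "open (?S \<times> (UNIV :: 'e set))" by (rule open_Times[OF oS open_UNIV])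
    have "smooth_on ?S (\<psi> \<circ> inv_into U \<phi>)" by (rule coordsD(6)[OF U d])
    from smooth_on_compose[OF smooth_on_linear[OF bounded_linear_fst oS'] this oS' oS]
    have "smooth_on (?S \<times> (UNIV :: 'e set)) (\<lambda>y. (\<psi> \<circ> inv_into U \<phi>) (fst y))" by auto
    then have "smooth_on (?S \<times> (UNIV :: 'e set)) (\<psi> \<circ> fst \<circ> inv_into (cotb U) (kap U \<phi>))"
      by (rule smooth_on_cong[OF _ oS']) (auto simp: inv_kap[OF U] coords_inv[OF U])
    moreover have "cotb U \<inter> fst -` V = cotb (U \<inter> V)" by auto
    ultimately show ?thesis by (simp add: kap_image[OF U])
  qed
  show "case c of (U, \<phi>) \<Rightarrow> \<forall>(V, \<psi>) \<in> charts M.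
      smooth_on (\<phi> ` (U \<inter> fst -` V)) (\<psi> \<circ> fst \<circ> inv_into U \<phi>)"
    unfolding cU(1) prod.case using key by (simp add: split_beta)
qed

lemmas fst_smooth_fun = smooth_map_smooth_fun[OF atlasN atlasM fst_smooth]
  and fst_smooth_near = smooth_map_smooth_near[OF atlasN atlasM fst_smooth]

text \<open>The fibrewise linear function of a vector field. Together with functions lifted from the
  base these serve as test functions on \<open>N\<close>, so that lifts can be described without
  fibre coordinates.\<close>

definition pf :: "('m \<Rightarrow> 'm tv) \<Rightarrow> 'm \<times> ('m tv \<Rightarrow> real) \<Rightarrow> real" where
  "pf Y z = snd z (Y (fst z))"

lemma pf_smooth:
  assumes "vfield_on M W Y"
  shows "smooth_fun N {z \<in> points N. fst z \<in> W} (pf Y)"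
proof (rule smooth_fun_local[OF atlasN])
  fix z assume "z \<in> {z \<in> points N. fst z \<in> W}"
  then have z: "z \<in> points N" "fst z \<in> W" by auto
  obtain U and \<phi> :: "'m \<Rightarrow> 'e" where U: "(U, \<phi>) \<in> charts M" "coords M U \<phi>" "fst z \<in> U"
    "coords N (cotb U) (kap U \<phi>)" "z \<in> cotb U" by (rule chart_N_at[OF z(1)])
  have oW: "openin (mtop M) W" by (rule vfield_open[OF assms])
  have o: "openin (mtop M) (U \<inter> W)" by (rule openin_Int[OF coordsD(1)[OF U(2)] oW])
  let ?Q = "{z \<in> points N. fst z \<in> U \<inter> W}"
  have oQ: "openin (mtop N) ?Q" by (rule fst_preimage_open[OF o])
  have QU: "?Q \<subseteq> cotb U" by (auto simp: points_N)
  have "smooth_fun M (U \<inter> W) (\<lambda>x. Y x (\<lambda>y. \<phi> y \<bullet> b))" for b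
    by (rule vfield_smooth[OF assms _ smooth_fun_subset[OF coord_fun_smooth[OF atlasM U(2)] o]]) auto
  from fst_smooth_fun[OF this]
  have 1: "smooth_fun N ?Q ((\<lambda>x. Y x (\<lambda>y. \<phi> y \<bullet> b)) \<circ> fst)" for b .
  have 2: "smooth_fun N ?Q (\<lambda>z. kap U \<phi> z \<bullet> (0, b))" for b
    by (rule smooth_fun_subset[OF coord_fun_smooth[OF atlasN U(4)] oQ QU])
  have "smooth_fun N ?Q (\<lambda>z. \<Sum>b\<in>Basis. (kap U \<phi> z \<bullet> (0, b)) * ((\<lambda>x. Y x (\<lambda>y. \<phi> y \<bullet> b)) \<circ> fst) z)"
    by (intro smooth_fun_sum[OF atlasN oQ] smooth_fun_mult[OF atlasN] 1 2)
  then have "smooth_fun N ?Q (pf Y)"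
  proof (rule smooth_fun_cong[OF atlasN])
    fix w assume w: "w \<in> ?Q"
    then have wU: "fst w \<in> U" "fst w \<in> W" "w \<in> points N" by auto
    show "pf Y w = (\<Sum>b\<in>Basis. (kap U \<phi> w \<bullet> (0, b)) * ((\<lambda>x. Y x (\<lambda>y. \<phi> y \<bullet> b)) \<circ> fst) w)"
      using linear_form_coords[OF atlasM U(2) wU(1) cotangentD(2)[OF points_ND(2)[OF wU(3)]] vfield_tangent[OF assms wU(2)]]
      by (simp add: pf_def inner_prod_def)
  qed
  then show "\<exists>V. z \<in> V \<and> V \<subseteq> {z \<in> points N. fst z \<in> W} \<and> smooth_fun N V (pf Y)"
    using z U(3) by (intro exI[of _ ?Q]) auto
qed

lemma pf_near:
  assumes "vfield_on M W Y" "z \<in> points N" "fst z \<in> W"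
  shows "smooth_near N z (pf Y)"
  by (rule smooth_fun_imp_near[OF pf_smooth[OF assms(1)]]) (use assms in simp)

lemma kap_basis:
  assumes "b \<in> Basis"
  shows "(\<lambda>z. kap U \<phi> z \<bullet> (b, 0)) = (\<lambda>x. \<phi> x \<bullet> b) \<circ> fst" "(\<lambda>z. kap U \<phi> z \<bullet> (0, b)) = pf (\<lambda>x. cv M U \<phi> x b)"
  using assms by (auto simp: inner_prod_def pf_def fun_eq_iff)

lemma Basis_prodE:
  assumes "c \<in> (Basis :: ('e \<times> 'e) set)"
  obtains b where "b \<in> Basis" "c = (b, 0)" | b where "b \<in> Basis" "c = (0, b)"
  using assms by (auto simp: Basis_prod_def)

text \<open>By \<open>kap_basis\<close> the coordinates of \<open>N\<close> are themselves of the
  two kinds tested: base coordinates composed with \<open>fst\<close>, and \<open>pf\<close> of the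
  coordinate fields.\<close>

lemma tangent_N_eqI:
  assumes "u \<in> tangent N z" "w \<in> tangent N z"
    and "\<And>f. smooth_near M (fst z) f \<Longrightarrow> u (f \<circ> fst) = w (f \<circ> fst)"
    and "\<And>U Y. vfield_on M U Y \<Longrightarrow> fst z \<in> U \<Longrightarrow> u (pf Y) = w (pf Y)"
  shows "u = w"
proof -
  obtain U and \<phi> :: "'m \<Rightarrow> 'e" where U: "(U, \<phi>) \<in> charts M" "coords M U \<phi>" "fst z \<in> U"
    "coords N (cotb U) (kap U \<phi>)" "z \<in> cotb U" by (rule chart_N_at[OF tangent_points[OF assms(1)]])
  show ?thesis
  proof (rule tangent_eqI[OF atlasN U(4,5) assms(1,2)])
    fix c :: "'e \<times> 'e" assume "c \<in> Basis"
    then show "u (\<lambda>z. kap U \<phi> z \<bullet> c) = w (\<lambda>z. kap U \<phi> z \<bullet> c)"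
    proof (cases rule: Basis_prodE)
      case (1 b)
      show ?thesis unfolding 1(2) kap_basis(1)[OF 1(1)]
        by (rule assms(3)[OF smooth_fun_imp_near[OF coord_fun_smooth[OF atlasM U(2)] U(3)]])
    next
      case (2 b)
      show ?thesis unfolding 2(2) kap_basis(2)[OF 2(1)]
        by (rule assms(4)[OF cv_vfield[OF atlasM U(2)] U(3)])
    qed
  qed
qed

subsection \<open>Horizontal lifts\<close>

text \<open>A section over \<open>W\<close> is no \<open>smooth_map\<close> on all of
  \<open>M\<close>; pulling back functions smooth near one point is what
  \<open>push_tangent_local\<close> asks of it.\<close>

lemma section_smooth_near:
  assumes "one_form_on M W s" "x \<in> W" "smooth_near N (x, s x) f"
  shows "smooth_near M x (f \<circ> (\<lambda>x. (x, s x)))"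
proof -
  have oW: "openin (mtop M) W" and sc: "\<And>y. y \<in> W \<Longrightarrow> s y \<in> cotangent M y"
    and ss: "\<And>V X. V \<subseteq> W \<Longrightarrow> vfield_on M V X \<Longrightarrow> smooth_fun M V (\<lambda>x. s x (X x))"
    using assms(1) by (auto simp: one_form_on_def)
  have xM: "x \<in> points M" using openin_subset[OF oW] assms(2) by blast
  obtain U and \<phi> :: "'m \<Rightarrow> 'e" where U: "(U, \<phi>) \<in> charts M" "coords M U \<phi>" "x \<in> U"
    by (rule atlas_chart_at[OF atlasM xM])
  note UN = kap_coords[OF U(1)]
  obtain Q where Q: "(x, s x) \<in> Q" "smooth_fun N Q f" using assms(3) by (auto simp: smooth_near_def)
  let ?W = "U \<inter> W" and ?\<sigma> = "\<lambda>x. (x, s x)"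
  have o: "openin (mtop M) ?W" by (rule openin_Int[OF coordsD(1)[OF U(2)] oW])
  have oS: "open (\<phi> ` ?W)" by (rule coords_open[OF U(2) oW])
  have "smooth_fun M ?W (\<lambda>y. s y (cv M U \<phi> y b))" for b
    by (rule ss[OF _ vfield_subset[OF cv_vfield[OF atlasM U(2)] o]]) auto
  from smooth_fun_vec[OF atlasM U(2) _ this o]
  have "smooth_on (\<phi> ` ?W) (\<lambda>y. \<Sum>b\<in>Basis. s (inv_into U \<phi> y) (cv M U \<phi> (inv_into U \<phi> y) b) *\<^sub>R b)" by simp
  from smooth_on_Pair[OF smooth_on_linear[OF bounded_linear_ident oS] this oS]
  have "smooth_on (\<phi> ` ?W) (\<lambda>y. kap U \<phi> (?\<sigma> (inv_into U \<phi> y)))"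
    by (rule smooth_on_cong[OF _ oS])
       (auto simp: cotangent_chart_def coord_vector_def cv_def coords_inv[OF U(2)])
  note sk = this
  let ?T = "{y \<in> ?W. ?\<sigma> y \<in> cotb U \<inter> Q}"
  have oK: "open (kap U \<phi> ` (cotb U \<inter> Q))" by (rule coords_open[OF UN smooth_fun_open[OF Q(2)]])
  have eqT: "\<phi> ` ?T = {y \<in> \<phi> ` ?W. kap U \<phi> (?\<sigma> (inv_into U \<phi> y)) \<in> kap U \<phi> ` (cotb U \<inter> Q)}"
  proof (intro set_eqI iffI)
    fix y assume "y \<in> \<phi> ` ?T"
    then obtain q where q: "q \<in> ?W" "?\<sigma> q \<in> cotb U \<inter> Q" "y = \<phi> q" by blast
    then show "y \<in> {y \<in> \<phi> ` ?W. kap U \<phi> (?\<sigma> (inv_into U \<phi> y)) \<in> kap U \<phi> ` (cotb U \<inter> Q)}"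
      using coords_inv[OF U(2)] by auto
  next
    fix y assume y: "y \<in> {y \<in> \<phi> ` ?W. kap U \<phi> (?\<sigma> (inv_into U \<phi> y)) \<in> kap U \<phi> ` (cotb U \<inter> Q)}"
    then obtain q where q: "q \<in> ?W" "y = \<phi> q" by blast
    have inv: "inv_into U \<phi> y = q" using q coords_inv[OF U(2)] by auto
    have sq: "?\<sigma> q \<in> cotb U" using q(1) sc by auto
    obtain w where w: "w \<in> cotb U" "w \<in> Q" "kap U \<phi> (?\<sigma> q) = kap U \<phi> w" using y inv by auto
    have "?\<sigma> q = w" by (rule inj_onD[OF coordsD(2)[OF UN] w(3) sq w(1)])
    then show "y \<in> \<phi> ` ?T" using q w by auto
  qed
  have oT: "open (\<phi> ` ?T)"
    unfolding eqT
    using continuous_open_preimage[OF smooth_on_imp_continuous_on[OF sk] oS oK]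
    by (simp add: vimage_def Int_def)
  have TU: "?T \<subseteq> U" by auto
  have oT': "openin (mtop M) ?T" using coordsD(3)[OF U(2) TU] oT by simp
  have "smooth_on (\<phi> ` ?T) (\<lambda>y. (f \<circ> inv_into (cotb U) (kap U \<phi>)) (kap U \<phi> (?\<sigma> (inv_into U \<phi> y))))"
  proof (rule smooth_on_compose[OF smooth_on_subset[OF sk] smooth_fun_coords[OF atlasN UN Q(2)] oT oK])
    show "\<phi> ` ?T \<subseteq> \<phi> ` ?W" by (rule image_mono) blast
    show "(\<lambda>y. kap U \<phi> (?\<sigma> (inv_into U \<phi> y))) ` (\<phi> ` ?T) \<subseteq> kap U \<phi> ` (cotb U \<inter> Q)"
      unfolding eqT by (rule image_subsetI) simp
  qed
  then have "smooth_on (\<phi> ` ?T) ((f \<circ> ?\<sigma>) \<circ> inv_into U \<phi>)"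
  proof (rule smooth_on_cong[OF _ oT])
    fix y assume "y \<in> \<phi> ` ?T"
    then obtain q where q: "q \<in> ?W" "?\<sigma> q \<in> cotb U \<inter> Q" "y = \<phi> q" by blast
    have "inv_into U \<phi> y = q" using q coords_inv[OF U(2)] by auto
    then show "((f \<circ> ?\<sigma>) \<circ> inv_into U \<phi>) y = (f \<circ> inv_into (cotb U) (kap U \<phi>)) (kap U \<phi> (?\<sigma> (inv_into U \<phi> y)))"
      using q(2) inv_into_f_f[OF coordsD(2)[OF UN], of "?\<sigma> q"] by (simp add: o_def)
  qed
  then have "smooth_fun M ?T (f \<circ> ?\<sigma>)" by (rule smooth_fun_coordsI[OF atlasM U(2) oT' TU])
  moreover have "x \<in> ?T" using U(3) assms(2) sc Q(1) by auto
  ultimately show ?thesis by (rule smooth_fun_imp_near)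
qed

text \<open>Only the first jet at one point is prescribed, so components that are affine in the
  coordinates can achieve it.\<close>

lemma parallel_section_exists:
  assumes "z \<in> points N"
  obtains W s where "fst z \<in> W" "one_form_on M W s" "s (fst z) = snd z" "form_parallel_at M nab s (fst z)"
proof -
  obtain p \<alpha> where zp: "z = (p, \<alpha>)" by fastforce
  have pM: "p \<in> points M" and \<alpha>: "\<alpha> \<in> cotangent M p" using points_ND[OF assms] zp by auto
  note lin\<alpha> = cotangentD(2)[OF \<alpha>]
  obtain U and \<phi> :: "'m \<Rightarrow> 'e" where U: "(U, \<phi>) \<in> charts M" "coords M U \<phi>" "p \<in> U"
    by (rule atlas_chart_at[OF atlasM pM])
  let ?cv = "\<lambda>b x. cv M U \<phi> x b"
  note cvt = cv_tangent[OF atlasM U(2)] and cvf = cv_vfield[OF atlasM U(2)]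
  \<comment> \<open>The slopes are read off the requirement that the derivative of the component
    \<open>s(e_b)\<close> in direction \<open>e_c\<close> be \<open>\<alpha>(nab e_b)\<close> in
    that direction.\<close>
  define G where "G c b = \<alpha> (nab p (?cv c p) (?cv b))" for b c
  define A where "A b x = \<alpha> (?cv b p) + (\<Sum>c\<in>Basis. (\<phi> x \<bullet> c + - (\<phi> p \<bullet> c)) * G c b)" for b x
  define s where "s x = form_restrict x (\<lambda>w. \<Sum>b\<in>Basis. A b x * w (\<lambda>y. \<phi> y \<bullet> b))" for x
  have oU: "openin (mtop M) U" by (rule coordsD(1)[OF U(2)])
  have smA: "smooth_fun M U (A b)" for b
    unfolding A_def
    by (intro smooth_fun_add smooth_fun_sum smooth_fun_mult smooth_fun_const coord_fun_smooth atlasM oU U(2))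
  have s_apply: "s x w = (\<Sum>b\<in>Basis. A b x * w (\<lambda>y. \<phi> y \<bullet> b))" if "w \<in> tangent M x" for x w
    unfolding s_def by (rule form_restrict_apply[OF that])
  have one: "one_form_on M U s"
    unfolding one_form_on_def
  proof (intro conjI ballI allI impI)
    show "openin (mtop M) U" by (fact oU)
    fix x assume "x \<in> U"
    then have "x \<in> points M" using coordsD(4)[OF U(2)] by blast
    then show "s x \<in> cotangent M x"
      unfolding s_def
      by (rule form_restrict_cotangent)
         (simp add: linear_form_on_def lcomb_def sum_distrib_left sum.distrib[symmetric] algebra_simps)
  next
    fix V X assume VX: "V \<subseteq> U \<and> vfield_on M V X"
    then have V: "V \<subseteq> U" "vfield_on M V X" by auto
    have oV: "openin (mtop M) V" by (rule vfield_open[OF V(2)])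
    have "smooth_fun M V (\<lambda>x. \<Sum>b\<in>Basis. A b x * X x (\<lambda>y. \<phi> y \<bullet> b))"
      by (intro smooth_fun_sum[OF atlasM oV] smooth_fun_mult[OF atlasM] smooth_fun_subset[OF smA oV V(1)]
          vfield_smooth[OF V(2) order_refl] smooth_fun_subset[OF coord_fun_smooth[OF atlasM U(2)] oV V(1)])
    then show "smooth_fun M V (\<lambda>x. s x (X x))"
      by (rule smooth_fun_cong[OF atlasM]) (rule s_apply[OF vfield_tangent[OF V(2)]])
  qed
  have Ap: "A b p = \<alpha> (?cv b p)" for b by (simp add: A_def)
  have sp: "s p = \<alpha>"
  proof (rule cotangent_eqI[OF _ \<alpha>])
    show "s p \<in> cotangent M p" using one U(3) by (simp add: one_form_on_def)
    fix v assume "v \<in> tangent M p"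
    then show "s p v = \<alpha> v"
      using linear_form_coords[OF atlasM U(2,3) lin\<alpha>] by (simp add: s_apply Ap)
  qed
  have ck: "smooth_near M p (\<lambda>x. \<phi> x \<bullet> c)" for c
    by (rule smooth_fun_imp_near[OF coord_fun_smooth[OF atlasM U(2)] U(3)])
  have ck': "smooth_near M p (\<lambda>x. \<phi> x \<bullet> c + - (\<phi> p \<bullet> c))" for c
    by (rule smooth_near_add[OF atlasM ck smooth_near_const[OF atlasM pM]])
  have vA: "v (A b) = \<alpha> (nab p v (?cv b))" if v: "v \<in> tangent M p" for v b
  proof -
    have nt: "nab p w (?cv b) \<in> tangent M p" if "w \<in> tangent M p" for w
      by (rule nab_tangent[OF cvf U(3) that])
    have "linear_form_on (tangent M p) (\<lambda>w. \<alpha> (nab p w (?cv b)))"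
      by (simp add: linear_form_on_def nab_lcomb[OF cvf U(3)] linear_form_lcomb[OF lin\<alpha>] nt)
    from linear_form_coords[OF atlasM U(2,3) this v]
    have 1: "\<alpha> (nab p v (?cv b)) = (\<Sum>c\<in>Basis. G c b * v (\<lambda>x. \<phi> x \<bullet> c))" by (simp add: G_def)
    have 2: "v (\<lambda>x. (\<phi> x \<bullet> c + - (\<phi> p \<bullet> c)) * G c b) = G c b * v (\<lambda>x. \<phi> x \<bullet> c)" for c
    proof -
      have "v (\<lambda>x. \<phi> x \<bullet> c + - (\<phi> p \<bullet> c)) = v (\<lambda>x. \<phi> x \<bullet> c)"
        by (subst tangent_add[OF v ck smooth_near_const[OF atlasM pM]])
           (simp only: tangent_const[OF atlasM v] add_0_right)
      then show ?thesis
        by (subst tangent_mult[OF v ck' smooth_near_const[OF atlasM pM]])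
           (simp only: tangent_const[OF atlasM v] mult_zero_right add_0_right mult.commute)
    qed
    have "v (A b) = v (\<lambda>x. \<alpha> (?cv b p)) + v (\<lambda>x. \<Sum>c\<in>Basis. (\<phi> x \<bullet> c + - (\<phi> p \<bullet> c)) * G c b)"
      unfolding A_def[abs_def]
      by (rule tangent_add[OF v smooth_near_const[OF atlasM pM]])
         (intro smooth_near_sum[OF atlasM pM] smooth_near_mult[OF atlasM] ck' smooth_near_const[OF atlasM pM])
    also have "\<dots> = (\<Sum>c\<in>Basis. G c b * v (\<lambda>x. \<phi> x \<bullet> c))"
      by (subst tangent_sum[OF atlasM v]) (simp_all only: tangent_const[OF atlasM v] 2 add_0_left
          smooth_near_mult[OF atlasM ck' smooth_near_const[OF atlasM pM]])
    finally show ?thesis using 1 by simp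
  qed
  have "form_parallel_at M nab s p"
    unfolding form_parallel_at_def
  proof (intro allI impI ballI)
    fix V Y v assume VY: "p \<in> V \<and> vfield_on M V Y" and v: "v \<in> tangent M p"
    then have V: "p \<in> V" "vfield_on M V Y" by auto
    let ?f = "\<lambda>b x. Y x (\<lambda>y. \<phi> y \<bullet> b)"
    have sf: "smooth_near M p (?f b)" for b by (rule vfield_smooth_near[OF V(2,1) ck])
    have sA: "smooth_near M p (A b)" for b by (rule smooth_fun_imp_near[OF smA U(3)])
    have "v (\<lambda>x. s x (Y x)) = v (\<lambda>x. \<Sum>b\<in>Basis. A b x * ?f b x)"
      by (rule tangent_germ[OF atlasM v vfield_open[OF V(2)] V(1)]) (rule s_apply[OF vfield_tangent[OF V(2)]])
    also have "\<dots> = (\<Sum>b\<in>Basis. v (\<lambda>x. A b x * ?f b x))"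
      by (rule tangent_sum[OF atlasM v smooth_near_mult[OF atlasM sA sf]])
    also have "\<dots> = (\<Sum>b\<in>Basis. v (A b) * ?f b p + A b p * v (?f b))"
      by (rule sum.cong[OF refl]) (rule tangent_mult[OF v sA sf])
    also have "\<dots> = (\<Sum>b\<in>Basis. v (?f b) * \<alpha> (?cv b p)) + (\<Sum>b\<in>Basis. ?f b p * \<alpha> (nab p v (?cv b)))"
      by (simp add: vA[OF v] Ap sum.distrib algebra_simps)
    also have "\<dots> = \<alpha> (nab p v Y)"
    proof -
      have 1: "(\<lambda>h. \<Sum>b\<in>Basis. v (?f b) * ?cv b p h) \<in> tangent M p \<and>
          \<alpha> (\<lambda>h. \<Sum>b\<in>Basis. v (?f b) * ?cv b p h) = (\<Sum>b\<in>Basis. v (?f b) * \<alpha> (?cv b p))"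
        by (rule linear_form_sum[OF atlasM lin\<alpha> pM cvt[OF U(3)] finite_Basis])
      have 2: "(\<lambda>h. \<Sum>b\<in>Basis. ?f b p * nab p v (?cv b) h) \<in> tangent M p \<and>
          \<alpha> (\<lambda>h. \<Sum>b\<in>Basis. ?f b p * nab p v (?cv b) h) = (\<Sum>b\<in>Basis. ?f b p * \<alpha> (nab p v (?cv b)))"
        by (rule linear_form_sum[OF atlasM lin\<alpha> pM nab_tangent[OF cvf U(3) v] finite_Basis])
      have "nab p v Y = lcomb 1 (\<lambda>h. \<Sum>b\<in>Basis. v (?f b) * ?cv b p h) 1 (\<lambda>h. \<Sum>b\<in>Basis. ?f b p * nab p v (?cv b) h)"
        unfolding nab_expansion[OF U(2,3) V(2,1) v] by (simp add: lcomb_def sum.distrib)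
      then show ?thesis using 1 2 linear_form_lcomb[OF lin\<alpha>, of _ _ 1 1] by simp
    qed
    finally show "v (\<lambda>x. s x (Y x)) - s p (nab p v Y) = 0" by (simp add: sp)
  qed
  then show thesis using that[of U s] U(3) one sp by (simp add: zp)
qed

text \<open>On lifted functions the section cancels against the projection. On \<open>pf Y\<close>
  one differentiates \<open>s(Y)\<close>, and parallelism at \<open>x\<close> turns this into
  \<open>s(nab Y)\<close>.\<close>

lemma parallel_section_push:
  assumes "v \<in> tangent M x" "x \<in> W" "one_form_on M W s" "form_parallel_at M nab s x"
  shows "push M N (\<lambda>x. (x, s x)) x v \<in> tangent N (x, s x)"
    and "smooth_near M x f \<Longrightarrow> push M N (\<lambda>x. (x, s x)) x v (f \<circ> fst) = v f"
    and "vfield_on M U Y \<Longrightarrow> x \<in> U \<Longrightarrow> push M N (\<lambda>x. (x, s x)) x v (pf Y) = s x (nab x v Y)"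
proof -
  have zN: "(x, s x) \<in> points N"
    using assms(2,3) cotangentD(1) by (fastforce simp: points_N one_form_on_def)
  show "push M N (\<lambda>x. (x, s x)) x v \<in> tangent N (x, s x)"
    by (rule push_tangent_local[where F="\<lambda>x. (x, s x)", OF atlasN section_smooth_near[OF assms(3,2)] zN assms(1)])
  show "push M N (\<lambda>x. (x, s x)) x v (f \<circ> fst) = v f" if "smooth_near M x f"
    using fst_smooth_near[OF zN, of f] that by (simp add: push_def o_def)
  show "push M N (\<lambda>x. (x, s x)) x v (pf Y) = s x (nab x v Y)" if "vfield_on M U Y" "x \<in> U"
    using pf_near[OF that(1) zN] that assms(1,4) by (simp add: push_def o_def pf_def form_parallel_at_def)
qed

text \<open>The vector pushed along a parallel section has values on test functions that depend on
  \<open>z\<close> and \<open>v\<close> alone. Any two admissible sections thus give the same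
  vector, and the description in \<open>hlift\<close> is definite.\<close>

lemma hlift_props:
  assumes "z \<in> points N" "v \<in> tangent M (fst z)"
  shows "hlift z v \<in> tangent N z"
    and "smooth_near M (fst z) f \<Longrightarrow> hlift z v (f \<circ> fst) = v f"
    and "vfield_on M U Y \<Longrightarrow> fst z \<in> U \<Longrightarrow> hlift z v (pf Y) = snd z (nab (fst z) v Y)"
proof -
  obtain W s where s: "fst z \<in> W" "one_form_on M W s" "s (fst z) = snd z" "form_parallel_at M nab s (fst z)"
    by (rule parallel_section_exists[OF assms(1)])
  let ?h = "push M N (\<lambda>x. (x, s x)) (fst z) v"
  note P = parallel_section_push[OF assms(2)]
  have "hlift z v = ?h"
    unfolding hlift_def
  proof (rule the_equality)
    show "\<exists>U s. fst z \<in> U \<and> one_form_on M U s \<and> s (fst z) = snd z \<and> form_parallel_at M nab s (fst z) \<and>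
      ?h = push M N (\<lambda>x. (x, s x)) (fst z) v" using s by blast
    fix h assume "\<exists>U s. fst z \<in> U \<and> one_form_on M U s \<and> s (fst z) = snd z \<and> form_parallel_at M nab s (fst z) \<and>
      h = push M N (\<lambda>x. (x, s x)) (fst z) v"
    then obtain U s' where s': "fst z \<in> U" "one_form_on M U s'" "s' (fst z) = snd z"
      "form_parallel_at M nab s' (fst z)" "h = push M N (\<lambda>x. (x, s' x)) (fst z) v" by blast
    have "push M N (\<lambda>x. (x, s' x)) (fst z) v \<in> tangent N z" "?h \<in> tangent N z"
      using P(1)[OF s'(1,2,4)] P(1)[OF s(1,2,4)] s'(3) s(3) by simp_all
    then show "h = ?h"
      unfolding s'(5)
      by (rule tangent_N_eqI) (simp_all add: P(2,3)[OF s'(1,2,4)] P(2,3)[OF s(1,2,4)] s(3) s'(3))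
  qed
  then show "hlift z v \<in> tangent N z"
    and "smooth_near M (fst z) f \<Longrightarrow> hlift z v (f \<circ> fst) = v f"
    and "vfield_on M U Y \<Longrightarrow> fst z \<in> U \<Longrightarrow> hlift z v (pf Y) = snd z (nab (fst z) v Y)"
    using P(1)[OF s(1,2,4)] P(2)[OF s(1,2,4)] P(3)[OF s(1,2,4)] s(3) by simp_all
qed

lemma hlift_lcomb:
  assumes "z \<in> points N" "u \<in> tangent M (fst z)" "v \<in> tangent M (fst z)"
  shows "hlift z (lcomb a u b v) = lcomb a (hlift z u) b (hlift z v)"
proof -
  note lt = lcomb_tangent[OF atlasM assms(2,3)]
  show ?thesis
  proof (rule tangent_N_eqI[OF hlift_props(1)[OF assms(1) lt] lcomb_tangent[OF atlasN hlift_props(1)[OF assms(1,2)] hlift_props(1)[OF assms(1,3)]]])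
    fix f assume f: "smooth_near M (fst z) f"
    show "hlift z (lcomb a u b v) (f \<circ> fst) = lcomb a (hlift z u) b (hlift z v) (f \<circ> fst)"
      unfolding hlift_props(2)[OF assms(1) lt f]
      by (simp add: lcomb_def hlift_props(2)[OF assms(1,2) f] hlift_props(2)[OF assms(1,3) f])
  next
    fix U Y assume Y: "vfield_on M U Y" "fst z \<in> U"
    show "hlift z (lcomb a u b v) (pf Y) = lcomb a (hlift z u) b (hlift z v) (pf Y)"
      unfolding hlift_props(3)[OF assms(1) lt Y] nab_lcomb[OF Y assms(2,3)]
        linear_form_lcomb[OF cotangentD(2)[OF points_ND(2)[OF assms(1)]] nab_tangent[OF Y assms(2)] nab_tangent[OF Y assms(3)]]
      by (simp add: lcomb_def hlift_props(3)[OF assms(1,2) Y] hlift_props(3)[OF assms(1,3) Y])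
  qed
qed

subsection \<open>Vertical lifts and the splitting\<close>

lemma cotangent_lcomb:
  assumes "\<alpha> \<in> cotangent M p" "\<beta> \<in> cotangent M p"
  shows "lcomb a \<alpha> b \<beta> \<in> cotangent M p"
  using assms by (simp add: cotangent_def linear_form_on_def lcomb_def algebra_simps)

lemma vlift_props:
  assumes "z \<in> points N" "\<beta> \<in> cotangent M (fst z)"
  shows "vlift z \<beta> \<in> tangent N z"
    and "smooth_near M (fst z) f \<Longrightarrow> vlift z \<beta> (f \<circ> fst) = 0"
    and "vfield_on M U Y \<Longrightarrow> fst z \<in> U \<Longrightarrow> vlift z \<beta> (pf Y) = \<beta> (Y (fst z))"
proof -
  obtain U and \<phi> :: "'m \<Rightarrow> 'e" where U: "(U, \<phi>) \<in> charts M" "coords M U \<phi>" "fst z \<in> U"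
    "coords N (cotb U) (kap U \<phi>)" "z \<in> cotb U" by (rule chart_N_at[OF assms(1)])
  let ?b = "snd (kap U \<phi> (fst z, \<beta>))"
  let ?c = "\<lambda>t. (fst z, lcomb 1 (snd z) t \<beta>)"
  have line: "?c t \<in> cotb U" "kap U \<phi> (?c t) = kap U \<phi> z + t *\<^sub>R (0, ?b)" for t
  proof -
    show "?c t \<in> cotb U" using U(3) cotangent_lcomb[OF points_ND(2)[OF assms(1)] assms(2)] by simp
    show "kap U \<phi> (?c t) = kap U \<phi> z + t *\<^sub>R (0, ?b)"
    proof (rule prod_eqI)
      show "snd (kap U \<phi> (?c t)) = snd (kap U \<phi> z + t *\<^sub>R (0, ?b))"
        by (rule euclidean_eqI) (simp add: inner_add_left lcomb_def)
    qed simp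
  qed
  have c0: "?c 0 = z" by (simp add: lcomb_def prod_eq_iff)
  \<comment> \<open>In a bundle chart the curve through \<open>z\<close> is a straight line in the
    fibre direction, so its velocity is a coordinate vector.\<close>
  have eq: "vlift z \<beta> = cv N (cotb U) (kap U \<phi>) z (0, ?b)"
  proof (rule ext)
    fix f
    show "vlift z \<beta> f = cv N (cotb U) (kap U \<phi>) z (0, ?b) f"
    proof (cases "smooth_near N z f")
      case True
      let ?F = "f \<circ> inv_into (cotb U) (kap U \<phi>)"
      have dF: "(?F has_derivative frechet_derivative ?F (at (kap U \<phi> z))) (at (kap U \<phi> z))"
        by (rule smooth_near_coords_derivative[OF atlasN U(4,5) True])
      have "((\<lambda>t. kap U \<phi> z + t *\<^sub>R (0, ?b)) has_derivative (\<lambda>t. t *\<^sub>R (0, ?b))) (at 0)"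
        by (auto intro!: derivative_eq_intros)
      from diff_chain_at[OF this, of ?F "frechet_derivative ?F (at (kap U \<phi> z))"] dF
      have "((\<lambda>t. ?F (kap U \<phi> z + t *\<^sub>R (0, ?b))) has_derivative
          (\<lambda>t. frechet_derivative ?F (at (kap U \<phi> z)) (t *\<^sub>R (0, ?b)))) (at 0)"
        by (simp add: o_def zero_prod_def[symmetric])
      moreover have "?F (kap U \<phi> z + t *\<^sub>R (0, ?b)) = f (?c t)" for t
        unfolding line(2)[symmetric] using coords_inv[OF U(4) line(1)[of t]] by simp
      ultimately have "((\<lambda>t. f (?c t)) has_derivative
          (\<lambda>t. t * frechet_derivative ?F (at (kap U \<phi> z)) (0, ?b))) (at 0)"
        using linear_cmul[OF has_derivative_linear[OF dF]] by (simp del: scaleR_Pair)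
      then have "((\<lambda>t. f (?c t)) has_real_derivative frechet_derivative ?F (at (kap U \<phi> z)) (0, ?b)) (at 0)"
        by (simp add: has_field_derivative_def mult_commute_abs)
      from DERIV_imp_deriv[OF this] show ?thesis
        using True c0 by (simp add: vlift_def curve_velocity_def cv_def)
    next
      case False
      then show ?thesis using c0 by (simp add: vlift_def curve_velocity_def cv_def)
    qed
  qed
  show t: "vlift z \<beta> \<in> tangent N z" unfolding eq by (rule cv_tangent[OF atlasN U(4,5)])
  have val: "vlift z \<beta> f = deriv (\<lambda>t. f (?c t)) 0" if "smooth_near N z f" for f
    using that c0 by (simp add: vlift_def curve_velocity_def)
  show "vlift z \<beta> (f \<circ> fst) = 0" if "smooth_near M (fst z) f"
    unfolding val[OF fst_smooth_near[OF assms(1) that]] by simp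
  show "vlift z \<beta> (pf Y) = \<beta> (Y (fst z))" if Y: "vfield_on M U Y" "fst z \<in> U" for U Y
  proof -
    have "((\<lambda>t. snd z (Y (fst z)) + t * \<beta> (Y (fst z))) has_real_derivative \<beta> (Y (fst z))) (at 0)"
      by (auto intro!: derivative_eq_intros)
    from DERIV_imp_deriv[OF this] show ?thesis
      unfolding val[OF pf_near[OF Y(1) assms(1) Y(2)]] by (simp add: pf_def lcomb_def)
  qed
qed

lemma from_split_props:
  assumes "z \<in> points N" "v \<in> tangent M (fst z)" "\<beta> \<in> cotangent M (fst z)"
  shows "from_split z v \<beta> \<in> tangent N z"
    and "smooth_near M (fst z) f \<Longrightarrow> from_split z v \<beta> (f \<circ> fst) = v f"
    and "vfield_on M U Y \<Longrightarrow> fst z \<in> U \<Longrightarrow>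
      from_split z v \<beta> (pf Y) = snd z (nab (fst z) v Y) + \<beta> (Y (fst z))"
  using lcomb_tangent[OF atlasN hlift_props(1)[OF assms(1,2)] vlift_props(1)[OF assms(1,3)], of 1 1]
    hlift_props(2,3)[OF assms(1,2)] vlift_props(2,3)[OF assms(1,3)]
  by (simp_all add: from_split_def lcomb_def)

lemma dpi_tangent: "u \<in> tangent N z \<Longrightarrow> dpi z u \<in> tangent M (fst z)"
  unfolding dpi_def by (rule push_tangent[OF atlasN atlasM fst_smooth])

lemma dpi_apply: "smooth_near M (fst z) f \<Longrightarrow> dpi z u f = u (f \<circ> fst)"
  by (simp add: dpi_def push_def)

lemma dpi_lcomb: "dpi z (lcomb a u b w) = lcomb a (dpi z u) b (dpi z w)"
  unfolding dpi_def by (rule push_lcomb)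

lemma dpi_from_split:
  assumes "z \<in> points N" "v \<in> tangent M (fst z)" "\<beta> \<in> cotangent M (fst z)"
  shows "dpi z (from_split z v \<beta>) = v"
proof (rule ext)
  fix f show "dpi z (from_split z v \<beta>) f = v f"
    using from_split_props(2)[OF assms, of f] tangent_outside[OF assms(2), of f]
    by (cases "smooth_near M (fst z) f") (simp_all add: dpi_def push_def)
qed

lemma from_split_inj:
  assumes "z \<in> points N" "v \<in> tangent M (fst z)" "\<beta> \<in> cotangent M (fst z)" "\<beta>' \<in> cotangent M (fst z)"
    and "from_split z v \<beta> = from_split z v \<beta>'"
  shows "\<beta> = \<beta>'"
proof (rule cotangent_eqI[OF assms(3,4)])
  fix w assume w: "w \<in> tangent M (fst z)"
  obtain U X Y where U: "fst z \<in> U" "vfield_on M U X" "vfield_on M U Y" "X (fst z) = w" "Y (fst z) = w"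
    by (rule tangent_extend[OF atlasM w w])
  show "\<beta> w = \<beta>' w"
    using from_split_props(3)[OF assms(1-3) U(2,1)] from_split_props(3)[OF assms(1,2,4) U(2,1)] assms(5) U(4) by simp
qed

lemma from_split_surj:
  assumes "u \<in> tangent N z"
  obtains \<beta> where "\<beta> \<in> cotangent M (fst z)" "u = from_split z (dpi z u) \<beta>"
proof -
  note z = tangent_points[OF assms] and v = dpi_tangent[OF assms]
  obtain U and \<phi> :: "'m \<Rightarrow> 'e" where U: "(U, \<phi>) \<in> charts M" "coords M U \<phi>" "fst z \<in> U"
    "coords N (cotb U) (kap U \<phi>)" "z \<in> cotb U" by (rule chart_N_at[OF z])
  let ?cv = "\<lambda>b x. cv M U \<phi> x b"
  \<comment> \<open>The components of the vertical part: what \<open>u\<close> does on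
    \<open>pf\<close> of each coordinate field beyond the horizontal lift of its projection.\<close>
  define a where "a = (\<Sum>b\<in>Basis. (u (pf (?cv b)) - snd z (nab (fst z) (dpi z u) (?cv b))) *\<^sub>R b)"
  have ab: "a \<bullet> b = u (pf (?cv b)) - snd z (nab (fst z) (dpi z u) (?cv b))" if "b \<in> Basis" for b
    using that by (simp add: a_def inner_sum_left inner_Basis if_distrib cong: if_cong)
  have \<beta>: "cf \<phi> (fst z) a \<in> cotangent M (fst z)" by (rule cf_cotangent[OF points_ND(1)[OF z]])
  have "u = from_split z (dpi z u) (cf \<phi> (fst z) a)"
  proof (rule tangent_eqI[OF atlasN U(4,5) assms from_split_props(1)[OF z v \<beta>]])
    fix c :: "'e \<times> 'e" assume "c \<in> Basis"
    then show "u (\<lambda>z. kap U \<phi> z \<bullet> c) = from_split z (dpi z u) (cf \<phi> (fst z) a) (\<lambda>z. kap U \<phi> z \<bullet> c)"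
    proof (cases rule: Basis_prodE)
      case (1 b)
      have near: "smooth_near M (fst z) (\<lambda>x. \<phi> x \<bullet> b)"
        by (rule smooth_fun_imp_near[OF coord_fun_smooth[OF atlasM U(2)] U(3)])
      show ?thesis unfolding 1(2) kap_basis(1)[OF 1(1)] from_split_props(2)[OF z v \<beta> near] dpi_apply[OF near] ..
    next
      case (2 b)
      have "cf \<phi> (fst z) a (?cv b (fst z)) = a \<bullet> b"
        using 2(1) by (simp add: cf_apply[OF cv_tangent[OF atlasM U(2,3)]] cv_coord[OF atlasM U(2,3)] inner_Basis if_distrib cong: if_cong)
      then show ?thesis
        unfolding 2(2) kap_basis(2)[OF 2(1)] from_split_props(3)[OF z v \<beta> cv_vfield[OF atlasM U(2)] U(3)]
        using ab[OF 2(1)] by simp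
    qed
  qed
  then show thesis using that \<beta> by blast
qed

lemma vpart_eqI:
  assumes "z \<in> points N" "u = from_split z (dpi z u) \<beta>" "dpi z u \<in> tangent M (fst z)" "\<beta> \<in> cotangent M (fst z)"
  shows "vpart z u = \<beta>"
  unfolding vpart_def
proof (rule the_equality)
  show "\<beta> \<in> cotangent M (fst z) \<and> u = from_split z (dpi z u) \<beta>" using assms by blast
  fix \<beta>' assume "\<beta>' \<in> cotangent M (fst z) \<and> u = from_split z (dpi z u) \<beta>'"
  then show "\<beta>' = \<beta>" using from_split_inj[OF assms(1,3) _ assms(4), of \<beta>'] assms(2) by simp
qed

lemma vpart_from_split:
  assumes "z \<in> points N" "v \<in> tangent M (fst z)" "\<beta> \<in> cotangent M (fst z)"
  shows "vpart z (from_split z v \<beta>) = \<beta>"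
  by (rule vpart_eqI) (use assms dpi_from_split[OF assms] in simp_all)

lemma split_props:
  assumes "u \<in> tangent N z"
  shows "vpart z u \<in> cotangent M (fst z)" "from_split z (dpi z u) (vpart z u) = u"
proof -
  obtain \<beta> where \<beta>: "\<beta> \<in> cotangent M (fst z)" "u = from_split z (dpi z u) \<beta>" by (rule from_split_surj[OF assms])
  have "vpart z u = \<beta>" by (rule vpart_eqI[OF tangent_points[OF assms] \<beta>(2) dpi_tangent[OF assms] \<beta>(1)])
  then show "vpart z u \<in> cotangent M (fst z)" "from_split z (dpi z u) (vpart z u) = u" using \<beta> by simp_all
qed

lemma vlift_lcomb:
  assumes "z \<in> points N" "\<alpha> \<in> cotangent M (fst z)" "\<beta> \<in> cotangent M (fst z)"
  shows "vlift z (lcomb a \<alpha> b \<beta>) = lcomb a (vlift z \<alpha>) b (vlift z \<beta>)"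
proof -
  note lt = cotangent_lcomb[OF assms(2,3)]
  show ?thesis
  proof (rule tangent_N_eqI[OF vlift_props(1)[OF assms(1) lt] lcomb_tangent[OF atlasN vlift_props(1)[OF assms(1,2)] vlift_props(1)[OF assms(1,3)]]])
    fix f assume f: "smooth_near M (fst z) f"
    show "vlift z (lcomb a \<alpha> b \<beta>) (f \<circ> fst) = lcomb a (vlift z \<alpha>) b (vlift z \<beta>) (f \<circ> fst)"
      unfolding vlift_props(2)[OF assms(1) lt f]
      by (simp add: lcomb_def vlift_props(2)[OF assms(1,2) f] vlift_props(2)[OF assms(1,3) f])
  next
    fix U Y assume Y: "vfield_on M U Y" "fst z \<in> U"
    show "vlift z (lcomb a \<alpha> b \<beta>) (pf Y) = lcomb a (vlift z \<alpha>) b (vlift z \<beta>) (pf Y)"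
      unfolding vlift_props(3)[OF assms(1) lt Y]
      by (simp add: lcomb_def vlift_props(3)[OF assms(1,2) Y] vlift_props(3)[OF assms(1,3) Y])
  qed
qed

lemma from_split_lcomb:
  assumes "z \<in> points N" "u \<in> tangent M (fst z)" "v \<in> tangent M (fst z)"
    "\<alpha> \<in> cotangent M (fst z)" "\<beta> \<in> cotangent M (fst z)"
  shows "from_split z (lcomb a u b v) (lcomb a \<alpha> b \<beta>) = lcomb a (from_split z u \<alpha>) b (from_split z v \<beta>)"
  unfolding from_split_def hlift_lcomb[OF assms(1-3)] vlift_lcomb[OF assms(1,4,5)]
  by (simp add: lcomb_def algebra_simps)

lemma vpart_lcomb:
  assumes "u \<in> tangent N z" "w \<in> tangent N z"
  shows "vpart z (lcomb a u b w) = lcomb a (vpart z u) b (vpart z w)"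
proof (rule vpart_eqI[OF tangent_points[OF assms(1)] _ dpi_tangent[OF lcomb_tangent[OF atlasN assms]]
      cotangent_lcomb[OF split_props(1)[OF assms(1)] split_props(1)[OF assms(2)]]])
  show "lcomb a u b w = from_split z (dpi z (lcomb a u b w)) (lcomb a (vpart z u) b (vpart z w))"
    unfolding dpi_lcomb from_split_lcomb[OF tangent_points[OF assms(1)] dpi_tangent[OF assms(1)] dpi_tangent[OF assms(2)]
        split_props(1)[OF assms(1)] split_props(1)[OF assms(2)]] split_props(2)[OF assms(1)] split_props(2)[OF assms(2)] ..
qed


subsection \<open>Horizontal vector fields\<close>

text \<open>A lift sends \<open>pf Y\<close> to \<open>pf\<close> of the covariant derivative of
  \<open>Y\<close>, again a smooth test function; on lifted functions it acts as the field on the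
  base.\<close>

lemma hlift_vfield:
  assumes "vfield_on M (points M) X"
  shows "vfield_on N (points N) (\<lambda>z. hlift z (X (fst z)))"
proof (rule vfield_local[OF atlasN])
  fix z assume z: "z \<in> points N"
  obtain U and \<phi> :: "'m \<Rightarrow> 'e" where U: "(U, \<phi>) \<in> charts M" "coords M U \<phi>" "fst z \<in> U"
    "coords N (cotb U) (kap U \<phi>)" "z \<in> cotb U" by (rule chart_N_at[OF z])
  have oU: "openin (mtop M) U" and subU: "U \<subseteq> points M" by (rule coordsD(1)[OF U(2)], rule coordsD(4)[OF U(2)])
  have subN: "cotb U \<subseteq> points N" by (rule coordsD(4)[OF U(4)])
  have oN: "openin (mtop N) (cotb U)" by (rule coordsD(1)[OF U(4)])
  have XU: "vfield_on M U X" by (rule vfield_subset[OF assms oU subU])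
  have in_U: "fst w \<in> U" "w \<in> points N" "X (fst w) \<in> tangent M (fst w)" if "w \<in> cotb U" for w
    using that subN vfield_tangent[OF XU] by auto
  have "vfield_on N (cotb U) (\<lambda>z. hlift z (X (fst z)))"
  proof (rule vfield_onI_coords[OF atlasN U(4) oN order_refl])
    show "hlift w (X (fst w)) \<in> tangent N w" if "w \<in> cotb U" for w
      by (rule hlift_props(1)[OF in_U(2,3)[OF that]])
    fix c :: "'e \<times> 'e" assume "c \<in> Basis"
    then show "smooth_fun N (cotb U) (\<lambda>w. hlift w (X (fst w)) (\<lambda>z. kap U \<phi> z \<bullet> c))"
    proof (cases rule: Basis_prodE)
      case (1 b)
      have "smooth_fun M U (\<lambda>x. X x (\<lambda>y. \<phi> y \<bullet> b))"
        by (rule vfield_smooth[OF XU order_refl coord_fun_smooth[OF atlasM U(2)]])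
      from smooth_fun_subset[OF fst_smooth_fun[OF this] oN]
      have "smooth_fun N (cotb U) ((\<lambda>x. X x (\<lambda>y. \<phi> y \<bullet> b)) \<circ> fst)" using in_U by auto
      then show ?thesis
        unfolding 1(2) kap_basis(1)[OF 1(1)]
        by (rule smooth_fun_cong[OF atlasN])
           (simp add: hlift_props(2)[OF in_U(2,3)] smooth_fun_imp_near[OF coord_fun_smooth[OF atlasM U(2)] in_U(1)])
    next
      case (2 b)
      have "smooth_fun N {z \<in> points N. fst z \<in> U} (pf (\<lambda>x. nab x (X x) (\<lambda>x. cv M U \<phi> x b)))"
        by (rule pf_smooth[OF nab_vfield[OF XU cv_vfield[OF atlasM U(2)]]])
      from smooth_fun_subset[OF this oN]
      have "smooth_fun N (cotb U) (pf (\<lambda>x. nab x (X x) (\<lambda>x. cv M U \<phi> x b)))" using in_U by auto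
      then show ?thesis
        unfolding 2(2) kap_basis(2)[OF 2(1)]
        by (rule smooth_fun_cong[OF atlasN])
           (simp add: hlift_props(3)[OF in_U(2,3) cv_vfield[OF atlasM U(2)] in_U(1)] pf_def)
    qed
  qed
  then show "\<exists>V. z \<in> V \<and> V \<subseteq> points N \<and> vfield_on N V (\<lambda>z. hlift z (X (fst z)))"
    using U(5) subN by blast
qed

lemma hlift_zero:
  assumes "z \<in> points N"
  shows "hlift z (\<lambda>f. 0) = (\<lambda>f. 0)"
  using hlift_lcomb[OF assms zero_tangent zero_tangent, of 0 0] points_ND(1)[OF assms] by (simp add: lcomb_def)

text \<open>Horizontal lifts of vector fields commute as the fields do, because \<open>nab\<close> is flat.\<close>

lemma hlift_bracket:
  assumes X: "vfield_on M (points M) X" and Y: "vfield_on M (points M) Y" and z: "z \<in> points N"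
  shows "lie_bracket N (\<lambda>z. hlift z (X (fst z))) (\<lambda>z. hlift z (Y (fst z))) z = hlift z (lie_bracket M X Y (fst z))"
proof -
  let ?h = "\<lambda>X z. hlift z (X (fst z))"
  note p = points_ND(1)[OF z]
  have lbt: "lie_bracket M X Y (fst z) \<in> tangent M (fst z)" by (rule lie_bracket_tangent[OF atlasM X Y p])
  have t: "?h X w \<in> tangent N w" if "vfield_on M (points M) X" "w \<in> points N" for X w
    by (rule hlift_props(1)[OF that(2) vfield_tangent[OF that(1) points_ND(1)[OF that(2)]]])
  show ?thesis
  proof (rule tangent_N_eqI[OF lie_bracket_tangent[OF atlasN hlift_vfield[OF X] hlift_vfield[OF Y] z] hlift_props(1)[OF z lbt]])
    fix f assume f: "smooth_near M (fst z) f"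
    obtain W where W: "openin (mtop M) W" "fst z \<in> W" "\<And>x. x \<in> W \<Longrightarrow> smooth_near M x f"
      using smooth_near_nbhd[OF f] by metis
    have *: "?h X z (\<lambda>w. ?h Y w (f \<circ> fst)) = X (fst z) (\<lambda>x. Y x f)"
      if X: "vfield_on M (points M) X" and Y: "vfield_on M (points M) Y" for X Y
    proof -
      have "?h X z (\<lambda>w. ?h Y w (f \<circ> fst)) = ?h X z ((\<lambda>x. Y x f) \<circ> fst)"
      proof (rule tangent_germ[OF atlasN t[OF X z] fst_preimage_open[OF W(1)]])
        fix w assume w: "w \<in> {z \<in> points N. fst z \<in> W}"
        then show "?h Y w (f \<circ> fst) = ((\<lambda>x. Y x f) \<circ> fst) w"
          using hlift_props(2)[of w "Y (fst w)" f] W(3) vfield_tangent[OF Y points_ND(1)] by simp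
      qed (use z W(2) in simp)
      also have "\<dots> = X (fst z) (\<lambda>x. Y x f)"
        by (rule hlift_props(2)[OF z vfield_tangent[OF X p] vfield_smooth_near[OF Y p f]])
      finally show ?thesis .
    qed
    have "smooth_near N z (f \<circ> fst)" by (rule fst_smooth_near[OF z f])
    then show "lie_bracket N (?h X) (?h Y) z (f \<circ> fst) = hlift z (lie_bracket M X Y (fst z)) (f \<circ> fst)"
      unfolding hlift_props(2)[OF z lbt f]
      by (simp add: lie_bracket_def[of N] lie_bracket_def[of M] f *[OF X Y] *[OF Y X])
  next
    fix U T assume T: "vfield_on M U T" and zU: "fst z \<in> U"
    have oU: "openin (mtop M) U" by (rule vfield_open[OF T])
    have sub: "U \<subseteq> points M" by (rule openin_subset[OF oU])
    have *: "?h X z (\<lambda>w. ?h Y w (pf T)) = snd z (nab (fst z) (X (fst z)) (\<lambda>x. nab x (Y x) T))"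
      if X: "vfield_on M (points M) X" and Y: "vfield_on M (points M) Y" for X Y
    proof -
      have "?h X z (\<lambda>w. ?h Y w (pf T)) = ?h X z (pf (\<lambda>x. nab x (Y x) T))"
      proof (rule tangent_germ[OF atlasN t[OF X z] fst_preimage_open[OF oU]])
        fix w assume w: "w \<in> {z \<in> points N. fst z \<in> U}"
        then show "?h Y w (pf T) = pf (\<lambda>x. nab x (Y x) T) w"
          using hlift_props(3)[of w "Y (fst w)" U T] T vfield_tangent[OF Y points_ND(1)] by (simp add: pf_def)
      qed (use z zU in simp)
      also have "\<dots> = snd z (nab (fst z) (X (fst z)) (\<lambda>x. nab x (Y x) T))"
        by (rule hlift_props(3)[OF z vfield_tangent[OF X p] nab_vfield[OF vfield_subset[OF Y oU sub] T] zU])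
      finally show ?thesis .
    qed
    have nt: "nab (fst z) (X (fst z)) (\<lambda>x. nab x (Y x) T) \<in> tangent M (fst z)"
      if X: "vfield_on M (points M) X" and Y: "vfield_on M (points M) Y" for X Y
      by (rule nab_tangent[OF nab_vfield[OF vfield_subset[OF Y oU sub] T] zU vfield_tangent[OF X p]])
    have "lcomb 1 (nab (fst z) (X (fst z)) (\<lambda>x. nab x (Y x) T)) (- 1) (nab (fst z) (Y (fst z)) (\<lambda>x. nab x (X x) T))
        = nab (fst z) (lie_bracket M X Y (fst z)) T"
      using flat_nab vfield_subset[OF X oU sub] vfield_subset[OF Y oU sub] T zU
      unfolding flat_connection_def by simp
    then have "snd z (nab (fst z) (X (fst z)) (\<lambda>x. nab x (Y x) T)) - snd z (nab (fst z) (Y (fst z)) (\<lambda>x. nab x (X x) T))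
        = snd z (nab (fst z) (lie_bracket M X Y (fst z)) T)"
      using linear_form_lcomb[OF cotangentD(2)[OF points_ND(2)[OF z]] nt[OF X Y] nt[OF Y X], of 1 "-1"] by simp
    then show "lie_bracket N (?h X) (?h Y) z (pf T) = hlift z (lie_bracket M X Y (fst z)) (pf T)"
      unfolding hlift_props(3)[OF z lbt T zU]
      by (simp add: lie_bracket_def[of N] pf_near[OF T z zU] *[OF X Y] *[OF Y X])
  qed
qed

text \<open>By \<open>I1_Z\<close> this equals \<open>I1 z (Z z)\<close>, so it lies in the
  quaternionic span of \<open>Z\<close>.\<close>

definition xit :: "'m \<times> ('m tv \<Rightarrow> real) \<Rightarrow> ('m \<times> ('m tv \<Rightarrow> real)) tv" where
  "xit z = hlift z (xi (fst z))"

lemma xit_vfield: "vfield_on N (points N) xit"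
  using hlift_vfield[OF xi_vfield] by (simp add: xit_def[abs_def])

lemma neg_Jxi_vfield: "vfield_on M (points M) (\<lambda>x f. - J x (xi x) f)"
  using vfield_lcomb[OF atlasM Jxi_vfield Jxi_vfield smooth_fun_const[OF atlasM openin_topspace, of "-1"]
      smooth_fun_const[OF atlasM openin_topspace, of 0]] by (simp add: lcomb_def)

lemma Z_vfield: "vfield_on N (points N) Z"
  using hlift_vfield[OF neg_Jxi_vfield] by (simp add: Z_def[abs_def])

lemma bracket_Z_xit:
  assumes "z \<in> points N"
  shows "lie_bracket N Z xit z = (\<lambda>f. 0)"
proof -
  note p = points_ND(1)[OF assms]
  have "lie_bracket M (\<lambda>x f. - J x (xi x) f) xi (fst z) f = 0" for f
  proof (cases "smooth_near M (fst z) f")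
    case True
    have "xi (fst z) (\<lambda>y. (-1) * J y (xi y) f) = (-1) * xi (fst z) (\<lambda>y. J y (xi y) f)"
      by (rule tangent_cmult[OF atlasM xi_tangent[OF p] vfield_smooth_near[OF Jxi_vfield p True]])
    then show ?thesis
      using fun_cong[OF bracket_xi_Jxi[OF p], of f] True by (simp add: lie_bracket_def)
  qed (simp add: lie_bracket_def)
  then have "lie_bracket M (\<lambda>x f. - J x (xi x) f) xi (fst z) = (\<lambda>f. 0)" by (simp add: fun_eq_iff)
  then show ?thesis
    using hlift_bracket[OF neg_Jxi_vfield xi_vfield assms] hlift_zero[OF assms]
    by (simp add: Z_def[abs_def] xit_def[abs_def])
qed

subsection \<open>Musical isomorphisms\<close>

lemma flat_cotangent: "v \<in> tangent M p \<Longrightarrow> form_restrict p (g p v) \<in> cotangent M p"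
  by (rule form_restrict_cotangent[OF tangent_points linear_g])

lemma flat_inj:
  assumes "v \<in> tangent M p" "w \<in> tangent M p" "\<And>u. u \<in> tangent M p \<Longrightarrow> g p v u = g p w u"
  shows "v = w"
proof -
  have "lcomb 1 v (-1) w = (\<lambda>_. 0)"
    by (rule g_nondeg[OF lcomb_tangent[OF atlasM assms(1,2)]])
       (simp add: g_lcomb_left[OF _ assms(1,2)] assms(3))
  then show ?thesis by (auto simp: lcomb_def fun_eq_iff)
qed

text \<open>In coordinates the metric is a linear endomorphism, injective by nondegeneracy and hence
  surjective.\<close>

lemma flat_surj:
  assumes "\<beta> \<in> cotangent M p"
  obtains v where "v \<in> tangent M p" "\<And>w. w \<in> tangent M p \<Longrightarrow> g p v w = \<beta> w"
proof -
  obtain U and \<phi> :: "'m \<Rightarrow> 'e" where U: "coords M U \<phi>" "p \<in> U"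
    by (rule atlas_chart_at[OF atlasM cotangentD(1)[OF assms]])
  let ?cv = "cv M U \<phi> p"
  note cvt = cv_tangent[OF atlasM U]
  define L where "L a = (\<Sum>b\<in>Basis. g p (?cv a) (?cv b) *\<^sub>R b)" for a
  have Lb: "L a \<bullet> b = g p (?cv a) (?cv b)" if "b \<in> Basis" for a b
    using that by (simp add: L_def inner_sum_left inner_Basis if_distrib cong: if_cong)
  have coord: "g p (?cv a) w = (\<Sum>b\<in>Basis. (L a \<bullet> b) * w (\<lambda>x. \<phi> x \<bullet> b))" if "w \<in> tangent M p" for a w
    using linear_form_coords[OF atlasM U linear_g[OF cvt] that] by (simp add: Lb)
  have lin: "linear L"
  proof (rule linearI)
    show "L (a + a') = L a + L a'" for a a'
      by (rule euclidean_eqI)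
         (use cv_lcomb[OF atlasM U, of 1 a 1 a'] in \<open>simp add: Lb inner_add_left g_lcomb_left[OF cvt cvt cvt]\<close>)
    show "L (r *\<^sub>R a) = r *\<^sub>R L a" for r a
      by (rule euclidean_eqI)
         (use cv_lcomb[OF atlasM U, of r a 0 a] in \<open>simp add: Lb g_lcomb_left[OF cvt cvt cvt]\<close>)
  qed
  have "inj L"
    unfolding linear_injective_0[OF lin]
  proof (intro allI impI)
    fix a assume "L a = 0"
    then have "?cv a = (\<lambda>_. 0)" by (intro g_nondeg[OF cvt]) (simp add: coord)
    then have "a \<bullet> b = 0" for b using cv_coord[OF atlasM U, of a b] by simp
    then show "a = 0" by (metis inner_eq_zero_iff)
  qed
  then have "surj L" using linear_injective_imp_surjective[OF lin] by blast
  then obtain a where a: "L a = (\<Sum>b\<in>Basis. \<beta> (?cv b) *\<^sub>R b)" by (metis surjD)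
  have "g p (?cv a) w = \<beta> w" if "w \<in> tangent M p" for w
    unfolding coord[OF that] a linear_form_coords[OF atlasM U cotangentD(2)[OF assms] that]
    by (simp add: inner_sum_left inner_Basis if_distrib cong: if_cong)
  then show thesis using that[of "?cv a"] cvt by blast
qed

lemma g_sharp_eqI:
  assumes "\<beta> \<in> cotangent M p" "v \<in> tangent M p" "\<And>w. w \<in> tangent M p \<Longrightarrow> g p v w = \<beta> w"
  shows "g_sharp p \<beta> = v"
  unfolding g_sharp_def
proof (rule the_equality)
  have "form_restrict p (g p v) = \<beta>"
    by (rule cotangent_eqI[OF flat_cotangent[OF assms(2)] assms(1)]) (simp add: form_restrict_apply assms(3))
  then show "v \<in> tangent M p \<and> form_restrict p (g p v) = \<beta>" using assms(2) by simp
  fix w assume w: "w \<in> tangent M p \<and> form_restrict p (g p w) = \<beta>"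
  show "w = v"
  proof (rule flat_inj)
    fix u assume u: "u \<in> tangent M p"
    show "g p w u = g p v u" using w form_restrict_apply[OF u, of "g p w"] assms(3)[OF u] by simp
  qed (use w assms(2) in auto)
qed

lemma g_sharp_props:
  assumes "\<beta> \<in> cotangent M p"
  shows "g_sharp p \<beta> \<in> tangent M p" "w \<in> tangent M p \<Longrightarrow> g p (g_sharp p \<beta>) w = \<beta> w"
proof -
  obtain v where v: "v \<in> tangent M p" "\<And>w. w \<in> tangent M p \<Longrightarrow> g p v w = \<beta> w" by (rule flat_surj[OF assms]) blast
  have "g_sharp p \<beta> = v" by (rule g_sharp_eqI[OF assms v])
  then show "g_sharp p \<beta> \<in> tangent M p" "w \<in> tangent M p \<Longrightarrow> g p (g_sharp p \<beta>) w = \<beta> w" using v by simp_all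
qed

lemma g_inv_eq: "\<alpha> \<in> cotangent M p \<Longrightarrow> \<beta> \<in> cotangent M p \<Longrightarrow> g_inv p \<alpha> \<beta> = \<alpha> (g_sharp p \<beta>)"
  by (simp add: g_inv_def g_sharp_props)

lemma g_inv_sym: "\<alpha> \<in> cotangent M p \<Longrightarrow> \<beta> \<in> cotangent M p \<Longrightarrow> g_inv p \<alpha> \<beta> = g_inv p \<beta> \<alpha>"
  unfolding g_inv_def by (rule g_sym[OF g_sharp_props(1) g_sharp_props(1)])

lemma g_inv_flat:
  assumes "\<alpha> \<in> cotangent M p" "v \<in> tangent M p"
  shows "g_inv p (form_restrict p (g p v)) \<alpha> = \<alpha> v"
proof -
  have "g_sharp p (form_restrict p (g p v)) = v"
    by (rule g_sharp_eqI[OF flat_cotangent[OF assms(2)] assms(2)]) (simp add: form_restrict_apply)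
  then show ?thesis
    using g_inv_eq[OF assms(1) flat_cotangent[OF assms(2)]] g_inv_sym[OF assms(1) flat_cotangent[OF assms(2)]] by simp
qed

lemma g_inv_lcomb:
  assumes "\<alpha> \<in> cotangent M p" "\<alpha>' \<in> cotangent M p" "\<beta> \<in> cotangent M p"
  shows "g_inv p (lcomb a \<alpha> b \<alpha>') \<beta> = a * g_inv p \<alpha> \<beta> + b * g_inv p \<alpha>' \<beta>"
  by (simp add: g_inv_eq assms cotangent_lcomb) (simp add: lcomb_def)

lemma gN_sym:
  assumes "u \<in> tangent N z" "w \<in> tangent N z"
  shows "gN z u w = gN z w u"
  unfolding gN_def
  using g_sym[OF dpi_tangent[OF assms(1)] dpi_tangent[OF assms(2)]]
    g_inv_sym[OF split_props(1)[OF assms(1)] split_props(1)[OF assms(2)]] by simp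

lemma gN_lcomb_left:
  assumes "u \<in> tangent N z" "v \<in> tangent N z" "w \<in> tangent N z"
  shows "gN z (lcomb a u b v) w = a * gN z u w + b * gN z v w"
  unfolding gN_def dpi_lcomb vpart_lcomb[OF assms(1,2)]
    g_lcomb_left[OF dpi_tangent[OF assms(3)] dpi_tangent[OF assms(1)] dpi_tangent[OF assms(2)]]
    g_inv_lcomb[OF split_props(1)[OF assms(1)] split_props(1)[OF assms(2)] split_props(1)[OF assms(3)]]
  by (simp add: algebra_simps)

lemma gN_lcomb_right:
  assumes "u \<in> tangent N z" "v \<in> tangent N z" "w \<in> tangent N z"
  shows "gN z w (lcomb a u b v) = a * gN z w u + b * gN z w v"
  using gN_lcomb_left[OF assms] gN_sym[OF assms(3) lcomb_tangent[OF atlasN assms(1,2)]]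
    gN_sym[OF assms(3,1)] gN_sym[OF assms(3,2)] by simp

subsection \<open>The quaternionic span of the rotating field\<close>

lemma zero_cotangent: "p \<in> points M \<Longrightarrow> (\<lambda>v. 0) \<in> cotangent M p"
  by (simp add: cotangent_def linear_form_on_def)

lemma from_split_hlift:
  assumes "z \<in> points N"
  shows "from_split z v (\<lambda>w. 0) = hlift z v"
proof -
  have "vlift z (lcomb 0 (\<lambda>w. 0) 0 (\<lambda>w. 0)) = (\<lambda>f. 0)"
    unfolding vlift_lcomb[OF assms zero_cotangent zero_cotangent, OF points_ND(1)[OF assms] points_ND(1)[OF assms]]
    by (simp add: lcomb_def)
  then show ?thesis by (simp add: from_split_def lcomb_def)
qed

lemma hlift_split:
  assumes "z \<in> points N" "v \<in> tangent M (fst z)"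
  shows "dpi z (hlift z v) = v" "vpart z (hlift z v) = (\<lambda>w. 0)"
  using dpi_from_split[OF assms zero_cotangent] vpart_from_split[OF assms zero_cotangent] points_ND(1)[OF assms(1)]
  by (simp_all add: from_split_hlift[OF assms(1)])

lemma I1_hlift:
  assumes "z \<in> points N" "v \<in> tangent M (fst z)"
  shows "I1 z (hlift z v) = hlift z (J (fst z) v)"
proof -
  have "form_restrict (fst z) (\<lambda>v. 0) = (\<lambda>v. 0)" by (auto simp: form_restrict_def)
  then show ?thesis by (simp add: I1_def hlift_split[OF assms] from_split_hlift[OF assms(1)])
qed

text \<open>\<open>E2\<close> and \<open>E3\<close> are the vertical vectors \<open>I2 Z\<close> and
  \<open>I3 Z\<close> in explicit form: a horizontal \<open>Z\<close> has vertical image under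
  \<open>I2\<close>, and \<open>I1\<close> preserves the splitting.\<close>

definition E2 :: "'m \<times> ('m tv \<Rightarrow> real) \<Rightarrow> ('m \<times> ('m tv \<Rightarrow> real)) tv" where
  "E2 z = from_split z (\<lambda>f. 0) (form_restrict (fst z) (g (fst z) (xi (fst z))))"

definition E3 :: "'m \<times> ('m tv \<Rightarrow> real) \<Rightarrow> ('m \<times> ('m tv \<Rightarrow> real)) tv" where
  "E3 z = from_split z (\<lambda>f. 0) (form_restrict (fst z) (g (fst z) (\<lambda>f. - J (fst z) (xi (fst z)) f)))"

context
  fixes z assumes z: "z \<in> points N"
begin

private lemma p: "fst z \<in> points M"
  by (rule points_ND(1)[OF z])

private lemma xi_t: "xi (fst z) \<in> tangent M (fst z)" and Jxi_t: "J (fst z) (xi (fst z)) \<in> tangent M (fst z)"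
  and nJxi_t: "(\<lambda>f. - J (fst z) (xi (fst z)) f) \<in> tangent M (fst z)" and zero_t: "(\<lambda>f. 0) \<in> tangent M (fst z)"
  using p tangent_neg zero_tangent by simp_all

lemma Z_tangent: "Z z \<in> tangent N z" and xit_tangent: "xit z \<in> tangent N z"
  by (rule vfield_tangent[OF Z_vfield z], rule vfield_tangent[OF xit_vfield z])

lemma E2_tangent: "E2 z \<in> tangent N z" and E3_tangent: "E3 z \<in> tangent N z"
  unfolding E2_def E3_def
  by (rule from_split_props(1)[OF z zero_t flat_cotangent[OF xi_t]],
      rule from_split_props(1)[OF z zero_t flat_cotangent[OF nJxi_t]])

lemma Z_split: "dpi z (Z z) = (\<lambda>f. - J (fst z) (xi (fst z)) f)" "vpart z (Z z) = (\<lambda>w. 0)"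
  unfolding Z_def by (rule hlift_split[OF z nJxi_t])+

lemma xit_split: "dpi z (xit z) = xi (fst z)" "vpart z (xit z) = (\<lambda>w. 0)"
  unfolding xit_def by (rule hlift_split[OF z xi_t])+

lemma E2_split: "dpi z (E2 z) = (\<lambda>f. 0)" "vpart z (E2 z) = form_restrict (fst z) (g (fst z) (xi (fst z)))"
  unfolding E2_def
  by (rule dpi_from_split[OF z zero_t flat_cotangent[OF xi_t]],
      rule vpart_from_split[OF z zero_t flat_cotangent[OF xi_t]])

lemma E3_split: "dpi z (E3 z) = (\<lambda>f. 0)"
  "vpart z (E3 z) = form_restrict (fst z) (g (fst z) (\<lambda>f. - J (fst z) (xi (fst z)) f))"
  unfolding E3_def
  by (rule dpi_from_split[OF z zero_t flat_cotangent[OF nJxi_t]],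
      rule vpart_from_split[OF z zero_t flat_cotangent[OF nJxi_t]])

lemma I1_Z: "I1 z (Z z) = xit z"
  unfolding Z_def xit_def I1_hlift[OF z nJxi_t] J_neg[OF Jxi_t] JJ[OF xi_t] by simp

lemma I2_Z: "I2 z (Z z) = E2 z"
proof -
  \<comment> \<open>The vertical part of \<open>Z\<close> is 0, but \<open>om_inv\<close> is a
    definite description, so even its value at 0 has to be established.\<close>
  have "om_inv (fst z) (\<lambda>w. 0) = (\<lambda>f. 0)"
    unfolding om_inv_def
  proof (rule the_equality)
    have "om (fst z) (\<lambda>f. 0) v = 0" if "v \<in> tangent M (fst z)" for v
      using om_lcomb_left[OF that zero_t zero_t, of 0 0] by (simp add: lcomb_def)
    then have "form_restrict (fst z) (om (fst z) (\<lambda>f. 0)) = (\<lambda>w. 0)" by (auto simp: form_restrict_def)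
    then show "(\<lambda>f. 0) \<in> tangent M (fst z) \<and> form_restrict (fst z) (om (fst z) (\<lambda>f. 0)) = (\<lambda>w. 0)"
      using zero_t by simp
    fix v assume v: "v \<in> tangent M (fst z) \<and> form_restrict (fst z) (om (fst z) v) = (\<lambda>w. 0)"
    show "v = (\<lambda>f. 0)"
    proof (rule om_nondeg)
      show "om (fst z) v w = 0" if w: "w \<in> tangent M (fst z)" for w
        using v form_restrict_apply[OF w, of "om (fst z) v"] by simp
    qed (use v in simp)
  qed
  moreover have "form_restrict (fst z) (om (fst z) (\<lambda>f. - J (fst z) (xi (fst z)) f)) = form_restrict (fst z) (g (fst z) (xi (fst z)))"
    by (rule form_restrict_cong) (simp add: om_g[OF nJxi_t] J_neg[OF Jxi_t] JJ[OF xi_t])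
  ultimately show ?thesis by (simp add: I2_def Z_split E2_def)
qed

lemma I3_Z: "I3 z (Z z) = E3 z"
proof -
  have "form_restrict (fst z) (\<lambda>v. form_restrict (fst z) (g (fst z) (xi (fst z))) (J (fst z) v))
      = form_restrict (fst z) (g (fst z) (\<lambda>f. - J (fst z) (xi (fst z)) f))"
    by (rule form_restrict_cong)
       (simp add: form_restrict_apply[OF J_tangent] g_J_right[OF xi_t] g_neg_left[OF _ Jxi_t])
  then show ?thesis unfolding I3_def I2_Z I1_def E2_split by (simp add: E3_def J_zero[OF p])
qed

lemma gN_Z: "u \<in> tangent N z \<Longrightarrow> gN z (Z z) u = - lam (fst z) (dpi z u)"
  unfolding gN_def Z_split
  by (simp add: g_neg_left[OF dpi_tangent Jxi_t] lam_def g_inv_eq[OF zero_cotangent[OF p] split_props(1)])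

lemma gN_xit: "u \<in> tangent N z \<Longrightarrow> gN z (xit z) u = g (fst z) (xi (fst z)) (dpi z u)"
  unfolding gN_def xit_split
  by (simp add: g_inv_eq[OF zero_cotangent[OF p] split_props(1)])

lemma gN_E2: "u \<in> tangent N z \<Longrightarrow> gN z (E2 z) u = vpart z u (xi (fst z))"
  unfolding gN_def E2_split
  by (simp add: g_zero_left[OF dpi_tangent] g_inv_flat[OF split_props(1) xi_t])

lemma gN_E3: "u \<in> tangent N z \<Longrightarrow> gN z (E3 z) u = vpart z u (\<lambda>f. - J (fst z) (xi (fst z)) f)"
  unfolding gN_def E3_split
  by (simp add: g_zero_left[OF dpi_tangent] g_inv_flat[OF split_props(1) nJxi_t])

private lemma gram:
  "gN z (Z z) (Z z) = - yM (fst z)" "gN z (xit z) (xit z) = - yM (fst z)"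
  "gN z (E2 z) (E2 z) = - yM (fst z)" "gN z (E3 z) (E3 z) = - yM (fst z)"
  "gN z (Z z) (xit z) = 0" "gN z (Z z) (E2 z) = 0" "gN z (Z z) (E3 z) = 0"
  "gN z (xit z) (E2 z) = 0" "gN z (xit z) (E3 z) = 0" "gN z (E2 z) (E3 z) = 0"
  "gN z (xit z) (Z z) = 0" "gN z (E2 z) (Z z) = 0" "gN z (E3 z) (Z z) = 0"
  "gN z (E2 z) (xit z) = 0" "gN z (E3 z) (xit z) = 0" "gN z (E3 z) (E2 z) = 0"
  by (simp_all add: gN_Z[OF Z_tangent] gN_Z[OF xit_tangent] gN_Z[OF E2_tangent] gN_Z[OF E3_tangent]
      gN_xit[OF Z_tangent] gN_xit[OF xit_tangent] gN_xit[OF E2_tangent] gN_xit[OF E3_tangent]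
      gN_E2[OF Z_tangent] gN_E2[OF xit_tangent] gN_E2[OF E2_tangent] gN_E2[OF E3_tangent]
      gN_E3[OF Z_tangent] gN_E3[OF xit_tangent] gN_E3[OF E2_tangent] gN_E3[OF E3_tangent]
      Z_split xit_split E2_split E3_split lam_def yM_def form_restrict_apply[OF xi_t] form_restrict_apply[OF nJxi_t]
      g_neg_right[OF Jxi_t Jxi_t] g_neg_right[OF xi_t Jxi_t] g_neg_left[OF xi_t Jxi_t] g_neg_right[OF nJxi_t Jxi_t]
      g_neg_left[OF Jxi_t Jxi_t] g_zero_right[OF Jxi_t] g_zero_right[OF xi_t]
      g_J[OF xi_t xi_t] g_xi_Jxi[OF p])

text \<open>The general element of \<open>HZ\<close>, nested in \<open>lcomb\<close> because
  tangency and linearity are stated for that form.\<close>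

private definition h4 where
  "h4 a b c d = lcomb 1 (lcomb a (Z z) b (xit z)) 1 (lcomb c (E2 z) d (E3 z))"

private lemma h4_tangent: "h4 a b c d \<in> tangent N z"
  unfolding h4_def by (intro lcomb_tangent atlasN Z_tangent xit_tangent E2_tangent E3_tangent)

private lemma HZ_h4: "HZ z = {h4 a b c d | a b c d. True}"
  unfolding HZ_def I1_Z I2_Z I3_Z h4_def by (simp add: lcomb_def add.assoc)

private lemma gN_h4: "u \<in> tangent N z \<Longrightarrow>
    gN z u (h4 a b c d) = a * gN z u (Z z) + b * gN z u (xit z) + c * gN z u (E2 z) + d * gN z u (E3 z)"
  unfolding h4_def
  by (simp add: gN_lcomb_right lcomb_tangent[OF atlasN] Z_tangent xit_tangent E2_tangent E3_tangent)

private lemma h4_basis: "Z z = h4 1 0 0 0" "xit z = h4 0 1 0 0" "E2 z = h4 0 0 1 0" "E3 z = h4 0 0 0 1"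
  by (simp_all add: h4_def lcomb_def)

private lemma h4_gN: "gN z (h4 a b c d) (Z z) = - a * yM (fst z)" "gN z (h4 a b c d) (xit z) = - b * yM (fst z)"
  "gN z (h4 a b c d) (E2 z) = - c * yM (fst z)" "gN z (h4 a b c d) (E3 z) = - d * yM (fst z)"
  using gN_sym[OF h4_tangent Z_tangent] gN_sym[OF h4_tangent xit_tangent] gN_sym[OF h4_tangent E2_tangent]
    gN_sym[OF h4_tangent E3_tangent]
  by (simp_all add: gN_h4[OF Z_tangent] gN_h4[OF xit_tangent] gN_h4[OF E2_tangent] gN_h4[OF E3_tangent] gram)

text \<open>The four spanning vectors are orthogonal and each has square \<open>- y\<close>. Since y
  is nonzero, the projection exists, is unique, and has coefficients
  \<open>- gN(u, e)/y\<close>.\<close>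

lemma projHZ_props:
  assumes "u \<in> tangent N z" "yM (fst z) \<noteq> 0"
  shows "projHZ z u \<in> HZ z" "projHZ z u \<in> tangent N z"
    "\<And>w. w \<in> HZ z \<Longrightarrow> gN z (lcomb 1 u (- 1) (projHZ z u)) w = 0"
    "u \<in> HZ z \<Longrightarrow> projHZ z u = u"
proof -
  let ?y = "yM (fst z)"
  let ?v = "h4 (- gN z u (Z z) / ?y) (- gN z u (xit z) / ?y) (- gN z u (E2 z) / ?y) (- gN z u (E3 z) / ?y)"
  have diff: "gN z (lcomb 1 u (- 1) v) w = gN z u w - gN z v w" if "v \<in> tangent N z" "w \<in> tangent N z" for v w
    by (simp add: gN_lcomb_left[OF assms(1) that])
  have uniq: "v = ?v" if v: "v \<in> HZ z" "\<And>w. w \<in> HZ z \<Longrightarrow> gN z (lcomb 1 u (- 1) v) w = 0" for v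
  proof -
    obtain a b c d where abcd: "v = h4 a b c d" using v(1) unfolding HZ_h4 by blast
    have HZb: "Z z \<in> HZ z" "xit z \<in> HZ z" "E2 z \<in> HZ z" "E3 z \<in> HZ z"
      unfolding HZ_h4 using h4_basis by blast+
    have "gN z u (Z z) = - a * ?y" "gN z u (xit z) = - b * ?y" "gN z u (E2 z) = - c * ?y" "gN z u (E3 z) = - d * ?y"
      using v(2)[OF HZb(1)] v(2)[OF HZb(2)] v(2)[OF HZb(3)] v(2)[OF HZb(4)]
      unfolding abcd diff[OF h4_tangent Z_tangent] diff[OF h4_tangent xit_tangent]
        diff[OF h4_tangent E2_tangent] diff[OF h4_tangent E3_tangent] h4_gN by simp_all
    then show ?thesis using assms(2) by (simp add: abcd)
  qed
  have ex: "?v \<in> HZ z" "gN z (lcomb 1 u (- 1) ?v) w = 0" if "w \<in> HZ z" for w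
  proof -
    show "?v \<in> HZ z" unfolding HZ_h4 by blast
    obtain a b c d where w: "w = h4 a b c d" using \<open>w \<in> HZ z\<close> unfolding HZ_h4 by blast
    show "gN z (lcomb 1 u (- 1) ?v) w = 0"
      unfolding diff[OF h4_tangent h4_tangent] w gN_h4[OF assms(1)] gN_h4[OF h4_tangent] h4_gN
      using assms(2) by simp
  qed
  have P: "projHZ z u = ?v"
    unfolding projHZ_def
  proof (rule the_equality)
    show "?v \<in> HZ z \<and> (\<forall>w\<in>HZ z. gN z (lcomb 1 u (- 1) ?v) w = 0)"
      using ex unfolding HZ_h4 by blast
  qed (use uniq in blast)
  show "projHZ z u \<in> HZ z" unfolding P HZ_h4 by blast
  show "projHZ z u \<in> tangent N z" unfolding P by (rule h4_tangent)
  show "gN z (lcomb 1 u (- 1) (projHZ z u)) w = 0" if "w \<in> HZ z" for w unfolding P by (rule ex(2)[OF that])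
  show "projHZ z u = u" if u: "u \<in> HZ z"
  proof -
    have "gN z (lcomb 1 u (- 1) u) w = 0" if "w \<in> HZ z" for w
      using that h4_tangent diff[OF assms(1)] unfolding HZ_h4 by auto
    from uniq[OF u this] show ?thesis unfolding P by simp
  qed
qed

lemma xit_HZ: "xit z \<in> HZ z"
  unfolding HZ_h4 using h4_basis by blast

text \<open>A vector of \<open>HZ\<close> has no component in the orthogonal complement, and
  orthogonality removes the projection from the other argument. All values of the deformed metric
  computed later are of this kind.\<close>

lemma gHc_HZ:
  assumes "w \<in> HZ z" "u \<in> tangent N z" "yM (fst z) \<noteq> 0"
  shows "gHc c z w u = fHc c z / (fZc c z)\<^sup>2 * gN z w u"
proof -
  have w: "w \<in> tangent N z" using assms(1) h4_tangent unfolding HZ_h4 by blast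
  note P = projHZ_props[OF assms(2,3)]
  have d: "lcomb 1 u (- 1) (projHZ z u) \<in> tangent N z" by (rule lcomb_tangent[OF atlasN assms(2) P(2)])
  have "gN z (lcomb 1 w (- 1) w) (lcomb 1 u (- 1) (projHZ z u)) = 0"
    by (simp add: gN_lcomb_left[OF w w d])
  moreover have "gN z u w - gN z (projHZ z u) w = 0"
    using P(3)[OF assms(1)] gN_lcomb_left[OF assms(2) P(2) w, of 1 "-1"] by simp
  then have "gN z w (projHZ z u) = gN z w u"
    using gN_sym[OF w assms(2)] gN_sym[OF w P(2)] by simp
  ultimately show ?thesis
    by (simp add: gHc_def projHZ_props(4)[OF w assms(3,1)])
qed

lemma gHc_sym:
  assumes "w \<in> tangent N z" "u \<in> tangent N z" "yM (fst z) \<noteq> 0"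
  shows "gHc c z w u = gHc c z u w"
proof -
  note Pw = projHZ_props(2)[OF assms(1,3)] and Pu = projHZ_props(2)[OF assms(2,3)]
  show ?thesis
    unfolding gHc_def
    using gN_sym[OF lcomb_tangent[OF atlasN assms(1) Pw] lcomb_tangent[OF atlasN assms(2) Pu]] gN_sym[OF Pw Pu]
    by simp
qed

lemma fZ_yM: "fZ z = yM (fst z) / 2" and fH_yM: "fH z = - yM (fst z) / 2"
  by (simp_all add: fZ_def fH_def gram)

text \<open>The form \<open>gN(Z, .)\<close> is minus the pullback of \<open>lam\<close>; exterior
  derivatives commute with pullback, and the derivative of \<open>lam\<close> is
  \<open>2 om\<close>.\<close>

lemma iota_ext_deriv:
  assumes "u \<in> tangent N z" "w \<in> tangent N z"
  shows "ext_deriv1 N iota_Z_gN z u w = - 2 * om (fst z) (dpi z u) (dpi z w)"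
proof -
  obtain V and a k :: "'e \<Rightarrow> 'm \<Rightarrow> real" where V: "fst z \<in> V" "form_expr M V lam Basis a k" by (rule lam_expr[OF p])
  let ?V = "{z \<in> points N. fst z \<in> V}" and ?l = "\<lambda>z u. lam (fst z) (push N M fst z u)"
  have oV: "openin (mtop M) V" using V(2) by (simp add: form_expr_def)
  note oV' = fst_preimage_open[OF oV]
  have zV: "z \<in> ?V" using z V(1) by simp
  note E = form_expr_pullback[OF atlasN atlasM fst_smooth V(2)]
  note c = smooth_fun_const[OF atlasN oV', of "-1"]
  have "ext_deriv1 N iota_Z_gN z u w = ext_deriv1 N (\<lambda>z u. (-1) * ?l z u) z u w"
  proof (rule ext_deriv1_cong[OF atlasN form_expr_scale[OF atlasN E c] zV assms oV' zV])
    fix y v assume "y \<in> ?V" "v \<in> tangent N y"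
    then show "iota_Z_gN y v = (-1) * ?l y v"
      \<comment> \<open>The context fixes \<open>z\<close>, whereas equality of the forms is
        required at all points of a neighbourhood; hence the exported version.\<close>
      using cask.gN_Z[OF cask_axioms, of y v] by (simp add: iota_Z_gN_def dpi_def)
  qed
  also have "\<dots> = - ext_deriv1 N ?l z u w"
    using ext_deriv1_scale[OF atlasN E c zV assms] tangent_const[OF atlasN assms(1), of "-1"]
      tangent_const[OF atlasN assms(2), of "-1"] by simp
  also have "ext_deriv1 N ?l z u w = 2 * om (fst z) (dpi z u) (dpi z w)"
    using ext_deriv1_pullback[OF atlasN atlasM fst_smooth V(2,1) assms]
      ext_deriv_lam[OF dpi_tangent[OF assms(1)] dpi_tangent[OF assms(2)]] by (simp add: dpi_def)
  finally show ?thesis by simp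
qed

text \<open>The summands of \<open>omegaH\<close> contribute \<open>g(xi, .)\<close> and
  \<open>- 2 g(xi, .)\<close>. As \<open>fH = - y/2\<close>, this is the relation between the
  contraction of \<open>omegaH\<close> with \<open>Z\<close> and \<open>- d fH\<close>.\<close>

lemma omegaH_Z:
  assumes "w \<in> tangent N z"
  shows "omegaH z (Z z) w = - g (fst z) (xi (fst z)) (dpi z w)"
proof -
  note dw = dpi_tangent[OF assms]
  have "om (fst z) (\<lambda>f. - J (fst z) (xi (fst z)) f) (dpi z w) = g (fst z) (xi (fst z)) (dpi z w)"
    by (simp add: om_g[OF nJxi_t dw] J_neg[OF Jxi_t] JJ[OF xi_t])
  then show ?thesis
    by (simp add: omegaH_def omega1_def I1_Z gN_xit[OF assms] iota_ext_deriv[OF Z_tangent assms] Z_split)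
qed

text \<open>Here the summands are \<open>lam\<close> and \<open>- 2 lam\<close>.\<close>

lemma omegaH_xit:
  assumes "w \<in> tangent N z"
  shows "omegaH z (xit z) w = - lam (fst z) (dpi z w)"
proof -
  note dw = dpi_tangent[OF assms]
  have "gN z (I1 z (xit z)) w = lam (fst z) (dpi z w)"
    unfolding xit_def I1_hlift[OF z xi_t] gN_def hlift_split[OF z Jxi_t]
    by (simp add: lam_def g_inv_eq[OF zero_cotangent[OF p] split_props(1)[OF assms]])
  then show ?thesis
    by (simp add: omegaH_def omega1_def iota_ext_deriv[OF xit_tangent assms] xit_split om_g[OF xi_t dw] lam_def)
qed

lemma omegaH_zero:
  assumes "w \<in> tangent N z"
  shows "omegaH z (\<lambda>f. 0) w = 0"
proof -
  note dw = dpi_tangent[OF assms]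
  have I: "I1 z (\<lambda>f. 0) = (\<lambda>f. 0)"
    using I1_hlift[OF z zero_t] by (simp add: hlift_zero[OF z] J_zero[OF p])
  have zN: "(\<lambda>f. 0) \<in> tangent N z" by (rule zero_tangent[OF z])
  have d: "dpi z (\<lambda>f. 0) = (\<lambda>f. 0)" using hlift_split(1)[OF z zero_t] by (simp add: hlift_zero[OF z])
  have "gN z (\<lambda>f. 0) w = 0" using gN_lcomb_left[OF zN zN assms, of 0 0] by (simp add: lcomb_def)
  then show ?thesis
    by (simp add: omegaH_def omega1_def I iota_ext_deriv[OF zN assms] d om_g[OF zero_t dw] J_zero[OF p] g_zero_left[OF dw])
qed

end

end

section \<open>Principal circle bundles\<close>

text \<open>Together with \<open>circle_arg\<close> this names the domain and the map of the angular
  charts of \<open>circle_mfd\<close>.\<close>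

definition circle_arc :: "real \<Rightarrow> complex set" where
  "circle_arc \<theta> = sphere 0 1 - {- cis \<theta>}"

definition circle_arg :: "real \<Rightarrow> complex \<Rightarrow> real" where
  "circle_arg \<theta> z = Arg (z * cis (- \<theta>))"

lemma arg_arc:
  assumes "z \<in> circle_arc \<theta>"
  shows "circle_arg \<theta> z \<in> {- pi<..<pi}" "cis (circle_arg \<theta> z + \<theta>) = z"
proof -
  have n: "norm (z * cis (- \<theta>)) = 1" using assms by (auto simp: circle_arc_def norm_mult dist_norm)
  then have nz: "z * cis (- \<theta>) \<noteq> 0" by auto
  have c: "cis (circle_arg \<theta> z) = z * cis (- \<theta>)"
    using cis_Arg[OF nz] n by (simp add: circle_arg_def sgn_div_norm)
  then show z: "cis (circle_arg \<theta> z + \<theta>) = z" by (simp add: cis_mult[symmetric] mult.assoc) (simp add: cis_mult)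
  have "circle_arg \<theta> z \<noteq> pi"
  proof
    assume "circle_arg \<theta> z = pi"
    then have "z = - cis \<theta>" using z by (simp add: cis_mult[symmetric])
    then show False using assms by (simp add: circle_arc_def)
  qed
  then show "circle_arg \<theta> z \<in> {- pi<..<pi}"
    using Arg_bounded[of "z * cis (- \<theta>)"] by (auto simp: circle_arg_def)
qed

lemma arc_arg:
  assumes "t \<in> {- pi<..<pi}"
  shows "circle_arg \<theta> (cis (t + \<theta>)) = t" "cis (t + \<theta>) \<in> circle_arc \<theta>"
proof -
  show 1: "circle_arg \<theta> (cis (t + \<theta>)) = t" using assms by (simp add: circle_arg_def cis_mult Arg_cis)
  have "cis (t + \<theta>) \<noteq> - cis \<theta>"
  proof
    assume "cis (t + \<theta>) = - cis \<theta>"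
    then have "cis (t + \<theta>) = cis (pi + \<theta>)" by (simp add: cis_mult[symmetric])
    then have "t = circle_arg \<theta> (cis (pi + \<theta>))" using 1 by simp
    also have "\<dots> = pi" using Arg_cis[of pi] pi_gt_zero by (simp add: circle_arg_def cis_mult del: cis_pi)
    finally show False using assms by simp
  qed
  then show "cis (t + \<theta>) \<in> circle_arc \<theta>" by (simp add: circle_arc_def)
qed

lemma arg_image_open:
  assumes "openin (top_of_set (sphere 0 1)) A" "A \<subseteq> circle_arc \<theta>"
  shows "open (circle_arg \<theta> ` A)"
proof -
  obtain G where G: "open G" "A = sphere 0 1 \<inter> G" using assms(1) by (auto simp: openin_open)
  have "circle_arg \<theta> ` A = {- pi<..<pi} \<inter> (\<lambda>t. cis (t + \<theta>)) -` G"
  proof (intro set_eqI iffI)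
    fix t assume "t \<in> circle_arg \<theta> ` A"
    then obtain z where z: "z \<in> A" "t = circle_arg \<theta> z" by auto
    show "t \<in> {- pi<..<pi} \<inter> (\<lambda>t. cis (t + \<theta>)) -` G"
      using arg_arc[of z \<theta>] z assms(2) G(2) by auto
  next
    fix t assume t: "t \<in> {- pi<..<pi} \<inter> (\<lambda>t. cis (t + \<theta>)) -` G"
    then have "cis (t + \<theta>) \<in> A" by (simp add: G(2))
    then show "t \<in> circle_arg \<theta> ` A" using arc_arg(1)[of t \<theta>] t by (metis IntD1 image_eqI)
  qed
  also have "open \<dots>"
    by (rule continuous_open_preimage[OF _ open_greaterThanLessThan G(1)]) (intro continuous_intros)
  finally show ?thesis .
qed

text \<open>A chart of the base and an angular chart, transported by a local trivialisation. In
  these coordinates small rotations are translations of the last coordinate, which makes the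
  generator of the action accessible.\<close>

lemma circle_bundle_coords:
  fixes P :: "('p, 'f::euclidean_space) mfd" and B :: "('b, 'k::euclidean_space) mfd"
  assumes pcb: "principal_circle_bundle P B pr act" and x0: "x0 \<in> points P"
  obtains UB and \<phi> :: "'b \<Rightarrow> 'k" and UP a where "(UB, \<phi>) \<in> charts B"
    "coords P UP (\<lambda>x. (\<phi> (pr x), a x))" "x0 \<in> UP" "\<And>x. x \<in> UP \<Longrightarrow> pr x \<in> UB"
    "\<And>x. x \<in> UP \<Longrightarrow> \<exists>e>0. \<forall>t. \<bar>t\<bar> < e \<longrightarrow> act (cis t) x \<in> UP \<and> a (act (cis t) x) = a x + (t::real)"
proof -
  have at: "atlas P" "atlas B"
    using pcb by (auto simp: principal_circle_bundle_def intro: smooth_manifold_imp_atlas)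
  have sm: "smooth_map P B pr" and sa: "smooth_action circle_mfd P act"
    using pcb by (simp_all add: principal_circle_bundle_def)
  obtain U0 and \<phi> :: "'b \<Rightarrow> 'k" where U0: "(U0, \<phi>) \<in> charts B" "coords B U0 \<phi>" "pr x0 \<in> U0"
    by (rule atlas_chart_at[OF at(2) smooth_map_points[OF sm x0]])
  have "\<exists>V \<Psi>. openin (mtop B) V \<and> pr x0 \<in> V \<and>
      diffeo (restrict_mfd P {x \<in> points P. pr x \<in> V}) (prod_mfd (restrict_mfd B V) circle_mfd) \<Psi> \<and>
      (\<forall>x\<in>points P. pr x \<in> V \<longrightarrow> fst (\<Psi> x) = pr x \<and>
         (\<forall>z\<in>points circle_mfd. \<Psi> (act z x) = (pr x, z * snd (\<Psi> x))))"
    using pcb smooth_map_points[OF sm x0] by (simp add: principal_circle_bundle_def)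
  then obtain V \<Psi> where V: "openin (mtop B) V" "pr x0 \<in> V"
    and dif: "diffeo (restrict_mfd P {x \<in> points P. pr x \<in> V}) (prod_mfd (restrict_mfd B V) circle_mfd) \<Psi>"
    and \<Psi>: "\<And>x. x \<in> points P \<Longrightarrow> pr x \<in> V \<Longrightarrow> fst (\<Psi> x) = pr x"
    "\<And>x z. x \<in> points P \<Longrightarrow> pr x \<in> V \<Longrightarrow> z \<in> points circle_mfd \<Longrightarrow> \<Psi> (act z x) = (pr x, z * snd (\<Psi> x))"
    by (elim exE conjE) (rule that, assumption+, simp_all)
  define PV where "PV = {x \<in> points P. pr x \<in> V}"
  define RP where "RP = restrict_mfd P PV"
  define Q where "Q = prod_mfd (restrict_mfd B V) circle_mfd"
  define \<Psi>' where "\<Psi>' = inv_into PV \<Psi>"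
  have oPV: "openin (mtop P) PV" unfolding PV_def by (rule smooth_map_preimage_open[OF sm V(1)])
  have pRP: "points RP = PV" using openin_subset[OF oPV] by (auto simp: RP_def restrict_mfd_def)
  have pc: "points circle_mfd = sphere 0 1" by (simp add: circle_mfd_def)
  have pQ: "points Q = V \<times> sphere 0 1"
    using openin_subset[OF V(1)] by (auto simp: Q_def prod_mfd_def restrict_mfd_def circle_mfd_def)
  have d: "smooth_map RP Q \<Psi>" "bij_betw \<Psi> PV (V \<times> sphere 0 1)" "smooth_map Q RP \<Psi>'"
    using dif[folded PV_def, folded RP_def Q_def] by (simp_all add: diffeo_def pRP pQ \<Psi>'_def)
  have \<Psi>_in: "\<Psi> x \<in> V \<times> sphere 0 1" if "x \<in> PV" for x using bij_betwE[OF d(2)] that by blast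
  have inv1: "\<Psi>' (\<Psi> x) = x" if "x \<in> PV" for x
    unfolding \<Psi>'_def by (rule inv_into_f_f[OF bij_betw_imp_inj_on[OF d(2)] that])
  have inv2: "\<Psi> (\<Psi>' y) = y" "\<Psi>' y \<in> PV" if "y \<in> V \<times> sphere 0 1" for y
    using that bij_betw_imp_surj_on[OF d(2)] by (auto simp: \<Psi>'_def intro: f_inv_into_f inv_into_into)
  have x0V: "x0 \<in> PV" using x0 V(2) by (simp add: PV_def)
  have prPV: "fst (\<Psi> x) = pr x" "pr x \<in> V" "x \<in> points P" if "x \<in> PV" for x
    using \<Psi>(1) that by (simp_all add: PV_def)
  \<comment> \<open>The arc is centred at the fibre coordinate of \<open>x0\<close>, so that
    \<open>x0\<close> gets angle 0, opposite to the removed point.\<close>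
  define \<theta> where "\<theta> = Arg (snd (\<Psi> x0))"
  have sx0: "norm (snd (\<Psi> x0)) = 1" using \<Psi>_in[OF x0V] by (auto simp: mem_Times_iff)
  then have "snd (\<Psi> x0) \<noteq> 0" by auto
  from cis_Arg[OF this] sx0 have c\<theta>: "cis \<theta> = snd (\<Psi> x0)" by (simp add: \<theta>_def sgn_div_norm)
  define UB where "UB = U0 \<inter> V"
  define Ob where "Ob = UB \<times> circle_arc \<theta>"
  define mp where "mp = map_prod \<phi> (circle_arg \<theta>)"
  define UP where "UP = {x \<in> PV. \<Psi> x \<in> Ob}"
  define \<kappa> where "\<kappa> x = (\<phi> (pr x), circle_arg \<theta> (snd (\<Psi> x)))" for x
  have \<kappa>mp: "\<kappa> x = mp (\<Psi> x)" if "x \<in> PV" for x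
    using prPV(1)[OF that] by (simp add: \<kappa>_def mp_def map_prod_def split_beta)
  have UPV: "UP \<subseteq> PV" by (auto simp: UP_def)
  have ObQ: "Ob \<subseteq> V \<times> sphere 0 1" by (auto simp: Ob_def UB_def circle_arc_def)
  have inj_mp: "inj_on mp Ob"
  proof (rule inj_onI)
    fix y w assume y: "y \<in> Ob" and w: "w \<in> Ob" and eq: "mp y = mp w"
    have "fst y = fst w" using inj_onD[OF coordsD(2)[OF U0(2)], of "fst y" "fst w"] y w eq
      by (auto simp: Ob_def UB_def mp_def map_prod_def split_beta)
    moreover have "circle_arg \<theta> (snd y) = circle_arg \<theta> (snd w)" "snd y \<in> circle_arc \<theta>" "snd w \<in> circle_arc \<theta>"
      using y w eq by (auto simp: Ob_def mp_def map_prod_def split_beta)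
    then have "snd y = snd w" using arg_arc(2) by metis
    ultimately show "y = w" by (simp add: prod_eq_iff)
  qed
  have chQ: "(Ob, mp) \<in> charts Q"
  proof -
    have "(UB, \<phi>) \<in> charts (restrict_mfd B V)" using U0(1) by (auto simp: restrict_mfd_def UB_def)
    moreover have "(circle_arc \<theta>, circle_arg \<theta>) \<in> charts circle_mfd"
      by (auto simp: circle_mfd_def circle_arc_def circle_arg_def[abs_def])
    ultimately show ?thesis by (auto simp: Q_def prod_mfd_def Ob_def mp_def)
  qed
  have oUB: "openin (mtop B) UB" unfolding UB_def by (rule openin_Int[OF coordsD(1)[OF U0(2)] V(1)])
  have oarc: "openin (top_of_set (sphere 0 1)) (circle_arc \<theta>)"
    unfolding circle_arc_def by (simp add: openin_open_eq openin_diff closedin_closed_eq)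
  have topQ: "mtop Q = prod_topology (subtopology (mtop B) V) (top_of_set (sphere 0 1))"
    by (simp add: Q_def prod_mfd_def restrict_mfd_def circle_mfd_def)
  have oOb: "openin (mtop Q) Ob"
    unfolding topQ Ob_def openin_prod_Times_iff
    using oUB oarc openin_open_subtopology[OF V(1), of UB] by (auto simp: UB_def)
  have RPopen: "openin (mtop RP) W \<longleftrightarrow> openin (mtop P) W" if "W \<subseteq> PV" for W
    using openin_open_subtopology[OF oPV, of W] that by (simp add: RP_def restrict_mfd_def)
  have "openin (mtop RP) {x \<in> points RP. \<Psi> x \<in> Ob}" by (rule smooth_map_preimage_open[OF d(1) oOb])
  then have oUP: "openin (mtop P) UP" using RPopen[OF UPV] by (simp add: pRP UP_def)
  have inj\<kappa>: "inj_on \<kappa> UP"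
  proof (rule inj_onI)
    fix x y assume x: "x \<in> UP" and y: "y \<in> UP" and eq: "\<kappa> x = \<kappa> y"
    have "\<Psi> x = \<Psi> y"
      by (rule inj_onD[OF inj_mp]) (use x y eq \<kappa>mp UPV in \<open>auto simp: UP_def\<close>)
    then show "x = y" using inj_onD[OF bij_betw_imp_inj_on[OF d(2)]] x y UPV by blast
  qed
  have trans1: "smooth_on (\<psi> ` (UP \<inter> A)) (\<kappa> \<circ> inv_into A \<psi>)" if A: "(A, \<psi>) \<in> charts P" for A \<psi>
  proof -
    note cA = atlas_chart[OF at(1) A]
    have "(A \<inter> PV, \<psi>) \<in> charts RP" using A by (auto simp: RP_def restrict_mfd_def)
    from smooth_map_charts[OF d(1) this chQ]
    have s: "smooth_on (\<psi> ` (A \<inter> PV \<inter> \<Psi> -` Ob)) (mp \<circ> \<Psi> \<circ> inv_into (A \<inter> PV) \<psi>)" .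
    have eq: "A \<inter> PV \<inter> \<Psi> -` Ob = UP \<inter> A" by (auto simp: UP_def)
    have o: "open (\<psi> ` (UP \<inter> A))" using coords_open[OF cA oUP] by (simp add: Int_commute)
    show ?thesis
    proof (rule smooth_on_cong[OF s[unfolded eq] o])
      fix y assume "y \<in> \<psi> ` (UP \<inter> A)"
      then obtain x where x: "x \<in> UP" "x \<in> A" "y = \<psi> x" by auto
      have xPV: "x \<in> A \<inter> PV" using x UPV by blast
      have "inv_into (A \<inter> PV) \<psi> y = x"
        using inv_into_f_f[OF inj_on_subset[OF coordsD(2)[OF cA]] xPV] x(3) by simp
      then show "(\<kappa> \<circ> inv_into A \<psi>) y = (mp \<circ> \<Psi> \<circ> inv_into (A \<inter> PV) \<psi>) y"
        using coords_inv[OF cA x(2)] x(3) \<kappa>mp[of x] xPV by simp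
    qed
  qed
  \<comment> \<open>\<open>\<Psi>\<close> is open because its inverse is continuous, and
    \<open>mp\<close> because it maps small rectangles of the product topology to open
    rectangles.\<close>
  have \<kappa>open: "open (\<kappa> ` W)" if W: "W \<subseteq> UP" "openin (mtop P) W" for W
  proof -
    have WPV: "W \<subseteq> PV" using W(1) UPV by blast
    have \<Psi>W: "\<Psi> ` W = {y \<in> points Q. \<Psi>' y \<in> W}"
    proof (intro set_eqI iffI)
      fix y assume "y \<in> \<Psi> ` W"
      then show "y \<in> {y \<in> points Q. \<Psi>' y \<in> W}" using \<Psi>_in inv1 WPV by (auto simp: pQ)
    next
      fix y assume "y \<in> {y \<in> points Q. \<Psi>' y \<in> W}"
      then have "\<Psi>' y \<in> W" "\<Psi> (\<Psi>' y) = y" using inv2(1)[of y] by (simp_all add: pQ)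
      then show "y \<in> \<Psi> ` W" by (metis image_eqI)
    qed
    have oR: "openin (mtop RP) W" using RPopen[OF WPV] W(2) by simp
    have oQ: "openin (mtop Q) (\<Psi> ` W)"
      unfolding \<Psi>W by (rule smooth_map_preimage_open[OF d(3) oR])
    have sub: "\<Psi> ` W \<subseteq> Ob" using W(1) by (auto simp: UP_def)
    have eq: "\<kappa> ` W = mp ` (\<Psi> ` W)" using \<kappa>mp WPV by (force simp: image_iff)
    show ?thesis
      unfolding eq
    proof (subst open_subopen, rule ballI)
      fix y assume "y \<in> mp ` (\<Psi> ` W)"
      then obtain b z where bz: "(b, z) \<in> \<Psi> ` W" "y = mp (b, z)" by auto
      from oQ[unfolded topQ openin_prod_topology_alt] bz(1)
      have "\<exists>A C. openin (subtopology (mtop B) V) A \<and> openin (top_of_set (sphere 0 1)) C \<and>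
          b \<in> A \<and> z \<in> C \<and> A \<times> C \<subseteq> \<Psi> ` W" by simp
      then obtain A C where AC: "openin (subtopology (mtop B) V) A" "openin (top_of_set (sphere 0 1)) C"
        "b \<in> A" "z \<in> C" "A \<times> C \<subseteq> \<Psi> ` W"
        by (elim exE conjE) (rule that)
      have AU: "A \<subseteq> U0" "C \<subseteq> circle_arc \<theta>" using AC(3-5) sub by (auto simp: Ob_def UB_def)
      have "openin (mtop B) A" using AC(1) openin_open_subtopology[OF V(1)] by blast
      then have "open (\<phi> ` A)" using coordsD(3)[OF U0(2) AU(1)] by simp
      then have "open (\<phi> ` A \<times> circle_arg \<theta> ` C)" by (rule open_Times[OF _ arg_image_open[OF AC(2) AU(2)]])
      moreover have "y \<in> \<phi> ` A \<times> circle_arg \<theta> ` C" using AC(3,4) by (simp add: bz(2) mp_def)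
      moreover have "\<phi> ` A \<times> circle_arg \<theta> ` C \<subseteq> mp ` (\<Psi> ` W)"
        using image_mono[OF AC(5), of mp] by (simp add: mp_def map_prod_surj_on[OF refl refl])
      ultimately show "\<exists>T. open T \<and> y \<in> T \<and> T \<subseteq> mp ` (\<Psi> ` W)" by blast
    qed
  qed
  have trans2: "smooth_on (\<kappa> ` (UP \<inter> A)) (\<psi> \<circ> inv_into UP \<kappa>)" if A: "(A, \<psi>) \<in> charts P" for A \<psi>
  proof -
    note cA = atlas_chart[OF at(1) A]
    have "(A \<inter> PV, \<psi>) \<in> charts RP" using A by (auto simp: RP_def restrict_mfd_def)
    from smooth_map_charts[OF d(3) chQ this]
    have s: "smooth_on (mp ` (Ob \<inter> \<Psi>' -` (A \<inter> PV))) (\<psi> \<circ> \<Psi>' \<circ> inv_into Ob mp)" .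
    have eq1: "\<Psi> ` (UP \<inter> A) = Ob \<inter> \<Psi>' -` (A \<inter> PV)"
    proof (intro set_eqI iffI)
      fix y assume "y \<in> \<Psi> ` (UP \<inter> A)"
      then obtain x where x: "x \<in> UP" "x \<in> A" "y = \<Psi> x" by auto
      then show "y \<in> Ob \<inter> \<Psi>' -` (A \<inter> PV)" using inv1[of x] UPV by (auto simp: UP_def)
    next
      fix y assume y: "y \<in> Ob \<inter> \<Psi>' -` (A \<inter> PV)"
      then have "\<Psi> (\<Psi>' y) = y" using inv2(1)[of y] ObQ by blast
      moreover have "\<Psi>' y \<in> UP \<inter> A" using y calculation by (simp add: UP_def)
      ultimately show "y \<in> \<Psi> ` (UP \<inter> A)" by (metis image_eqI)
    qed
    have eq: "mp ` (Ob \<inter> \<Psi>' -` (A \<inter> PV)) = \<kappa> ` (UP \<inter> A)"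
      unfolding eq1[symmetric] image_image using \<kappa>mp UPV by (intro image_cong) auto
    have o: "open (\<kappa> ` (UP \<inter> A))"
      by (rule \<kappa>open[OF _ openin_Int[OF oUP coordsD(1)[OF cA]]]) simp
    show ?thesis
    proof (rule smooth_on_cong[OF s[unfolded eq] o])
      fix y assume "y \<in> \<kappa> ` (UP \<inter> A)"
      then obtain x where x: "x \<in> UP" "x \<in> A" "y = \<kappa> x" by auto
      have "inv_into UP \<kappa> y = x" using inv_into_f_f[OF inj\<kappa> x(1)] x(3) by simp
      moreover have "inv_into Ob mp y = \<Psi> x"
        using inv_into_f_f[OF inj_mp, of "\<Psi> x"] x UPV \<kappa>mp[of x] by (auto simp: UP_def)
      ultimately show "(\<psi> \<circ> inv_into UP \<kappa>) y = (\<psi> \<circ> \<Psi>' \<circ> inv_into Ob mp) y"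
        using inv1[of x] x(1) UPV by auto
    qed
  qed
  have "coords P UP \<kappa>"
    unfolding coords_def
  proof (intro conjI allI impI ballI)
    show "openin (mtop P) UP" "inj_on \<kappa> UP" by fact+
    show "openin (mtop P) W = open (\<kappa> ` W)" if W: "W \<subseteq> UP" for W
    proof
      show "open (\<kappa> ` W)" if "openin (mtop P) W" by (rule \<kappa>open[OF W that])
      assume o: "open (\<kappa> ` W)"
      show "openin (mtop P) W"
      proof (subst openin_subopen, rule ballI)
        fix x assume x: "x \<in> W"
        then have "x \<in> points P" using W openin_subset[OF oUP] by blast
        then obtain A \<psi> where A: "(A, \<psi>) \<in> charts P" "coords P A \<psi>" "x \<in> A" by (rule atlas_chart_at[OF at(1)])
        let ?D = "\<psi> ` (UP \<inter> A)"
        have oD: "open ?D" using coords_open[OF A(2) oUP] by (simp add: Int_commute)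
        have "\<psi> ` (W \<inter> A) = ?D \<inter> (\<kappa> \<circ> inv_into A \<psi>) -` (\<kappa> ` W)"
        proof (intro set_eqI iffI)
          fix y assume "y \<in> \<psi> ` (W \<inter> A)"
          then show "y \<in> ?D \<inter> (\<kappa> \<circ> inv_into A \<psi>) -` (\<kappa> ` W)" using W coords_inv[OF A(2)] by auto
        next
          fix y assume "y \<in> ?D \<inter> (\<kappa> \<circ> inv_into A \<psi>) -` (\<kappa> ` W)"
          then obtain q where q: "q \<in> UP" "q \<in> A" "y = \<psi> q" "\<kappa> q \<in> \<kappa> ` W"
            using coords_inv[OF A(2)] by auto
          then obtain w where w: "w \<in> W" "\<kappa> q = \<kappa> w" by blast
          have "q = w" using inj_onD[OF inj\<kappa> w(2) q(1)] w(1) W by blast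
          then show "y \<in> \<psi> ` (W \<inter> A)" using q w by blast
        qed
        also have "open \<dots>"
          by (rule continuous_open_preimage[OF smooth_on_imp_continuous_on[OF trans1[OF A(1)]] oD o])
        finally have "openin (mtop P) (W \<inter> A)" using coordsD(3)[OF A(2), of "W \<inter> A"] by simp
        then show "\<exists>T. openin (mtop P) T \<and> x \<in> T \<and> T \<subseteq> W" using x A(3) by blast
      qed
    qed
    fix c assume "c \<in> charts P"
    then show "case c of (V, \<psi>) \<Rightarrow> smooth_on (\<psi> ` (UP \<inter> V)) (\<kappa> \<circ> inv_into V \<psi>) \<and>
        smooth_on (\<kappa> ` (UP \<inter> V)) (\<psi> \<circ> inv_into UP \<kappa>)"
      using trans1 trans2 by (simp add: split_beta)
  qed
  moreover have "x0 \<in> UP"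
    using x0V V(2) U0(3) arc_arg(2)[of 0 \<theta>] c\<theta> prPV(1)[OF x0V] by (simp add: UP_def Ob_def UB_def mem_Times_iff)
  moreover have "pr x \<in> U0" if "x \<in> UP" for x
    using that prPV(1)[of x] UPV by (auto simp: UP_def Ob_def UB_def mem_Times_iff)
  moreover have "\<exists>e>0. \<forall>t. \<bar>t\<bar> < e \<longrightarrow> act (cis t) x \<in> UP \<and> circle_arg \<theta> (snd (\<Psi> (act (cis t) x))) = circle_arg \<theta> (snd (\<Psi> x)) + t"
    if x: "x \<in> UP" for x
  proof (intro exI conjI allI impI)
    let ?s = "circle_arg \<theta> (snd (\<Psi> x))"
    have xPV: "x \<in> PV" using x UPV by blast
    have z: "snd (\<Psi> x) \<in> circle_arc \<theta>" using x by (auto simp: UP_def Ob_def mem_Times_iff)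
    have s: "?s \<in> {- pi<..<pi}" "cis (?s + \<theta>) = snd (\<Psi> x)" by (rule arg_arc[OF z])+
    \<comment> \<open>The witness is the distance of the angle of \<open>x\<close> from the ends of
      the interval; smaller rotations cannot leave the arc.\<close>
    show "0 < pi - \<bar>?s\<bar>" using s(1) by auto
    fix t assume "\<bar>t\<bar> < pi - \<bar>?s\<bar>"
    then have st: "?s + t \<in> {- pi<..<pi}" by auto
    have \<Psi>a: "\<Psi> (act (cis t) x) = (pr x, cis t * snd (\<Psi> x))"
      by (rule \<Psi>(2)) (use prPV[OF xPV] pc in auto)
    have "cis t * snd (\<Psi> x) = cis ((?s + t) + \<theta>)"
      by (subst s(2)[symmetric]) (simp add: cis_mult algebra_simps)
    with \<Psi>a have \<Psi>a': "\<Psi> (act (cis t) x) = (pr x, cis ((?s + t) + \<theta>))" by simp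
    have "(cis t, x) \<in> points (prod_mfd circle_mfd P)" using prPV(3)[OF xPV] by (simp add: prod_mfd_def pc)
    from smooth_map_points[OF _ this] sa have "act (cis t) x \<in> points P"
      by (fastforce simp: smooth_action_def)
    moreover have "pr (act (cis t) x) = pr x"
      using pcb prPV(3)[OF xPV] pc by (simp add: principal_circle_bundle_def)
    ultimately have "act (cis t) x \<in> PV" using prPV(2)[OF xPV] by (simp add: PV_def)
    then show "act (cis t) x \<in> UP"
      using \<Psi>a' arc_arg(2)[OF st, of \<theta>] x prPV(1)[OF xPV] by (auto simp: UP_def Ob_def mem_Times_iff)
    show "circle_arg \<theta> (snd (\<Psi> (act (cis t) x))) = ?s + t" using \<Psi>a' arc_arg(1)[OF st, of \<theta>] by simp
  qed
  ultimately show thesis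
    using that[OF U0(1), of UP "\<lambda>x. circle_arg \<theta> (snd (\<Psi> x))"] by (simp add: \<kappa>_def[abs_def])
qed

section \<open>Related vector fields and flow quotients\<close>

text \<open>The naturality of brackets, needed twice: with \<open>pr\<close> to find brackets on the
  twist bundle from those on \<open>N\<close>, and with \<open>q\<close> to carry them to the
  quotient.\<close>

lemma related_lie_bracket:
  assumes at: "atlas P" "atlas B" and F: "smooth_map P B F"
    and A: "vfield_on P (points P) A" "vfield_on P (points P) A'"
    and Y: "vfield_on B (points B) Y" "vfield_on B (points B) Y'"
    and rel: "\<And>x. x \<in> points P \<Longrightarrow> push P B F x (A x) = Y (F x)"
      "\<And>x. x \<in> points P \<Longrightarrow> push P B F x (A' x) = Y' (F x)"
    and x: "x \<in> points P"
  shows "push P B F x (lie_bracket P A A' x) = lie_bracket B Y Y' (F x)"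
proof
  fix f
  show "push P B F x (lie_bracket P A A' x) f = lie_bracket B Y Y' (F x) f"
  proof (cases "smooth_near B (F x) f")
    case False
    then show ?thesis by (simp add: push_def lie_bracket_def)
  next
    case True
    obtain W where W: "openin (mtop B) W" "F x \<in> W" "\<And>z. z \<in> W \<Longrightarrow> smooth_near B z f"
      by (rule smooth_near_nbhd[OF True]) (rule that)
    let ?D = "{y \<in> points P. F y \<in> W}"
    have oD: "openin (mtop P) ?D" by (rule smooth_map_preimage_open[OF F W(1)])
    have xD: "x \<in> ?D" using x W(2) by simp
    have step: "C x (\<lambda>y. C' y (f \<circ> F)) = V (F x) (\<lambda>z. V' z f)"
      if C: "vfield_on P (points P) C" and V': "vfield_on B (points B) V'"
        and r: "\<And>x. x \<in> points P \<Longrightarrow> push P B F x (C x) = V (F x)"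
        "\<And>x. x \<in> points P \<Longrightarrow> push P B F x (C' x) = V' (F x)" for C C' V V'
    proof -
      have "C x (\<lambda>y. C' y (f \<circ> F)) = C x ((\<lambda>z. V' z f) \<circ> F)"
      proof (rule tangent_germ[OF at(1) vfield_tangent[OF C x] oD xD])
        fix y assume y: "y \<in> ?D"
        then have "push P B F y (C' y) f = C' y (f \<circ> F)" using W(3)[of "F y"] by (simp add: push_def)
        then show "C' y (f \<circ> F) = ((\<lambda>z. V' z f) \<circ> F) y" using r(2)[of y] y by simp
      qed
      also have "\<dots> = push P B F x (C x) (\<lambda>z. V' z f)"
        using vfield_smooth_near[OF V' smooth_map_points[OF F x] True] by (simp add: push_def)
      finally show ?thesis using r(1)[OF x] by simp
    qed
    have "smooth_near P x (f \<circ> F)" by (rule smooth_map_smooth_near[OF at F x True])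
    then show ?thesis
      by (simp only: lie_bracket_def push_def True if_True
          step[OF A(1) Y(2) rel] step[OF A(2) Y(1) rel(2) rel(1)])
  qed
qed

lemma flow_quotientD:
  assumes "flow_quotient P X B q"
  shows "complete_vfield P X" "atlas B" "smooth_map P B q" "q ` points P = points B"
    "\<And>x. x \<in> points P \<Longrightarrow> push P B q x ` tangent P x = tangent B (q x)"
    "\<And>x y. x \<in> points P \<Longrightarrow> y \<in> points P \<Longrightarrow>
      q x = q y \<longleftrightarrow> (\<exists>\<gamma> t. integral_curve P X \<gamma> \<and> \<gamma> 0 = x \<and> \<gamma> t = y)"
  using assms by (simp_all add: flow_quotient_def smooth_manifold_imp_atlas)

lemma integral_curve_points: "integral_curve P X \<gamma> \<Longrightarrow> \<gamma> t \<in> points P"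
  by (auto simp: integral_curve_def continuous_map_def)

lemma integral_curve_deriv:
  "integral_curve P X \<gamma> \<Longrightarrow> smooth_near P (\<gamma> t) f \<Longrightarrow>
    ((\<lambda>s. f (\<gamma> s)) has_real_derivative X (\<gamma> t) f) (at t)"
  by (simp add: integral_curve_def)

lemma flow_quotient_curve:
  assumes "flow_quotient P X B q" "integral_curve P X \<gamma>"
  shows "q (\<gamma> t) = q (\<gamma> 0)"
proof -
  have p: "\<gamma> 0 \<in> points P" "\<gamma> t \<in> points P" by (rule integral_curve_points[OF assms(2)])+
  show ?thesis using flow_quotientD(6)[OF assms(1) p] assms(2) by metis
qed

lemma flow_quotient_push:
  assumes Q: "flow_quotient P X B q" and at: "atlas P" and x: "x \<in> points P"
  shows "push P B q x (X x) = (\<lambda>f. 0)"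
proof
  fix f
  obtain \<gamma> where \<gamma>: "\<gamma> 0 = x" "integral_curve P X \<gamma>"
    using flow_quotientD(1)[OF Q] x by (auto simp: complete_vfield_def)
  show "push P B q x (X x) f = 0"
  proof (cases "smooth_near B (q x) f")
    case False
    then show ?thesis by (simp add: push_def)
  next
    case True
    have "smooth_near P x (f \<circ> q)"
      by (rule smooth_map_smooth_near[OF at flow_quotientD(2,3)[OF Q] x True])
    then have "((\<lambda>s. (f \<circ> q) (\<gamma> s)) has_real_derivative X x (f \<circ> q)) (at 0)"
      using integral_curve_deriv[OF \<gamma>(2), of 0 "f \<circ> q"] \<gamma>(1) by simp
    moreover have "(\<lambda>s. (f \<circ> q) (\<gamma> s)) = (\<lambda>s. f (q x))"
      using flow_quotient_curve[OF Q \<gamma>(2)] \<gamma>(1) by auto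
    ultimately have "X x (f \<circ> q) = 0" using DERIV_unique[OF _ DERIV_const] by force
    then show ?thesis by (simp add: push_def)
  qed
qed

text \<open>The fibres of \<open>q\<close> are single flow lines, so vanishing of \<open>X G\<close>
  suffices.\<close>

lemma flow_quotient_const:
  assumes Q: "flow_quotient P X B q"
    and G: "smooth_fun P {x \<in> points P. q x \<in> V} G"
      "\<And>x. x \<in> points P \<Longrightarrow> q x \<in> V \<Longrightarrow> X x G = 0"
    and x: "x \<in> points P" "x' \<in> points P" "q x = q x'" "q x \<in> V"
  shows "G x = G x'"
proof -
  obtain \<gamma> t where \<gamma>: "integral_curve P X \<gamma>" "\<gamma> 0 = x" "\<gamma> t = x'"
    using flow_quotientD(6)[OF Q x(1,2)] x(3) by auto
  have "((\<lambda>s. G (\<gamma> s)) has_real_derivative 0) (at s)" for s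
  proof -
    have p: "\<gamma> s \<in> points P" "q (\<gamma> s) \<in> V"
      using integral_curve_points[OF \<gamma>(1)] flow_quotient_curve[OF Q \<gamma>(1), of s] \<gamma>(2) x(4) by simp_all
    then have "smooth_near P (\<gamma> s) G" by (intro smooth_fun_imp_near[OF G(1)]) simp
    from integral_curve_deriv[OF \<gamma>(1) this] G(2)[OF p] show ?thesis by simp
  qed
  then have "G (\<gamma> 0) = G (\<gamma> t)" by (rule DERIV_isconst_all[OF allI])
  then show ?thesis using \<gamma> by simp
qed

text \<open>Near each point the descended function is \<open>G\<close> composed with a local section
  of the submersion \<open>q\<close>.\<close>

lemma flow_quotient_smooth_fun:
  assumes Q: "flow_quotient P X B q" and at: "atlas P" and V: "openin (mtop B) V"
    and G: "smooth_fun P {x \<in> points P. q x \<in> V} G"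
      "\<And>x. x \<in> points P \<Longrightarrow> q x \<in> V \<Longrightarrow> Gb (q x) = G x"
  shows "smooth_fun B V Gb"
proof (rule smooth_fun_local[OF flow_quotientD(2)[OF Q]])
  fix y assume y: "y \<in> V"
  then have "y \<in> q ` points P" using openin_subset[OF V] flow_quotientD(4)[OF Q] by blast
  then obtain x where x: "x \<in> points P" "y = q x" by auto
  obtain T \<sigma> where T: "openin (mtop B) T" "q x \<in> T" "\<sigma> ` T \<subseteq> points P" "\<And>y. y \<in> T \<Longrightarrow> q (\<sigma> y) = y"
    and sm: "\<And>A W G. smooth_fun P W G \<Longrightarrow> openin (mtop B) A \<Longrightarrow> A \<subseteq> T \<Longrightarrow> \<sigma> ` A \<subseteq> W \<Longrightarrow> smooth_fun B A (G \<circ> \<sigma>)"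
    by (rule submersion_section[OF at flow_quotientD(2,3)[OF Q] x(1) flow_quotientD(5)[OF Q x(1)]]) (rule that)
  have o: "openin (mtop B) (V \<inter> T)" by (rule openin_Int[OF V T(1)])
  have "smooth_fun B (V \<inter> T) (G \<circ> \<sigma>)"
    by (rule sm[OF G(1) o]) (use T in auto)
  then have "smooth_fun B (V \<inter> T) Gb"
  proof (rule smooth_fun_cong[OF flow_quotientD(2)[OF Q]])
    fix z assume z: "z \<in> V \<inter> T"
    then have "\<sigma> z \<in> points P" "q (\<sigma> z) = z" using T(3,4) by auto
    then show "Gb z = (G \<circ> \<sigma>) z" using G(2)[of "\<sigma> z"] z by simp
  qed
  then show "\<exists>T'. y \<in> T' \<and> T' \<subseteq> V \<and> smooth_fun B T' Gb" using y x(2) T(2) by (intro exI[of _ "V \<inter> T"]) simp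
qed

text \<open>The value is taken from an arbitrary point of the fibre; \<open>descended_vfield\<close>
  shows that the choice does not matter when the field commutes with the flow.\<close>

definition descended :: "('p, 'f::euclidean_space) mfd \<Rightarrow> ('b, 'h::euclidean_space) mfd \<Rightarrow> ('p \<Rightarrow> 'b) \<Rightarrow>
    ('p \<Rightarrow> 'p tv) \<Rightarrow> 'b \<Rightarrow> 'b tv" where
  "descended P B q A y = (let x = inv_into (points P) q y in push P B q x (A x))"

text \<open>Lifted functions \<open>h \<circ> q\<close> are invariant under X. If A commutes with X
  then \<open>A (h \<circ> q)\<close> is invariant too, hence constant on fibres and smooth on the
  quotient.\<close>

lemma descended_vfield:
  fixes P :: "('p, 'f::euclidean_space) mfd" and B :: "('b, 'h::euclidean_space) mfd"
  assumes Q: "flow_quotient P X B q" and at: "atlas P" and A: "vfield_on P (points P) A"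
    and comm: "\<And>x. x \<in> points P \<Longrightarrow> lie_bracket P X A x = (\<lambda>f. 0)"
  shows "\<And>x. x \<in> points P \<Longrightarrow> push P B q x (A x) = descended P B q A (q x)"
    and "vfield_on B (points B) (descended P B q A)"
proof -
  note F = flow_quotientD[OF Q]
  have X: "vfield_on P (points P) X" using F(1) by (simp add: complete_vfield_def)
  have oP: "openin (mtop P) {x \<in> points P. q x \<in> V}" if "openin (mtop B) V" for V
    by (rule smooth_map_preimage_open[OF F(3) that])
  have G: "smooth_fun P {x \<in> points P. q x \<in> V} (\<lambda>x. A x (h \<circ> q))" if h: "smooth_fun B V h" for V h
    by (rule vfield_smooth[OF A _ smooth_map_smooth_fun[OF at F(2,3) h]]) simp
  have XG: "X x (\<lambda>x. A x (h \<circ> q)) = 0" if h: "smooth_fun B V h" and x: "x \<in> points P" "q x \<in> V" for V h x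
  proof -
    have n: "smooth_near B (q y) h" if "q y \<in> V" for y by (rule smooth_fun_imp_near[OF h that])
    have "A x (\<lambda>y. X y (h \<circ> q)) = A x (\<lambda>y. 0)"
    proof (rule tangent_germ[OF at vfield_tangent[OF A x(1)] oP[OF smooth_fun_open[OF h]]])
      show "x \<in> {x \<in> points P. q x \<in> V}" using x by simp
      fix y assume y: "y \<in> {x \<in> points P. q x \<in> V}"
      then have "push P B q y (X y) h = X y (h \<circ> q)" using n[of y] by (simp add: push_def)
      then show "X y (h \<circ> q) = 0" using flow_quotient_push[OF Q at, of y] y by simp
    qed
    also have "\<dots> = 0" by (rule tangent_const[OF at vfield_tangent[OF A x(1)]])
    finally have 1: "A x (\<lambda>y. X y (h \<circ> q)) = 0" .
    have "smooth_near P x (h \<circ> q)" by (rule smooth_map_smooth_near[OF at F(2,3) x(1) n[OF x(2)]])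
    then have "lie_bracket P X A x (h \<circ> q) = X x (\<lambda>y. A y (h \<circ> q)) - A x (\<lambda>y. X y (h \<circ> q))"
      by (simp add: lie_bracket_def)
    then show ?thesis using 1 comm[OF x(1)] by simp
  qed
  have fib: "push P B q x (A x) = push P B q x' (A x')"
    if x: "x \<in> points P" "x' \<in> points P" "q x = q x'" for x x'
  proof
    fix h
    show "push P B q x (A x) h = push P B q x' (A x') h"
    proof (cases "smooth_near B (q x) h")
      case False
      then show ?thesis using x(3) by (simp add: push_def)
    next
      case True
      then obtain V where V: "q x \<in> V" "smooth_fun B V h" by (auto simp: smooth_near_def)
      have "A x (h \<circ> q) = A x' (h \<circ> q)"
        by (rule flow_quotient_const[OF Q G[OF V(2)] XG[OF V(2)] x V(1)])
      then show ?thesis using True x(3) by (simp add: push_def)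
    qed
  qed
  show d: "push P B q x (A x) = descended P B q A (q x)" if x: "x \<in> points P" for x
  proof -
    have im: "q x \<in> q ` points P" using x by simp
    show ?thesis
      using fib[OF x inv_into_into[OF im] f_inv_into_f[OF im, symmetric]] by (simp add: descended_def Let_def)
  qed
  show "vfield_on B (points B) (descended P B q A)"
    unfolding vfield_on_def
  proof (intro conjI ballI allI impI)
    show "openin (mtop B) (points B)" by simp
    fix y assume "y \<in> points B"
    then obtain x where x: "x \<in> points P" "y = q x" using F(4) by auto
    show "descended P B q A y \<in> tangent B y"
      using push_tangent[OF at F(2,3) vfield_tangent[OF A x(1)]] d[OF x(1)] x(2) by simp
  next
    fix V h assume "V \<subseteq> points B \<and> smooth_fun B V h"
    then have h: "smooth_fun B V h" by simp
    show "smooth_fun B V (\<lambda>y. descended P B q A y h)"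
    proof (rule flow_quotient_smooth_fun[OF Q at smooth_fun_open[OF h] G[OF h]])
      fix x assume x: "x \<in> points P" "q x \<in> V"
      have "push P B q x (A x) h = A x (h \<circ> q)" using smooth_fun_imp_near[OF h x(2)] by (simp add: push_def)
      then show "descended P B q A (q x) h = A x (h \<circ> q)" using d[OF x(1)] by simp
    qed
  qed
qed

section \<open>The twist\<close>

locale sugra = cask M g J om nab xi
  for M :: "('m, 'e::euclidean_space) mfd" and g J om nab xi +
  fixes c T :: real
    and P :: "('p, 'f::euclidean_space) mfd"
    and pr :: "'p \<Rightarrow> 'm \<times> ('m tv \<Rightarrow> real)"
    and act :: "complex \<Rightarrow> 'p \<Rightarrow> 'p"
    and eta :: "'p \<Rightarrow> 'p tv \<Rightarrow> real"
    and Nbar :: "('b, 'h::euclidean_space) mfd"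
    and q :: "'p \<Rightarrow> 'b"
    and gbar :: "'b \<Rightarrow> 'b tv \<Rightarrow> 'b tv \<Rightarrow> real"
    and Q :: "'b \<Rightarrow> ('b tv \<Rightarrow> 'b tv) set"
  assumes c_pos: "c > 0" and cmap: "deformed_sugra_cmap c T P pr act eta Nbar q gbar Q"
begin

lemma T_pos: "T > 0"
  and twist: "twist_bundle c T P pr act eta"
  and quot: "flow_quotient P (ZP c T P pr act eta) Nbar q"
  and tensor_gbar: "tensor2_field Nbar gbar"
  and H_rel: "H_related2 c P pr eta Nbar q (gHc c) gbar"
  using cmap by (simp_all add: deformed_sugra_cmap_def)

lemma pcb: "principal_circle_bundle P (Nc c) pr act"
  and conn: "principal_connection T P act eta"
  using twist by (simp_all add: twist_bundle_def)

lemma atlasP: "atlas P" and atlas_Nc: "atlas (Nc c)"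
  and pr_smooth_Nc: "smooth_map P (Nc c) pr" and action: "smooth_action circle_mfd P act"
  using pcb by (simp_all add: principal_circle_bundle_def smooth_manifold_imp_atlas)

lemma atlasB: "atlas Nbar" by (rule flow_quotientD(2)[OF quot])

text \<open>The domain of \<open>Nc c\<close>, rewritten through \<open>fZc = (y - c)/2\<close> as
  the preimage of an open half-line, from which openness is immediate.\<close>

definition W0 :: "('m \<times> ('m tv \<Rightarrow> real)) set" where
  "W0 = {z \<in> points N. fst z \<in> {x \<in> points M. yM x \<in> {c<..}}}"

lemma W0_eq: "W0 = {z \<in> points N. fZc c z > 0}"
  using points_ND(1) by (auto simp: W0_def fZc_def fZ_yM)

lemma Nc_restrict: "Nc c = restrict_mfd N W0"
  by (simp add: Nc_def W0_eq)

lemma W0_open: "openin (mtop N) W0"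
  unfolding W0_def
  by (rule fst_preimage_open, rule smooth_fun_preimage_open[OF atlasM yM_smooth]) simp

lemma points_Nc: "points (Nc c) = W0"
  using openin_subset[OF W0_open] by (auto simp: Nc_restrict restrict_mfd_def)

lemma pr_W0: "x \<in> points P \<Longrightarrow> pr x \<in> W0"
  using smooth_map_points[OF pr_smooth_Nc] by (simp add: points_Nc)

lemma pr_N: "x \<in> points P \<Longrightarrow> pr x \<in> points N"
  and pr_M: "x \<in> points P \<Longrightarrow> fst (pr x) \<in> points M"
  and pr_yM: "x \<in> points P \<Longrightarrow> yM (fst (pr x)) > c"
  using pr_W0 by (auto simp: W0_def)

lemma tangent_Nc: "z \<in> W0 \<Longrightarrow> tangent (Nc c) z = tangent N z"
  unfolding Nc_restrict by (rule restrict_tangent[OF atlasN W0_open])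

lemma smooth_fun_Nc: "W \<subseteq> W0 \<Longrightarrow> smooth_fun (Nc c) W f \<longleftrightarrow> smooth_fun N W f"
  unfolding Nc_restrict by (rule restrict_smooth_fun[OF atlasN W0_open])

text \<open>\<open>Nc c\<close> is open in \<open>N\<close>, so functions on \<open>N\<close>
  restrict to it. From here on \<open>pr\<close> is read as a map to \<open>N\<close>, where the
  calculus of the previous sections lives.\<close>

lemma pr_smooth: "smooth_map P N pr"
proof (rule smooth_mapI[OF atlasP atlasN pr_N])
  fix W f assume f: "smooth_fun N W f"
  have "smooth_fun N (W \<inter> W0) f"
    by (rule smooth_fun_subset[OF f openin_Int[OF smooth_fun_open[OF f] W0_open]]) simp
  then have "smooth_fun (Nc c) (W \<inter> W0) f" by (simp add: smooth_fun_Nc)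
  from smooth_map_smooth_fun[OF atlasP atlas_Nc pr_smooth_Nc this]
  have "smooth_fun P {x \<in> points P. pr x \<in> W \<inter> W0} (f \<circ> pr)" .
  moreover have "{x \<in> points P. pr x \<in> W \<inter> W0} = {x \<in> points P. pr x \<in> W}" using pr_W0 by auto
  ultimately show "smooth_fun P {x \<in> points P. pr x \<in> W} (f \<circ> pr)" by simp
qed

abbreviation pp :: "'p \<Rightarrow> 'p tv \<Rightarrow> ('m \<times> ('m tv \<Rightarrow> real)) tv" where
  "pp \<equiv> push P N pr"

lemma push_Nc: "x \<in> points P \<Longrightarrow> push P (Nc c) pr x v = pp x v"
  unfolding Nc_restrict by (rule restrict_push[where F=pr and p=x, OF atlasN W0_open], rule pr_W0)

lemma pp_tangent: "v \<in> tangent P x \<Longrightarrow> pp x v \<in> tangent N (pr x)"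
  by (rule push_tangent[OF atlasP atlasN pr_smooth])

lemma eta_form: "one_form_on P (points P) eta"
  and eta_XP: "x \<in> points P \<Longrightarrow> eta x (circle_generator T P act x) = 1"
  using conn by (simp_all add: principal_connection_def)

lemma eta_lcomb: "u \<in> tangent P x \<Longrightarrow> v \<in> tangent P x \<Longrightarrow> eta x (lcomb a u b v) = a * eta x u + b * eta x v"
  using eta_form tangent_points[of u P x] linear_form_lcomb[of "tangent P x" "eta x" u v a b]
  by (simp add: one_form_on_def cotangent_def)

lemma eta_smooth: "vfield_on P V X \<Longrightarrow> smooth_fun P V (\<lambda>x. eta x (X x))"
  using eta_form vfield_open[of P V X] openin_subset[of "mtop P" V] by (simp add: one_form_on_def)

section \<open>The generator of the principal action and vertical vectors\<close>

abbreviation XP :: "'p \<Rightarrow> 'p tv" where "XP \<equiv> circle_generator T P act"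

lemma act_one: "x \<in> points P \<Longrightarrow> act 1 x = x"
  using action by (simp add: smooth_action_def)

lemma pr_act: "x \<in> points P \<Longrightarrow> pr (act (cis t) x) = pr x"
  using pcb by (simp add: principal_circle_bundle_def circle_mfd_def)

lemma XP_apply: "x \<in> points P \<Longrightarrow> smooth_near P x f \<Longrightarrow>
    XP x f = deriv (\<lambda>t. f (act (cis (2 * pi * t / T)) x)) 0"
  by (simp add: circle_generator_def curve_velocity_def act_one)

lemma pp_XP: "x \<in> points P \<Longrightarrow> pp x (XP x) = (\<lambda>f. 0)"
  using smooth_map_smooth_near[OF atlasP atlasN pr_smooth, of x]
  by (simp add: push_def fun_eq_iff XP_apply pr_act)

text \<open>In the bundle coordinates the action translates the angle. With period \<open>T\<close>
  its speed is \<open>2 * pi / T\<close>, so the generator is a constant coordinate field.\<close>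

lemma XP_local:
  assumes x0: "x0 \<in> points P"
  obtains UB and \<phi> :: "'m \<times> ('m tv \<Rightarrow> real) \<Rightarrow> 'e \<times> 'e" and UP a where "(UB, \<phi>) \<in> charts (Nc c)"
    "coords P UP (\<lambda>x. (\<phi> (pr x), a x))" "x0 \<in> UP" "\<And>x. x \<in> UP \<Longrightarrow> pr x \<in> UB"
    "\<And>x. x \<in> UP \<Longrightarrow> XP x = cv P UP (\<lambda>x. (\<phi> (pr x), a x)) x (0, 2 * pi / T)"
proof -
  obtain UB and \<phi> :: "'m \<times> ('m tv \<Rightarrow> real) \<Rightarrow> 'e \<times> 'e" and UP a where b: "(UB, \<phi>) \<in> charts (Nc c)"
    "coords P UP (\<lambda>x. (\<phi> (pr x), a x))" "x0 \<in> UP" "\<And>x. x \<in> UP \<Longrightarrow> pr x \<in> UB"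
    and e: "\<And>x. x \<in> UP \<Longrightarrow> \<exists>e>0. \<forall>t. \<bar>t\<bar> < e \<longrightarrow> act (cis t) x \<in> UP \<and> a (act (cis t) x) = a x + (t::real)"
    by (rule circle_bundle_coords[OF pcb x0]) (rule that)
  define \<kappa> where "\<kappa> = (\<lambda>x. (\<phi> (pr x), a x))"
  have k: "coords P UP \<kappa>" using b(2) by (simp add: \<kappa>_def)
  have "XP x = cv P UP \<kappa> x (0, 2 * pi / T)" if x: "x \<in> UP" for x
  proof
    fix f
    have xP: "x \<in> points P" using coordsD(4)[OF k] x by blast
    show "XP x f = cv P UP \<kappa> x (0, 2 * pi / T) f"
    proof (cases "smooth_near P x f")
      case False
      then show ?thesis by (simp add: circle_generator_def curve_velocity_def cv_def act_one xP)
    next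
      case True
      let ?F = "f \<circ> inv_into UP \<kappa>" and ?s = "\<lambda>t. 2 * pi * t / T"
      let ?D = "frechet_derivative ?F (at (\<kappa> x))"
      have D: "(?F has_derivative ?D) (at (\<kappa> x))"
        by (rule smooth_near_coords_derivative[OF atlasP k x True])
      have l: "((\<lambda>t. \<kappa> x + t *\<^sub>R w) has_derivative (\<lambda>t. t *\<^sub>R w)) (at 0)" for w
        by (auto intro!: derivative_eq_intros)
      have "((\<lambda>t. ?F (\<kappa> x + t *\<^sub>R w)) has_derivative (\<lambda>t. t * ?D w)) (at 0)" for w
        using has_derivative_compose[OF l[of w], of ?F ?D] D linear_scale[OF has_derivative_linear[OF D]] by simp
      moreover have "(\<lambda>t. t * ?D w) = (*) (?D w)" for w by (simp add: fun_eq_iff)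
      ultimately have d: "((\<lambda>t. ?F (\<kappa> x + t *\<^sub>R (0, 2 * pi / T))) has_real_derivative ?D (0, 2 * pi / T)) (at 0)"
        unfolding has_field_derivative_def by metis
      obtain e where e: "e > 0" "\<And>t. \<bar>t\<bar> < e \<Longrightarrow> act (cis t) x \<in> UP \<and> a (act (cis t) x) = a x + (t::real)"
        using e[OF x] by auto
      have "((\<lambda>t. f (act (cis (?s t)) x)) has_real_derivative ?D (0, 2 * pi / T)) (at 0)"
      \<comment> \<open>The action is a straight line in coordinates only for small
        \<open>t\<close>, so the two functions agree merely near 0.\<close>
      proof (rule DERIV_cong_ev[THEN iffD2, OF refl _ refl d])
        have "\<forall>\<^sub>F t in nhds 0. t \<in> {t. \<bar>?s t\<bar> < e}"
          by (rule eventually_nhds_in_open) (use T_pos in \<open>auto intro!: open_Collect_less continuous_intros simp: e(1)\<close>)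
        then show "\<forall>\<^sub>F t in nhds 0. f (act (cis (?s t)) x) = ?F (\<kappa> x + t *\<^sub>R (0, 2 * pi / T))"
        proof (rule eventually_mono)
          fix t assume t: "t \<in> {t. \<bar>?s t\<bar> < e}"
          then have "act (cis (?s t)) x \<in> UP" "a (act (cis (?s t)) x) = a x + ?s t" using e(2)[of "?s t"] by simp_all
          then have "inv_into UP \<kappa> (\<kappa> (act (cis (?s t)) x)) = act (cis (?s t)) x \<and>
            \<kappa> (act (cis (?s t)) x) = \<kappa> x + t *\<^sub>R (0, 2 * pi / T)"
            by (simp add: coords_inv[OF k]) (simp add: \<kappa>_def pr_act xP)
          then show "f (act (cis (?s t)) x) = ?F (\<kappa> x + t *\<^sub>R (0, 2 * pi / T))" by (metis comp_apply)
        qed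
      qed
      then show ?thesis using True by (simp add: XP_apply xP cv_def DERIV_imp_deriv)
    qed
  qed
  then show thesis using that[OF b] by (simp add: \<kappa>_def)
qed

lemma XP_vfield: "vfield_on P (points P) XP"
proof (rule vfield_local[OF atlasP])
  fix x assume "x \<in> points P"
  then obtain UB and \<phi> :: "'m \<times> ('m tv \<Rightarrow> real) \<Rightarrow> 'e \<times> 'e" and UP a where
    k: "coords P UP (\<lambda>x. (\<phi> (pr x), a x))" "x \<in> UP"
    and X: "\<And>x. x \<in> UP \<Longrightarrow> XP x = cv P UP (\<lambda>x. (\<phi> (pr x), a x)) x (0, 2 * pi / T)"
    by (rule XP_local) (rule that)
  have "vfield_on P UP XP" by (rule vfield_cong[OF atlasP cv_vfield[OF atlasP k(1)] X])
  then show "\<exists>V. x \<in> V \<and> V \<subseteq> points P \<and> vfield_on P V XP" using k(2) coordsD(4)[OF k(1)] by auto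
qed

lemma XP_tangent: "x \<in> points P \<Longrightarrow> XP x \<in> tangent P x"
  by (rule vfield_tangent[OF XP_vfield])

text \<open>If the projection of the difference vanishes, so do its base coordinates, and it is a
  multiple of \<open>XP\<close>. The multiple is 0 because \<open>eta\<close> is 1 on
  \<open>XP\<close>.\<close>

lemma tangent_P_eqI:
  assumes "v \<in> tangent P x" "w \<in> tangent P x" "pp x v = pp x w" "eta x v = eta x w"
  shows "v = w"
proof -
  have x: "x \<in> points P" by (rule tangent_points[OF assms(1)])
  obtain UB and \<phi> :: "'m \<times> ('m tv \<Rightarrow> real) \<Rightarrow> 'e \<times> 'e" and UP a where
    ch: "(UB, \<phi>) \<in> charts (Nc c)" and k: "coords P UP (\<lambda>x. (\<phi> (pr x), a x))" "x \<in> UP"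
    and U: "\<And>x. x \<in> UP \<Longrightarrow> pr x \<in> UB"
    and X: "\<And>x. x \<in> UP \<Longrightarrow> XP x = cv P UP (\<lambda>x. (\<phi> (pr x), a x)) x (0, 2 * pi / T)"
    by (rule XP_local[OF x]) (rule that)
  define \<kappa> where "\<kappa> = (\<lambda>x. (\<phi> (pr x), a x))"
  note k = k[folded \<kappa>_def] and X = X[folded \<kappa>_def]
  define u where "u = lcomb 1 v (- 1) w"
  have u: "u \<in> tangent P x" unfolding u_def by (rule lcomb_tangent[OF atlasP assms(1,2)])
  have pu: "pp x u = (\<lambda>f. 0)" unfolding u_def push_lcomb assms(3) by (simp add: lcomb_def)
  have eu: "eta x u = 0" unfolding u_def eta_lcomb[OF assms(1,2)] assms(4) by simp
  \<comment> \<open>The angular component of \<open>u\<close> in units of that of \<open>XP\<close>,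
    which is \<open>2 * pi / T\<close>.\<close>
  define r where "r = T / (2 * pi) * u (\<lambda>y. \<kappa> y \<bullet> (0, 1))"
  have "u = lcomb r (XP x) 0 (XP x)"
  proof (rule tangent_eqI[OF atlasP k u lcomb_tangent[OF atlasP XP_tangent[OF x] XP_tangent[OF x]]])
    fix b :: "('e \<times> 'e) \<times> real" assume b: "b \<in> Basis"
    have r: "lcomb r (XP x) 0 (XP x) (\<lambda>y. \<kappa> y \<bullet> b) = r * ((0, 2 * pi / T) \<bullet> b)"
      by (simp add: lcomb_def X[OF k(2)] cv_coord[OF atlasP k])
    from b consider b' where "b = (b', 0)" | "b = (0, 1)" by (auto simp: Basis_prod_def)
    then show "u (\<lambda>y. \<kappa> y \<bullet> b) = lcomb r (XP x) 0 (XP x) (\<lambda>y. \<kappa> y \<bullet> b)"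
    proof cases
      case (1 b')
      have "smooth_near (Nc c) (pr x) (\<lambda>z. \<phi> z \<bullet> b')"
        by (rule smooth_fun_imp_near[OF coord_fun_smooth[OF atlas_Nc atlas_chart[OF atlas_Nc ch]] U[OF k(2)]])
      then have "push P (Nc c) pr x u (\<lambda>z. \<phi> z \<bullet> b') = u (\<lambda>y. \<kappa> y \<bullet> b)"
        by (simp add: push_def 1 \<kappa>_def comp_def)
      then show ?thesis unfolding r by (simp add: push_Nc[OF x] pu 1)
    next
      case 2
      then show ?thesis unfolding r using T_pos by (simp add: r_def)
    qed
  qed
  moreover have "eta x (lcomb r (XP x) 0 (XP x)) = r"
    by (simp add: eta_lcomb XP_tangent x eta_XP)
  ultimately have "u = lcomb 0 (XP x) 0 (XP x)" using eu by simp
  then have "u f = 0" for f by (simp add: lcomb_def)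
  then show ?thesis by (simp add: u_def lcomb_def fun_eq_iff)
qed

text \<open>The horizontal lift with respect to the connection \<open>eta\<close>; on
  \<open>Z\<close> it gives \<open>Zhat\<close>.\<close>

definition hl :: "'p \<Rightarrow> ('m \<times> ('m tv \<Rightarrow> real)) tv \<Rightarrow> 'p tv" where
  "hl x w = (THE v. v \<in> tangent P x \<and> eta x v = 0 \<and> pp x v = w)"

lemma hl_eqI:
  assumes "v \<in> tangent P x" "eta x v = 0" "pp x v = w"
  shows "hl x w = v"
  unfolding hl_def by (rule the_equality) (use assms tangent_P_eqI in auto)

text \<open>Uniqueness of the lift is \<open>tangent_P_eqI\<close>. A smooth lift is constructed in
  bundle coordinates, and \<open>hl\<close> must coincide with it.\<close>

lemma hl_vfield_local:
  assumes Y: "vfield_on N (points N) Y" and x0: "x0 \<in> points P"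
  shows "\<exists>V. x0 \<in> V \<and> V \<subseteq> points P \<and> vfield_on P V (\<lambda>x. hl x (Y (pr x))) \<and>
    (\<forall>x\<in>V. eta x (hl x (Y (pr x))) = 0 \<and> pp x (hl x (Y (pr x))) = Y (pr x))"
proof -
  obtain UB and \<phi> :: "'m \<times> ('m tv \<Rightarrow> real) \<Rightarrow> 'e \<times> 'e" and UP a where
    ch: "(UB, \<phi>) \<in> charts (Nc c)" and k: "coords P UP (\<lambda>x. (\<phi> (pr x), a x))" "x0 \<in> UP"
    and U: "\<And>x. x \<in> UP \<Longrightarrow> pr x \<in> UB"
    and X: "\<And>x. x \<in> UP \<Longrightarrow> XP x = cv P UP (\<lambda>x. (\<phi> (pr x), a x)) x (0, 2 * pi / T)"
    by (rule XP_local[OF x0]) (rule that)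
  define \<kappa> where "\<kappa> = (\<lambda>x. (\<phi> (pr x), a x))"
  note k = k[folded \<kappa>_def]
  note cB = atlas_chart[OF atlas_Nc ch]
  have UW: "UB \<subseteq> W0" using coordsD(4)[OF cB] by (simp add: points_Nc)
  have UPp: "UP \<subseteq> points P" by (rule coordsD(4)[OF k(1)])
  have Ysm: "smooth_fun P UP (\<lambda>x. Y (pr x) (\<lambda>z. \<phi> z \<bullet> b))" for b
  proof -
    have "smooth_fun N UB (\<lambda>z. \<phi> z \<bullet> b)"
      using coord_fun_smooth[OF atlas_Nc cB] smooth_fun_Nc[OF UW] by simp
    then have "smooth_fun N UB (\<lambda>z. Y z (\<lambda>z. \<phi> z \<bullet> b))"
      by (rule vfield_smooth[OF Y, rotated]) (use UW openin_subset[OF W0_open] in blast)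
    from smooth_map_smooth_fun[OF atlasP atlasN pr_smooth this]
    have "smooth_fun P {x \<in> points P. pr x \<in> UB} ((\<lambda>z. Y z (\<lambda>z. \<phi> z \<bullet> b)) \<circ> pr)" .
    then have "smooth_fun P UP ((\<lambda>z. Y z (\<lambda>z. \<phi> z \<bullet> b)) \<circ> pr)"
      by (rule smooth_fun_subset[OF _ coordsD(1)[OF k(1)]]) (use U UPp in auto)
    then show ?thesis by (simp add: comp_def)
  qed
  define w where "w x = (\<Sum>b\<in>Basis. Y (pr x) (\<lambda>z. \<phi> z \<bullet> b) *\<^sub>R b)" for x
  \<comment> \<open>A first lift of \<open>Y\<close>, with angular component 0; it need not be
    horizontal for \<open>eta\<close>.\<close>
  define V0 where "V0 x = cv P UP \<kappa> x (w x, 0)" for x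
  have V0t: "V0 x \<in> tangent P x" if "x \<in> UP" for x
    unfolding V0_def by (rule cv_tangent[OF atlasP k(1) that])
  have V0: "vfield_on P UP V0"
  proof (rule vfield_onI_coords[OF atlasP k(1) coordsD(1)[OF k(1)] order_refl V0t])
    fix b :: "('e \<times> 'e) \<times> real" assume b: "b \<in> Basis"
    then consider b' where "b = (b', 0)" "b' \<in> Basis" | "b = (0, 1)" by (auto simp: Basis_prod_def)
    then show "smooth_fun P UP (\<lambda>x. V0 x (\<lambda>y. \<kappa> y \<bullet> b))"
    proof cases
      case (1 b')
      show ?thesis
        by (rule smooth_fun_cong[OF atlasP Ysm[of b']]) (simp add: V0_def cv_coord[OF atlasP k(1)] 1 w_def)
    next
      case 2
      show ?thesis
        by (rule smooth_fun_cong[OF atlasP smooth_fun_const[OF atlasP coordsD(1)[OF k(1)], of 0]])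
          (simp add: V0_def cv_coord[OF atlasP k(1)] 2)
    qed
  qed
  have ppV0: "pp x (V0 x) = Y (pr x)" if x: "x \<in> UP" for x
  proof -
    have xP: "x \<in> points P" using x UPp by blast
    have t1: "pp x (V0 x) \<in> tangent (Nc c) (pr x)" "Y (pr x) \<in> tangent (Nc c) (pr x)"
      using pp_tangent[OF V0t[OF x]] vfield_tangent[OF Y pr_N[OF xP]] by (simp_all add: tangent_Nc pr_W0 xP)
    show ?thesis
    proof (rule tangent_eqI[OF atlas_Nc cB U[OF x] t1])
      fix b :: "'e \<times> 'e" assume b: "b \<in> Basis"
      have "smooth_near (Nc c) (pr x) (\<lambda>z. \<phi> z \<bullet> b)"
        by (rule smooth_fun_imp_near[OF coord_fun_smooth[OF atlas_Nc cB] U[OF x]])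
      then have "push P (Nc c) pr x (V0 x) (\<lambda>z. \<phi> z \<bullet> b) = V0 x (\<lambda>y. \<kappa> y \<bullet> (b, 0))"
        by (simp add: push_def \<kappa>_def comp_def)
      also have "\<dots> = Y (pr x) (\<lambda>z. \<phi> z \<bullet> b)"
        using b by (simp add: V0_def cv_coord[OF atlasP k(1) x] w_def)
      finally show "pp x (V0 x) (\<lambda>z. \<phi> z \<bullet> b) = Y (pr x) (\<lambda>z. \<phi> z \<bullet> b)" by (simp add: push_Nc xP)
    qed
  qed
  \<comment> \<open>Subtracting the \<open>eta\<close>-value times \<open>XP\<close> makes the lift
    horizontal and does not change its projection, since \<open>XP\<close> projects to 0.\<close>
  define H where "H x = lcomb 1 (V0 x) (- eta x (V0 x)) (XP x)" for x
  have XPU: "vfield_on P UP XP" by (rule vfield_subset[OF XP_vfield coordsD(1)[OF k(1)] UPp])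
  have one: "smooth_fun P UP (\<lambda>x. 1)" by (rule smooth_fun_const[OF atlasP coordsD(1)[OF k(1)]])
  have "smooth_fun P UP (\<lambda>x. - 1 * eta x (V0 x))"
    by (rule smooth_fun_mult[OF atlasP smooth_fun_const[OF atlasP coordsD(1)[OF k(1)]] eta_smooth[OF V0]])
  then have vH: "vfield_on P UP H"
    unfolding H_def[abs_def] by (intro vfield_lcomb[OF atlasP V0 XPU one]) simp
  have Ht: "H x \<in> tangent P x" "eta x (H x) = 0" "pp x (H x) = Y (pr x)" if x: "x \<in> UP" for x
  proof -
    have xP: "x \<in> points P" using x UPp by blast
    show "H x \<in> tangent P x" unfolding H_def by (rule lcomb_tangent[OF atlasP V0t[OF x] XP_tangent[OF xP]])
    show "eta x (H x) = 0" by (simp add: H_def eta_lcomb V0t x XP_tangent xP eta_XP)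
    show "pp x (H x) = Y (pr x)" by (simp add: H_def push_lcomb ppV0[OF x] pp_XP[OF xP]) (simp add: lcomb_def)
  qed
  have hH: "hl x (Y (pr x)) = H x" if "x \<in> UP" for x by (rule hl_eqI[OF Ht[OF that]])
  have "vfield_on P UP (\<lambda>x. hl x (Y (pr x)))" by (rule vfield_cong[OF atlasP vH hH])
  then show ?thesis using k(2) UPp hH Ht(2,3) by auto
qed

lemma hl_vfield:
  assumes "vfield_on N (points N) Y"
  shows "vfield_on P (points P) (\<lambda>x. hl x (Y (pr x)))"
    and "x \<in> points P \<Longrightarrow> eta x (hl x (Y (pr x))) = 0"
    and "x \<in> points P \<Longrightarrow> pp x (hl x (Y (pr x))) = Y (pr x)"
proof -
  show "vfield_on P (points P) (\<lambda>x. hl x (Y (pr x)))"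
    by (rule vfield_local[OF atlasP]) (drule hl_vfield_local[OF assms], elim exE conjE, intro exI conjI)
  show "eta x (hl x (Y (pr x))) = 0" "pp x (hl x (Y (pr x))) = Y (pr x)" if "x \<in> points P"
    using hl_vfield_local[OF assms that] by auto
qed


section \<open>The lifted fields and their pairings on the twist bundle\<close>

abbreviation ZF :: "'p \<Rightarrow> 'p tv" where "ZF \<equiv> ZP c T P pr act eta"

definition Xih :: "'p \<Rightarrow> 'p tv" where "Xih x = hl x (xit (pr x))"

definition yP :: "'p \<Rightarrow> real" where "yP x = yM (fst (pr x))"

text \<open>The differential of the composite projection from the twist bundle to
  \<open>M\<close>.\<close>

definition dw :: "'p \<Rightarrow> 'p tv \<Rightarrow> 'm tv" where "dw x v = dpi (pr x) (pp x v)"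

lemma Zhat_hl: "x \<in> points P \<Longrightarrow> Zhat c P pr eta x = hl x (Z (pr x))"
  by (simp add: Zhat_def hl_def push_Nc)

lemma fHc_yM: "z \<in> points N \<Longrightarrow> fHc c z = - (yM (fst z) + c) / 2"
  and fZc_yM: "z \<in> points N \<Longrightarrow> fZc c z = (yM (fst z) - c) / 2"
  by (simp_all add: fHc_def fZc_def fH_yM fZ_yM field_simps)

lemma yP_gt: "x \<in> points P \<Longrightarrow> yP x > c"
  by (simp add: yP_def pr_yM)

lemma yP_smooth: "smooth_fun P (points P) yP"
proof -
  have "smooth_fun P {x \<in> points P. pr x \<in> {z \<in> points N. fst z \<in> points M}} ((yM \<circ> fst) \<circ> pr)"
    by (rule smooth_map_smooth_fun[OF atlasP atlasN pr_smooth fst_smooth_fun[OF yM_smooth]])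
  moreover have "{x \<in> points P. pr x \<in> {z \<in> points N. fst z \<in> points M}} = points P" using pr_N pr_M by auto
  ultimately show ?thesis by (simp add: comp_def yP_def[abs_def])
qed

lemma yP_near: "x \<in> points P \<Longrightarrow> smooth_near P x yP"
  by (rule smooth_fun_imp_near[OF yP_smooth])

lemma dw_tangent: "v \<in> tangent P x \<Longrightarrow> dw x v \<in> tangent M (fst (pr x))"
  unfolding dw_def by (intro dpi_tangent pp_tangent)

lemma dw_lcomb: "dw x (lcomb a u b v) = lcomb a (dw x u) b (dw x v)"
  by (simp add: dw_def push_lcomb dpi_lcomb)

lemma tangent_yP:
  assumes "v \<in> tangent P x"
  shows "v yP = - 2 * g (fst (pr x)) (xi (fst (pr x))) (dw x v)"
proof -
  have x: "x \<in> points P" by (rule tangent_points[OF assms])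
  have "smooth_near N (pr x) (yM \<circ> fst)" by (rule fst_smooth_near[OF pr_N[OF x] yM_near[OF pr_M[OF x]]])
  then have "dw x v yM = v ((yM \<circ> fst) \<circ> pr)"
    unfolding dw_def dpi_apply[OF yM_near[OF pr_M[OF x]]] by (simp add: push_def)
  moreover have "(yM \<circ> fst) \<circ> pr = yP" by (simp add: comp_def yP_def[abs_def])
  ultimately show ?thesis using yM_derivative[OF dw_tangent[OF assms]] by simp
qed

lemma Xih_vfield: "vfield_on P (points P) Xih"
  and eta_Xih: "x \<in> points P \<Longrightarrow> eta x (Xih x) = 0"
  and pp_Xih: "x \<in> points P \<Longrightarrow> pp x (Xih x) = xit (pr x)"
  unfolding Xih_def[abs_def] using hl_vfield[OF xit_vfield] by simp_all

lemma Zhat_vfield: "vfield_on P (points P) (\<lambda>x. hl x (Z (pr x)))"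
  and eta_Zhat: "x \<in> points P \<Longrightarrow> eta x (hl x (Z (pr x))) = 0"
  and pp_Zhat: "x \<in> points P \<Longrightarrow> pp x (hl x (Z (pr x))) = Z (pr x)"
  using hl_vfield[OF Z_vfield] by simp_all

lemma Xih_tangent: "x \<in> points P \<Longrightarrow> Xih x \<in> tangent P x"
  by (rule vfield_tangent[OF Xih_vfield])

lemma ZF_eq: "x \<in> points P \<Longrightarrow> ZF x = lcomb 1 (hl x (Z (pr x))) (- (yP x + c) / 2) (XP x)"
  by (simp add: ZP_def Zhat_hl fHc_yM pr_N yP_def)

lemma ZF_vfield: "vfield_on P (points P) ZF"
  using flow_quotientD(1)[OF quot] by (simp add: complete_vfield_def)

lemma ZF_tangent: "x \<in> points P \<Longrightarrow> ZF x \<in> tangent P x"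
  by (rule vfield_tangent[OF ZF_vfield])

lemma eta_ZF: "x \<in> points P \<Longrightarrow> eta x (ZF x) = - (yP x + c) / 2"
  by (simp add: ZF_eq eta_lcomb vfield_tangent[OF Zhat_vfield] XP_tangent eta_Zhat eta_XP)

lemma pp_ZF: "x \<in> points P \<Longrightarrow> pp x (ZF x) = Z (pr x)"
  by (simp add: ZF_eq push_lcomb pp_Zhat pp_XP) (simp add: lcomb_def)

lemma dw_Xih: "x \<in> points P \<Longrightarrow> dw x (Xih x) = xi (fst (pr x))"
  by (simp add: dw_def pp_Xih xit_split pr_N)

lemma dw_ZF: "x \<in> points P \<Longrightarrow> dw x (ZF x) = (\<lambda>f. - J (fst (pr x)) (xi (fst (pr x))) f)"
  by (simp add: dw_def pp_ZF Z_split pr_N)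

lemma dw_XP: "x \<in> points P \<Longrightarrow> dw x (XP x) = (\<lambda>f. 0)"
  unfolding dw_def pp_XP dpi_def by (simp add: push_def)

lemma Xih_yP: "x \<in> points P \<Longrightarrow> Xih x yP = 2 * yP x"
  by (simp add: tangent_yP[OF Xih_tangent] dw_Xih) (simp add: yP_def yM_def)

lemma ZF_yP: "x \<in> points P \<Longrightarrow> ZF x yP = 0"
  by (simp add: tangent_yP[OF ZF_tangent] dw_ZF g_neg_right pr_M g_xi_Jxi)

lemma XP_yP: "x \<in> points P \<Longrightarrow> XP x yP = 0"
  by (simp add: tangent_yP[OF XP_tangent] dw_XP g_zero_right pr_M)

lemma ext_deriv_eta: "u \<in> tangent P x \<Longrightarrow> v \<in> tangent P x \<Longrightarrow>
    ext_deriv1 P eta x u v = omegaH (pr x) (pp x u) (pp x v)"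
  using twist tangent_points[of u P x] by (simp add: twist_bundle_def push_Nc)

section \<open>Commutators on the twist bundle\<close>

lemma eta_bracket:
  assumes A: "vfield_on P (points P) A" and B: "vfield_on P (points P) B" and x: "x \<in> points P"
  shows "eta x (lie_bracket P A B x) = A x (\<lambda>y. eta y (B y)) - B x (\<lambda>y. eta y (A y))
    - omegaH (pr x) (pp x (A x)) (pp x (B x))"
proof -
  obtain V and a k :: "'f \<Rightarrow> 'p \<Rightarrow> real" where V: "x \<in> V" "form_expr P V eta Basis a k"
    by (rule one_form_expr[OF atlasP eta_form x])
  show ?thesis
    using ext_deriv1_vfields[OF atlasP V(2) V(1) A B x]
      ext_deriv_eta[OF vfield_tangent[OF A x] vfield_tangent[OF B x]] by simp
qed

lemma zero_vfield_N: "vfield_on N (points N) (\<lambda>z f. 0)"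
  by (rule vfield_zero[OF atlasN]) simp

lemma bracket_zero_right: "v \<in> points N \<Longrightarrow> vfield_on N (points N) Y \<Longrightarrow> lie_bracket N Y (\<lambda>z f. 0) v = (\<lambda>f. 0)"
  using tangent_const[OF atlasN vfield_tangent[of N "points N" Y v], of 0]
  by (auto simp: lie_bracket_def fun_eq_iff)

text \<open>By \<open>tangent_P_eqI\<close> two components decide. The projected one is a bracket on
  \<open>N\<close>, and the \<open>eta\<close>-component is governed by the curvature through
  \<open>eta_bracket\<close>.\<close>

lemma P_bracket_zero:
  assumes A: "vfield_on P (points P) A" and B: "vfield_on P (points P) B" and x: "x \<in> points P"
    and "pp x (lie_bracket P A B x) = (\<lambda>f. 0)" "eta x (lie_bracket P A B x) = 0"
  shows "lie_bracket P A B x = (\<lambda>f. 0)"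
proof (rule tangent_P_eqI[OF lie_bracket_tangent[OF atlasP A B x] zero_tangent[OF x]])
  have z: "(\<lambda>f. 0) = lcomb 0 (XP x) 0 (XP x)" by (simp add: lcomb_def)
  show "pp x (lie_bracket P A B x) = pp x (\<lambda>f. 0)" unfolding assms(4) by (simp add: push_def)
  show "eta x (lie_bracket P A B x) = eta x (\<lambda>f. 0)"
    unfolding assms(5) z eta_lcomb[OF XP_tangent[OF x] XP_tangent[OF x]] by simp
qed

lemma tangent_yP_affine:
  assumes v: "v \<in> tangent P x"
  shows "v (\<lambda>y. eta y (ZF y)) = - v yP / 2" "v (\<lambda>y. eta y (XP y)) = 0" "v (\<lambda>y. eta y (Xih y)) = 0"
proof -
  have x: "x \<in> points P" by (rule tangent_points[OF v])
  have o: "openin (mtop P) (points P)" by simp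
  have "v (\<lambda>y. eta y (ZF y)) = v (lcomb (- 1 / 2) yP (- c / 2) (\<lambda>y. 1))"
    by (rule tangent_germ[OF atlasP v o x]) (simp add: eta_ZF lcomb_def field_simps)
  also have "\<dots> = - v yP / 2"
    using tangent_lcomb[OF v yP_near[OF x] smooth_near_const[OF atlasP x]] tangent_const[OF atlasP v] by simp
  finally show "v (\<lambda>y. eta y (ZF y)) = - v yP / 2" .
  show "v (\<lambda>y. eta y (XP y)) = 0" "v (\<lambda>y. eta y (Xih y)) = 0"
    using tangent_germ[OF atlasP v o x, of "\<lambda>y. eta y (XP y)" "\<lambda>y. 1"] eta_XP
      tangent_germ[OF atlasP v o x, of "\<lambda>y. eta y (Xih y)" "\<lambda>y. 0"] eta_Xih
      tangent_const[OF atlasP v] by auto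
qed

lemma omegaH_pp:
  assumes x: "x \<in> points P" and w: "w \<in> tangent P x"
  shows "omegaH (pr x) (pp x (ZF x)) (pp x w) = - g (fst (pr x)) (xi (fst (pr x))) (dw x w)"
    "omegaH (pr x) (pp x (Xih x)) (pp x w) = - lam (fst (pr x)) (dw x w)"
    "omegaH (pr x) (pp x (XP x)) (pp x w) = 0"
  using omegaH_Z[OF pr_N[OF x] pp_tangent[OF w]] omegaH_xit[OF pr_N[OF x] pp_tangent[OF w]]
    omegaH_zero[OF pr_N[OF x] pp_tangent[OF w]]
  by (simp_all add: pp_ZF pp_Xih pp_XP x dw_def)

text \<open>\<open>XP\<close> projects to 0, so curvature contributes nothing; and
  \<open>eta\<close> of \<open>ZF\<close> is a function of y, which is constant along the fibres of
  \<open>pr\<close>.\<close>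

lemma bracket_ZF_XP:
  assumes x: "x \<in> points P"
  shows "lie_bracket P ZF XP x = (\<lambda>f. 0)"
proof (rule P_bracket_zero[OF ZF_vfield XP_vfield x])
  have "pp x (lie_bracket P ZF XP x) = lie_bracket N Z (\<lambda>z f. 0) (pr x)"
    by (rule related_lie_bracket[OF atlasP atlasN pr_smooth ZF_vfield XP_vfield Z_vfield zero_vfield_N pp_ZF pp_XP x])
  then show "pp x (lie_bracket P ZF XP x) = (\<lambda>f. 0)"
    by (simp add: bracket_zero_right pr_N x Z_vfield)
  show "eta x (lie_bracket P ZF XP x) = 0"
    by (simp add: eta_bracket[OF ZF_vfield XP_vfield x] omegaH_pp x XP_tangent ZF_tangent
        tangent_yP_affine[OF XP_tangent] tangent_yP_affine[OF ZF_tangent] XP_yP dw_XP g_zero_right pr_M)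
qed

text \<open>The term \<open>- Xih (eta(ZF))\<close> equals y, while the curvature term is
  \<open>- omegaH(Z, xit) = - y\<close>. This balance is the reason for the coefficient
  \<open>fHc\<close> in the dividing field.\<close>

lemma bracket_ZF_Xih:
  assumes x: "x \<in> points P"
  shows "lie_bracket P ZF Xih x = (\<lambda>f. 0)"
proof (rule P_bracket_zero[OF ZF_vfield Xih_vfield x])
  have "pp x (lie_bracket P ZF Xih x) = lie_bracket N Z xit (pr x)"
    by (rule related_lie_bracket[OF atlasP atlasN pr_smooth ZF_vfield Xih_vfield Z_vfield xit_vfield pp_ZF pp_Xih x])
  then show "pp x (lie_bracket P ZF Xih x) = (\<lambda>f. 0)"
    by (simp add: bracket_Z_xit pr_N x)
  show "eta x (lie_bracket P ZF Xih x) = 0"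
    by (simp add: eta_bracket[OF ZF_vfield Xih_vfield x] omegaH_pp x Xih_tangent ZF_tangent
        tangent_yP_affine[OF Xih_tangent] tangent_yP_affine[OF ZF_tangent] Xih_yP dw_Xih) (simp add: yP_def yM_def)
qed

lemma bracket_Xih_XP:
  assumes x: "x \<in> points P"
  shows "lie_bracket P Xih XP x = (\<lambda>f. 0)"
proof (rule P_bracket_zero[OF Xih_vfield XP_vfield x])
  have "pp x (lie_bracket P Xih XP x) = lie_bracket N xit (\<lambda>z f. 0) (pr x)"
    by (rule related_lie_bracket[OF atlasP atlasN pr_smooth Xih_vfield XP_vfield xit_vfield zero_vfield_N pp_Xih pp_XP x])
  then show "pp x (lie_bracket P Xih XP x) = (\<lambda>f. 0)"
    by (simp add: bracket_zero_right pr_N x xit_vfield)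
  show "eta x (lie_bracket P Xih XP x) = 0"
    by (simp add: eta_bracket[OF Xih_vfield XP_vfield x] omegaH_pp x Xih_tangent XP_tangent
        tangent_yP_affine[OF Xih_tangent] tangent_yP_affine[OF XP_tangent] dw_XP lam_def g_zero_right pr_M)
qed


section \<open>Descent to the quotient\<close>

abbreviation qq :: "'p \<Rightarrow> 'p tv \<Rightarrow> 'b tv" where "qq \<equiv> push P Nbar q"

definition RB :: "'b \<Rightarrow> 'b tv" where "RB = descended P Nbar q Xih"
definition XB :: "'b \<Rightarrow> 'b tv" where "XB = descended P Nbar q XP"
definition yB :: "'b \<Rightarrow> real" where "yB y = yP (inv_into (points P) q y)"

lemma qq_ZF: "x \<in> points P \<Longrightarrow> qq x (ZF x) = (\<lambda>f. 0)"
  by (rule flow_quotient_push[OF quot atlasP])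

lemma RB_vfield: "vfield_on Nbar (points Nbar) RB"
  and RB_q: "x \<in> points P \<Longrightarrow> RB (q x) = qq x (Xih x)"
  unfolding RB_def using descended_vfield[OF quot atlasP Xih_vfield bracket_ZF_Xih] by simp_all

lemma XB_vfield: "vfield_on Nbar (points Nbar) XB"
  and XB_q: "x \<in> points P \<Longrightarrow> XB (q x) = qq x (XP x)"
  unfolding XB_def using descended_vfield[OF quot atlasP XP_vfield bracket_ZF_XP] by simp_all

lemma q_smooth: "smooth_map P Nbar q"
  by (rule flow_quotientD(3)[OF quot])

lemma q_points: "x \<in> points P \<Longrightarrow> q x \<in> points Nbar"
  by (rule smooth_map_points[OF q_smooth])

lemma q_surj:
  assumes "y \<in> points Nbar"
  obtains x where "x \<in> points P" "y = q x"
  using assms flow_quotientD(4)[OF quot] by auto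

lemma qq_surj:
  assumes "x \<in> points P" "v \<in> tangent Nbar (q x)"
  obtains u where "u \<in> tangent P x" "v = qq x u"
  using assms(2) flow_quotientD(5)[OF quot assms(1)] by auto

lemma q_UNIV: "{x \<in> points P. q x \<in> points Nbar} = points P"
  using q_points by auto

lemma yB_q: "x \<in> points P \<Longrightarrow> yB (q x) = yP x"
proof -
  assume x: "x \<in> points P"
  then have im: "q x \<in> q ` points P" by simp
  show "yB (q x) = yP x"
    unfolding yB_def
  proof (rule flow_quotient_const[where G = yP and V = "points Nbar", OF quot])
    show "smooth_fun P {x \<in> points P. q x \<in> points Nbar} yP" by (simp add: q_UNIV yP_smooth)
    show "ZF x yP = 0" if "x \<in> points P" for x by (rule ZF_yP[OF that])
    show "inv_into (points P) q (q x) \<in> points P" "q (inv_into (points P) q (q x)) = q x"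
      by (rule inv_into_into[OF im], rule f_inv_into_f[OF im])
    then show "q (inv_into (points P) q (q x)) \<in> points Nbar" using q_points[OF x] by simp
  qed (rule x)
qed

lemma yB_smooth: "smooth_fun Nbar (points Nbar) yB"
proof (rule flow_quotient_smooth_fun[where G = yP, OF quot atlasP])
  show "smooth_fun P {x \<in> points P. q x \<in> points Nbar} yP" by (simp add: q_UNIV yP_smooth)
  show "yB (q x) = yP x" if "x \<in> points P" for x by (rule yB_q[OF that])
qed simp

lemma yB_gt: "y \<in> points Nbar \<Longrightarrow> yB y > c"
  using q_surj[of y] yB_q yP_gt by metis

lemma qq_yB:
  assumes u: "u \<in> tangent P x"
  shows "qq x u yB = u yP"
proof -
  have x: "x \<in> points P" by (rule tangent_points[OF u])
  have "smooth_near Nbar (q x) yB" by (rule smooth_fun_imp_near[OF yB_smooth q_points[OF x]])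
  then have "qq x u yB = u (yB \<circ> q)" by (simp add: push_def)
  also have "\<dots> = u yP"
    by (rule tangent_germ[OF atlasP u _ x]) (simp_all add: yB_q)
  finally show ?thesis .
qed

lemma RB_yB: "y \<in> points Nbar \<Longrightarrow> RB y yB = 2 * yB y"
  and XB_yB: "y \<in> points Nbar \<Longrightarrow> XB y yB = 0"
  by (erule q_surj, simp add: RB_q XB_q qq_yB Xih_tangent XP_tangent Xih_yP XP_yP yB_q)+

lemma bracket_RB_XB:
  assumes y: "y \<in> points Nbar"
  shows "lie_bracket Nbar RB XB y f = 0"
proof -
  obtain x where x: "x \<in> points P" "y = q x" by (rule q_surj[OF y])
  have "lie_bracket Nbar RB XB (q x) = qq x (lie_bracket P Xih XP x)"
    by (rule related_lie_bracket[OF atlasP atlasB q_smooth Xih_vfield XP_vfield RB_vfield XB_vfield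
          RB_q[symmetric] XB_q[symmetric] x(1), symmetric])
  then show ?thesis unfolding bracket_Xih_XP[OF x(1)] x(2) by (simp add: push_def)
qed

text \<open>Since \<open>q\<close> contracts the flow of \<open>ZF\<close>, tangent vectors of the quotient are represented by their
  \<open>eta\<close>-horizontal lifts \<open>hz x u\<close>, obtained by subtracting a multiple of \<open>ZF\<close>.\<close>

definition hz :: "'p \<Rightarrow> 'p tv \<Rightarrow> 'p tv" where
  "hz x u = lcomb 1 u (2 * eta x u / (yP x + c)) (ZF x)"

lemma hz_props:
  assumes u: "u \<in> tangent P x"
  shows "hz x u \<in> tangent P x" "eta x (hz x u) = 0" "qq x (hz x u) = qq x u"
    "dw x (hz x u) = lcomb 1 (dw x u) (- (2 * eta x u / (yP x + c))) (J (fst (pr x)) (xi (fst (pr x))))"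
proof -
  have x: "x \<in> points P" by (rule tangent_points[OF u])
  show "hz x u \<in> tangent P x" unfolding hz_def by (rule lcomb_tangent[OF atlasP u ZF_tangent[OF x]])
  show "eta x (hz x u) = 0"
    \<comment> \<open>The coefficient in \<open>hz\<close> is the one that cancels
      \<open>eta(u)\<close>, because \<open>eta(ZF) = - (y + c)/2\<close>.\<close>
    using yP_gt[OF x] c_pos by (simp add: hz_def eta_lcomb u ZF_tangent x eta_ZF field_simps)
  show "qq x (hz x u) = qq x u" unfolding hz_def push_lcomb qq_ZF[OF x] by (simp add: lcomb_def)
  show "dw x (hz x u) = lcomb 1 (dw x u) (- (2 * eta x u / (yP x + c))) (J (fst (pr x)) (xi (fst (pr x))))"
    unfolding hz_def dw_lcomb dw_ZF[OF x] by (simp add: lcomb_def)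
qed

section \<open>The twisted metric on the quotient\<close>

lemma gbar_qq:
  assumes u: "u \<in> tangent P x" and v: "v \<in> tangent P x"
  shows "gbar (q x) (qq x u) (qq x v) = gHc c (pr x) (pp x (hz x u)) (pp x (hz x v))"
proof -
  have x: "x \<in> points P" by (rule tangent_points[OF u])
  show ?thesis
    using H_rel[unfolded H_related2_def, rule_format, OF x hz_props(1)[OF u] hz_props(1)[OF v]]
      hz_props(2,3)[OF u] hz_props(2,3)[OF v] by (simp add: push_Nc x)
qed

lemma yM_nz: "x \<in> points P \<Longrightarrow> yM (fst (pr x)) \<noteq> 0"
  using pr_yM[of x] c_pos by simp

lemma gbar_sym:
  assumes y: "y \<in> points Nbar" and u: "u \<in> tangent Nbar y" and v: "v \<in> tangent Nbar y"
  shows "gbar y u v = gbar y v u"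
proof -
  obtain x where x: "x \<in> points P" "y = q x" by (rule q_surj[OF y])
  obtain u' where u': "u' \<in> tangent P x" "u = qq x u'" by (rule qq_surj[OF x(1) u[unfolded x(2)]])
  obtain v' where v': "v' \<in> tangent P x" "v = qq x v'" by (rule qq_surj[OF x(1) v[unfolded x(2)]])
  show ?thesis
    unfolding x(2) u'(2) v'(2) gbar_qq[OF u'(1) v'(1)] gbar_qq[OF v'(1) u'(1)]
    by (rule gHc_sym[OF pr_N[OF x(1)] pp_tangent[OF hz_props(1)[OF u'(1)]] pp_tangent[OF hz_props(1)[OF v'(1)]] yM_nz[OF x(1)]])
qed

lemma gHc_factor:
  assumes x: "x \<in> points P"
  shows "fHc c (pr x) / (fZc c (pr x))\<^sup>2 = - 2 * (yP x + c) / (yP x - c)\<^sup>2"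
  using yP_gt[OF x] by (simp add: fHc_yM fZc_yM pr_N x yP_def power2_eq_square divide_simps)

text \<open>\<open>Xih\<close> is horizontal and lies over \<open>xit\<close>, a vector of
  \<open>HZ\<close>, so \<open>gHc_HZ\<close> applies. The correction made by \<open>hz\<close> in
  the other argument drops out since \<open>xi\<close> and \<open>J xi\<close> are orthogonal, and
  \<open>g(xi, .) = - dy/2\<close>.\<close>

lemma gbar_RB:
  assumes y: "y \<in> points Nbar" and v: "v \<in> tangent Nbar y"
  shows "gbar y (RB y) v = (yB y + c) / (yB y - c)\<^sup>2 * v yB"
proof -
  obtain x where x: "x \<in> points P" "y = q x" by (rule q_surj[OF y])
  obtain u where u: "u \<in> tangent P x" "v = qq x u" by (rule qq_surj[OF x(1) v[unfolded x(2)]])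
  note X = Xih_tangent[OF x(1)] and M = pr_M[OF x(1)]
  have "hz x (Xih x) = Xih x" by (simp add: hz_def eta_Xih x(1)) (simp add: lcomb_def)
  then have "gbar y (RB y) v = gHc c (pr x) (xit (pr x)) (pp x (hz x u))"
    unfolding x(2) u(2) RB_q[OF x(1)] gbar_qq[OF X u(1)] by (simp add: pp_Xih x(1))
  also have "\<dots> = fHc c (pr x) / (fZc c (pr x))\<^sup>2 * gN (pr x) (xit (pr x)) (pp x (hz x u))"
    by (rule gHc_HZ[OF pr_N[OF x(1)] xit_HZ[OF pr_N[OF x(1)]] pp_tangent[OF hz_props(1)[OF u(1)]] yM_nz[OF x(1)]])
  also have "gN (pr x) (xit (pr x)) (pp x (hz x u)) = g (fst (pr x)) (xi (fst (pr x))) (dw x (hz x u))"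
    unfolding dw_def by (rule gN_xit[OF pr_N[OF x(1)] pp_tangent[OF hz_props(1)[OF u(1)]]])
  also have "\<dots> = g (fst (pr x)) (xi (fst (pr x))) (dw x u)"
    by (simp add: hz_props(4)[OF u(1)] g_lcomb_right dw_tangent u(1) M g_xi_Jxi)
  also have "\<dots> = - u yP / 2" by (simp add: tangent_yP[OF u(1)])
  also have "u yP = v yB" by (simp add: qq_yB u)
  finally have "gbar y (RB y) v = - 2 * (yP x + c) / (yP x - c)\<^sup>2 * (- (v yB) / 2)"
    unfolding gHc_factor[OF x(1)] .
  moreover have "- 2 * A / d * (- w / 2) = A / d * w" for A d w :: real by simp
  ultimately show ?thesis unfolding x(2) yB_q[OF x(1)] by metis
qed

definition lamP :: "'p \<Rightarrow> 'p tv \<Rightarrow> real" where "lamP x u = lam (fst (pr x)) (dw x u)"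

text \<open>The value of \<open>gbar\<close> on the pair (\<open>XB\<close>, \<open>XB\<close>): the
  horizontal representative of \<open>XP\<close> lies over \<open>2/(y + c)\<close> times
  \<open>Z\<close>, and \<open>Z\<close> has square \<open>- y\<close>.\<close>

definition gam :: "real \<Rightarrow> real" where "gam s = 8 * s / ((s - c)\<^sup>2 * (s + c))"

text \<open>Defined through the metric, the form lives on the quotient from the outset, with
  smoothness inherited from \<open>gbar\<close>; its pullback is identified afterwards in
  \<open>th_qq\<close>.\<close>

definition th :: "'b \<Rightarrow> 'b tv \<Rightarrow> real" where "th y v = gbar y (XB y) v / gam (yB y)"

lemma gam_nz: "s > c \<Longrightarrow> gam s \<noteq> 0"
  using c_pos by (simp add: gam_def)

lemma gbar_XB: "y \<in> points Nbar \<Longrightarrow> gbar y (XB y) v = gam (yB y) * th y v"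
  using gam_nz[OF yB_gt[of y]] by (simp add: th_def)

text \<open>The right side annihilates \<open>ZF\<close>, as it must: \<open>eta\<close> and
  \<open>lamP\<close> take the values \<open>- (y + c)/2\<close> and \<open>y\<close> there.\<close>

lemma th_qq:
  assumes u: "u \<in> tangent P x"
  shows "th (q x) (qq x u) = eta x u + (yP x + c) / (2 * yP x) * lamP x u"
proof -
  have x: "x \<in> points P" by (rule tangent_points[OF u])
  note X = XP_tangent[OF x] and M = pr_M[OF x] and z = pr_N[OF x]
  note w = pp_tangent[OF hz_props(1)[OF u]]
  define s where "s = 2 / (yP x + c)"
  \<comment> \<open>\<open>hz\<close> adds \<open>s\<close> times \<open>ZF\<close> to
    \<open>XP\<close>, and \<open>XP\<close> projects to 0. The remaining multiple of
    \<open>Z\<close> is written with \<open>lcomb\<close> to suit the linearity lemmas.\<close>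
  have pX: "pp x (hz x (XP x)) = lcomb 0 (Z (pr x)) s (Z (pr x))"
    by (simp add: hz_def push_lcomb pp_XP pp_ZF x eta_XP s_def) (simp add: lcomb_def)
  have H: "lcomb 0 (Z (pr x)) s (Z (pr x)) \<in> HZ (pr x)"
    unfolding HZ_def lcomb_def by (rule CollectI, rule exI[of _ s], rule exI[of _ 0], rule exI[of _ 0], rule exI[of _ 0]) simp
  have "gbar (q x) (XB (q x)) (qq x u) = gHc c (pr x) (lcomb 0 (Z (pr x)) s (Z (pr x))) (pp x (hz x u))"
    unfolding XB_q[OF x] gbar_qq[OF X u] pX ..
  also have "\<dots> = fHc c (pr x) / (fZc c (pr x))\<^sup>2 * gN (pr x) (lcomb 0 (Z (pr x)) s (Z (pr x))) (pp x (hz x u))"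
    by (rule gHc_HZ[OF z H w yM_nz[OF x]])
  also have "gN (pr x) (lcomb 0 (Z (pr x)) s (Z (pr x))) (pp x (hz x u)) = - s * lam (fst (pr x)) (dw x (hz x u))"
    by (simp add: gN_lcomb_left Z_tangent z w gN_Z dw_def)
  also have "lam (fst (pr x)) (dw x (hz x u)) = lamP x u + 2 * eta x u / (yP x + c) * yP x"
    by (simp add: hz_props(4)[OF u] lam_def lamP_def g_lcomb_right dw_tangent u M g_J)
      (simp add: yP_def yM_def)
  finally have "gbar (q x) (XB (q x)) (qq x u) =
    - 2 * (yP x + c) / (yP x - c)\<^sup>2 * (- s * (lamP x u + 2 * eta x u / (yP x + c) * yP x))"
    unfolding gHc_factor[OF x] .
  moreover have "yP x > c" by (rule yP_gt[OF x])
  moreover have "- 2 * (y + c) / (y - c)\<^sup>2 * (- (2 / (y + c)) * (l + 2 * e / (y + c) * y))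
      / (8 * y / ((y - c)\<^sup>2 * (y + c))) = e + (y + c) / (2 * y) * l" if "y > c" for y l e :: real
    using that c_pos by (simp add: divide_simps) (simp add: algebra_simps power2_eq_square)
  ultimately show ?thesis by (simp only: th_def yB_q[OF x] gam_def s_def)
qed

lemma th_XB: "y \<in> points Nbar \<Longrightarrow> th y (XB y) = 1"
  by (erule q_surj)
    (simp add: XB_q th_qq XP_tangent eta_XP lamP_def dw_XP lam_def g_zero_right pr_M)


section \<open>The exterior derivative of \<open>th\<close>\<close>

lemma gbar_linear: "y \<in> points Nbar \<Longrightarrow> u \<in> tangent Nbar y \<Longrightarrow> linear_form_on (tangent Nbar y) (gbar y u)"
  and gbar_smooth: "vfield_on Nbar V X \<Longrightarrow> vfield_on Nbar V Y \<Longrightarrow> smooth_fun Nbar V (\<lambda>x. gbar x (X x) (Y x))"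
  using tensor_gbar by (simp_all add: tensor2_field_def)

lemma smooth_yB_compose:
  assumes "smooth_on {c<..} G" "openin (mtop Nbar) V"
  shows "smooth_fun Nbar V (\<lambda>y. G (yB y))"
proof (rule smooth_fun_compose[OF atlasB _ assms(1)])
  show "smooth_fun Nbar V yB" by (rule smooth_fun_subset[OF yB_smooth assms(2) openin_subset[OF assms(2)]])
  show "yB ` V \<subseteq> {c<..}" using yB_gt openin_subset[OF assms(2)] by auto
qed simp

lemma smooth_inverse_gam: "smooth_on {c<..} (\<lambda>s. inverse (gam s))"
proof -
  note r = smooth_on_real_rational[OF c_pos]
  have o: "open {c<..}" by simp
  have "smooth_on {c<..} (\<lambda>s. 1 / 8 * ((s - c) * (s - c) * (s + c) * inverse s))"
    using smooth_on_add[OF r(4) smooth_on_const o, of "- c"] o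
    by (intro smooth_on_mult smooth_on_add r smooth_on_const) simp_all
  then show ?thesis
    by (rule smooth_on_cong[OF _ o]) (use c_pos in \<open>simp add: gam_def power2_eq_square divide_simps\<close>)
qed

lemma th_form_expr:
  fixes \<phi> :: "'b \<Rightarrow> 'h"
  assumes k: "coords Nbar U \<phi>"
  shows "form_expr Nbar U th Basis (\<lambda>b y. th y (cv Nbar U \<phi> y b)) (\<lambda>b y. \<phi> y \<bullet> b)"
proof (rule form_expr_coords[OF atlasB k order_refl coordsD(1)[OF k]])
  fix y assume "y \<in> U"
  then have y: "y \<in> points Nbar" using coordsD(4)[OF k] by blast
  show "linear_form_on (tangent Nbar y) (th y)"
    using gbar_linear[OF y vfield_tangent[OF XB_vfield y]]
    by (simp add: linear_form_on_def th_def add_divide_distrib)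
next
  note oU = coordsD(1)[OF k] and sub = coordsD(4)[OF k]
  fix b :: 'h
  have "smooth_fun Nbar U (\<lambda>y. gbar y (XB y) (cv Nbar U \<phi> y b) * inverse (gam (yB y)))"
    by (rule smooth_fun_mult[OF atlasB gbar_smooth[OF vfield_subset[OF XB_vfield oU sub] cv_vfield[OF atlasB k]]
          smooth_yB_compose[OF smooth_inverse_gam oU]])
  then show "smooth_fun Nbar U (\<lambda>y. th y (cv Nbar U \<phi> y b))" by (simp add: th_def divide_inverse)
qed

text \<open>The coefficient of \<open>lamP\<close> in the pullback of \<open>th\<close>. Its
  derivative \<open>- c/(2 s^2)\<close> is the source of the last term in
  \<open>ext_deriv_th\<close>.\<close>

definition Fc :: "real \<Rightarrow> real" where "Fc s = (s + c) / (2 * s)"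

lemma Fc_smooth: "smooth_on {c<..} Fc"
proof -
  note r = smooth_on_real_rational[OF c_pos]
  have o: "open {c<..}" by simp
  have "smooth_on {c<..} (\<lambda>s. 1 / 2 * ((s + c) * inverse s))"
    using o by (intro smooth_on_mult smooth_on_add r smooth_on_const)
  then show ?thesis
    by (rule smooth_on_cong[OF _ o]) (use c_pos in \<open>simp add: Fc_def divide_simps\<close>)
qed

lemma tangent_Fc:
  assumes u: "u \<in> tangent P x"
  shows "u (\<lambda>y. Fc (yP y)) = - c / (2 * (yP x)\<^sup>2) * u yP"
proof (rule tangent_of_function[OF atlasP u yP_smooth tangent_points[OF u] Fc_smooth])
  show "yP ` points P \<subseteq> {c<..}" using yP_gt by auto
  have "yP x \<noteq> 0" using yP_gt[OF tangent_points[OF u]] c_pos by simp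
  then show "(Fc has_real_derivative - c / (2 * (yP x)\<^sup>2)) (at (yP x))"
    unfolding Fc_def[abs_def]
    by (auto intro!: derivative_eq_intros simp: power2_eq_square field_simps)
qed

lemma Fc_yP_smooth: "smooth_fun P (points P) (\<lambda>y. Fc (yP y))"
  by (rule smooth_fun_compose[OF atlasP yP_smooth Fc_smooth]) (use yP_gt in auto)

lemma foot_smooth: "smooth_map P M (fst \<circ> pr)"
  by (rule smooth_map_compose[OF atlasP atlasN atlasM pr_smooth fst_smooth])

lemma dw_push: "x \<in> points P \<Longrightarrow> dw x u = push P M (fst \<circ> pr) x u"
  unfolding dw_def dpi_def by (rule push_compose[where F = pr and p = x, OF atlasN atlasM fst_smooth], rule pr_N)

lemma lamP_push: "x \<in> points P \<Longrightarrow> lamP x u = lam ((fst \<circ> pr) x) (push P M (fst \<circ> pr) x u)"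
  by (simp add: lamP_def dw_push)

lemma lamP_form:
  assumes x: "x \<in> points P"
  obtains W and a k :: "'e \<Rightarrow> 'p \<Rightarrow> real" where "x \<in> W" "form_expr P W lamP Basis a k"
    "\<And>u v. u \<in> tangent P x \<Longrightarrow> v \<in> tangent P x \<Longrightarrow>
      ext_deriv1 P lamP x u v = 2 * om (fst (pr x)) (dw x u) (dw x v)"
proof -
  let ?F = "fst \<circ> pr"
  have "?F x \<in> points M" using pr_M[OF x] by simp
  then obtain V and a k :: "'e \<Rightarrow> 'm \<Rightarrow> real" where V: "?F x \<in> V" "form_expr M V lam Basis a k"
    by (rule lam_expr) (rule that)
  let ?W = "{x \<in> points P. ?F x \<in> V}" and ?l = "\<lambda>x v. lam (?F x) (push P M ?F x v)"
  note e = form_expr_pullback[OF atlasP atlasM foot_smooth V(2)]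
  have fe: "form_expr P ?W lamP Basis (\<lambda>c. a c \<circ> ?F) (\<lambda>c. k c \<circ> ?F)"
    using e by (simp add: form_expr_def lamP_push)
  have "ext_deriv1 P lamP x u v = 2 * om (fst (pr x)) (dw x u) (dw x v)"
    if u: "u \<in> tangent P x" and v: "v \<in> tangent P x" for u v
  proof -
    have "ext_deriv1 P lamP x u v = ext_deriv1 P ?l x u v"
    proof (rule ext_deriv1_cong[where V = "points P", OF atlasP e _ u v])
      show "lamP y w = lam (?F y) (push P M ?F y w)" if "y \<in> points P" for y w by (rule lamP_push[OF that])
    qed (use x V(1) in simp_all)
    also have "\<dots> = ext_deriv1 M lam (?F x) (push P M ?F x u) (push P M ?F x v)"
      by (rule ext_deriv1_pullback[OF atlasP atlasM foot_smooth V(2,1) u v])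
    also have "\<dots> = 2 * om (?F x) (push P M ?F x u) (push P M ?F x v)"
      by (rule ext_deriv_lam[OF push_tangent[OF atlasP atlasM foot_smooth u] push_tangent[OF atlasP atlasM foot_smooth v]])
    finally show ?thesis by (simp add: dw_push[OF x])
  qed
  moreover have "x \<in> ?W" using x V(1) by simp
  ultimately show thesis using that[OF _ fe] by blast
qed

text \<open>The three terms are the curvature of \<open>eta\<close>, the contribution of
  \<open>d lam = 2 om\<close>, and the differential of the coefficient wedged with
  \<open>lam\<close>. As \<open>q\<close> is a submersion, all pairs of tangent vectors of the
  quotient are reached.\<close>

lemma ext_deriv_th:
  assumes u: "u \<in> tangent P x" and v: "v \<in> tangent P x"
  shows "ext_deriv1 Nbar th (q x) (qq x u) (qq x v)
    = omegaH (pr x) (pp x u) (pp x v) + (yP x + c) / yP x * om (fst (pr x)) (dw x u) (dw x v)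
      - c / (2 * (yP x)\<^sup>2) * (u yP * lamP x v - v yP * lamP x u)"
proof -
  have x: "x \<in> points P" by (rule tangent_points[OF u])
  obtain U and \<phi> :: "'b \<Rightarrow> 'h" where U: "coords Nbar U \<phi>" "q x \<in> U"
    by (rule atlas_chart_at[OF atlasB q_points[OF x]])
  obtain V and a k :: "'f \<Rightarrow> 'p \<Rightarrow> real" where V: "x \<in> V" "form_expr P V eta Basis a k"
    by (rule one_form_expr[OF atlasP eta_form x])
  obtain W and a' k' :: "'e \<Rightarrow> 'p \<Rightarrow> real" where W: "x \<in> W" "form_expr P W lamP Basis a' k'"
    and dl: "\<And>u v. u \<in> tangent P x \<Longrightarrow> v \<in> tangent P x \<Longrightarrow>
      ext_deriv1 P lamP x u v = 2 * om (fst (pr x)) (dw x u) (dw x v)"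
    by (rule lamP_form[OF x]) (rule that)
  let ?I = "V \<inter> W" and ?F = "\<lambda>y. Fc (yP y)"
  have oV: "openin (mtop P) V" "openin (mtop P) W" using V(2) W(2) by (simp_all add: form_expr_def)
  have oI: "openin (mtop P) ?I" by (rule openin_Int[OF oV])
  have e: "form_expr P ?I eta Basis a k" by (rule form_expr_subset[OF V(2) oI]) simp
  have l: "form_expr P ?I lamP Basis a' k'" by (rule form_expr_subset[OF W(2) oI]) simp
  have F: "smooth_fun P ?I ?F" by (rule smooth_fun_subset[OF Fc_yP_smooth oI openin_subset[OF oI]])
  note s = form_expr_scale[OF atlasP l F]
  have xI: "x \<in> ?I" using V W by simp
  \<comment> \<open>The computation moves to the twist bundle, where \<open>th_qq\<close> makes the
    form explicit.\<close>
  have "ext_deriv1 Nbar th (q x) (qq x u) (qq x v) = ext_deriv1 P (\<lambda>x v. th (q x) (qq x v)) x u v"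
    by (simp only: ext_deriv1_pullback[OF atlasP atlasB q_smooth th_form_expr[OF U(1)] U(2) u v])
  also have "\<dots> = ext_deriv1 P (\<lambda>x v. eta x v + ?F x * lamP x v) x u v"
  proof (rule ext_deriv1_cong[where V = "points P", OF atlasP form_expr_add[OF atlasP e s] xI u v])
    show "th (q y) (qq y w) = eta y w + ?F y * lamP y w" if "y \<in> points P" "w \<in> tangent P y" for y w
      by (simp add: th_qq[OF that(2)] Fc_def)
  qed (use x in simp_all)
  also have "\<dots> = ext_deriv1 P eta x u v + ext_deriv1 P (\<lambda>x v. ?F x * lamP x v) x u v"
    by (rule ext_deriv1_add[OF atlasP e s xI u v])
  also have "\<dots> = omegaH (pr x) (pp x u) (pp x v)
      + (?F x * (2 * om (fst (pr x)) (dw x u) (dw x v)) + u ?F * lamP x v - v ?F * lamP x u)"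
    unfolding ext_deriv1_scale[OF atlasP l F xI u v] dl[OF u v] ext_deriv_eta[OF u v] ..
  finally have d: "ext_deriv1 Nbar th (q x) (qq x u) (qq x v) = omegaH (pr x) (pp x u) (pp x v)
      + (?F x * (2 * om (fst (pr x)) (dw x u) (dw x v)) + u ?F * lamP x v - v ?F * lamP x u)" .
  have r: "w + (F * (2 * o1) + A * a * l - A * b * m) = w + 2 * F * o1 - (- A) * (a * l - b * m)"
    for w F o1 A a l b m :: real by (simp add: algebra_simps)
  have f: "2 * ?F x = (yP x + c) / yP x" "- (- c / (2 * (yP x)\<^sup>2)) = c / (2 * (yP x)\<^sup>2)"
    using yP_gt[OF x] c_pos by (simp_all add: Fc_def field_simps)
  show ?thesis unfolding d tangent_Fc[OF u] tangent_Fc[OF v] by (simp only: r f)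
qed

text \<open>All three terms are multiples of \<open>lamP\<close>, with coefficients
  \<open>- 1\<close>, \<open>(y + c)/y\<close> and \<open>- c/y\<close>, whose sum is 0.\<close>

lemma dth_RB:
  assumes y: "y \<in> points Nbar" and v: "v \<in> tangent Nbar y"
  shows "ext_deriv1 Nbar th y (RB y) v = 0"
proof -
  obtain x where x: "x \<in> points P" "y = q x" by (rule q_surj[OF y])
  obtain u where u: "u \<in> tangent P x" "v = qq x u" by (rule qq_surj[OF x(1) v[unfolded x(2)]])
  have l0: "lamP x (Xih x) = 0" by (simp add: lamP_def dw_Xih x lam_def g_xi_Jxi pr_M)
  have "om (fst (pr x)) (dw x (Xih x)) (dw x u) = lamP x u"
    by (simp add: dw_Xih x lamP_def lam_om dw_tangent u)
  then have "ext_deriv1 Nbar th y (RB y) v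
      = - lamP x u + (yP x + c) / yP x * lamP x u - c / (2 * (yP x)\<^sup>2) * (2 * yP x * lamP x u)"
    unfolding x(2) u(2) RB_q[OF x(1)] ext_deriv_th[OF Xih_tangent[OF x(1)] u(1)]
    by (simp add: omegaH_pp x(1) u(1) l0 Xih_yP) (simp add: lamP_def)
  also have "\<dots> = 0" using yP_gt[OF x(1)] c_pos by (simp add: field_simps power2_eq_square)
  finally show ?thesis .
qed

text \<open>\<open>XP\<close> is killed by the projections to \<open>N\<close> and \<open>M\<close>,
  and y is constant along it, so each of the three terms vanishes.\<close>

lemma dth_XB:
  assumes y: "y \<in> points Nbar" and v: "v \<in> tangent Nbar y"
  shows "ext_deriv1 Nbar th y (XB y) v = 0"
proof -
  obtain x where x: "x \<in> points P" "y = q x" by (rule q_surj[OF y])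
  obtain u where u: "u \<in> tangent P x" "v = qq x u" by (rule qq_surj[OF x(1) v[unfolded x(2)]])
  have l0: "lamP x (XP x) = 0" by (simp add: lamP_def dw_XP x lam_def g_zero_right pr_M)
  have "om (fst (pr x)) (dw x (XP x)) (dw x u) = 0"
    by (simp add: dw_XP x om_g zero_tangent pr_M dw_tangent u J_zero g_zero_left)
  then show ?thesis
    unfolding x(2) u(2) XB_q[OF x(1)] ext_deriv_th[OF XP_tangent[OF x(1)] u(1)]
    by (simp add: omegaH_pp x(1) u(1) l0 XP_yP)
qed

text \<open>The coordinate expression of \<open>th\<close> exists over a chart domain only, so
  everything is restricted to a chart around \<open>p\<close>; being Killing passes to open
  subsets.\<close>

lemma killing_yB:
  assumes K: "killing_on Nbar gbar U K" and p: "p \<in> U"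
  shows "K p yB = 0"
proof -
  have oU: "openin (mtop Nbar) U" using K by (auto simp: killing_on_def vfield_on_def)
  then have "p \<in> points Nbar" using p openin_subset by blast
  then obtain A and \<phi> :: "'b \<Rightarrow> 'h" where A: "coords Nbar A \<phi>" "p \<in> A"
    by (rule atlas_chart_at[OF atlasB])
  let ?V = "U \<inter> A"
  have oV: "openin (mtop Nbar) ?V" by (rule openin_Int[OF oU coordsD(1)[OF A(1)]])
  have sub: "?V \<subseteq> points Nbar" by (rule openin_subset[OF oV])
  have KV: "killing_on Nbar gbar ?V K"
    unfolding killing_on_def
  proof (intro conjI allI impI)
    show "vfield_on Nbar ?V K" by (rule vfield_subset[OF K[unfolded killing_on_def, THEN conjunct1] oV]) simp
    fix V X Y assume "V \<subseteq> ?V \<and> vfield_on Nbar V X \<and> vfield_on Nbar V Y"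
    then have "V \<subseteq> U \<and> vfield_on Nbar V X \<and> vfield_on Nbar V Y" by simp
    then show "\<forall>x\<in>V. K x (\<lambda>y. gbar y (X y) (Y y))
        = gbar x (lie_bracket Nbar K X x) (Y x) + gbar x (X x) (lie_bracket Nbar K Y x)"
      using K[unfolded killing_on_def, THEN conjunct2] by blast
  qed
  have e: "form_expr Nbar ?V th Basis (\<lambda>b y. th y (cv Nbar A \<phi> y b)) (\<lambda>b y. \<phi> y \<bullet> b)"
    by (rule form_expr_subset[OF th_form_expr[OF A(1)] oV]) simp
  show ?thesis
  proof (rule killing_annihilates_function[OF atlasB c_pos vfield_subset[OF RB_vfield oV sub]
        vfield_subset[OF XB_vfield oV sub] KV smooth_fun_subset[OF yB_smooth oV sub] _ _ _ _ _ _ _ e])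
    show "yB ` ?V \<subseteq> {c<..}" using yB_gt sub by auto
    show "p \<in> ?V" using p A(2) by simp
    fix y assume "y \<in> ?V"
    then have y: "y \<in> points Nbar" using sub by blast
    show "RB y yB = 2 * yB y" by (rule RB_yB[OF y])
    show "XB y yB = 0" by (rule XB_yB[OF y])
    show "th y (XB y) = 1" by (rule th_XB[OF y])
    show "lie_bracket Nbar RB XB y f = 0" for f by (rule bracket_RB_XB[OF y])
    fix v assume v: "v \<in> tangent Nbar y"
    show "gbar y (RB y) v = (yB y + c) / (yB y - c)\<^sup>2 * v yB" by (rule gbar_RB[OF y v])
    show "gbar y (XB y) v = 8 * yB y / ((yB y - c)\<^sup>2 * (yB y + c)) * th y v"
      using gbar_XB[OF y, of v] by (simp add: gam_def)
    show "ext_deriv1 Nbar th y (RB y) v = 0" by (rule dth_RB[OF y v])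
    show "ext_deriv1 Nbar th y (XB y) v = 0" by (rule dth_XB[OF y v])
    fix u assume u: "u \<in> tangent Nbar y"
    show "gbar y u v = gbar y v u" by (rule gbar_sym[OF y u v])
  qed
qed

section \<open>Existence of a point and conclusion\<close>

lemma xi_nonzero:
  obtains x where "x \<in> points M" "xi x \<noteq> (\<lambda>_. 0)"
proof (rule ccontr)
  assume "\<not> thesis"
  then have zero: "\<And>y. y \<in> points M \<Longrightarrow> xi y = (\<lambda>_. 0)" using that by blast
  obtain x where x: "x \<in> points M" using cask unfolding cask_manifold_def by blast
  obtain U and \<phi> :: "'m \<Rightarrow> 'e" where U: "coords M U \<phi>" "x \<in> U" by (rule atlas_chart_at[OF atlasM x])
  \<comment> \<open>The model space has positive dimension, so there is a nonzero tangent vector; if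
    \<open>xi\<close> were zero everywhere, \<open>nab v xi = v\<close> would make it
    vanish.\<close>
  obtain b :: 'e where b: "b \<in> Basis" using nonempty_Basis by blast
  let ?v = "cv M U \<phi> x b"
  have v: "?v \<in> tangent M x" by (rule cv_tangent[OF atlasM U])
  have "?v = nab x ?v xi" by (rule LC(3)[OF v, symmetric])
  also have "\<dots> = nab x ?v (\<lambda>y h. 0)" by (rule nab_germ[OF xi_vfield zero x v])
  also have "\<dots> = (\<lambda>_. 0)" by (rule nab_zero[OF xi_vfield x v zero])
  finally have "?v (\<lambda>y. \<phi> y \<bullet> b) = 0" by metis
  then show False using b by (simp add: cv_coord[OF atlasM U])
qed

text \<open>Along the flow of \<open>xi\<close> the function y grows like
  \<open>exp (2 * t)\<close>, and it is positive wherever \<open>xi\<close> is nonzero because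
  \<open>g\<close> is negative on the span of \<open>xi\<close> and \<open>J xi\<close>. The flow is
  complete, so every level is passed, whatever \<open>c\<close> is.\<close>

lemma yM_unbounded:
  obtains x where "x \<in> points M" "yM x > c"
proof -
  obtain x0 where x0: "x0 \<in> points M" "xi x0 \<noteq> (\<lambda>_. 0)" by (rule xi_nonzero)
  have "let v = lcomb 1 (xi x0) 0 (J x0 (xi x0)) in v \<noteq> (\<lambda>_. 0) \<longrightarrow> g x0 v v < 0"
    using cask x0(1) unfolding cask_manifold_def by blast
  then have y0: "yM x0 > 0" using x0(2) by (simp add: lcomb_def yM_def Let_def)
  obtain \<gamma> where \<gamma>: "\<gamma> 0 = x0" "integral_curve M xi \<gamma>"
    using xi_complete x0(1) by (auto simp: complete_vfield_def)
  have p: "\<gamma> t \<in> points M" for t by (rule integral_curve_points[OF \<gamma>(2)])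
  have "xi (\<gamma> t) yM = 2 * yM (\<gamma> t)" for t
    unfolding yM_derivative[OF xi_tangent[OF p]] by (simp add: yM_def)
  then have "((\<lambda>s. yM (\<gamma> s)) has_real_derivative 2 * yM (\<gamma> t)) (at t)" for t
    using integral_curve_deriv[OF \<gamma>(2) yM_near[OF p], of t] by simp
  then have "((\<lambda>s. exp (- 2 * s) * yM (\<gamma> s)) has_real_derivative 0) (at t)" for t
    by (auto intro!: derivative_eq_intros)
  then have "exp (- 2 * t) * yM (\<gamma> t) = exp (- 2 * 0) * yM (\<gamma> 0)" for t by (rule DERIV_isconst_all[OF allI])
  then have y: "yM (\<gamma> t) = exp (2 * t) * yM x0" for t
    using \<gamma>(1) by (simp add: exp_minus field_simps)
  have "yM (\<gamma> (ln ((c + 1) / yM x0) / 2)) = c + 1"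
    unfolding y using y0 c_pos by simp
  then have "yM (\<gamma> (ln ((c + 1) / yM x0) / 2)) > c" by simp
  then show thesis by (rule that[OF p])
qed

text \<open>The zero covector over a point with y > c lies in the restricted cotangent bundle, and
  local triviality puts a circle above it.\<close>

lemma points_P_nonempty: "points P \<noteq> {}"
proof -
  obtain x where x: "x \<in> points M" "yM x > c" by (rule yM_unbounded)
  define z where "z = (x, \<lambda>v::'m tv. 0::real)"
  have z: "z \<in> points (Nc c)"
    using x zero_cotangent[OF x(1)] by (simp add: points_Nc W0_def z_def points_N)
  then obtain V \<Psi> where V: "openin (mtop (Nc c)) V" "z \<in> V"
    and d: "diffeo (restrict_mfd P {x \<in> points P. pr x \<in> V}) (prod_mfd (restrict_mfd (Nc c) V) circle_mfd) \<Psi>"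
    using pcb unfolding principal_circle_bundle_def by meson
  have "(z, 1) \<in> points (prod_mfd (restrict_mfd (Nc c) V) circle_mfd)"
    using z V(2) by (simp add: prod_mfd_def restrict_mfd_def circle_mfd_def)
  then have "points (restrict_mfd P {x \<in> points P. pr x \<in> V}) \<noteq> {}"
    using d by (auto simp: diffeo_def bij_betw_def)
  then show ?thesis by (auto simp: restrict_mfd_def)
qed

lemma not_locally_homogeneous: "\<not> locally_homogeneous Nbar gbar"
proof
  assume hom: "locally_homogeneous Nbar gbar"
  obtain x where x: "x \<in> points P" using points_P_nonempty by blast
  let ?p = "q x"
  have p: "?p \<in> points Nbar" by (rule q_points[OF x])
  obtain U K where U: "?p \<in> U" "\<And>i. i < DIM('h) \<Longrightarrow> killing_on Nbar gbar U (K i)"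
    and ind: "\<And>a. \<forall>f. (\<Sum>i<DIM('h). a i * K i ?p f) = 0 \<Longrightarrow> \<forall>i<DIM('h). a i = 0"
    using hom p unfolding locally_homogeneous_def by blast
  have K: "K i ?p \<in> tangent Nbar ?p" if "i < DIM('h)" for i
    using U(2)[OF that] U(1) by (auto simp: killing_on_def vfield_on_def)
  obtain a where a: "RB ?p = (\<lambda>f. \<Sum>i<DIM('h). a i * K i ?p f)"
    by (rule tangent_spanning[where K = "\<lambda>i. K i ?p", OF atlasB K ind vfield_tangent[OF RB_vfield p]])
      (assumption, assumption, rule that, rule ext)
  have "RB ?p yB = 0" unfolding a using killing_yB[OF U(2) U(1)] by simp
  then show False using RB_yB[OF p] yB_gt[OF p] c_pos by simp
qed

end

theorem theorem3p9:
  fixes M :: "('m, 'e::euclidean_space) mfd"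
    and g :: "'m \<Rightarrow> 'm tv \<Rightarrow> 'm tv \<Rightarrow> real"
    and J :: "'m \<Rightarrow> 'm tv \<Rightarrow> 'm tv"
    and om :: "'m \<Rightarrow> 'm tv \<Rightarrow> 'm tv \<Rightarrow> real"
    and nab :: "'m conn"
    and xi :: "'m \<Rightarrow> 'm tv"
    and c T :: real
    and P :: "('p, 'f::euclidean_space) mfd"
    and pr :: "'p \<Rightarrow> 'm \<times> ('m tv \<Rightarrow> real)"
    and act :: "complex \<Rightarrow> 'p \<Rightarrow> 'p"
    and eta :: "'p \<Rightarrow> 'p tv \<Rightarrow> real"
    and Nbar :: "('b, 'h::euclidean_space) mfd"
    and q :: "'p \<Rightarrow> 'b"
    and gbar :: "'b \<Rightarrow> 'b tv \<Rightarrow> 'b tv \<Rightarrow> real"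
    and Q :: "'b \<Rightarrow> ('b tv \<Rightarrow> 'b tv) set"
  assumes "cask_manifold M g J om nab xi"
    and "c > 0"
    and "cask_data.deformed_sugra_cmap M g J om nab xi c T P pr act eta Nbar q gbar Q"
  shows "\<not> locally_homogeneous Nbar gbar"
proof -
  interpret sugra M g J om nab xi c T P pr act eta Nbar q gbar Q
    by unfold_locales (use assms in simp_all)
  show ?thesis by (rule not_locally_homogeneous)
qed

end
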